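(* Let $t,c\in\mathbb C$ and let $V$ be a representation of $\mathcal S_n$, inflated to a representation of $H_n(\mathbf y)=\mathbb C[y_1,\dots,y_n]\rtimes\mathcal S_n$ by letting each $y_i$ act by $0$. The induced module $\Delta_{t,c}(V)=\mathrm{Ind}_{H_n(\mathbf y)}^{H_{t,c}}(V)$ has a filtration whose subquotients are isomorphic, as $H_n(\mathbf u)$-modules, to the induced representations $$V_{\mathbf d}:=\mathrm{Ind}_{H(\mathbf d,\mathbf u)}^{H_n(\mathbf u)}\left[\mathrm{Res}^{H_n(\mathbf u)}_{H(\mathbf d^{\mathrm{rev}},\mathbf u)}V\right]^{\mathrm{rev}_{\mathbf d}},\qquad \mathbf d\in\mathcal P^-(n),$$ where here $V$ is regarded as an $H_n(\mathbf u)$-module by inflation along $\mathrm{ev}_0$.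
   Context: $H_{t,c}=H_{t,c}(\mathcal S_n,\mathbb C^n)$ is the quotient of $\mathbb C\langle x_1,\dots,x_n,y_1,\dots,y_n\rangle\rtimes\mathcal S_n$ by $[x_i,x_j]=[y_i,y_j]=0$, $[y_i,x_j]=c\,(ij)$ for $i\ne j$, $[y_i,x_i]=t-c\sum_{j\ne i}(ij)$. $s_i=(i,i+1)$, $u_i=x_iy_i-c\sum_{j<i}(ij)$; the $u_i$ commute and $s_iu_i=u_{i+1}s_i+c$, $s_ju_i=u_is_j$ for $j\neq i,i-1$. $H_n(\mathbf u)\subset H_{t,c}$ is the subalgebra generated by $\mathcal S_n$ and $u_1,\dots,u_n$ (a degenerate affine Hecke algebra). $\mathrm{ev}_0:H_n(\mathbf u)\to\mathbb C\mathcal S_n$ is the algebra homomorphism with $s_i\mapsto s_i$, $u_1\mapsto0$ (so $u_i\mapsto-c\sum_{j<i}(ij)$). $\mathcal P^-(n)=\{\mathbf d\in\mathbb Z_{\ge0}^n:d_1\ge d_2\ge\cdots\ge d_n\}$, and $\mathbf d^{\mathrm{rev}}=(d_n,\dots,d_1)$. For $\mathbf b=\mathbf d$ or $\mathbf d^{\mathrm{rev}}$, $H(\mathbf b,\mathbf u)\subset H_n(\mathbf u)$ is the subalgebra generated by all $u_j$ ($1\le j\le n$) and those $s_i$ with $b_i=b_{i+1}$. Let $g_{\mathbf d}\in\mathcal S_n$ be the minimal length permutation sorting $\mathbf d$ to be non-decreasing: $g_{\mathbf d}(i)=\#\{j:d_j<d_i\}+\#\{j\le i:d_j=d_i\}$.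 The algebra isomorphism $\mathrm{rev}_{\mathbf d}:H(\mathbf d,\mathbf u)\to H(\mathbf d^{\mathrm{rev}},\mathbf u)$ is given by $s_i\mapsto s_{g_{\mathbf d}(i)}$ (for $d_i=d_{i+1}$), $u_j\mapsto u_{g_{\mathbf d}(j)}+d_jt$. For an $H(\mathbf d^{\mathrm{rev}},\mathbf u)$-module $M$, $M^{\mathrm{rev}_{\mathbf d}}$ is $M$ viewed as an $H(\mathbf d,\mathbf u)$-module through $\mathrm{rev}_{\mathbf d}$. *)

theory Defs
  imports
    "HOL-Algebra.Sym_Groups"
    "HOL-Algebra.QuotRing"
    "HOL-Algebra.Generated_Rings"
    "HOL-Algebra.Free_Abelian_Groups"
    "HOL-Algebra.Module"
begin

section \<open>Complex associative algebras\<close>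

text \<open>
  An associative (not necessarily commutative) unital complex algebra is a record of type
  \<open>(complex, 'a) module\<close>: its ring fields carry the ring structure and \<open>smult\<close> is the
  multiplication by complex scalars.
\<close>

definition monoid_algebra :: "('g, 'm) monoid_scheme \<Rightarrow> (complex, 'g \<Rightarrow> complex) module" where
  "monoid_algebra G =
    \<lparr>carrier = {f. finite {g. f g \<noteq> 0} \<and> {g. f g \<noteq> 0} \<subseteq> carrier G},
     monoid.mult = (\<lambda>f h k. \<Sum>(a, b)\<in>{(a, b). f a \<noteq> 0 \<and> h b \<noteq> 0 \<and> a \<otimes>\<^bsub>G\<^esub> b = k}. f a * h b),
     one = (\<lambda>g. if g = \<one>\<^bsub>G\<^esub> then 1 else 0),
     ring.zero = (\<lambda>g. 0),
     ring.add = (\<lambda>f h g. f g + h g),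
     module.smult = (\<lambda>z f g. z * f g)\<rparr>"

definition basis_elt :: "'g \<Rightarrow> 'g \<Rightarrow> complex" where
  "basis_elt g = (\<lambda>h. if h = g then 1 else 0)"

definition quot_algebra :: "(complex, 'a) module \<Rightarrow> 'a set \<Rightarrow> (complex, 'a set) module" where
  "quot_algebra A I =
    ring.extend (A Quot I) (module.fields (\<lambda>z K. \<Union>k\<in>K. I +>\<^bsub>A\<^esub> (z \<odot>\<^bsub>A\<^esub> k)))"

text \<open>The subalgebra generated by \<open>S\<close> is the subring generated by \<open>S\<close> and the scalars.\<close>

definition gen_subalgebra :: "(complex, 'a) module \<Rightarrow> 'a set \<Rightarrow> (complex, 'a) module" where
  "gen_subalgebra A S =
    A\<lparr>carrier := generate_ring A (range (\<lambda>z. z \<odot>\<^bsub>A\<^esub> \<one>\<^bsub>A\<^esub>) \<union> S)\<rparr>"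

text \<open>Homomorphisms are extensional, so that they are determined by their values on the carrier.\<close>

definition alg_hom :: "(complex, 'a) module \<Rightarrow> (complex, 'b) module \<Rightarrow> ('a \<Rightarrow> 'b) set" where
  "alg_hom A B =
    {f \<in> ring_hom A B. f \<in> extensional (carrier A) \<and>
      (\<forall>z. \<forall>a\<in>carrier A. f (z \<odot>\<^bsub>A\<^esub> a) = z \<odot>\<^bsub>B\<^esub> f a)}"


section \<open>Left modules over algebras\<close>

text \<open>
  A left module over an algebra with elements of type \<open>'a\<close> is a record of type
  \<open>('a, 'm) module\<close>, of which only the additive fields and the action \<open>smult\<close> are relevant.
  The algebra is not part of the record, so restriction to a subalgebra does not change it.
\<close>

definition module_of_group :: "('m, 'z) monoid_scheme \<Rightarrow> ('a \<Rightarrow> 'm \<Rightarrow> 'm) \<Rightarrow> ('a, 'm) module" where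
  "module_of_group G act =
    \<lparr>carrier = carrier G, monoid.mult = undefined, one = undefined,
     ring.zero = \<one>\<^bsub>G\<^esub>, ring.add = monoid.mult G, module.smult = act\<rparr>"

definition pullback :: "('b \<Rightarrow> 'a) \<Rightarrow> ('a, 'm) module \<Rightarrow> ('b, 'm) module" where
  "pullback f M = module_of_group (add_monoid M) (\<lambda>b m. f b \<odot>\<^bsub>M\<^esub> m)"

text \<open>
  \<open>induced f B A M\<close> is the tensor product of \<open>A\<close> with \<open>M\<close> over \<open>B\<close>, where \<open>A\<close> is a right
  \<open>B\<close>-module through the homomorphism \<open>f\<close> from \<open>B\<close> to \<open>A\<close>: the free abelian group on the pairs
  \<open>(a, m)\<close> modulo biadditivity and \<open>(a \<cdot> f b, m) = (a, b \<cdot> m)\<close>.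
\<close>

definition tensor_rels ::
    "('b \<Rightarrow> 'a) \<Rightarrow> (complex, 'b) module \<Rightarrow> (complex, 'a) module \<Rightarrow> ('b, 'm) module
      \<Rightarrow> ('a \<times> 'm \<Rightarrow>\<^sub>0 int) set" where
  "tensor_rels f B A M =
     {frag_of (a \<oplus>\<^bsub>A\<^esub> a', m) - frag_of (a, m) - frag_of (a', m) |a a' m.
        a \<in> carrier A \<and> a' \<in> carrier A \<and> m \<in> carrier M} \<union>
     {frag_of (a, m \<oplus>\<^bsub>M\<^esub> m') - frag_of (a, m) - frag_of (a, m') |a m m'.
        a \<in> carrier A \<and> m \<in> carrier M \<and> m' \<in> carrier M} \<union>
     {frag_of (a \<otimes>\<^bsub>A\<^esub> f b, m) - frag_of (a, b \<odot>\<^bsub>M\<^esub> m) |a b m.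
        a \<in> carrier A \<and> b \<in> carrier B \<and> m \<in> carrier M}"

definition induced ::
    "('b \<Rightarrow> 'a) \<Rightarrow> (complex, 'b) module \<Rightarrow> (complex, 'a) module \<Rightarrow> ('b, 'm) module
      \<Rightarrow> ('a, ('a \<times> 'm \<Rightarrow>\<^sub>0 int) set) module" where
  "induced f B A M =
    (let G = free_Abelian_group (carrier A \<times> carrier M);
         N = generate G (tensor_rels f B A M)
     in module_of_group (G Mod N)
          (\<lambda>a K. \<Union>k\<in>K. N #>\<^bsub>G\<^esub> frag_extend (\<lambda>(a', m). frag_of (a \<otimes>\<^bsub>A\<^esub> a', m)) k))"

text \<open>The quotient \<open>L / N\<close> of two submodules of \<open>M\<close> with \<open>N \<subseteq> L\<close>.\<close>

definition subquotient ::
    "('a, 'm) module \<Rightarrow> 'm set \<Rightarrow> 'm set \<Rightarrow> ('a, 'm set) module" where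
  "subquotient M L N =
    module_of_group (M\<lparr>carrier := L\<rparr> A_Mod N) (\<lambda>a K. \<Union>k\<in>K. N +>\<^bsub>M\<^esub> (a \<odot>\<^bsub>M\<^esub> k))"

definition module_isomorphic ::
    "(complex, 'a) module \<Rightarrow> ('a, 'm) module \<Rightarrow> ('a, 'k) module \<Rightarrow> bool" where
  "module_isomorphic A M N \<longleftrightarrow>
    (\<exists>f. bij_betw f (carrier M) (carrier N) \<and>
      (\<forall>x\<in>carrier M. \<forall>y\<in>carrier M. f (x \<oplus>\<^bsub>M\<^esub> y) = f x \<oplus>\<^bsub>N\<^esub> f y) \<and>
      (\<forall>a\<in>carrier A. \<forall>x\<in>carrier M. f (a \<odot>\<^bsub>M\<^esub> x) = a \<odot>\<^bsub>N\<^esub> f x))"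

text \<open>
  An exhaustive ascending filtration of the \<open>A\<close>-module \<open>M\<close>, starting at \<open>0\<close>, in which each
  \<open>W d\<close> with \<open>d \<in> D\<close> is the subquotient of exactly one step, for countably infinite \<open>D\<close>.
\<close>

definition has_filtration_by ::
    "(complex, 'a) module \<Rightarrow> ('a, 'm) module \<Rightarrow> 'd set \<Rightarrow> ('d \<Rightarrow> ('a, 'k) module) \<Rightarrow> bool" where
  "has_filtration_by A M D W \<longleftrightarrow>
    (\<exists>(F :: nat \<Rightarrow> 'm set) (e :: nat \<Rightarrow> 'd).
      bij_betw e UNIV D \<and>
      (\<forall>k. submodule (F k) A M) \<and>
      F 0 = {\<zero>\<^bsub>M\<^esub>} \<and>
      (\<forall>k. F k \<subseteq> F (Suc k)) \<and>
      (\<Union>k. F k) = carrier M \<and>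
      (\<forall>k. module_isomorphic A (subquotient M (F (Suc k)) (F k)) (W (e k))))"


section \<open>The rational Cherednik algebra\<close>

definition semidirect ::
    "nat \<Rightarrow> 'w monoid \<Rightarrow> ((nat \<Rightarrow> nat) \<Rightarrow> 'w \<Rightarrow> 'w) \<Rightarrow> ('w \<times> (nat \<Rightarrow> nat)) monoid" where
  "semidirect n W act =
    \<lparr>carrier = carrier W \<times> carrier (sym_group n),
     monoid.mult = (\<lambda>(v, p) (w, q). (v \<otimes>\<^bsub>W\<^esub> act p w, p \<circ> q)),
     one = (\<one>\<^bsub>W\<^esub>, id)\<rparr>"

datatype 'i letter = LX 'i | LY 'i

definition words :: "nat \<Rightarrow> nat letter list monoid" where
  "words n = \<lparr>carrier = lists (LX ` {1..n} \<union> LY ` {1..n}), monoid.mult = (@), one = []\<rparr>"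

type_synonym free_elt = "nat letter list \<times> (nat \<Rightarrow> nat) \<Rightarrow> complex"

text \<open>The algebra of noncommutative polynomials in the \<open>x\<^sub>i\<close>, \<open>y\<^sub>i\<close>, smashed with the symmetric group.\<close>

definition free_smash :: "nat \<Rightarrow> (complex, free_elt) module" where
  "free_smash n = monoid_algebra (semidirect n (words n) (\<lambda>p. map (map_letter p)))"

definition fx :: "nat \<Rightarrow> free_elt" where "fx i = basis_elt ([LX i], id)"
definition fy :: "nat \<Rightarrow> free_elt" where "fy i = basis_elt ([LY i], id)"
definition fperm :: "(nat \<Rightarrow> nat) \<Rightarrow> free_elt" where "fperm p = basis_elt ([], p)"

definition cherednik_rels :: "nat \<Rightarrow> complex \<Rightarrow> complex \<Rightarrow> free_elt set" where
  "cherednik_rels n t c =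
    (let A = free_smash n in
     {fx i \<otimes>\<^bsub>A\<^esub> fx j \<ominus>\<^bsub>A\<^esub> fx j \<otimes>\<^bsub>A\<^esub> fx i |i j. i \<in> {1..n} \<and> j \<in> {1..n}} \<union>
     {fy i \<otimes>\<^bsub>A\<^esub> fy j \<ominus>\<^bsub>A\<^esub> fy j \<otimes>\<^bsub>A\<^esub> fy i |i j. i \<in> {1..n} \<and> j \<in> {1..n}} \<union>
     {(fy i \<otimes>\<^bsub>A\<^esub> fx j \<ominus>\<^bsub>A\<^esub> fx j \<otimes>\<^bsub>A\<^esub> fy i) \<ominus>\<^bsub>A\<^esub> c \<odot>\<^bsub>A\<^esub> fperm (transpose i j) |i j.
        i \<in> {1..n} \<and> j \<in> {1..n} \<and> i \<noteq> j} \<union>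
     {(fy i \<otimes>\<^bsub>A\<^esub> fx i \<ominus>\<^bsub>A\<^esub> fx i \<otimes>\<^bsub>A\<^esub> fy i) \<ominus>\<^bsub>A\<^esub>
        (t \<odot>\<^bsub>A\<^esub> \<one>\<^bsub>A\<^esub> \<ominus>\<^bsub>A\<^esub> c \<odot>\<^bsub>A\<^esub> (\<Oplus>\<^bsub>A\<^esub>j\<in>{1..n} - {i}. fperm (transpose i j))) |i.
        i \<in> {1..n}})"

definition cherednik_ideal :: "nat \<Rightarrow> complex \<Rightarrow> complex \<Rightarrow> free_elt set" where
  "cherednik_ideal n t c = Idl\<^bsub>free_smash n\<^esub> (cherednik_rels n t c)"

definition cherednik :: "nat \<Rightarrow> complex \<Rightarrow> complex \<Rightarrow> (complex, free_elt set) module" where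
  "cherednik n t c = quot_algebra (free_smash n) (cherednik_ideal n t c)"

definition cls :: "nat \<Rightarrow> complex \<Rightarrow> complex \<Rightarrow> free_elt \<Rightarrow> free_elt set" where
  "cls n t c f = cherednik_ideal n t c +>\<^bsub>free_smash n\<^esub> f"

definition hx :: "nat \<Rightarrow> complex \<Rightarrow> complex \<Rightarrow> nat \<Rightarrow> free_elt set" where
  "hx n t c i = cls n t c (fx i)"

definition hy :: "nat \<Rightarrow> complex \<Rightarrow> complex \<Rightarrow> nat \<Rightarrow> free_elt set" where
  "hy n t c i = cls n t c (fy i)"

definition hperm :: "nat \<Rightarrow> complex \<Rightarrow> complex \<Rightarrow> (nat \<Rightarrow> nat) \<Rightarrow> free_elt set" where
  "hperm n t c p = cls n t c (fperm p)"

definition hs :: "nat \<Rightarrow> complex \<Rightarrow> complex \<Rightarrow> nat \<Rightarrow> free_elt set" where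
  "hs n t c i = hperm n t c (transpose i (i + 1))"

definition hu :: "nat \<Rightarrow> complex \<Rightarrow> complex \<Rightarrow> nat \<Rightarrow> free_elt set" where
  "hu n t c i =
    (let A = cherednik n t c in
     hx n t c i \<otimes>\<^bsub>A\<^esub> hy n t c i \<ominus>\<^bsub>A\<^esub>
       c \<odot>\<^bsub>A\<^esub> (\<Oplus>\<^bsub>A\<^esub>j\<in>{1..<i}. hperm n t c (transpose i j)))"


section \<open>Representations of the symmetric group and standard modules\<close>

definition group_alg :: "nat \<Rightarrow> (complex, (nat \<Rightarrow> nat) \<Rightarrow> complex) module" where
  "group_alg n = monoid_algebra (sym_group n)"

definition sym_rep ::
    "nat \<Rightarrow> (complex \<Rightarrow> 'v \<Rightarrow> 'v) \<Rightarrow> ((nat \<Rightarrow> nat) \<Rightarrow> 'v \<Rightarrow> 'v :: ab_group_add) \<Rightarrow> bool" where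
  "sym_rep n scale \<rho> \<longleftrightarrow>
    vector_space scale \<and>
    (\<forall>p\<in>carrier (sym_group n). Vector_Spaces.linear scale scale (\<rho> p)) \<and>
    \<rho> id = id \<and>
    (\<forall>p\<in>carrier (sym_group n). \<forall>q\<in>carrier (sym_group n). \<rho> (p \<circ> q) = \<rho> p \<circ> \<rho> q)"

definition rep_module ::
    "nat \<Rightarrow> (complex \<Rightarrow> 'v \<Rightarrow> 'v) \<Rightarrow> ((nat \<Rightarrow> nat) \<Rightarrow> 'v \<Rightarrow> 'v :: ab_group_add)
      \<Rightarrow> ((nat \<Rightarrow> nat) \<Rightarrow> complex, 'v) module" where
  "rep_module n scale \<rho> =
    module_of_group \<lparr>carrier = UNIV, monoid.mult = (+), one = 0\<rparr>
      (\<lambda>a v. \<Sum>p\<in>carrier (sym_group n). scale (a p) (\<rho> p v))"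

text \<open>
  \<open>y_smash n\<close> is the smash product of the polynomial ring in \<open>y\<^sub>1, \<dots>, y\<^sub>n\<close> with the symmetric
  group; a monomial is given by its exponents \<open>a\<close>, and \<open>p\<close> maps \<open>y\<^sub>i\<close> to \<open>y\<^bsub>p i\<^esub>\<close>.
\<close>

type_synonym y_elt = "(nat \<Rightarrow> nat) \<times> (nat \<Rightarrow> nat) \<Rightarrow> complex"

definition exponents :: "nat \<Rightarrow> (nat \<Rightarrow> nat) monoid" where
  "exponents n =
    \<lparr>carrier = {a. \<forall>i. i \<notin> {1..n} \<longrightarrow> a i = 0},
     monoid.mult = (\<lambda>a b i. a i + b i), one = (\<lambda>i. 0)\<rparr>"

definition y_smash :: "nat \<Rightarrow> (complex, y_elt) module" where
  "y_smash n = monoid_algebra (semidirect n (exponents n) (\<lambda>p a. a \<circ> inv_into UNIV p))"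

definition y_word :: "nat \<Rightarrow> (nat \<Rightarrow> nat) \<Rightarrow> nat letter list" where
  "y_word n a = concat (map (\<lambda>i. replicate (a i) (LY i)) [1..<Suc n])"

definition y_to_cherednik :: "nat \<Rightarrow> complex \<Rightarrow> complex \<Rightarrow> y_elt \<Rightarrow> free_elt set" where
  "y_to_cherednik n t c f =
    (let A = cherednik n t c in
     \<Oplus>\<^bsub>A\<^esub>k\<in>{k. f k \<noteq> 0}. f k \<odot>\<^bsub>A\<^esub> cls n t c (basis_elt (y_word n (fst k), snd k)))"

definition y_zero :: "y_elt \<Rightarrow> (nat \<Rightarrow> nat) \<Rightarrow> complex" where
  "y_zero f = (\<lambda>p. f ((\<lambda>i. 0), p))"

definition standard_module ::
    "nat \<Rightarrow> complex \<Rightarrow> complex \<Rightarrow> (complex \<Rightarrow> 'v \<Rightarrow> 'v)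
      \<Rightarrow> ((nat \<Rightarrow> nat) \<Rightarrow> 'v \<Rightarrow> 'v :: ab_group_add)
      \<Rightarrow> (free_elt set, (free_elt set \<times> 'v \<Rightarrow>\<^sub>0 int) set) module" where
  "standard_module n t c scale \<rho> =
    induced (y_to_cherednik n t c) (y_smash n) (cherednik n t c)
      (pullback y_zero (rep_module n scale \<rho>))"


section \<open>Degenerate affine Hecke algebras\<close>

definition hecke :: "nat \<Rightarrow> complex \<Rightarrow> complex \<Rightarrow> (complex, free_elt set) module" where
  "hecke n t c =
    gen_subalgebra (cherednik n t c)
      (hperm n t c ` carrier (sym_group n) \<union> hu n t c ` {1..n})"

definition parabolic ::
    "nat \<Rightarrow> complex \<Rightarrow> complex \<Rightarrow> (nat \<Rightarrow> nat) \<Rightarrow> (complex, free_elt set) module" where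
  "parabolic n t c b =
    gen_subalgebra (cherednik n t c)
      (hu n t c ` {1..n} \<union> hs n t c ` {i \<in> {1..<n}. b i = b (i + 1)})"

definition ev0 ::
    "nat \<Rightarrow> complex \<Rightarrow> complex \<Rightarrow> free_elt set \<Rightarrow> (nat \<Rightarrow> nat) \<Rightarrow> complex" where
  "ev0 n t c =
    (THE f. f \<in> alg_hom (hecke n t c) (group_alg n) \<and>
       (\<forall>i\<in>{1..<n}. f (hs n t c i) = basis_elt (transpose i (i + 1))) \<and>
       f (hu n t c 1) = \<zero>\<^bsub>group_alg n\<^esub>)"

text \<open>
  A sequence \<open>(d\<^sub>1, \<dots>, d\<^sub>n)\<close> is a function vanishing outside \<open>{1..n}\<close>.
\<close>

definition Pminus :: "nat \<Rightarrow> (nat \<Rightarrow> nat) set" where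
  "Pminus n =
    {d. (\<forall>i. i \<notin> {1..n} \<longrightarrow> d i = 0) \<and> (\<forall>i\<in>{1..<n}. d i \<ge> d (i + 1))}"

definition rev_seq :: "nat \<Rightarrow> (nat \<Rightarrow> nat) \<Rightarrow> nat \<Rightarrow> nat" where
  "rev_seq n d = (\<lambda>i. if i \<in> {1..n} then d (n + 1 - i) else 0)"

definition sort_perm :: "nat \<Rightarrow> (nat \<Rightarrow> nat) \<Rightarrow> nat \<Rightarrow> nat" where
  "sort_perm n d i = card {j \<in> {1..n}. d j < d i} + card {j \<in> {1..i}. d j = d i}"

definition rev_hom ::
    "nat \<Rightarrow> complex \<Rightarrow> complex \<Rightarrow> (nat \<Rightarrow> nat) \<Rightarrow> free_elt set \<Rightarrow> free_elt set" where
  "rev_hom n t c d =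
    (let A = cherednik n t c in
     THE f. f \<in> alg_hom (parabolic n t c d) (parabolic n t c (rev_seq n d)) \<and>
       (\<forall>i\<in>{1..<n}. d i = d (i + 1) \<longrightarrow> f (hs n t c i) = hs n t c (sort_perm n d i)) \<and>
       (\<forall>j\<in>{1..n}. f (hu n t c j) =
          hu n t c (sort_perm n d j) \<oplus>\<^bsub>A\<^esub> (of_nat (d j) * t) \<odot>\<^bsub>A\<^esub> \<one>\<^bsub>A\<^esub>))"

definition V_ind ::
    "nat \<Rightarrow> complex \<Rightarrow> complex \<Rightarrow> (complex \<Rightarrow> 'v \<Rightarrow> 'v)
      \<Rightarrow> ((nat \<Rightarrow> nat) \<Rightarrow> 'v \<Rightarrow> 'v :: ab_group_add) \<Rightarrow> (nat \<Rightarrow> nat)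
      \<Rightarrow> (free_elt set, (free_elt set \<times> 'v \<Rightarrow>\<^sub>0 int) set) module" where
  "V_ind n t c scale \<rho> d =
    induced (\<lambda>h. h) (parabolic n t c d) (hecke n t c)
      (pullback (rev_hom n t c d) (pullback (ev0 n t c) (rep_module n scale \<rho>)))"

end

theory Submission
  imports Defs
begin

text \<open>
  Suppose \<open>\<S>\<^sub>n\<close> acts on \<open>M\<close> together with operators \<open>Z\<^sub>i\<close>, in the role of \<open>x\<^sub>i y\<^sub>i\<close>, that are permuted by \<open>\<S>\<^sub>n\<close> and
  satisfy \<open>[Z\<^sub>i, Z\<^sub>j] = c (Z\<^sub>i - Z\<^sub>j) (i j)\<close>. Then the Cherednik algebra acts on Laurent polynomials with
  coefficients in \<open>M\<close>, where \<open>y\<^sub>i\<close> is a Dunkl operator corrected by \<open>x\<^sub>i\<^sup>-\<^sup>1 Z\<^sub>i\<close>: the commutator of two of these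
  operators commutes with every \<open>x\<^sub>k\<close> by the Jacobi identity, and it kills the constants.

  For \<open>M = V\<close> and \<open>Z = 0\<close>, the span of the monomials with non-negative exponents is the standard module, so no
  PBW theorem is needed. For \<open>M\<close> the regular representation and \<open>Z = 0\<close>, the degree zero part yields the
  homomorphism \<open>ev\<^sub>0\<close>. For \<open>M\<close> the Cherednik algebra itself and \<open>Z\<^sub>i = x\<^sub>i y\<^sub>i\<close>, the coefficient of \<open>x\<^sup>d\<close> yields
  \<open>rev\<^sub>d\<close>.

  The elements \<open>u\<^sub>i\<close> act triangularly with respect to \<open>\<Sum>i. (a\<^sub>i)\<^sup>2\<close> on the monomials \<open>x\<^sup>a\<close>: a monomial goes to its
  \<open>\<S>\<^sub>n\<close>-orbit plus terms with a strictly smaller sum of squares, and on \<open>x\<^sup>d\<close> with \<open>d\<close> non-increasing the leading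
  part is the action twisted by \<open>rev\<^sub>d\<close>. Enumerating the non-increasing \<open>d\<close> by their sum of squares gives the
  filtration, and its subquotient at \<open>d\<close> is spanned by the orbit of \<open>x\<^sup>d\<close>, hence induced from the parabolic
  subalgebra of \<open>d\<close>.
\<close>

section \<open>Monoid algebras\<close>

text \<open>Both homomorphisms are given by definite descriptions, so existence and uniqueness must
  be supplied although no presentation or basis of the Hecke algebra or of its parabolic subalgebras
  is at hand. Each is therefore read off an action: \<open>ev0_rel\<close> and
  \<open>rev_rel\<close> are graphs, total by induction over generators and single-valued because
  the coefficient module is faithful.

  Negative exponents are forced by x_i^-1 Z_i. They are harmless because x_k acts injectively, so
  identities pass to negative exponents by cancellation.

  The sum of squares is the right order because x_i times a divided difference replaces a pair of
  exponents (p, q) by pairs (r, p + q - r) with r between p and q, and the sum of squares drops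
  unless r is an end point.

  Induced modules are raw quotients of free abelian groups. About the algebras only spanning is
  proved (ordered monomials in H_{t,c}; permutations times the parabolic subalgebra in H_n(u));
  independence is read off the concrete actions. One recognition result then covers both the
  standard module and every V_d.\<close>

definition lincomb :: "(complex \<Rightarrow> 'w \<Rightarrow> 'w::comm_monoid_add) \<Rightarrow> ('g \<Rightarrow> complex) \<Rightarrow> ('g \<Rightarrow> 'w) \<Rightarrow> 'w" where
  "lincomb sc f T = (\<Sum>k\<in>{k. f k \<noteq> 0}. sc (f k) (T k))"

lemma monoid_algebra_mult_apply:
  assumes "finite {k. f k \<noteq> 0}" "finite {k. h k \<noteq> 0}"
  shows "(f \<otimes>\<^bsub>monoid_algebra G\<^esub> h) k =
    (\<Sum>(a, b)\<in>{k. f k \<noteq> 0} \<times> {k. h k \<noteq> 0}. if a \<otimes>\<^bsub>G\<^esub> b = k then f a * h b else 0)"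
proof -
  have "(f \<otimes>\<^bsub>monoid_algebra G\<^esub> h) k =
    (\<Sum>(a, b)\<in>{(a, b). f a \<noteq> 0 \<and> h b \<noteq> 0 \<and> a \<otimes>\<^bsub>G\<^esub> b = k}. if a \<otimes>\<^bsub>G\<^esub> b = k then f a * h b else 0)"
    by (auto simp: monoid_algebra_def intro!: sum.cong)
  also have "\<dots> = (\<Sum>(a, b)\<in>{k. f k \<noteq> 0} \<times> {k. h k \<noteq> 0}. if a \<otimes>\<^bsub>G\<^esub> b = k then f a * h b else 0)"
    by (rule sum.mono_neutral_left) (use assms in \<open>auto split: if_splits\<close>)
  finally show ?thesis .
qed

lemma monoid_algebra_mult_support:
  "{k. (f \<otimes>\<^bsub>monoid_algebra G\<^esub> h) k \<noteq> 0} \<subseteq> (\<lambda>(a, b). a \<otimes>\<^bsub>G\<^esub> b) ` ({k. f k \<noteq> 0} \<times> {k. h k \<noteq> 0})"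
proof
  fix k assume "k \<in> {k. (f \<otimes>\<^bsub>monoid_algebra G\<^esub> h) k \<noteq> 0}"
  then have "{(a, b). f a \<noteq> 0 \<and> h b \<noteq> 0 \<and> a \<otimes>\<^bsub>G\<^esub> b = k} \<noteq> {}"
    by (intro notI) (simp add: monoid_algebra_def)
  then show "k \<in> (\<lambda>(a, b). a \<otimes>\<^bsub>G\<^esub> b) ` ({k. f k \<noteq> 0} \<times> {k. h k \<noteq> 0})" by force
qed

context
  fixes sc :: "complex \<Rightarrow> 'w \<Rightarrow> 'w::ab_group_add"
  assumes vs: "vector_space sc"
begin

interpretation vector_space sc by (fact vs)

lemma lincomb_superset:
  assumes "finite S" "{k. f k \<noteq> 0} \<subseteq> S"
  shows "lincomb sc f T = (\<Sum>k\<in>S. sc (f k) (T k))"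
  unfolding lincomb_def by (rule sum.mono_neutral_left) (use assms in auto)

lemma lincomb_zero: "lincomb sc (\<lambda>_. 0) T = 0"
  by (simp add: lincomb_def)

lemma lincomb_add:
  assumes "finite {k. f k \<noteq> 0}" "finite {k. h k \<noteq> 0}"
  shows "lincomb sc (\<lambda>k. f k + h k) T = lincomb sc f T + lincomb sc h T"
proof -
  let ?S = "{k. f k \<noteq> 0} \<union> {k. h k \<noteq> 0}"
  have "finite ?S" using assms by auto
  then show ?thesis
    by (subst (1 2 3) lincomb_superset[of ?S]) (auto simp: scale_left_distrib sum.distrib)
qed

lemma lincomb_scale:
  assumes "finite {k. f k \<noteq> 0}"
  shows "lincomb sc (\<lambda>k. z * f k) T = sc z (lincomb sc f T)"
  using assms by (subst (1 2) lincomb_superset[of "{k. f k \<noteq> 0}"]) (auto simp: scale_sum_right)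

lemma lincomb_basis: "lincomb sc (basis_elt g) T = T g"
  by (subst lincomb_superset[of "{g}"]) (auto simp: basis_elt_def split: if_splits)

lemma lincomb_add_right: "lincomb sc f (\<lambda>k. T k + T' k) = lincomb sc f T + lincomb sc f T'"
  by (simp add: lincomb_def scale_right_distrib sum.distrib)

lemma lincomb_scale_right: "lincomb sc f (\<lambda>k. sc z (T k)) = sc z (lincomb sc f T)"
  by (simp add: lincomb_def scale_sum_right mult.commute)

text \<open>Grouping the pairs (a, b) by their product turns convolution into nested evaluation.
  Associativity of the monoid algebra and multiplicativity of every action defined later reduce to
  identities between basis elements through this.\<close>

lemma lincomb_mult:
  assumes "finite {k. f k \<noteq> 0}" "finite {k. h k \<noteq> 0}"
  shows "lincomb sc (f \<otimes>\<^bsub>monoid_algebra G\<^esub> h) T = lincomb sc f (\<lambda>a. lincomb sc h (\<lambda>b. T (a \<otimes>\<^bsub>G\<^esub> b)))"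
proof -
  let ?P = "{k. f k \<noteq> 0} \<times> {k. h k \<noteq> 0}"
  let ?S = "(\<lambda>(a, b). a \<otimes>\<^bsub>G\<^esub> b) ` ?P"
  have fin: "finite ?S" "finite ?P" using assms by auto
  have "lincomb sc (f \<otimes>\<^bsub>monoid_algebra G\<^esub> h) T = (\<Sum>k\<in>?S. sc ((f \<otimes>\<^bsub>monoid_algebra G\<^esub> h) k) (T k))"
    by (rule lincomb_superset[OF fin(1) monoid_algebra_mult_support])
  also have "\<dots> = (\<Sum>k\<in>?S. \<Sum>(a, b)\<in>?P. if a \<otimes>\<^bsub>G\<^esub> b = k then sc (f a * h b) (T k) else 0)"
    by (intro sum.cong refl, subst monoid_algebra_mult_apply[OF assms])
       (auto simp: scale_sum_left intro!: sum.cong)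
  also have "\<dots> = (\<Sum>(a, b)\<in>?P. \<Sum>k\<in>?S. if a \<otimes>\<^bsub>G\<^esub> b = k then sc (f a * h b) (T k) else 0)"
    by (subst sum.swap) (auto simp: case_prod_beta)
  also have "\<dots> = (\<Sum>(a, b)\<in>?P. sc (f a * h b) (T (a \<otimes>\<^bsub>G\<^esub> b)))"
  proof (rule sum.cong[OF refl])
    fix x assume x: "x \<in> ?P"
    obtain a b where ab: "x = (a, b)" by (cases x)
    have "a \<otimes>\<^bsub>G\<^esub> b \<in> ?S" using x ab by (auto intro!: image_eqI[of _ _ "(a, b)"])
    then show "(case x of (a, b) \<Rightarrow> \<Sum>k\<in>?S. if a \<otimes>\<^bsub>G\<^esub> b = k then sc (f a * h b) (T k) else 0) =
      (case x of (a, b) \<Rightarrow> sc (f a * h b) (T (a \<otimes>\<^bsub>G\<^esub> b)))"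
      using fin(1) by (simp add: ab)
  qed
  also have "\<dots> = (\<Sum>a\<in>{k. f k \<noteq> 0}. \<Sum>b\<in>{k. h k \<noteq> 0}. sc (f a * h b) (T (a \<otimes>\<^bsub>G\<^esub> b)))"
    by (simp add: sum.cartesian_product)
  finally show ?thesis by (simp add: lincomb_def scale_sum_right)
qed

end

lemma vector_space_complex: "vector_space ((*) :: complex \<Rightarrow> complex \<Rightarrow> complex)"
  by unfold_locales (auto simp: algebra_simps)

text \<open>A coefficient of a product is an evaluation along an indicator function, so the ring
  axioms become instances of the \<open>lincomb\<close> calculus.\<close>

lemma monoid_algebra_mult_lincomb:
  assumes "finite {k. f k \<noteq> 0}" "finite {k. h k \<noteq> 0}"
  shows "(f \<otimes>\<^bsub>monoid_algebra G\<^esub> h) k =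
    lincomb (*) f (\<lambda>a. lincomb (*) h (\<lambda>b. if a \<otimes>\<^bsub>G\<^esub> b = k then 1 else 0))"
  by (subst monoid_algebra_mult_apply[OF assms])
     (auto simp: lincomb_def sum_distrib_left sum.cartesian_product intro!: sum.cong)

lemma monoid_algebra_simps:
  "\<zero>\<^bsub>monoid_algebra G\<^esub> = (\<lambda>g. 0)"
  "f \<oplus>\<^bsub>monoid_algebra G\<^esub> h = (\<lambda>g. f g + h g)"
  "\<one>\<^bsub>monoid_algebra G\<^esub> = basis_elt \<one>\<^bsub>G\<^esub>"
  "z \<odot>\<^bsub>monoid_algebra G\<^esub> f = (\<lambda>g. z * f g)"
  by (auto simp: monoid_algebra_def basis_elt_def)

lemma monoid_algebra_carrier:
  "f \<in> carrier (monoid_algebra G) \<longleftrightarrow> finite {g. f g \<noteq> 0} \<and> {g. f g \<noteq> 0} \<subseteq> carrier G"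
  by (simp add: monoid_algebra_def)

text \<open>The scalars are the type \<open>complex\<close>, not the carrier of a ring record, and
  the product need not commute; hence the axioms are listed directly.\<close>

locale calgebra = ring A for A :: "(complex, 'a) module" (structure) +
  assumes smult_closed [simp, intro]: "a \<in> carrier A \<Longrightarrow> z \<odot> a \<in> carrier A"
    and smult_add_right: "\<lbrakk>a \<in> carrier A; b \<in> carrier A\<rbrakk> \<Longrightarrow> z \<odot> (a \<oplus> b) = z \<odot> a \<oplus> z \<odot> b"
    and smult_add_left: "a \<in> carrier A \<Longrightarrow> (z + w) \<odot> a = z \<odot> a \<oplus> w \<odot> a"
    and smult_assoc: "a \<in> carrier A \<Longrightarrow> z \<odot> (w \<odot> a) = (z * w) \<odot> a"
    and smult_one_left: "a \<in> carrier A \<Longrightarrow> 1 \<odot> a = a"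
    and smult_mult: "\<lbrakk>a \<in> carrier A; b \<in> carrier A\<rbrakk> \<Longrightarrow> (z \<odot> a) \<otimes> b = z \<odot> (a \<otimes> b)"
    and mult_smult: "\<lbrakk>a \<in> carrier A; b \<in> carrier A\<rbrakk> \<Longrightarrow> a \<otimes> (z \<odot> b) = z \<odot> (a \<otimes> b)"
begin

lemma smult_zero_left: "a \<in> carrier A \<Longrightarrow> 0 \<odot> a = \<zero>"
  using smult_add_left[of a 0 0] by (simp add: add.r_cancel_one')

lemma smult_neg_one: "a \<in> carrier A \<Longrightarrow> (- 1) \<odot> a = \<ominus> a"
  using smult_add_left[of a "-1" 1] by (simp add: smult_zero_left smult_one_left minus_equality)

lemma smult_zero_right: "z \<odot> \<zero> = \<zero>"
  using smult_add_right[of "\<zero>" "\<zero>" z] by (simp add: add.r_cancel_one')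

end

lemma monoid_algebra_calgebra:
  assumes "Group.monoid G"
  shows "calgebra (monoid_algebra G)"
proof -
  let ?A = "monoid_algebra G"
  interpret G: Group.monoid G by (fact assms)
  note vc = vector_space_complex
  have mult_closed: "f \<otimes>\<^bsub>?A\<^esub> h \<in> carrier ?A" if "f \<in> carrier ?A" "h \<in> carrier ?A" for f h
  proof -
    have fin: "finite {k. f k \<noteq> 0}" "finite {k. h k \<noteq> 0}"
      and sub: "{k. f k \<noteq> 0} \<subseteq> carrier G" "{k. h k \<noteq> 0} \<subseteq> carrier G"
      using that by (auto simp: monoid_algebra_carrier)
    have "(\<lambda>(a, b). a \<otimes>\<^bsub>G\<^esub> b) ` ({k. f k \<noteq> 0} \<times> {k. h k \<noteq> 0}) \<subseteq> carrier G" using sub by auto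
    then show ?thesis
      using monoid_algebra_mult_support[where f=f and h=h and G=G] fin
      unfolding monoid_algebra_carrier by (meson finite_SigmaI finite_imageI finite_subset subset_trans)
  qed
  have ag: "abelian_group ?A"
  proof (rule abelian_groupI)
    fix f assume f: "f \<in> carrier ?A"
    have "(\<lambda>g. - f g) \<in> carrier ?A" using f by (auto simp: monoid_algebra_carrier)
    then show "\<exists>h\<in>carrier ?A. h \<oplus>\<^bsub>?A\<^esub> f = \<zero>\<^bsub>?A\<^esub>"
      by (intro bexI[of _ "\<lambda>g. - f g"]) (auto simp: monoid_algebra_simps)
  next
    fix f h assume "f \<in> carrier ?A" "h \<in> carrier ?A"
    then have "finite ({k. f k \<noteq> 0} \<union> {k. h k \<noteq> 0})" "{k. f k \<noteq> 0} \<union> {k. h k \<noteq> 0} \<subseteq> carrier G"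
      by (auto simp: monoid_algebra_carrier)
    moreover have "{k. f k + h k \<noteq> 0} \<subseteq> {k. f k \<noteq> 0} \<union> {k. h k \<noteq> 0}" by auto
    ultimately show "f \<oplus>\<^bsub>?A\<^esub> h \<in> carrier ?A"
      by (auto simp: monoid_algebra_carrier monoid_algebra_simps intro: finite_subset)
  qed (auto simp: monoid_algebra_simps monoid_algebra_carrier algebra_simps)
  have mn: "Group.monoid ?A"
  proof (rule monoidI)
    show "\<one>\<^bsub>?A\<^esub> \<in> carrier ?A" by (auto simp: monoid_algebra_simps monoid_algebra_carrier basis_elt_def)
  next
    fix f h l assume car: "f \<in> carrier ?A" "h \<in> carrier ?A" "l \<in> carrier ?A"
    have fin: "finite {k. f k \<noteq> 0}" "finite {k. h k \<noteq> 0}" "finite {k. l k \<noteq> 0}"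
      "finite {k. (f \<otimes>\<^bsub>?A\<^esub> h) k \<noteq> 0}" "finite {k. (h \<otimes>\<^bsub>?A\<^esub> l) k \<noteq> 0}"
      using car mult_closed[of f h] mult_closed[of h l] by (auto simp: monoid_algebra_carrier)
    show "(f \<otimes>\<^bsub>?A\<^esub> h) \<otimes>\<^bsub>?A\<^esub> l = f \<otimes>\<^bsub>?A\<^esub> (h \<otimes>\<^bsub>?A\<^esub> l)"
    proof
      fix k
      have "((f \<otimes>\<^bsub>?A\<^esub> h) \<otimes>\<^bsub>?A\<^esub> l) k = lincomb (*) f (\<lambda>a. lincomb (*) h (\<lambda>b. lincomb (*) l
          (\<lambda>c. if (a \<otimes>\<^bsub>G\<^esub> b) \<otimes>\<^bsub>G\<^esub> c = k then 1 else 0)))"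
        using fin by (simp add: monoid_algebra_mult_lincomb[of "f \<otimes>\<^bsub>?A\<^esub> h"] lincomb_mult[OF vc])
      also have "\<dots> = lincomb (*) f (\<lambda>a. lincomb (*) h (\<lambda>b. lincomb (*) l
          (\<lambda>c. if a \<otimes>\<^bsub>G\<^esub> (b \<otimes>\<^bsub>G\<^esub> c) = k then 1 else 0)))"
        \<comment> \<open>Associativity in \<open>G\<close> holds only on its carrier, so the
          rewriting is done inside the sums, where all indices lie in supports.\<close>
        unfolding lincomb_def
      proof (intro sum.cong refl arg_cong2[where f="(*)"])
        fix a b d assume "a \<in> {k. f k \<noteq> 0}" "b \<in> {k. h k \<noteq> 0}" "d \<in> {k. l k \<noteq> 0}"
        then have "a \<in> carrier G" "b \<in> carrier G" "d \<in> carrier G"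
          using car by (auto simp: monoid_algebra_carrier)
        then show "(if a \<otimes>\<^bsub>G\<^esub> b \<otimes>\<^bsub>G\<^esub> d = k then 1 else 0) = (if a \<otimes>\<^bsub>G\<^esub> (b \<otimes>\<^bsub>G\<^esub> d) = k then 1 else 0)"
          by (simp add: G.m_assoc)
      qed
      also have "\<dots> = (f \<otimes>\<^bsub>?A\<^esub> (h \<otimes>\<^bsub>?A\<^esub> l)) k"
        using fin by (simp add: monoid_algebra_mult_lincomb[of f "h \<otimes>\<^bsub>?A\<^esub> l"] lincomb_mult[OF vc])
      finally show "((f \<otimes>\<^bsub>?A\<^esub> h) \<otimes>\<^bsub>?A\<^esub> l) k = (f \<otimes>\<^bsub>?A\<^esub> (h \<otimes>\<^bsub>?A\<^esub> l)) k" .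
    qed
  next
    fix f assume f: "f \<in> carrier ?A"
    then have fin: "finite {k. f k \<noteq> 0}" and sub: "{k. f k \<noteq> 0} \<subseteq> carrier G"
      by (auto simp: monoid_algebra_carrier)
    have b: "finite {k. basis_elt \<one>\<^bsub>G\<^esub> k \<noteq> 0}" by (auto simp: basis_elt_def)
    have e: "lincomb (*) f (\<lambda>b. if b = k then 1 else 0) = f k" for k
      using fin by (auto simp: lincomb_def if_distrib cong: if_cong)
    have c: "lincomb (*) f (\<lambda>b. if \<one>\<^bsub>G\<^esub> \<otimes>\<^bsub>G\<^esub> b = k then 1 else 0) = lincomb (*) f (\<lambda>b. if b = k then 1 else 0)"
      "lincomb (*) f (\<lambda>b. if b \<otimes>\<^bsub>G\<^esub> \<one>\<^bsub>G\<^esub> = k then 1 else 0) = lincomb (*) f (\<lambda>b. if b = k then 1 else 0)"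
      for k using sub by (auto simp: lincomb_def intro!: sum.cong)
    show "\<one>\<^bsub>?A\<^esub> \<otimes>\<^bsub>?A\<^esub> f = f"
      unfolding monoid_algebra_simps
      by (rule ext, subst monoid_algebra_mult_lincomb[OF b fin]) (simp add: lincomb_basis[OF vc] c e)
    show "f \<otimes>\<^bsub>?A\<^esub> \<one>\<^bsub>?A\<^esub> = f"
      unfolding monoid_algebra_simps
      by (rule ext, subst monoid_algebra_mult_lincomb[OF fin b]) (simp add: lincomb_basis[OF vc] c e)
  qed (fact mult_closed)
  have fin_add: "finite {k. f k + h k \<noteq> 0}" if "finite {k. f k \<noteq> 0}" "finite {k. h k \<noteq> 0}" for f h :: "'a \<Rightarrow> complex"
    by (rule finite_subset[OF _ finite_UnI[OF that]]) auto
  have fin_smult: "finite {k. z * f k \<noteq> 0}" if "finite {k. f k \<noteq> 0}" for f :: "'a \<Rightarrow> complex" and z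
    by (rule finite_subset[OF _ that]) auto
  show ?thesis
  proof (intro calgebra.intro ringI ag mn calgebra_axioms.intro)
    fix f h l assume car: "f \<in> carrier ?A" "h \<in> carrier ?A" "l \<in> carrier ?A"
    then have fin: "finite {k. f k \<noteq> 0}" "finite {k. h k \<noteq> 0}" "finite {k. l k \<noteq> 0}"
      by (auto simp: monoid_algebra_carrier)
    show "(f \<oplus>\<^bsub>?A\<^esub> h) \<otimes>\<^bsub>?A\<^esub> l = f \<otimes>\<^bsub>?A\<^esub> l \<oplus>\<^bsub>?A\<^esub> h \<otimes>\<^bsub>?A\<^esub> l"
      unfolding monoid_algebra_simps using fin fin_add[OF fin(1,2)]
      by (auto simp: monoid_algebra_mult_lincomb lincomb_add[OF vc])
    show "l \<otimes>\<^bsub>?A\<^esub> (f \<oplus>\<^bsub>?A\<^esub> h) = l \<otimes>\<^bsub>?A\<^esub> f \<oplus>\<^bsub>?A\<^esub> l \<otimes>\<^bsub>?A\<^esub> h"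
      unfolding monoid_algebra_simps using fin fin_add[OF fin(1,2)]
      by (auto simp: monoid_algebra_mult_lincomb lincomb_add[OF vc] lincomb_add_right[OF vc])
  next
    fix z f h assume car: "f \<in> carrier ?A" "h \<in> carrier ?A"
    then have fin: "finite {k. f k \<noteq> 0}" "finite {k. h k \<noteq> 0}"
      by (auto simp: monoid_algebra_carrier)
    show "(z \<odot>\<^bsub>?A\<^esub> f) \<otimes>\<^bsub>?A\<^esub> h = z \<odot>\<^bsub>?A\<^esub> (f \<otimes>\<^bsub>?A\<^esub> h)"
      unfolding monoid_algebra_simps
      by (intro ext, subst monoid_algebra_mult_lincomb[OF fin_smult[OF fin(1)] fin(2)],
          subst monoid_algebra_mult_lincomb[OF fin]) (simp add: lincomb_scale[OF vc fin(1)])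
    show "f \<otimes>\<^bsub>?A\<^esub> (z \<odot>\<^bsub>?A\<^esub> h) = z \<odot>\<^bsub>?A\<^esub> (f \<otimes>\<^bsub>?A\<^esub> h)"
      unfolding monoid_algebra_simps
      by (intro ext, subst monoid_algebra_mult_lincomb[OF fin(1) fin_smult[OF fin(2)]],
          subst monoid_algebra_mult_lincomb[OF fin])
         (simp add: lincomb_scale[OF vc fin(2)] lincomb_scale_right[OF vc])
  next
    fix z f assume "f \<in> carrier ?A"
    then show "z \<odot>\<^bsub>?A\<^esub> f \<in> carrier ?A"
      unfolding monoid_algebra_carrier monoid_algebra_simps using fin_smult by auto
  qed (auto simp: monoid_algebra_simps algebra_simps)
qed

section \<open>Quotients of algebras\<close>

context
  fixes A :: "(complex, 'a) module" (structure) and I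
  assumes cA: "calgebra A" and idl: "ideal I A"
begin

interpretation calgebra A by (fact cA)
interpretation ideal I A by (fact idl)

text \<open>Since z x = (z 1) x, a ring ideal is automatically a subspace, and the ring quotient
  inherits the scalars.\<close>

lemma ideal_smult: "x \<in> I \<Longrightarrow> z \<odot> x \<in> I"
  using I_l_closed[of x "z \<odot> \<one>"] by (simp add: Icarr smult_mult)

lemma quot_algebra_simps:
  "carrier (quot_algebra A I) = a_rcosets I"
  "\<one>\<^bsub>quot_algebra A I\<^esub> = I +> \<one>"
  "\<zero>\<^bsub>quot_algebra A I\<^esub> = I"
  "K \<oplus>\<^bsub>quot_algebra A I\<^esub> L = K <+> L"
  "K \<otimes>\<^bsub>quot_algebra A I\<^esub> L = rcoset_mult A I K L"
  by (simp_all add: quot_algebra_def ring.defs module.defs FactRing_def)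

lemma quot_algebra_add:
  "\<lbrakk>a \<in> carrier A; b \<in> carrier A\<rbrakk> \<Longrightarrow> (I +> a) \<oplus>\<^bsub>quot_algebra A I\<^esub> (I +> b) = I +> (a \<oplus> b)"
  by (simp add: quot_algebra_simps a_rcos_sum)

lemma quot_algebra_mult:
  "\<lbrakk>a \<in> carrier A; b \<in> carrier A\<rbrakk> \<Longrightarrow> (I +> a) \<otimes>\<^bsub>quot_algebra A I\<^esub> (I +> b) = I +> (a \<otimes> b)"
  by (simp add: quot_algebra_simps rcoset_mult_add)

lemma coset_eq_iff:
  assumes "a \<in> carrier A" "b \<in> carrier A"
  shows "I +> a = I +> b \<longleftrightarrow> a \<ominus> b \<in> I"
  using assms quotient_eq_iff_same_a_r_cos[OF idl, of a b] by simp

text \<open>The union in the definition runs over all representatives of a coset; each contributes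
  the same coset, because two of them differ by an element of \<open>I\<close> and \<open>I\<close>
  is closed under scalars.\<close>

lemma quot_algebra_smult:
  assumes "a \<in> carrier A"
  shows "z \<odot>\<^bsub>quot_algebra A I\<^esub> (I +> a) = I +> (z \<odot> a)"
proof -
  have "I +> (z \<odot> k) = I +> (z \<odot> a)" if k: "k \<in> I +> a" for k
  proof -
    obtain x where x: "x \<in> I" "k = x \<oplus> a" using k by (auto simp: a_r_coset_def')
    have "z \<odot> k = z \<odot> x \<oplus> z \<odot> a" using x assms by (simp add: smult_add_right Icarr)
    then have "z \<odot> k \<ominus> z \<odot> a = z \<odot> x"
      using x assms by (simp add: a_assoc Icarr minus_eq r_neg)
    then show ?thesis using ideal_smult[OF x(1)] assms x
      by (subst coset_eq_iff) (auto simp: Icarr)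
  qed
  then have "(\<Union>k\<in>I +> a. I +> (z \<odot> k)) = (\<Union>k\<in>I +> a. I +> (z \<odot> a))" by (intro SUP_cong refl)
  moreover have "I +> a \<noteq> {}" using a_rcos_self[OF assms] by blast
  ultimately show ?thesis by (simp add: quot_algebra_def ring.defs module.defs)
qed

lemma quot_algebra_calgebra: "calgebra (quot_algebra A I)"
proof -
  let ?Q = "quot_algebra A I"
  have rep: "\<exists>a\<in>carrier A. K = I +> a" if "K \<in> carrier ?Q" for K
    using that by (auto simp: quot_algebra_simps A_RCOSETS_def')
  have cl: "I +> a \<in> carrier ?Q" if "a \<in> carrier A" for a
    using that by (auto simp: quot_algebra_simps A_RCOSETS_def')
  have I0: "I = I +> \<zero>" using a_rcos_zero[OF idl] additive_subgroup.zero_closed[OF ideal.axioms(1)[OF idl]] by simp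
  have ag: "abelian_group ?Q"
  proof (rule abelian_groupI)
    fix a b assume "a \<in> carrier ?Q" "b \<in> carrier ?Q"
    then obtain x y where xy: "x \<in> carrier A" "y \<in> carrier A" "a = I +> x" "b = I +> y"
      using rep[of a] rep[of b] by blast
    show "a \<oplus>\<^bsub>?Q\<^esub> b \<in> carrier ?Q" "a \<oplus>\<^bsub>?Q\<^esub> b = b \<oplus>\<^bsub>?Q\<^esub> a"
      using xy by (simp_all add: quot_algebra_add cl a_comm)
  next
    fix a b d assume "a \<in> carrier ?Q" "b \<in> carrier ?Q" "d \<in> carrier ?Q"
    then obtain x y z where xy: "x \<in> carrier A" "y \<in> carrier A" "z \<in> carrier A"
      "a = I +> x" "b = I +> y" "d = I +> z"
      using rep[of a] rep[of b] rep[of d] by blast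
    show "a \<oplus>\<^bsub>?Q\<^esub> b \<oplus>\<^bsub>?Q\<^esub> d = a \<oplus>\<^bsub>?Q\<^esub> (b \<oplus>\<^bsub>?Q\<^esub> d)"
      using xy by (simp add: quot_algebra_add a_assoc)
  next
    fix a assume "a \<in> carrier ?Q"
    then obtain x where xy: "x \<in> carrier A" "a = I +> x" using rep[of a] by blast
    show "\<zero>\<^bsub>?Q\<^esub> \<oplus>\<^bsub>?Q\<^esub> a = a"
      unfolding quot_algebra_simps(3) xy(2) by (subst (1) I0) (simp add: quot_algebra_add xy)
    have "(I +> (\<ominus> x)) \<oplus>\<^bsub>?Q\<^esub> a = \<zero>\<^bsub>?Q\<^esub>"
      unfolding quot_algebra_simps(3) xy(2) using xy by (simp add: quot_algebra_add l_neg flip: I0)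
    then show "\<exists>y\<in>carrier ?Q. y \<oplus>\<^bsub>?Q\<^esub> a = \<zero>\<^bsub>?Q\<^esub>" using cl xy by blast
  qed (simp add: quot_algebra_simps(3), subst I0, rule cl, simp)
  have mn: "Group.monoid ?Q"
  proof (rule monoidI)
    fix a b assume "a \<in> carrier ?Q" "b \<in> carrier ?Q"
    then obtain x y where xy: "x \<in> carrier A" "y \<in> carrier A" "a = I +> x" "b = I +> y"
      using rep[of a] rep[of b] by blast
    show "a \<otimes>\<^bsub>?Q\<^esub> b \<in> carrier ?Q" using xy by (simp add: quot_algebra_mult cl)
  next
    fix a b d assume "a \<in> carrier ?Q" "b \<in> carrier ?Q" "d \<in> carrier ?Q"
    then obtain x y z where xy: "x \<in> carrier A" "y \<in> carrier A" "z \<in> carrier A"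
      "a = I +> x" "b = I +> y" "d = I +> z"
      using rep[of a] rep[of b] rep[of d] by blast
    show "a \<otimes>\<^bsub>?Q\<^esub> b \<otimes>\<^bsub>?Q\<^esub> d = a \<otimes>\<^bsub>?Q\<^esub> (b \<otimes>\<^bsub>?Q\<^esub> d)"
      using xy by (simp add: quot_algebra_mult m_assoc)
  next
    fix a assume "a \<in> carrier ?Q"
    then obtain x where xy: "x \<in> carrier A" "a = I +> x" using rep[of a] by blast
    show "\<one>\<^bsub>?Q\<^esub> \<otimes>\<^bsub>?Q\<^esub> a = a" "a \<otimes>\<^bsub>?Q\<^esub> \<one>\<^bsub>?Q\<^esub> = a"
      unfolding quot_algebra_simps(2) using xy by (simp_all add: quot_algebra_mult)
  qed (simp add: quot_algebra_simps(2) cl)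
  have r: "ring ?Q"
  proof (rule ringI[OF ag mn])
    fix a b d assume "a \<in> carrier ?Q" "b \<in> carrier ?Q" "d \<in> carrier ?Q"
    then obtain x y z where xy: "x \<in> carrier A" "y \<in> carrier A" "z \<in> carrier A"
      "a = I +> x" "b = I +> y" "d = I +> z"
      using rep[of a] rep[of b] rep[of d] by blast
    show "(a \<oplus>\<^bsub>?Q\<^esub> b) \<otimes>\<^bsub>?Q\<^esub> d = a \<otimes>\<^bsub>?Q\<^esub> d \<oplus>\<^bsub>?Q\<^esub> b \<otimes>\<^bsub>?Q\<^esub> d"
      "d \<otimes>\<^bsub>?Q\<^esub> (a \<oplus>\<^bsub>?Q\<^esub> b) = d \<otimes>\<^bsub>?Q\<^esub> a \<oplus>\<^bsub>?Q\<^esub> d \<otimes>\<^bsub>?Q\<^esub> b"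
      using xy by (simp_all add: quot_algebra_mult quot_algebra_add l_distr r_distr)
  qed
  show ?thesis
  proof (intro calgebra.intro r calgebra_axioms.intro)
    fix a b z w assume "a \<in> carrier ?Q" "b \<in> carrier ?Q"
    then obtain x y where xy: "x \<in> carrier A" "y \<in> carrier A" "a = I +> x" "b = I +> y"
      using rep[of a] rep[of b] by blast
    show "z \<odot>\<^bsub>?Q\<^esub> (a \<oplus>\<^bsub>?Q\<^esub> b) = z \<odot>\<^bsub>?Q\<^esub> a \<oplus>\<^bsub>?Q\<^esub> z \<odot>\<^bsub>?Q\<^esub> b"
      using xy by (simp add: quot_algebra_add quot_algebra_smult smult_add_right)
    show "z \<odot>\<^bsub>?Q\<^esub> a \<otimes>\<^bsub>?Q\<^esub> b = z \<odot>\<^bsub>?Q\<^esub> (a \<otimes>\<^bsub>?Q\<^esub> b)" "a \<otimes>\<^bsub>?Q\<^esub> (z \<odot>\<^bsub>?Q\<^esub> b) = z \<odot>\<^bsub>?Q\<^esub> (a \<otimes>\<^bsub>?Q\<^esub> b)"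
      using xy by (simp_all add: quot_algebra_mult quot_algebra_smult smult_mult mult_smult)
  next
    fix a z w assume "a \<in> carrier ?Q"
    then obtain x where xy: "x \<in> carrier A" "a = I +> x"
      using rep[of a] by blast
    show "z \<odot>\<^bsub>?Q\<^esub> a \<in> carrier ?Q" "(z + w) \<odot>\<^bsub>?Q\<^esub> a = z \<odot>\<^bsub>?Q\<^esub> a \<oplus>\<^bsub>?Q\<^esub> w \<odot>\<^bsub>?Q\<^esub> a"
      "z \<odot>\<^bsub>?Q\<^esub> (w \<odot>\<^bsub>?Q\<^esub> a) = (z * w) \<odot>\<^bsub>?Q\<^esub> a" "1 \<odot>\<^bsub>?Q\<^esub> a = a"
      using xy by (simp_all add: quot_algebra_add quot_algebra_smult smult_add_left smult_assoc smult_one_left cl)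
  qed
qed

end

section \<open>The rational Cherednik algebra and its modules\<close>

declare One_nat_def [simp del]

lemma monoid_algebra_basis_mult:
  "basis_elt g \<otimes>\<^bsub>monoid_algebra G\<^esub> basis_elt h = basis_elt (g \<otimes>\<^bsub>G\<^esub> h)"
proof -
  have "finite {k. basis_elt g k \<noteq> 0}" for g :: 'a by (auto simp: basis_elt_def)
  then show ?thesis
    by (intro ext, subst monoid_algebra_mult_lincomb)
       (auto simp: lincomb_basis[OF vector_space_complex], auto simp: basis_elt_def)
qed

lemma basis_elt_closed: "g \<in> carrier G \<Longrightarrow> basis_elt g \<in> carrier (monoid_algebra G)"
  by (auto simp: monoid_algebra_carrier basis_elt_def)

lemma monoid_algebra_induct [consumes 1, case_names zero add]:
  assumes "f \<in> carrier (monoid_algebra G)"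
    and zero: "P (\<lambda>_. 0)"
    and add: "\<And>z g f. \<lbrakk>g \<in> carrier G; f \<in> carrier (monoid_algebra G); P f\<rbrakk>
      \<Longrightarrow> P (z \<odot>\<^bsub>monoid_algebra G\<^esub> basis_elt g \<oplus>\<^bsub>monoid_algebra G\<^esub> f)"
  shows "P f"
proof -
  \<comment> \<open>The induction is over a finite superset of the support, so that resetting one
    value to 0 decreases it whether or not that value vanished.\<close>
  have "finite S \<Longrightarrow> S \<subseteq> carrier G \<Longrightarrow> {g. f g \<noteq> 0} \<subseteq> S \<Longrightarrow> P f" for S f
  proof (induction S arbitrary: f rule: finite_induct)
    case empty
    then have "f = (\<lambda>_. 0)" by auto
    then show ?case using zero by simp
  next
    case (insert x S)
    let ?f = "f(x := 0)"
    have sub: "{g. ?f g \<noteq> 0} \<subseteq> S" using insert.prems by auto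
    then have "P ?f" using insert by auto
    moreover have "?f \<in> carrier (monoid_algebra G)"
      using sub insert.prems insert.hyps by (auto simp: monoid_algebra_carrier intro: finite_subset)
    moreover have "f = f x \<odot>\<^bsub>monoid_algebra G\<^esub> basis_elt x \<oplus>\<^bsub>monoid_algebra G\<^esub> ?f"
      by (auto simp: monoid_algebra_simps basis_elt_def)
    ultimately show ?case using add[of x ?f "f x"] insert.prems by simp
  qed
  then show ?thesis using assms(1) by (auto simp: monoid_algebra_carrier)
qed

abbreviation mon :: "nat letter list \<Rightarrow> (nat \<Rightarrow> nat) \<Rightarrow> free_elt" where
  "mon u p \<equiv> basis_elt (u, p)"

lemma words_carrier: "u \<in> carrier (words n) \<longleftrightarrow> set u \<subseteq> LX ` {1..n} \<union> LY ` {1..n}"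
  by (auto simp: words_def)

lemma map_letter_words:
  assumes "p permutes {1..n}" "u \<in> carrier (words n)"
  shows "map (map_letter p) u \<in> carrier (words n)"
proof -
  have "map_letter p l \<in> LX ` {1..n} \<union> LY ` {1..n}" if "l \<in> LX ` {1..n} \<union> LY ` {1..n}" for l
    using that permutes_in_image[OF assms(1)] by (cases l) auto
  then show ?thesis
    unfolding words_carrier set_map
    by (intro image_subsetI) (meson assms(2) subsetD words_carrier)
qed

lemma semidirect_simps:
  "carrier (semidirect n W act) = carrier W \<times> carrier (sym_group n)"
  "(v, p) \<otimes>\<^bsub>semidirect n W act\<^esub> (w, q) = (v \<otimes>\<^bsub>W\<^esub> act p w, p \<circ> q)"
  "\<one>\<^bsub>semidirect n W act\<^esub> = (\<one>\<^bsub>W\<^esub>, id)"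
  by (auto simp: semidirect_def)

lemma words_semidirect_monoid: "Group.monoid (semidirect n (words n) (\<lambda>p. map (map_letter p)))"
proof (rule monoidI)
  fix x y assume xy: "x \<in> carrier (semidirect n (words n) (\<lambda>p. map (map_letter p)))"
    "y \<in> carrier (semidirect n (words n) (\<lambda>p. map (map_letter p)))"
  obtain u p v q where "x = (u, p)" "y = (v, q)" by (cases x, cases y)
  then show "x \<otimes>\<^bsub>semidirect n (words n) (\<lambda>p. map (map_letter p))\<^esub> y
      \<in> carrier (semidirect n (words n) (\<lambda>p. map (map_letter p)))"
    using xy map_letter_words[of p n v]
    by (auto simp: semidirect_simps sym_group_carrier permutes_compose words_carrier words_def)
next
  fix x y z assume "x \<in> carrier (semidirect n (words n) (\<lambda>p. map (map_letter p)))"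
    "y \<in> carrier (semidirect n (words n) (\<lambda>p. map (map_letter p)))"
    "z \<in> carrier (semidirect n (words n) (\<lambda>p. map (map_letter p)))"
  obtain u p v q w r where "x = (u, p)" "y = (v, q)" "z = (w, r)" by (cases x, cases y, cases z)
  then show "x \<otimes>\<^bsub>semidirect n (words n) (\<lambda>p. map (map_letter p))\<^esub> y
      \<otimes>\<^bsub>semidirect n (words n) (\<lambda>p. map (map_letter p))\<^esub> z =
    x \<otimes>\<^bsub>semidirect n (words n) (\<lambda>p. map (map_letter p))\<^esub>
      (y \<otimes>\<^bsub>semidirect n (words n) (\<lambda>p. map (map_letter p))\<^esub> z)"
    by (auto simp: semidirect_simps words_def letter.map_comp o_assoc)
qed (auto simp: semidirect_simps words_def sym_group_carrier letter.map_id0 permutes_id)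

lemma free_smash_calgebra: "calgebra (free_smash n)"
  unfolding free_smash_def by (rule monoid_algebra_calgebra[OF words_semidirect_monoid])

lemma mon_closed:
  "\<lbrakk>u \<in> carrier (words n); p permutes {1..n}\<rbrakk> \<Longrightarrow> mon u p \<in> carrier (free_smash n)"
  unfolding free_smash_def by (rule basis_elt_closed) (simp add: semidirect_simps sym_group_carrier)

lemma mon_mult: "mon u p \<otimes>\<^bsub>free_smash n\<^esub> mon v q = mon (u @ map (map_letter p) v) (p \<circ> q)"
  by (simp add: free_smash_def monoid_algebra_basis_mult semidirect_simps words_def)

lemma mon_one: "\<one>\<^bsub>free_smash n\<^esub> = mon [] id"
  by (simp add: free_smash_def monoid_algebra_simps semidirect_simps words_def)

lemma words_LX [simp]: "LX i # u \<in> carrier (words n) \<longleftrightarrow> i \<in> {1..n} \<and> u \<in> carrier (words n)"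
  and words_LY [simp]: "LY i # u \<in> carrier (words n) \<longleftrightarrow> i \<in> {1..n} \<and> u \<in> carrier (words n)"
  and words_Nil [simp]: "[] \<in> carrier (words n)"
  and words_append [simp]: "u @ v \<in> carrier (words n) \<longleftrightarrow> u \<in> carrier (words n) \<and> v \<in> carrier (words n)"
  by (auto simp: words_carrier)

lemma transpose_permutes:
  "i \<in> {1..n::nat} \<Longrightarrow> j \<in> {1..n} \<Longrightarrow> transpose i j permutes {1..n}"
  by (rule permutes_swap_id)

locale cherednik_alg =
  fixes n :: nat and t c :: complex
begin

abbreviation "FS \<equiv> free_smash n"
abbreviation "HA \<equiv> cherednik n t c"
abbreviation "I \<equiv> cherednik_ideal n t c"
abbreviation "hX \<equiv> hx n t c"
abbreviation "hY \<equiv> hy n t c"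
abbreviation "hP \<equiv> hperm n t c"
abbreviation "hU \<equiv> hu n t c"
abbreviation "CL \<equiv> cls n t c"

sublocale FS: calgebra FS by (rule free_smash_calgebra)

lemma fx_closed [simp]: "i \<in> {1..n} \<Longrightarrow> fx i \<in> carrier FS"
  and fy_closed [simp]: "i \<in> {1..n} \<Longrightarrow> fy i \<in> carrier FS"
  and fperm_closed [simp]: "p permutes {1..n} \<Longrightarrow> fperm p \<in> carrier FS"
  by (auto simp: fx_def fy_def fperm_def mon_closed permutes_id)

lemma cherednik_rels_closed: "cherednik_rels n t c \<subseteq> carrier FS"
proof -
  have "(\<Oplus>\<^bsub>FS\<^esub>j\<in>{1..n} - {i}. fperm (transpose i j)) \<in> carrier FS" if "i \<in> {1..n}" for i
    by (rule FS.finsum_closed) (use that in \<open>auto intro!: fperm_closed transpose_permutes\<close>)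
  then show ?thesis
    unfolding cherednik_rels_def Let_def by (auto simp: transpose_permutes)
qed

lemma ideal_I: "ideal I FS"
  unfolding cherednik_ideal_def by (rule FS.genideal_ideal[OF cherednik_rels_closed])

lemma rels_in_I: "cherednik_rels n t c \<subseteq> I"
  unfolding cherednik_ideal_def by (rule FS.genideal_self[OF cherednik_rels_closed])

sublocale HA: calgebra HA
  unfolding cherednik_def by (rule quot_algebra_calgebra[OF FS.calgebra_axioms ideal_I])

lemma CL_closed [simp, intro]: "f \<in> carrier FS \<Longrightarrow> CL f \<in> carrier HA"
  by (auto simp: cls_def cherednik_def quot_algebra_simps[OF FS.calgebra_axioms ideal_I] A_RCOSETS_def')

lemma CL_surj: "a \<in> carrier HA \<Longrightarrow> \<exists>f\<in>carrier FS. a = CL f"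
  by (auto simp: cls_def cherednik_def quot_algebra_simps[OF FS.calgebra_axioms ideal_I] A_RCOSETS_def')

lemma CL_add: "\<lbrakk>f \<in> carrier FS; g \<in> carrier FS\<rbrakk> \<Longrightarrow> CL (f \<oplus>\<^bsub>FS\<^esub> g) = CL f \<oplus>\<^bsub>HA\<^esub> CL g"
  and CL_mult: "\<lbrakk>f \<in> carrier FS; g \<in> carrier FS\<rbrakk> \<Longrightarrow> CL (f \<otimes>\<^bsub>FS\<^esub> g) = CL f \<otimes>\<^bsub>HA\<^esub> CL g"
  and CL_smult: "f \<in> carrier FS \<Longrightarrow> CL (z \<odot>\<^bsub>FS\<^esub> f) = z \<odot>\<^bsub>HA\<^esub> CL f"
  and CL_one: "CL \<one>\<^bsub>FS\<^esub> = \<one>\<^bsub>HA\<^esub>"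
  and CL_eq_iff: "\<lbrakk>f \<in> carrier FS; g \<in> carrier FS\<rbrakk> \<Longrightarrow> CL f = CL g \<longleftrightarrow> f \<ominus>\<^bsub>FS\<^esub> g \<in> I"
  by (simp_all add: cls_def cherednik_def quot_algebra_add[OF FS.calgebra_axioms ideal_I]
      quot_algebra_mult[OF FS.calgebra_axioms ideal_I] quot_algebra_smult[OF FS.calgebra_axioms ideal_I]
      quot_algebra_simps(2)[OF FS.calgebra_axioms ideal_I] coset_eq_iff[OF FS.calgebra_axioms ideal_I])

lemma CL_zero: "CL \<zero>\<^bsub>FS\<^esub> = \<zero>\<^bsub>HA\<^esub>"
  using CL_smult[of "\<zero>\<^bsub>FS\<^esub>" 0] by (simp add: FS.smult_zero_right HA.smult_zero_left)

lemma CL_minus: "\<lbrakk>f \<in> carrier FS; g \<in> carrier FS\<rbrakk> \<Longrightarrow> CL (f \<ominus>\<^bsub>FS\<^esub> g) = CL f \<ominus>\<^bsub>HA\<^esub> CL g"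
  by (simp add: a_minus_def CL_add flip: FS.smult_neg_one HA.smult_neg_one CL_smult)

lemma CL_finsum:
  "f \<in> J \<rightarrow> carrier FS \<Longrightarrow> CL (\<Oplus>\<^bsub>FS\<^esub>j\<in>J. f j) = (\<Oplus>\<^bsub>HA\<^esub>j\<in>J. CL (f j))"
  by (induction J rule: infinite_finite_induct) (auto simp: CL_zero CL_add Pi_def)

lemma hX_closed [simp, intro]: "i \<in> {1..n} \<Longrightarrow> hX i \<in> carrier HA"
  and hY_closed [simp, intro]: "i \<in> {1..n} \<Longrightarrow> hY i \<in> carrier HA"
  and hP_closed [simp, intro]: "p permutes {1..n} \<Longrightarrow> hP p \<in> carrier HA"
  by (simp_all add: hx_def hy_def hperm_def CL_closed del: atLeastAtMost_iff)

lemma CL_mon_LX: "\<lbrakk>i \<in> {1..n}; u \<in> carrier (words n); p permutes {1..n}\<rbrakk>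
    \<Longrightarrow> CL (mon (LX i # u) p) = hX i \<otimes>\<^bsub>HA\<^esub> CL (mon u p)"
  and CL_mon_LY: "\<lbrakk>i \<in> {1..n}; u \<in> carrier (words n); p permutes {1..n}\<rbrakk>
    \<Longrightarrow> CL (mon (LY i # u) p) = hY i \<otimes>\<^bsub>HA\<^esub> CL (mon u p)"
  unfolding hx_def hy_def
  by (subst CL_mult[symmetric]; simp add: mon_closed fx_def fy_def mon_mult letter.map_id0 permutes_id del: atLeastAtMost_iff)+

lemma CL_mon_Nil: "CL (mon [] p) = hP p"
  by (simp add: hperm_def fperm_def)

lemma CL_mon_append:
  "\<lbrakk>u \<in> carrier (words n); v \<in> carrier (words n); p permutes {1..n}\<rbrakk>
    \<Longrightarrow> CL (mon (u @ v) p) = CL (mon u id) \<otimes>\<^bsub>HA\<^esub> CL (mon v p)"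
  by (subst CL_mult[symmetric]) (simp_all add: mon_closed mon_mult letter.map_id0 permutes_id)

lemma hP_CL_mon:
  "\<lbrakk>u \<in> carrier (words n); p permutes {1..n}; q permutes {1..n}\<rbrakk>
    \<Longrightarrow> hP p \<otimes>\<^bsub>HA\<^esub> CL (mon u q) = CL (mon (map (map_letter p) u) (p \<circ> q))"
  unfolding hperm_def by (subst CL_mult[symmetric]) (simp_all add: mon_closed fperm_def mon_mult)

lemma hP_id: "hP id = \<one>\<^bsub>HA\<^esub>"
  using CL_one by (simp add: mon_one CL_mon_Nil)

lemma hP_mult: "\<lbrakk>p permutes {1..n}; q permutes {1..n}\<rbrakk> \<Longrightarrow> hP p \<otimes>\<^bsub>HA\<^esub> hP q = hP (p \<circ> q)"
  using hP_CL_mon[of "[]" p q] by (simp add: CL_mon_Nil)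

lemma hP_hX: "\<lbrakk>p permutes {1..n}; i \<in> {1..n}\<rbrakk> \<Longrightarrow> hP p \<otimes>\<^bsub>HA\<^esub> hX i = hX (p i) \<otimes>\<^bsub>HA\<^esub> hP p"
  and hP_hY: "\<lbrakk>p permutes {1..n}; i \<in> {1..n}\<rbrakk> \<Longrightarrow> hP p \<otimes>\<^bsub>HA\<^esub> hY i = hY (p i) \<otimes>\<^bsub>HA\<^esub> hP p"
  using hP_CL_mon[of "[LX i]" p id] CL_mon_LX[of i "[]" id] CL_mon_LX[of "p i" "[]" p]
    hP_CL_mon[of "[LY i]" p id] CL_mon_LY[of i "[]" id] CL_mon_LY[of "p i" "[]" p]
    permutes_in_image[of p "{1..n}" i]
  by (simp_all add: CL_mon_Nil permutes_id hP_id del: atLeastAtMost_iff)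

lemma hX_comm:
  assumes "i \<in> {1..n}" "j \<in> {1..n}" shows "hX i \<otimes>\<^bsub>HA\<^esub> hX j = hX j \<otimes>\<^bsub>HA\<^esub> hX i"
proof -
  have "fx i \<otimes>\<^bsub>FS\<^esub> fx j \<ominus>\<^bsub>FS\<^esub> fx j \<otimes>\<^bsub>FS\<^esub> fx i \<in> I"
    using assms by (intro subsetD[OF rels_in_I]) (unfold cherednik_rels_def Let_def, blast)
  then have "CL (fx i \<otimes>\<^bsub>FS\<^esub> fx j) = CL (fx j \<otimes>\<^bsub>FS\<^esub> fx i)" using assms by (subst CL_eq_iff) simp_all
  then show ?thesis using assms by (simp add: hx_def CL_mult del: atLeastAtMost_iff)
qed

lemma hY_comm:
  assumes "i \<in> {1..n}" "j \<in> {1..n}" shows "hY i \<otimes>\<^bsub>HA\<^esub> hY j = hY j \<otimes>\<^bsub>HA\<^esub> hY i"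
proof -
  have "fy i \<otimes>\<^bsub>FS\<^esub> fy j \<ominus>\<^bsub>FS\<^esub> fy j \<otimes>\<^bsub>FS\<^esub> fy i \<in> I"
    using assms by (intro subsetD[OF rels_in_I]) (unfold cherednik_rels_def Let_def, blast)
  then have "CL (fy i \<otimes>\<^bsub>FS\<^esub> fy j) = CL (fy j \<otimes>\<^bsub>FS\<^esub> fy i)" using assms by (subst CL_eq_iff) simp_all
  then show ?thesis using assms by (simp add: hy_def CL_mult del: atLeastAtMost_iff)
qed

lemma hY_hX:
  assumes "i \<in> {1..n}" "j \<in> {1..n}" "i \<noteq> j"
  shows "hY i \<otimes>\<^bsub>HA\<^esub> hX j = hX j \<otimes>\<^bsub>HA\<^esub> hY i \<oplus>\<^bsub>HA\<^esub> c \<odot>\<^bsub>HA\<^esub> hP (transpose i j)"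
proof -
  note tp = transpose_permutes[OF assms(1,2)]
  have "(fy i \<otimes>\<^bsub>FS\<^esub> fx j \<ominus>\<^bsub>FS\<^esub> fx j \<otimes>\<^bsub>FS\<^esub> fy i) \<ominus>\<^bsub>FS\<^esub> c \<odot>\<^bsub>FS\<^esub> fperm (transpose i j) \<in> I"
    using assms by (intro subsetD[OF rels_in_I]) (unfold cherednik_rels_def Let_def, blast)
  then have "CL (fy i \<otimes>\<^bsub>FS\<^esub> fx j \<ominus>\<^bsub>FS\<^esub> fx j \<otimes>\<^bsub>FS\<^esub> fy i) = CL (c \<odot>\<^bsub>FS\<^esub> fperm (transpose i j))"
    using assms tp by (subst CL_eq_iff) simp_all
  then have "hY i \<otimes>\<^bsub>HA\<^esub> hX j \<ominus>\<^bsub>HA\<^esub> hX j \<otimes>\<^bsub>HA\<^esub> hY i = c \<odot>\<^bsub>HA\<^esub> hP (transpose i j)"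
    using assms tp by (simp add: hx_def hy_def hperm_def CL_mult CL_minus CL_smult del: atLeastAtMost_iff)
  moreover have "hY i \<otimes>\<^bsub>HA\<^esub> hX j = hX j \<otimes>\<^bsub>HA\<^esub> hY i \<oplus>\<^bsub>HA\<^esub> (hY i \<otimes>\<^bsub>HA\<^esub> hX j \<ominus>\<^bsub>HA\<^esub> hX j \<otimes>\<^bsub>HA\<^esub> hY i)"
    using assms by (simp add: a_minus_def HA.add.m_lcomm[of "hX j \<otimes>\<^bsub>HA\<^esub> hY i"] HA.r_neg del: atLeastAtMost_iff)
  ultimately show ?thesis by simp
qed

definition "commE i = t \<odot>\<^bsub>HA\<^esub> \<one>\<^bsub>HA\<^esub> \<ominus>\<^bsub>HA\<^esub> c \<odot>\<^bsub>HA\<^esub> (\<Oplus>\<^bsub>HA\<^esub>j\<in>{1..n} - {i}. hP (transpose i j))"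

lemma hY_hX_same:
  assumes "i \<in> {1..n}"
  shows "hY i \<otimes>\<^bsub>HA\<^esub> hX i = hX i \<otimes>\<^bsub>HA\<^esub> hY i \<oplus>\<^bsub>HA\<^esub> commE i"
proof -
  have tp: "(\<lambda>j. fperm (transpose i j)) \<in> {1..n} - {i} \<rightarrow> carrier FS"
    using transpose_permutes[OF assms] by auto
  have "(fy i \<otimes>\<^bsub>FS\<^esub> fx i \<ominus>\<^bsub>FS\<^esub> fx i \<otimes>\<^bsub>FS\<^esub> fy i) \<ominus>\<^bsub>FS\<^esub>
        (t \<odot>\<^bsub>FS\<^esub> \<one>\<^bsub>FS\<^esub> \<ominus>\<^bsub>FS\<^esub> c \<odot>\<^bsub>FS\<^esub> (\<Oplus>\<^bsub>FS\<^esub>j\<in>{1..n} - {i}. fperm (transpose i j))) \<in> I"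
    using assms by (intro subsetD[OF rels_in_I]) (unfold cherednik_rels_def Let_def, blast)
  then have "CL (fy i \<otimes>\<^bsub>FS\<^esub> fx i \<ominus>\<^bsub>FS\<^esub> fx i \<otimes>\<^bsub>FS\<^esub> fy i) =
      CL (t \<odot>\<^bsub>FS\<^esub> \<one>\<^bsub>FS\<^esub> \<ominus>\<^bsub>FS\<^esub> c \<odot>\<^bsub>FS\<^esub> (\<Oplus>\<^bsub>FS\<^esub>j\<in>{1..n} - {i}. fperm (transpose i j)))"
    using assms FS.finsum_closed[OF tp] by (subst CL_eq_iff) simp_all
  also have "\<dots> = commE i"
    unfolding commE_def hperm_def using FS.finsum_closed[OF tp]
    by (simp add: CL_minus CL_smult CL_one CL_finsum[OF tp])
  finally have "hY i \<otimes>\<^bsub>HA\<^esub> hX i \<ominus>\<^bsub>HA\<^esub> hX i \<otimes>\<^bsub>HA\<^esub> hY i = commE i"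
    using assms tp by (simp add: hx_def hy_def CL_mult CL_minus del: atLeastAtMost_iff)
  moreover have "hY i \<otimes>\<^bsub>HA\<^esub> hX i = hX i \<otimes>\<^bsub>HA\<^esub> hY i \<oplus>\<^bsub>HA\<^esub> (hY i \<otimes>\<^bsub>HA\<^esub> hX i \<ominus>\<^bsub>HA\<^esub> hX i \<otimes>\<^bsub>HA\<^esub> hY i)"
    using assms by (simp add: a_minus_def HA.add.m_lcomm[of "hX i \<otimes>\<^bsub>HA\<^esub> hY i"] HA.r_neg del: atLeastAtMost_iff)
  ultimately show ?thesis by simp
qed

lemma cherednik_induct [consumes 1, case_names zero add]:
  assumes "a \<in> carrier HA"
    and zero: "P \<zero>\<^bsub>HA\<^esub>"
    and add: "\<And>z u p b. \<lbrakk>u \<in> carrier (words n); p permutes {1..n}; b \<in> carrier HA; P b\<rbrakk>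
      \<Longrightarrow> P (z \<odot>\<^bsub>HA\<^esub> CL (mon u p) \<oplus>\<^bsub>HA\<^esub> b)"
  shows "P a"
proof -
  obtain f where f: "f \<in> carrier FS" "a = CL f" using CL_surj[OF assms(1)] by blast
  have "P (CL f)"
    using f(1) unfolding free_smash_def
  proof (induction f rule: monoid_algebra_induct)
    case zero
    then show ?case using assms(2) CL_zero by (simp add: free_smash_def monoid_algebra_simps)
  next
    case (add z g f)
    obtain u p where g: "g = (u, p)" by (cases g)
    have up: "u \<in> carrier (words n)" "p permutes {1..n}"
      using add(1) by (auto simp: g semidirect_simps sym_group_carrier)
    have f: "f \<in> carrier FS" using add(2) by (simp add: free_smash_def)
    have "P (z \<odot>\<^bsub>HA\<^esub> CL (mon u p) \<oplus>\<^bsub>HA\<^esub> CL f)"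
      using assms(3)[OF up] add f by auto
    also have "z \<odot>\<^bsub>HA\<^esub> CL (mon u p) \<oplus>\<^bsub>HA\<^esub> CL f = CL (z \<odot>\<^bsub>FS\<^esub> mon u p \<oplus>\<^bsub>FS\<^esub> f)"
      using up f by (simp add: CL_add CL_smult mon_closed)
    finally show ?case by (simp add: g free_smash_def)
  qed
  then show ?thesis by (simp add: f)
qed

end

section \<open>Representations of the Cherednik algebra from operators satisfying its
  relations\<close>

definition lin_op :: "(complex \<Rightarrow> 'w \<Rightarrow> 'w) \<Rightarrow> ('w \<Rightarrow> 'w::ab_group_add) \<Rightarrow> bool" where
  "lin_op sc f \<longleftrightarrow> (\<forall>x y. f (x + y) = f x + f y) \<and> (\<forall>z x. f (sc z x) = sc z (f x))"

lemma additive_zero: "f 0 = (0::'b::ab_group_add)"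
  and additive_uminus: "f (- x) = - f (x::'a::ab_group_add)"
  and additive_diff: "f (x - y) = f x - f y"
  and additive_sum: "f (sum g S) = (\<Sum>s\<in>S. f (g s))"
  if "\<And>x y. f (x + y) = f x + f y" for f :: "'a::ab_group_add \<Rightarrow> 'b::ab_group_add"
proof -
  show z: "f 0 = 0" using that[of 0 0] by simp
  show u: "f (- x) = - f x" for x using that[of x "- x"] z by (simp add: add_eq_0_iff)
  show "f (x - y) = f x - f y" using that[of x "- y"] u by simp
  show "f (sum g S) = (\<Sum>s\<in>S. f (g s))"
    by (induction S rule: infinite_finite_induct) (auto simp: z that)
qed

lemma lin_opD:
  assumes "lin_op sc f"
  shows "f (x + y) = f x + f y" "f (sc z x) = sc z (f x)" "f 0 = 0" "f (- x) = - f x"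
    "f (x - y) = f x - f y" "f (sum g S) = (\<Sum>s\<in>S. f (g s))"
  using assms additive_zero[of f] additive_uminus[of f] additive_diff[of f] additive_sum[of f]
  by (auto simp: lin_op_def)

lemma lin_op_lincomb: "lin_op sc f \<Longrightarrow> f (lincomb sc h T) = lincomb sc h (\<lambda>k. f (T k))"
  by (simp add: lincomb_def lin_opD)

lemma lin_op_comp: "lin_op sc f \<Longrightarrow> lin_op sc g \<Longrightarrow> lin_op sc (\<lambda>x. f (g x))"
  by (simp add: lin_op_def)

primrec letter_op :: "(nat \<Rightarrow> 'w \<Rightarrow> 'w) \<Rightarrow> (nat \<Rightarrow> 'w \<Rightarrow> 'w) \<Rightarrow> nat letter \<Rightarrow> 'w \<Rightarrow> 'w" where
  "letter_op X Y (LX i) = X i"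
| "letter_op X Y (LY i) = Y i"

primrec word_op :: "(nat \<Rightarrow> 'w \<Rightarrow> 'w) \<Rightarrow> (nat \<Rightarrow> 'w \<Rightarrow> 'w) \<Rightarrow> nat letter list \<Rightarrow> 'w \<Rightarrow> 'w" where
  "word_op X Y [] w = w"
| "word_op X Y (l # u) w = letter_op X Y l (word_op X Y u w)"

lemma word_op_append: "word_op X Y (u @ v) w = word_op X Y u (word_op X Y v w)"
  by (induction u) auto

text \<open>Generators and relations of H_{t,c} as conditions on operators: \<open>R_X\<close> and
  \<open>R_Y\<close> encode the smash product, the remaining ones the relations generating the
  ideal. The action \<open>act\<close> of the quotient algebra is built from these data
  alone.\<close>

locale cherednik_rep = cherednik_alg n t c for n t c +
  fixes sc :: "complex \<Rightarrow> 'w \<Rightarrow> 'w::ab_group_add"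
    and X Y :: "nat \<Rightarrow> 'w \<Rightarrow> 'w" and R :: "(nat \<Rightarrow> nat) \<Rightarrow> 'w \<Rightarrow> 'w"
  assumes vs: "vector_space sc"
    and X_lin: "i \<in> {1..n} \<Longrightarrow> lin_op sc (X i)"
    and Y_lin: "i \<in> {1..n} \<Longrightarrow> lin_op sc (Y i)"
    and R_lin: "p permutes {1..n} \<Longrightarrow> lin_op sc (R p)"
    and R_id: "R id w = w"
    and R_comp: "\<lbrakk>p permutes {1..n}; q permutes {1..n}\<rbrakk> \<Longrightarrow> R p (R q w) = R (p \<circ> q) w"
    and R_X: "\<lbrakk>p permutes {1..n}; i \<in> {1..n}\<rbrakk> \<Longrightarrow> R p (X i w) = X (p i) (R p w)"
    and R_Y: "\<lbrakk>p permutes {1..n}; i \<in> {1..n}\<rbrakk> \<Longrightarrow> R p (Y i w) = Y (p i) (R p w)"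
    and X_comm: "\<lbrakk>i \<in> {1..n}; j \<in> {1..n}\<rbrakk> \<Longrightarrow> X i (X j w) = X j (X i w)"
    and Y_comm: "\<lbrakk>i \<in> {1..n}; j \<in> {1..n}\<rbrakk> \<Longrightarrow> Y i (Y j w) = Y j (Y i w)"
    and Y_X: "\<lbrakk>i \<in> {1..n}; j \<in> {1..n}; i \<noteq> j\<rbrakk> \<Longrightarrow> Y i (X j w) = X j (Y i w) + sc c (R (transpose i j) w)"
    and Y_X_same: "i \<in> {1..n} \<Longrightarrow>
      Y i (X i w) = X i (Y i w) + (sc t w - sc c (\<Sum>j\<in>{1..n} - {i}. R (transpose i j) w))"
begin

interpretation vector_space sc by (fact vs)

abbreviation "wop \<equiv> word_op X Y"

lemma wop_lin: "u \<in> carrier (words n) \<Longrightarrow> lin_op sc (wop u)"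
proof (induction u)
  case Nil
  then show ?case by (simp add: lin_op_def)
next
  case (Cons l u)
  then have "lin_op sc (wop u)" by (auto simp: words_carrier)
  moreover have "lin_op sc (letter_op X Y l)" using Cons.prems X_lin Y_lin by (auto simp: words_carrier)
  ultimately show ?case by (simp add: lin_op_def)
qed

lemma R_wop: "\<lbrakk>u \<in> carrier (words n); p permutes {1..n}\<rbrakk>
    \<Longrightarrow> R p (wop u w) = wop (map (map_letter p) u) (R p w)"
proof (induction u)
  case (Cons l u)
  then show ?case by (cases l) (auto simp: R_X R_Y)
qed simp

definition free_act :: "free_elt \<Rightarrow> 'w \<Rightarrow> 'w" where
  "free_act f w = lincomb sc f (\<lambda>(u, p). wop u (R p w))"

lemma FS_support:
  assumes "f \<in> carrier FS"
  shows "finite {k. f k \<noteq> 0}" "f (u, p) \<noteq> 0 \<Longrightarrow> u \<in> carrier (words n) \<and> p permutes {1..n}"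
  using assms by (auto simp: free_smash_def monoid_algebra_carrier semidirect_simps sym_group_carrier)

lemma free_act_add:
  "\<lbrakk>f \<in> carrier FS; g \<in> carrier FS\<rbrakk> \<Longrightarrow> free_act (f \<oplus>\<^bsub>FS\<^esub> g) w = free_act f w + free_act g w"
  using FS_support(1)[of f] FS_support(1)[of g] lincomb_add[OF vs]
  by (simp add: free_act_def free_smash_def monoid_algebra_simps)

lemma free_act_smult: "f \<in> carrier FS \<Longrightarrow> free_act (z \<odot>\<^bsub>FS\<^esub> f) w = sc z (free_act f w)"
  using FS_support(1)[of f] lincomb_scale[OF vs]
  by (simp add: free_act_def free_smash_def monoid_algebra_simps)

lemma free_act_mon: "free_act (mon u p) w = wop u (R p w)"
  by (simp add: free_act_def lincomb_basis[OF vs])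

lemma free_act_zero: "free_act \<zero>\<^bsub>FS\<^esub> w = 0"
  by (simp add: free_act_def free_smash_def monoid_algebra_simps lincomb_zero[OF vs])

lemma free_act_lin: "f \<in> carrier FS \<Longrightarrow> lin_op sc (free_act f)"
proof -
  assume f: "f \<in> carrier FS"
  have *: "wop u (R p (x + y)) = wop u (R p x) + wop u (R p y)"
    "wop u (R p (sc z x)) = sc z (wop u (R p x))" if "f (u, p) \<noteq> 0" for u p x y z
    using FS_support(2)[OF f that] lin_opD(1,2)[OF wop_lin[of u]] lin_opD(1,2)[OF R_lin[of p]] by auto
  show ?thesis
    unfolding lin_op_def
  proof (intro conjI allI)
    fix x y z
    have "free_act f (x + y) = lincomb sc f (\<lambda>(u, p). wop u (R p x) + wop u (R p y))"
      unfolding free_act_def lincomb_def using * by (intro sum.cong) auto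
    also have "\<dots> = free_act f x + free_act f y"
      using lincomb_add_right[OF vs, of f "\<lambda>(u, p). wop u (R p x)" "\<lambda>(u, p). wop u (R p y)"]
      by (simp add: free_act_def case_prod_unfold)
    finally show "free_act f (x + y) = free_act f x + free_act f y" .
    have "free_act f (sc z x) = lincomb sc f (\<lambda>(u, p). sc z (wop u (R p x)))"
      unfolding free_act_def lincomb_def using * by (intro sum.cong) auto
    also have "\<dots> = sc z (free_act f x)"
      using lincomb_scale_right[OF vs, of f z "\<lambda>(u, p). wop u (R p x)"]
      by (simp add: free_act_def case_prod_unfold)
    finally show "free_act f (sc z x) = sc z (free_act f x)" .
  qed
qed

text \<open>On monomials this is \<open>R_wop\<close>: moving the permutation p past the word v
  relabels the letters of v, exactly as in the semidirect product.\<close>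

lemma free_act_mult:
  assumes f: "f \<in> carrier FS" and g: "g \<in> carrier FS"
  shows "free_act (f \<otimes>\<^bsub>FS\<^esub> g) w = free_act f (free_act g w)"
proof -
  have "free_act (f \<otimes>\<^bsub>FS\<^esub> g) w = lincomb sc f (\<lambda>a. lincomb sc g (\<lambda>b. case a \<otimes>\<^bsub>semidirect n (words n) (\<lambda>p. map (map_letter p))\<^esub> b of (u, p) \<Rightarrow> wop u (R p w)))"
    unfolding free_act_def free_smash_def
    by (rule lincomb_mult[OF vs FS_support(1)[OF f] FS_support(1)[OF g]])
  also have "\<dots> = lincomb sc f (\<lambda>(u, p). lincomb sc g (\<lambda>(v, q). wop u (R p (wop v (R q w)))))"
    unfolding lincomb_def case_prod_beta
  proof (intro sum.cong refl arg_cong2[where f=sc])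
    fix a b assume "a \<in> {k. f k \<noteq> 0}" "b \<in> {k. g k \<noteq> 0}"
    moreover obtain u p v q where "a = (u, p)" "b = (v, q)" by (cases a, cases b)
    ultimately show "wop (fst (a \<otimes>\<^bsub>semidirect n (words n) (\<lambda>p. map (map_letter p))\<^esub> b))
         (R (snd (a \<otimes>\<^bsub>semidirect n (words n) (\<lambda>p. map (map_letter p))\<^esub> b)) w) =
        wop (fst a) (R (snd a) (wop (fst b) (R (snd b) w)))"
      using FS_support(2)[OF f, of u p] FS_support(2)[OF g, of v q]
      by (simp add: semidirect_simps words_def word_op_append R_wop R_comp)
  qed
  also have "\<dots> = lincomb sc f (\<lambda>(u, p). wop u (R p (free_act g w)))"
    unfolding free_act_def lincomb_def[of sc f]
  proof (intro sum.cong refl arg_cong2[where f=sc])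
    fix a assume a: "a \<in> {k. f k \<noteq> 0}"
    obtain u p where up: "a = (u, p)" by (cases a)
    then have "lin_op sc (\<lambda>x. wop u (R p x))"
      using FS_support(2)[OF f, of u p] a lin_op_comp[of sc "wop u" "R p", OF wop_lin R_lin] by simp
    from lin_op_lincomb[OF this, of g "\<lambda>(v, q). wop v (R q w)"]
    show "(case a of (u, p) \<Rightarrow> lincomb sc g (\<lambda>(v, q). wop u (R p (wop v (R q w))))) =
         (case a of (u, p) \<Rightarrow> wop u (R p (lincomb sc g (\<lambda>(u, p). wop u (R p w)))))"
      by (simp add: up case_prod_unfold)
  qed
  finally show ?thesis by (simp add: free_act_def)
qed

lemma free_act_minus:
  "\<lbrakk>f \<in> carrier FS; g \<in> carrier FS\<rbrakk> \<Longrightarrow> free_act (f \<ominus>\<^bsub>FS\<^esub> g) w = free_act f w - free_act g w"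
  using free_act_smult[of g "-1" w]
  by (simp add: a_minus_def free_act_add FS.smult_neg_one)

lemma free_act_finsum:
  "\<lbrakk>finite J; f \<in> J \<rightarrow> carrier FS\<rbrakk> \<Longrightarrow> free_act (\<Oplus>\<^bsub>FS\<^esub>j\<in>J. f j) w = (\<Sum>j\<in>J. free_act (f j) w)"
  by (induction J rule: finite_induct) (auto simp: free_act_zero free_act_add Pi_def)

lemma free_act_gens:
  "free_act (fx i) w = X i w" "free_act (fy i) w = Y i w" "free_act (fperm p) w = R p w"
  by (simp_all add: fx_def fy_def fperm_def free_act_mon R_id)

lemma free_act_one: "free_act \<one>\<^bsub>FS\<^esub> w = w"
  by (simp add: mon_one free_act_mon R_id)

text \<open>The annihilator of the whole space is a two-sided ideal containing the defining
  relations, hence contains the ideal they generate. Annihilating every vector, not just one, is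
  what gives closure under right multiplication.\<close>

lemma free_act_ideal:
  assumes "f \<in> I" shows "free_act f w = 0"
proof -
  let ?J = "{f \<in> carrier FS. \<forall>w. free_act f w = 0}"
  have z: "free_act f 0 = 0" if "f \<in> carrier FS" for f
    using lin_opD(3)[OF free_act_lin[OF that]] .
  have "ideal ?J FS"
  proof (rule idealI)
    show "subgroup ?J (add_monoid FS)"
      by (rule FS.add.subgroupI)
         (auto simp: free_act_zero free_act_add free_act_smult simp flip: FS.smult_neg_one a_inv_def
           intro!: exI[of _ "\<zero>\<^bsub>FS\<^esub>"])
  qed (auto simp: free_act_mult z FS.ring_axioms)
  moreover have "cherednik_rels n t c \<subseteq> ?J"
  proof
    fix r assume r: "r \<in> cherednik_rels n t c"
    have "free_act r w = 0" for w
    proof -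
      have cl: "(\<Oplus>\<^bsub>FS\<^esub>j\<in>{1..n} - {i}. fperm (transpose i j)) \<in> carrier FS" if "i \<in> {1..n}" for i
        by (rule FS.finsum_closed) (use that in \<open>auto intro!: fperm_closed transpose_permutes\<close>)
      have fs: "free_act (\<Oplus>\<^bsub>FS\<^esub>j\<in>{1..n} - {i}. fperm (transpose i j)) w = (\<Sum>j\<in>{1..n}-{i}. R (transpose i j) w)"
        if "i \<in> {1..n}" for i
        by (subst free_act_finsum) (use that in \<open>auto intro!: fperm_closed transpose_permutes simp: free_act_gens\<close>)
      consider (xx) i j where "i \<in> {1..n}" "j \<in> {1..n}" "r = fx i \<otimes>\<^bsub>FS\<^esub> fx j \<ominus>\<^bsub>FS\<^esub> fx j \<otimes>\<^bsub>FS\<^esub> fx i"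
        | (yy) i j where "i \<in> {1..n}" "j \<in> {1..n}" "r = fy i \<otimes>\<^bsub>FS\<^esub> fy j \<ominus>\<^bsub>FS\<^esub> fy j \<otimes>\<^bsub>FS\<^esub> fy i"
        | (yx) i j where "i \<in> {1..n}" "j \<in> {1..n}" "i \<noteq> j"
           "r = (fy i \<otimes>\<^bsub>FS\<^esub> fx j \<ominus>\<^bsub>FS\<^esub> fx j \<otimes>\<^bsub>FS\<^esub> fy i) \<ominus>\<^bsub>FS\<^esub> c \<odot>\<^bsub>FS\<^esub> fperm (transpose i j)"
        | (s) i where "i \<in> {1..n}" "r = (fy i \<otimes>\<^bsub>FS\<^esub> fx i \<ominus>\<^bsub>FS\<^esub> fx i \<otimes>\<^bsub>FS\<^esub> fy i) \<ominus>\<^bsub>FS\<^esub>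
          (t \<odot>\<^bsub>FS\<^esub> \<one>\<^bsub>FS\<^esub> \<ominus>\<^bsub>FS\<^esub> c \<odot>\<^bsub>FS\<^esub> (\<Oplus>\<^bsub>FS\<^esub>j\<in>{1..n} - {i}. fperm (transpose i j)))"
        using r unfolding cherednik_rels_def Let_def by blast
      then show ?thesis
      proof cases
        case (xx i j)
        then show ?thesis using X_comm[OF xx(1,2)]
          by (simp add: free_act_minus free_act_mult free_act_gens del: atLeastAtMost_iff)
      next
        case (yy i j)
        then show ?thesis using Y_comm[OF yy(1,2)]
          by (simp add: free_act_minus free_act_mult free_act_gens del: atLeastAtMost_iff)
      next
        case (yx i j)
        then show ?thesis using Y_X[OF yx(1,2,3)] transpose_permutes[OF yx(1,2)]
          by (simp add: free_act_minus free_act_mult free_act_smult free_act_gens del: atLeastAtMost_iff)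
      next
        case (s i)
        then show ?thesis using Y_X_same[OF s(1)] fs[OF s(1)] cl[OF s(1)]
          by (simp add: free_act_minus free_act_mult free_act_smult free_act_gens free_act_one del: atLeastAtMost_iff)
      qed
    qed
    then show "r \<in> ?J" using r cherednik_rels_closed by auto
  qed
  ultimately have "I \<subseteq> ?J" unfolding cherednik_ideal_def by (rule FS.genideal_minimal)
  then show ?thesis using assms by auto
qed

text \<open>Elements of the quotient are cosets, so a representative is chosen;
  \<open>act_CL\<close> shows that the choice does not matter.\<close>

definition act :: "free_elt set \<Rightarrow> 'w \<Rightarrow> 'w" where
  "act K w = free_act (SOME f. f \<in> K) w"

lemma act_CL:
  assumes "f \<in> carrier FS" shows "act (CL f) w = free_act f w"
proof -
  interpret ideal I FS by (rule ideal_I)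
  define g where "g = (SOME f'. f' \<in> CL f)"
  have "f \<in> CL f" unfolding cls_def by (rule a_rcos_self[OF assms])
  then have "g \<in> CL f" unfolding g_def by (rule someI[where P = "\<lambda>f'. f' \<in> CL f"])
  then obtain i where i: "i \<in> I" "g = i \<oplus>\<^bsub>FS\<^esub> f" by (auto simp: cls_def a_r_coset_def')
  then show ?thesis
    using assms by (simp add: act_def g_def[symmetric] free_act_add Icarr free_act_ideal)
qed

lemma act_add: "\<lbrakk>a \<in> carrier HA; b \<in> carrier HA\<rbrakk> \<Longrightarrow> act (a \<oplus>\<^bsub>HA\<^esub> b) w = act a w + act b w"
  and act_mult: "\<lbrakk>a \<in> carrier HA; b \<in> carrier HA\<rbrakk> \<Longrightarrow> act (a \<otimes>\<^bsub>HA\<^esub> b) w = act a (act b w)"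
  using CL_surj[of a] CL_surj[of b]
  by (auto simp: act_CL free_act_add free_act_mult simp flip: CL_add CL_mult)

lemma act_smult: "a \<in> carrier HA \<Longrightarrow> act (z \<odot>\<^bsub>HA\<^esub> a) w = sc z (act a w)"
  and act_lin: "a \<in> carrier HA \<Longrightarrow> lin_op sc (act a)"
  using CL_surj[of a] free_act_lin
  by (auto simp: act_CL free_act_smult lin_op_def simp flip: CL_smult)

lemma act_one: "act \<one>\<^bsub>HA\<^esub> w = w"
  by (simp add: act_CL free_act_one flip: CL_one)

lemma act_zero: "act \<zero>\<^bsub>HA\<^esub> w = 0"
  by (simp add: act_CL free_act_zero flip: CL_zero)

lemma act_minus: "\<lbrakk>a \<in> carrier HA; b \<in> carrier HA\<rbrakk> \<Longrightarrow> act (a \<ominus>\<^bsub>HA\<^esub> b) w = act a w - act b w"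
  using act_smult[of b "-1" w] by (simp add: a_minus_def act_add HA.smult_neg_one)

lemma act_uminus: "a \<in> carrier HA \<Longrightarrow> act (\<ominus>\<^bsub>HA\<^esub> a) w = - act a w"
  using act_smult[of a "-1" w] by (simp add: HA.smult_neg_one)

lemma act_finsum:
  "\<lbrakk>finite J; f \<in> J \<rightarrow> carrier HA\<rbrakk> \<Longrightarrow> act (\<Oplus>\<^bsub>HA\<^esub>j\<in>J. f j) w = (\<Sum>j\<in>J. act (f j) w)"
  by (induction J rule: finite_induct) (auto simp: act_zero act_add Pi_def)

lemma act_mon: "\<lbrakk>u \<in> carrier (words n); p permutes {1..n}\<rbrakk> \<Longrightarrow> act (CL (mon u p)) w = wop u (R p w)"
  by (simp add: act_CL mon_closed free_act_mon)

lemma act_gens: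
  "i \<in> {1..n} \<Longrightarrow> act (hX i) w = X i w" "i \<in> {1..n} \<Longrightarrow> act (hY i) w = Y i w"
  "p permutes {1..n} \<Longrightarrow> act (hP p) w = R p w"
  by (simp_all add: hx_def hy_def hperm_def act_CL free_act_gens del: atLeastAtMost_iff)

end

section \<open>Laurent polynomials with coefficients in a module\<close>

abbreviation "lookup \<equiv> Poly_Mapping.lookup"
abbreviation "keys \<equiv> Poly_Mapping.keys"
abbreviation "single \<equiv> Poly_Mapping.single"

text \<open>Finitely supported maps serve as direct sums: \<open>single a m\<close> is the monomial
  x^a with coefficient \<open>m\<close>, and an operator is prescribed on such monomials and
  extended additively.\<close>

definition ext_op :: "('k \<Rightarrow> 'm \<Rightarrow> 'w) \<Rightarrow> ('k \<Rightarrow>\<^sub>0 'm::zero) \<Rightarrow> 'w::comm_monoid_add" where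
  "ext_op \<phi> f = (\<Sum>k\<in>keys f. \<phi> k (lookup f k))"

lemma ext_op_add:
  fixes \<phi> :: "'k \<Rightarrow> 'm::ab_group_add \<Rightarrow> 'w::ab_group_add"
  assumes "\<And>k x y. \<phi> k (x + y) = \<phi> k x + \<phi> k y"
  shows "ext_op \<phi> (f + g) = ext_op \<phi> f + ext_op \<phi> g"
  unfolding ext_op_def using additive_zero[of "\<phi> _"] assms
  by (intro setsum_keys_plus_distrib) auto

lemma ext_op_single:
  fixes \<phi> :: "'k \<Rightarrow> 'm::ab_group_add \<Rightarrow> 'w::ab_group_add"
  assumes "\<And>k x y. \<phi> k (x + y) = \<phi> k x + \<phi> k y"
  shows "ext_op \<phi> (single k m) = \<phi> k m"
  using additive_zero[of "\<phi> k"] assms by (simp add: ext_op_def)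

lemma poly_mapping_eq_sum_single: "f = (\<Sum>k\<in>keys f. single k (lookup f k))"
proof (rule poly_mapping_eqI)
  fix k
  show "lookup f k = lookup (\<Sum>k\<in>keys f. single k (lookup f k)) k"
    by (simp add: lookup_sum lookup_single when_def in_keys_iff)
qed

text \<open>Every element is a finite sum of monomials with coefficients, so additivity alone
  reduces an operator identity to monomials. Nearly all identities below are proved this
  way.\<close>

lemma additive_eqI:
  fixes F G :: "('k \<Rightarrow>\<^sub>0 'm::ab_group_add) \<Rightarrow> 'w::ab_group_add"
  assumes "\<And>x y. F (x + y) = F x + F y" "\<And>x y. G (x + y) = G x + G y"
    and "\<And>k m. k \<in> keys f \<Longrightarrow> F (single k m) = G (single k m)"
  shows "F f = G f"
proof -
  have "F f = (\<Sum>k\<in>keys f. F (single k (lookup f k)))"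
    by (subst poly_mapping_eq_sum_single[of f]) (rule additive_sum, rule assms)
  also have "\<dots> = (\<Sum>k\<in>keys f. G (single k (lookup f k)))" using assms(3) by simp
  also have "\<dots> = G f"
    by (subst (3) poly_mapping_eq_sum_single[of f]) (rule additive_sum[symmetric], rule assms)
  finally show ?thesis .
qed

text \<open>A discrete oriented integral from u to v: the sign flips when v < u. The divided
  difference of a monomial then has one formula for either order of its two exponents.\<close>

definition signed_sum :: "(int \<Rightarrow> 'w) \<Rightarrow> int \<Rightarrow> int \<Rightarrow> 'w::ab_group_add" where
  "signed_sum g u v = (\<Sum>r\<in>{u..<v}. g r) - (\<Sum>r\<in>{v..<u}. g r)"

lemma signed_sum_right: "signed_sum g u (v + 1) = signed_sum g u v + g v"
proof (cases "u \<le> v")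
  case True
  then have "{u..<v+1} = insert v {u..<v}" "{v+1..<u} = {}" "{v..<u} = {}" by auto
  then show ?thesis by (simp add: signed_sum_def)
next
  case False
  then have "{v..<u} = insert v {v+1..<u}" "{u..<v+1} = {}" "{u..<v} = {}" by auto
  then show ?thesis by (simp add: signed_sum_def)
qed

lemma signed_sum_swap: "signed_sum g u v = - signed_sum g v u"
  by (simp add: signed_sum_def)

lemma signed_sum_left: "signed_sum g (u + 1) v = signed_sum g u v - g u"
  by (simp add: signed_sum_swap[of g "u + 1" v] signed_sum_swap[of g u v] signed_sum_right)

lemma signed_sum_shift: "signed_sum (\<lambda>r. g (r + 1)) u v = signed_sum g (u + 1) (v + 1)"
proof -
  have "(\<Sum>r\<in>{u..<v}. g (r + 1)) = (\<Sum>r\<in>{u+1..<v+1}. g r)" for u v :: int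
    by (rule sum.reindex_bij_witness[of _ "\<lambda>r. r - 1" "\<lambda>r. r + 1"]) auto
  then show ?thesis by (simp add: signed_sum_def)
qed

lemma signed_sum_same [simp]: "signed_sum g u u = 0"
  by (simp add: signed_sum_def)

lemma signed_sum_add: "signed_sum (\<lambda>r. g r + h r) u v = signed_sum g u v + signed_sum h u v"
  by (simp add: signed_sum_def sum.distrib)

lemma signed_sum_additive:
  "(\<And>x y. F (x + y) = F x + F y) \<Longrightarrow> F (signed_sum g u v) = signed_sum (\<lambda>r. F (g r)) u v"
  for F :: "'a::ab_group_add \<Rightarrow> 'b::ab_group_add"
  by (simp add: signed_sum_def additive_diff[of F] additive_sum[of F])

text \<open>The divided difference (x^a - s x^a) / (x_i - x_k), with s the transposition of i and k,
  expanded as a geometric sum; the coefficient \<open>m\<close> is carried along untouched.\<close>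

definition divdiff :: "nat \<Rightarrow> nat \<Rightarrow> (nat \<Rightarrow> int) \<Rightarrow> 'm \<Rightarrow> (nat \<Rightarrow> int) \<Rightarrow>\<^sub>0 'm::ab_group_add" where
  "divdiff i k a m = signed_sum (\<lambda>r. single (a(i := r, k := a i + a k - 1 - r)) m) (a k) (a i)"

lemma divdiff_add: "divdiff i k a (x + y) = divdiff i k a x + divdiff i k a y"
  by (simp add: divdiff_def single_add signed_sum_add)

definition NX :: "nat \<Rightarrow> ((nat \<Rightarrow> int) \<Rightarrow>\<^sub>0 'm) \<Rightarrow> (nat \<Rightarrow> int) \<Rightarrow>\<^sub>0 'm::ab_group_add" where
  "NX i = ext_op (\<lambda>a m. single (a(i := a i + 1)) m)"

lemma NX_add: "NX i (f + g) = NX i f + NX i g"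
  unfolding NX_def by (rule ext_op_add) (simp add: single_add)

lemma NX_single: "NX i (single a m) = single (a(i := a i + 1)) m"
  unfolding NX_def by (rule ext_op_single) (simp add: single_add)

lemmas NX_additive = NX_add additive_zero[of "NX i" for i, OF NX_add]
  additive_uminus[of "NX i" for i, OF NX_add] additive_diff[of "NX i" for i, OF NX_add]
  additive_sum[of "NX i" for i, OF NX_add]

lemma NX_comm: "NX i (NX j f) = NX j (NX i f)"
  by (rule additive_eqI[where f=f]) (auto simp: NX_additive NX_single fun_upd_twist)

lemma lookup_NX: "lookup (NX i f) (a(i := a i + 1)) = lookup f a"
proof (rule additive_eqI[where f=f and F="\<lambda>f. lookup (NX i f) (a(i := a i + 1))" and G="\<lambda>f. lookup f a"])
  fix k :: "nat \<Rightarrow> int" and m :: 'a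
  have "k(i := k i + 1) = a(i := a i + 1) \<longleftrightarrow> k = a" by (auto simp: fun_eq_iff)
  then show "lookup (NX i (single k m)) (a(i := a i + 1)) = lookup (single k m) a"
    by (simp add: NX_single lookup_single when_def)
qed (auto simp: NX_additive lookup_add)

text \<open>Multiplication by x_i shifts exponents injectively. This cancellation is what carries
  the vanishing of commutators to monomials with negative exponents.\<close>

lemma NX_inj: "NX i f = 0 \<Longrightarrow> f = 0"
  by (rule poly_mapping_eqI) (metis lookup_NX lookup_zero)

text \<open>A twisted Leibniz rule: shifting the summation index absorbs the factor x_i, except for
  one end term of the geometric sum, which is the transposed monomial. For x_k the end term has the
  opposite sign, and for other variables there is none.\<close>

lemma divdiff_NX_left:
  assumes "i \<noteq> k"
  shows "divdiff i k (a(i := a i + 1)) m = NX i (divdiff i k a m) + single (a \<circ> transpose i k) m"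
proof -
  let ?g = "\<lambda>r. single (a(i := r, k := a i + a k - r)) m"
  have "divdiff i k (a(i := a i + 1)) m = signed_sum ?g (a k) (a i + 1)"
    using assms by (simp add: divdiff_def algebra_simps)
  moreover have "NX i (divdiff i k a m) = signed_sum (\<lambda>r. ?g (r + 1)) (a k) (a i)"
    unfolding divdiff_def using assms
    by (subst signed_sum_additive[OF NX_add]) (auto simp: NX_single fun_upd_twist[of i k] algebra_simps)
  moreover have "?g (a k) = single (a \<circ> transpose i k) m"
    using assms by (intro arg_cong2[where f=single] refl) (auto simp: fun_eq_iff transpose_def)
  ultimately show ?thesis using signed_sum_shift[of ?g "a k" "a i"] by (simp add: signed_sum_left)
qed

lemma divdiff_NX_right:
  assumes "i \<noteq> k"
  shows "divdiff i k (a(k := a k + 1)) m = NX k (divdiff i k a m) - single (a \<circ> transpose i k) m"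
proof -
  let ?g = "\<lambda>r. single (a(i := r, k := a i + a k - r)) m"
  have e: "a(k := x, i := y, k := z) = a(i := y, k := z)" for x y z
    using assms by (auto simp: fun_eq_iff)
  have "divdiff i k (a(k := a k + 1)) m = signed_sum ?g (a k + 1) (a i)"
    using assms by (simp add: divdiff_def algebra_simps e)
  moreover have "NX k (divdiff i k a m) = signed_sum ?g (a k) (a i)"
    unfolding divdiff_def using assms
    by (subst signed_sum_additive[OF NX_add]) (auto simp: NX_single algebra_simps)
  moreover have "?g (a k) = single (a \<circ> transpose i k) m"
    using assms by (intro arg_cong2[where f=single] refl) (auto simp: fun_eq_iff transpose_def)
  ultimately show ?thesis by (simp add: signed_sum_left)
qed

lemma divdiff_NX_other:
  assumes "j \<noteq> i" "j \<noteq> k" "i \<noteq> k"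
  shows "divdiff i k (a(j := a j + 1)) m = NX j (divdiff i k a m)"
proof -
  have e: "a(j := x, i := y, k := z) = a(i := y, k := z, j := x)" for x y z
    using assms by (auto simp: fun_eq_iff)
  show ?thesis unfolding divdiff_def using assms
    by (subst signed_sum_additive[OF NX_add]) (auto simp: NX_single e)
qed

lemma fun_upd_perm:
  assumes "p permutes S"
  shows "(a(i := v)) \<circ> inv' p = (a \<circ> inv' p)(p i := v)"
  using permutes_inverses[OF assms] by (auto simp: fun_eq_iff)

lemma perm_transpose: "p permutes S \<Longrightarrow> p \<circ> transpose i k = transpose (p i) (p k) \<circ> p"
  using permutes_inj[of p S] by (auto simp: fun_eq_iff transpose_def inj_eq)

lemma sum_perm_remove:
  assumes "p permutes S"
  shows "(\<Sum>k\<in>S - {i}. G (p k)) = (\<Sum>k\<in>S - {p i}. G k)"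
proof (rule sum.reindex_bij_betw)
  have "p ` (S - {i}) = S - {p i}"
    using image_set_diff[OF permutes_inj[OF assms], of S "{i}"] permutes_image[OF assms] by simp
  then show "bij_betw p (S - {i}) (S - {p i})"
    using permutes_inj_on[OF assms] by (auto simp: bij_betw_def)
qed

locale hecke_rep = cherednik_alg n t c for n t c +
  fixes sc :: "complex \<Rightarrow> 'm \<Rightarrow> 'm::ab_group_add"
    and \<rho> :: "(nat \<Rightarrow> nat) \<Rightarrow> 'm \<Rightarrow> 'm" and Z :: "nat \<Rightarrow> 'm \<Rightarrow> 'm"
  assumes rep: "sym_rep n sc \<rho>"
    and Z_lin: "i \<in> {1..n} \<Longrightarrow> lin_op sc (Z i)"
    and \<rho>_Z: "\<lbrakk>p permutes {1..n}; i \<in> {1..n}\<rbrakk> \<Longrightarrow> \<rho> p (Z i m) = Z (p i) (\<rho> p m)"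
    and Z_comm: "\<lbrakk>i \<in> {1..n}; j \<in> {1..n}; i \<noteq> j\<rbrakk> \<Longrightarrow>
      Z i (Z j m) - Z j (Z i m) = sc c (Z i (\<rho> (transpose i j) m) - Z j (\<rho> (transpose i j) m))"
begin

lemma vs: "vector_space sc" using rep by (simp add: sym_rep_def)

interpretation vector_space sc by (fact vs)

lemma \<rho>_id [simp]: "\<rho> id m = m" using rep by (simp add: sym_rep_def)

lemma \<rho>_comp: "\<lbrakk>p permutes {1..n}; q permutes {1..n}\<rbrakk> \<Longrightarrow> \<rho> p (\<rho> q m) = \<rho> (p \<circ> q) m"
  using rep by (simp add: sym_rep_def sym_group_carrier)

lemma \<rho>_lin: "p permutes {1..n} \<Longrightarrow> lin_op sc (\<rho> p)"
proof -
  assume "p permutes {1..n}"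
  then interpret l: Vector_Spaces.linear sc sc "\<rho> p"
    using rep by (simp add: sym_rep_def sym_group_carrier)
  show ?thesis by (simp add: lin_op_def l.add l.scale)
qed

lemma lin_sc: "lin_op sc (sc z)"
  by (simp add: lin_op_def scale_right_distrib mult.commute)

definition NR :: "(nat \<Rightarrow> nat) \<Rightarrow> ((nat \<Rightarrow> int) \<Rightarrow>\<^sub>0 'm) \<Rightarrow> (nat \<Rightarrow> int) \<Rightarrow>\<^sub>0 'm" where
  "NR p = ext_op (\<lambda>a m. single (a \<circ> inv' p) (\<rho> p m))"

lemma NR_add: "p permutes {1..n} \<Longrightarrow> NR p (f + g) = NR p f + NR p g"
  unfolding NR_def by (rule ext_op_add) (simp add: single_add lin_opD(1)[OF \<rho>_lin])

lemma NR_single: "p permutes {1..n} \<Longrightarrow> NR p (single a m) = single (a \<circ> inv' p) (\<rho> p m)"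
  unfolding NR_def by (rule ext_op_single) (simp add: single_add lin_opD(1)[OF \<rho>_lin])

lemmas NR_additive = NR_add additive_zero[of "NR p" for p, OF NR_add]
  additive_uminus[of "NR p" for p, OF NR_add] additive_diff[of "NR p" for p, OF NR_add]
  additive_sum[of "NR p" for p, OF NR_add]

definition NS :: "complex \<Rightarrow> ((nat \<Rightarrow> int) \<Rightarrow>\<^sub>0 'm) \<Rightarrow> (nat \<Rightarrow> int) \<Rightarrow>\<^sub>0 'm" where
  "NS z = ext_op (\<lambda>a m. single a (sc z m))"

lemma NS_add: "NS z (f + g) = NS z f + NS z g"
  unfolding NS_def by (rule ext_op_add) (simp add: single_add scale_right_distrib)

lemmas NS_additive = NS_add additive_zero[of "NS z" for z, OF NS_add]
  additive_uminus[of "NS z" for z, OF NS_add] additive_diff[of "NS z" for z, OF NS_add]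
  additive_sum[of "NS z" for z, OF NS_add]

lemma NS_single: "NS z (single a m) = single a (sc z m)"
  unfolding NS_def by (rule ext_op_single) (simp add: single_add scale_right_distrib)

lemma NS_vector_space: "vector_space NS"
proof
  fix x y :: "(nat \<Rightarrow> int) \<Rightarrow>\<^sub>0 'm" and z w :: complex
  show "NS z (x + y) = NS z x + NS z y" by (rule NS_add)
  show "NS (z + w) x = NS z x + NS w x"
    by (rule additive_eqI[where f=x]) (auto simp: NS_add NS_single scale_left_distrib single_add)
  show "NS z (NS w x) = NS (z * w) x"
    by (rule additive_eqI[where f=x]) (auto simp: NS_add NS_single)
  show "NS 1 x = x"
    by (rule additive_eqI[where f=x]) (auto simp: NS_add NS_single)
qed

text \<open>The Dunkl operator t d/dx_i + x_i^-1 Z_i - c sum_k (1 - s_ik) / (x_i - x_k), where in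
  each divided difference the coefficient is moved by the same transposition via
  \<open>\<rho>\<close>.\<close>

definition Dphi :: "nat \<Rightarrow> (nat \<Rightarrow> int) \<Rightarrow> 'm \<Rightarrow> (nat \<Rightarrow> int) \<Rightarrow>\<^sub>0 'm" where
  "Dphi i a m = single (a(i := a i - 1)) (sc (t * of_int (a i)) m + Z i m)
     - (\<Sum>k\<in>{1..n} - {i}. divdiff i k a (sc c (\<rho> (transpose i k) m)))"

definition ND :: "nat \<Rightarrow> ((nat \<Rightarrow> int) \<Rightarrow>\<^sub>0 'm) \<Rightarrow> (nat \<Rightarrow> int) \<Rightarrow>\<^sub>0 'm" where
  "ND i = ext_op (Dphi i)"

lemma Dphi_add: "i \<in> {1..n} \<Longrightarrow> Dphi i a (x + y) = Dphi i a x + Dphi i a y"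
proof -
  assume i: "i \<in> {1..n}"
  have "divdiff i k a (sc c (\<rho> (transpose i k) (x + y))) = divdiff i k a (sc c (\<rho> (transpose i k) x))
     + divdiff i k a (sc c (\<rho> (transpose i k) y))" if "k \<in> {1..n} - {i}" for k
    using lin_opD(1)[OF \<rho>_lin[OF transpose_permutes[OF i, of k]]] that
    by (simp add: scale_right_distrib divdiff_add)
  then show ?thesis
    using lin_opD(1)[OF Z_lin[OF i]]
    by (simp add: Dphi_def scale_right_distrib sum.distrib single_add algebra_simps)
qed

lemma ND_add: "i \<in> {1..n} \<Longrightarrow> ND i (f + g) = ND i f + ND i g"
  unfolding ND_def by (rule ext_op_add) (simp add: Dphi_add)

lemma ND_single: "i \<in> {1..n} \<Longrightarrow> ND i (single a m) = Dphi i a m"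
  unfolding ND_def by (rule ext_op_single) (simp add: Dphi_add)

lemma NS_divdiff: "NS z (divdiff i k a m) = divdiff i k a (sc z m)"
  unfolding divdiff_def by (subst signed_sum_additive[OF NS_add]) (simp add: NS_single)

lemma NR_divdiff:
  assumes "p permutes {1..n}"
  shows "NR p (divdiff i k a m) = divdiff (p i) (p k) (a \<circ> inv' p) (\<rho> p m)"
  unfolding divdiff_def using permutes_inverses[OF assms]
  by (subst signed_sum_additive[OF NR_add[OF assms]])
     (simp add: NR_single[OF assms] fun_upd_perm[OF assms])

lemma NX_lin: "lin_op NS (NX i)"
  unfolding lin_op_def
proof (intro conjI allI)
  fix z f show "NX i (NS z f) = NS z (NX i f)"
    by (rule additive_eqI[where f=f]) (auto simp: NX_add NS_add NS_single NX_single)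
qed (rule NX_add)

lemma NR_lin: "p permutes {1..n} \<Longrightarrow> lin_op NS (NR p)"
  unfolding lin_op_def
proof (intro conjI allI)
  fix z f assume p: "p permutes {1..n}"
  show "NR p (NS z f) = NS z (NR p f)"
    by (rule additive_eqI[where f=f])
       (auto simp: NR_add[OF p] NS_add NS_single NR_single[OF p] lin_opD(2)[OF \<rho>_lin[OF p]])
qed (rule NR_add)

lemma ND_lin: "i \<in> {1..n} \<Longrightarrow> lin_op NS (ND i)"
  unfolding lin_op_def
proof (intro conjI allI)
  fix z f assume i: "i \<in> {1..n}"
  have e: "sc c (\<rho> (transpose i k) (sc z m)) = sc z (sc c (\<rho> (transpose i k) m))"
    if "k \<in> {1..n} - {i}" for k m
    using lin_opD(2)[OF \<rho>_lin[OF transpose_permutes[OF i, of k]]] that by (simp add: mult.commute)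
  have "(\<Sum>k\<in>{1..n} - {i}. divdiff i k a (sc c (\<rho> (transpose i k) (sc z m)))) =
      (\<Sum>k\<in>{1..n} - {i}. NS z (divdiff i k a (sc c (\<rho> (transpose i k) m))))" for a m
    by (intro sum.cong refl) (simp only: e NS_divdiff)
  then have D: "Dphi i a (sc z m) = NS z (Dphi i a m)" for a m
    using lin_opD(2)[OF Z_lin[OF i]]
    by (simp add: Dphi_def NS_additive NS_single scale_right_distrib mult.commute mult.left_commute)
  show "ND i (NS z f) = NS z (ND i f)"
    by (rule additive_eqI[where f=f]) (simp_all add: ND_add[OF i] NS_add NS_single ND_single[OF i] D)
qed (rule ND_add)

lemma NR_id: "NR id f = f"
proof (rule additive_eqI[where f=f])
  show "NR id (x + y) = NR id x + NR id y" for x y by (rule NR_add[OF permutes_id])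
  show "NR id (single k m) = single k m" for k m by (subst NR_single[OF permutes_id]) simp
qed simp

lemma NR_comp:
  assumes p: "p permutes {1..n}" and q: "q permutes {1..n}"
  shows "NR p (NR q f) = NR (p \<circ> q) f"
proof (rule additive_eqI[where f=f])
  note pq = permutes_compose[OF q p]
  show "NR p (NR q (x + y)) = NR p (NR q x) + NR p (NR q y)" "NR (p \<circ> q) (x + y) = NR (p \<circ> q) x + NR (p \<circ> q) y" for x y
    by (simp_all only: NR_add[OF p] NR_add[OF q] NR_add[OF pq])
  show "NR p (NR q (single a m)) = NR (p \<circ> q) (single a m)" for a m
    unfolding NR_single[OF q] NR_single[OF p] NR_single[OF pq] \<rho>_comp[OF p q]
      o_inv_distrib[OF permutes_bij[OF p] permutes_bij[OF q]] by (simp add: comp_assoc)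
qed

lemma NR_NX:
  assumes p: "p permutes {1..n}"
  shows "NR p (NX i f) = NX (p i) (NR p f)"
  by (rule additive_eqI[where f=f])
     (simp_all add: NR_add[OF p] NX_add NR_single[OF p] NX_single fun_upd_perm[OF p] permutes_inverses[OF p])

text \<open>Conjugation by p only reindexes the Dunkl sum; the correction term follows because the
  Z_i are permuted too.\<close>

lemma NR_ND:
  assumes p: "p permutes {1..n}" and i: "i \<in> {1..n}"
  shows "NR p (ND i f) = ND (p i) (NR p f)"
proof (rule additive_eqI[where f=f])
  have pi: "p i \<in> {1..n}" using permutes_in_image[OF p] i by blast
  show "NR p (ND i (x + y)) = NR p (ND i x) + NR p (ND i y)"
    "ND (p i) (NR p (x + y)) = ND (p i) (NR p x) + ND (p i) (NR p y)" for x y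
    by (simp_all add: NR_add[OF p] ND_add[OF i] ND_add[OF pi])
  fix a m
  have tp: "transpose i k permutes {1..n}" "p k \<in> {1..n}" if "k \<in> {1..n} - {i}" for k
    using that i transpose_permutes permutes_in_image[OF p] by blast+
  have 1: "\<rho> p (\<rho> (transpose i k) m) = \<rho> (transpose (p i) (p k)) (\<rho> p m)"
    if "k \<in> {1..n} - {i}" for k
    using tp[OF that] transpose_permutes[OF pi tp(2)[OF that]]
    by (simp add: \<rho>_comp p perm_transpose[OF p])
  have "NR p (ND i (single a m)) = single ((a \<circ> inv' p)(p i := a i - 1)) (sc (t * of_int (a i)) (\<rho> p m) + Z (p i) (\<rho> p m))
     - (\<Sum>k\<in>{1..n} - {i}. divdiff (p i) (p k) (a \<circ> inv' p) (sc c (\<rho> (transpose (p i) (p k)) (\<rho> p m))))"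
    unfolding ND_single[OF i] Dphi_def NR_additive(4,5)[OF p] NR_divdiff[OF p]
    by (intro arg_cong2[where f=minus] sum.cong refl)
       (simp_all only: 1 NR_single[OF p] fun_upd_perm[OF p] lin_opD(1,2)[OF \<rho>_lin[OF p]] \<rho>_Z[OF p i])
  also have "\<dots> = ND (p i) (NR p (single a m))"
    unfolding NR_single[OF p] ND_single[OF pi] Dphi_def
    using sum_perm_remove[OF p, where i=i and G="\<lambda>k. divdiff (p i) k (a \<circ> inv' p) (sc c (\<rho> (transpose (p i) k) (\<rho> p m)))"]
    by (simp add: permutes_inverses[OF p])
  finally show "NR p (ND i (single a m)) = ND (p i) (NR p (single a m))" .
qed

lemma NR_transpose_single:
  assumes "i \<in> {1..n}" "k \<in> {1..n}"
  shows "NR (transpose i k) (single a m) = single (a \<circ> transpose i k) (\<rho> (transpose i k) m)"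
  using NR_single[OF transpose_permutes[OF assms]] by simp

text \<open>Among the divided differences only the one with k = j fails to commute with x_j, and its
  Leibniz defect is the transposed monomial, which yields c s_ij.\<close>

lemma ND_NX:
  assumes i: "i \<in> {1..n}" and j: "j \<in> {1..n}" and ij: "i \<noteq> j"
  shows "ND i (NX j f) = NX j (ND i f) + NS c (NR (transpose i j) f)"
proof (rule additive_eqI[where f=f and G="\<lambda>f. NX j (ND i f) + NS c (NR (transpose i j) f)"])
  note tp = transpose_permutes[OF i j]
  show "ND i (NX j (x + y)) = ND i (NX j x) + ND i (NX j y)"
    "NX j (ND i (x + y)) + NS c (NR (transpose i j) (x + y)) =
       NX j (ND i x) + NS c (NR (transpose i j) x) + (NX j (ND i y) + NS c (NR (transpose i j) y))" for x y
    by (simp_all add: ND_add[OF i] NX_add NR_add[OF tp] NS_add)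
  fix a m
  let ?m = "\<lambda>k. sc c (\<rho> (transpose i k) m)"
  have s: "(\<Sum>k\<in>{1..n}-{i}. g k) = g j + (\<Sum>k\<in>{1..n}-{i}-{j}. g k)" for g :: "nat \<Rightarrow> (nat \<Rightarrow> int) \<Rightarrow>\<^sub>0 'm"
    using ij j by (intro sum.remove) auto
  have "ND i (NX j (single a m)) = single (a(j := a j + 1, i := a i - 1)) (sc (t * of_int (a i)) m + Z i m) -
     (NX j (divdiff i j a (?m j)) - single (a \<circ> transpose i j) (?m j)) - (\<Sum>k\<in>{1..n}-{i}-{j}. NX j (divdiff i k a (?m k)))"
    unfolding NX_single ND_single[OF i] Dphi_def s using ij
    by (simp add: divdiff_NX_right divdiff_NX_other)
  also have "\<dots> = NX j (ND i (single a m)) + NS c (NR (transpose i j) (single a m))"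
    unfolding NX_single ND_single[OF i] Dphi_def s NX_additive NR_transpose_single[OF i j] NS_single
    using ij by (simp add: fun_upd_twist[of i j])
  finally show "ND i (NX j (single a m)) = NX j (ND i (single a m)) + NS c (NR (transpose i j) (single a m))" .
qed

text \<open>Here every divided difference has a Leibniz defect, which produces the whole sum of
  transpositions; the term t comes from the exponent of x_i growing by one.\<close>

lemma ND_NX_same:
  assumes i: "i \<in> {1..n}"
  shows "ND i (NX i f) = NX i (ND i f) + (NS t f - NS c (\<Sum>j\<in>{1..n} - {i}. NR (transpose i j) f))"
proof (rule additive_eqI[where f=f and G="\<lambda>f. NX i (ND i f) + (NS t f - NS c (\<Sum>j\<in>{1..n} - {i}. NR (transpose i j) f))"])
  have tp: "transpose i j permutes {1..n}" if "j \<in> {1..n} - {i}" for j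
    using transpose_permutes[OF i] that by blast
  then have "(\<Sum>j\<in>{1..n} - {i}. NR (transpose i j) (x + y)) =
     (\<Sum>j\<in>{1..n} - {i}. NR (transpose i j) x) + (\<Sum>j\<in>{1..n} - {i}. NR (transpose i j) y)" for x y
    by (simp add: NR_add flip: sum.distrib)
  then show "ND i (NX i (x + y)) = ND i (NX i x) + ND i (NX i y)"
    "NX i (ND i (x + y)) + (NS t (x + y) - NS c (\<Sum>j\<in>{1..n} - {i}. NR (transpose i j) (x + y))) =
       NX i (ND i x) + (NS t x - NS c (\<Sum>j\<in>{1..n} - {i}. NR (transpose i j) x)) +
       (NX i (ND i y) + (NS t y - NS c (\<Sum>j\<in>{1..n} - {i}. NR (transpose i j) y)))" for x y
    by (simp_all add: ND_add[OF i] NX_add NS_add)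
  fix a m
  let ?m = "\<lambda>k. sc c (\<rho> (transpose i k) m)"
  have "ND i (NX i (single a m)) = single a (sc (t * of_int (a i + 1)) m + Z i m) -
     (\<Sum>k\<in>{1..n}-{i}. NX i (divdiff i k a (?m k)) + single (a \<circ> transpose i k) (?m k))"
    unfolding NX_single ND_single[OF i] Dphi_def
    by (intro arg_cong2[where f=minus] sum.cong) (auto simp: divdiff_NX_left)
  also have "\<dots> = NX i (ND i (single a m)) + (NS t (single a m) - NS c (\<Sum>j\<in>{1..n} - {i}. NR (transpose i j) (single a m)))"
  proof -
    have "(\<Sum>k\<in>{1..n}-{i}. single (a \<circ> transpose i k) (?m k)) = NS c (\<Sum>j\<in>{1..n} - {i}. NR (transpose i j) (single a m))"
      unfolding NS_additive using i
      by (intro sum.cong refl) (simp add: NR_transpose_single NS_single)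
    moreover have "NX i (ND i (single a m)) = single a (sc (t * of_int (a i)) m + Z i m) -
        (\<Sum>k\<in>{1..n}-{i}. NX i (divdiff i k a (?m k)))"
      unfolding ND_single[OF i] Dphi_def NX_additive NX_single by simp
    ultimately show ?thesis
      by (simp add: NS_single sum.distrib single_add scale_left_distrib algebra_simps)
  qed
  finally show "ND i (NX i (single a m)) = NX i (ND i (single a m)) + (NS t (single a m) - NS c (\<Sum>j\<in>{1..n} - {i}. NR (transpose i j) (single a m)))" .
qed

end

section \<open>Commutativity of the Dunkl operators\<close>

context hecke_rep
begin

interpretation VS: vector_space sc by (rule vs)

text \<open>The operator that the defining relations prescribe for the commutator [y_i, x_k], in
  both cases at once.\<close>

definition NE :: "nat \<Rightarrow> nat \<Rightarrow> ((nat \<Rightarrow> int) \<Rightarrow>\<^sub>0 'm) \<Rightarrow> (nat \<Rightarrow> int) \<Rightarrow>\<^sub>0 'm" where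
  "NE i k f = (if i = k then NS t f - NS c (\<Sum>j\<in>{1..n} - {i}. NR (transpose i j) f)
    else NS c (NR (transpose i k) f))"

lemma ND_NX_NE: "\<lbrakk>i \<in> {1..n}; k \<in> {1..n}\<rbrakk> \<Longrightarrow> ND i (NX k f) = NX k (ND i f) + NE i k f"
  using ND_NX ND_NX_same by (auto simp: NE_def)

text \<open>Of the transpositions (i l) in the sum only (i j) moves the index j; the others commute
  with y_j and drop out.\<close>

lemma NE_ND_same:
  assumes i: "i \<in> {1..n}" and j: "j \<in> {1..n}" and ij: "i \<noteq> j"
  shows "NE i i (ND j f) - ND j (NE i i f) =
    NS c (ND j (NR (transpose i j) f) - ND i (NR (transpose i j) f))"
proof -
  let ?S = "{1..n} - {i}"
  let ?G = "\<lambda>l. ND j (NR (transpose i l) f) - NR (transpose i l) (ND j f)"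
  note L = lin_opD[OF ND_lin[OF j]]
  have "NE i i (ND j f) - ND j (NE i i f) = NS c (\<Sum>l\<in>?S. ?G l)"
    by (simp add: NE_def L NS_additive sum_subtractf)
  also have "(\<Sum>l\<in>?S. ?G l) = ?G j + (\<Sum>l\<in>?S - {j}. ?G l)"
    using ij j by (intro sum.remove) auto
  also have "(\<Sum>l\<in>?S - {j}. ?G l) = 0"
  proof (rule sum.neutral, rule ballI)
    fix l assume l: "l \<in> ?S - {j}"
    then show "?G l = 0"
      using NR_ND[OF transpose_permutes[OF i, of l] j, of f] ij by (simp add: transpose_def)
  qed
  also have "?G j = ND j (NR (transpose i j) f) - ND i (NR (transpose i j) f)"
    using NR_ND[OF transpose_permutes[OF i j] j, of f] by simp
  finally show ?thesis by simp
qed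

lemma NE_ND_other:
  assumes "i \<in> {1..n}" "j \<in> {1..n}" "k \<in> {1..n}" "i \<noteq> k"
  shows "NE i k (ND j f) - ND j (NE i k f) =
    NS c (ND (transpose i k j) (NR (transpose i k) f) - ND j (NR (transpose i k) f))"
  using NR_ND[OF transpose_permutes[OF assms(1,3)] assms(2)] lin_opD[OF ND_lin[OF assms(2)]] assms(4)
  by (simp add: NE_def NS_additive)

text \<open>By the Jacobi identity, [[y_i, x_k], y_j] = [[y_j, x_k], y_i] is exactly the condition
  for [y_i, y_j] to commute with x_k. If k is neither i nor j, both sides vanish; otherwise a
  diagonal and an off-diagonal commutator are compared.\<close>

lemma NE_ND:
  assumes i: "i \<in> {1..n}" and j: "j \<in> {1..n}" and k: "k \<in> {1..n}" and ij: "i \<noteq> j"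
  shows "NE i k (ND j f) - ND j (NE i k f) = NE j k (ND i f) - ND i (NE j k f)"
proof -
  consider "k = i" | "k = j" | "k \<noteq> i" "k \<noteq> j" by blast
  then show ?thesis
  proof cases
    case 1
    then show ?thesis using NE_ND_same[OF i j ij, of f] NE_ND_other[OF j i i, of f] ij
      by (simp add: transpose_commute[of j i])
  next
    case 2
    then show ?thesis using NE_ND_same[OF j i, of f] NE_ND_other[OF i j j, of f] ij
      by (simp add: transpose_commute[of j i])
  next
    case 3
    then show ?thesis using NE_ND_other[OF i j k, of f] NE_ND_other[OF j i k, of f] ij
      by (simp add: transpose_def NS_additive)
  qed
qed

definition NC :: "nat \<Rightarrow> nat \<Rightarrow> ((nat \<Rightarrow> int) \<Rightarrow>\<^sub>0 'm) \<Rightarrow> (nat \<Rightarrow> int) \<Rightarrow>\<^sub>0 'm" where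
  "NC i j f = ND i (ND j f) - ND j (ND i f)"

lemma NC_NX:
  assumes i: "i \<in> {1..n}" and j: "j \<in> {1..n}" and k: "k \<in> {1..n}" and ij: "i \<noteq> j"
  shows "NC i j (NX k f) = NX k (NC i j f)"
  using NE_ND[OF assms, of f]
  by (simp add: NC_def ND_NX_NE[OF i k] ND_NX_NE[OF j k] ND_add[OF i] ND_add[OF j] NX_additive algebra_simps)

lemma ND_single_base:
  assumes i: "i \<in> {1..n}" and a: "\<forall>k\<in>{1..n}. a k = 0"
  shows "ND i (single a m) = single (a(i := - 1)) (Z i m)"
proof -
  have "a k = a i" if "k \<in> {1..n}" for k using a i that by metis
  then have "(\<Sum>k\<in>{1..n} - {i}. divdiff i k a (sc c (\<rho> (transpose i k) m))) = 0"
    by (intro sum.neutral) (auto simp: divdiff_def)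
  moreover have "a i = 0" using a i by blast
  ultimately show ?thesis by (simp add: ND_single[OF i] Dphi_def)
qed

text \<open>On a constant y_j leaves only x_j^-1. In the following y_i the exponents of i and k
  agree unless k = j, so a single divided difference survives, and it has just one term.\<close>

lemma ND_ND_single_base:
  assumes i: "i \<in> {1..n}" and j: "j \<in> {1..n}" and ij: "i \<noteq> j" and a: "\<forall>k\<in>{1..n}. a k = 0"
  shows "ND i (ND j (single a m)) = single (a(i := - 1, j := - 1)) (Z i (Z j m) - sc c (Z i (\<rho> (transpose i j) m)))"
proof -
  let ?b = "a(j := - 1)" and ?m = "Z j m"
  have b: "?b i = 0" "?b j = -1" using a i ij by auto
  have "(\<Sum>k\<in>{1..n} - {i}. divdiff i k ?b (sc c (\<rho> (transpose i k) ?m))) =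
     divdiff i j ?b (sc c (\<rho> (transpose i j) ?m)) + (\<Sum>k\<in>{1..n} - {i} - {j}. divdiff i k ?b (sc c (\<rho> (transpose i k) ?m)))"
    using ij j by (intro sum.remove) auto
  also have "(\<Sum>k\<in>{1..n} - {i} - {j}. divdiff i k ?b (sc c (\<rho> (transpose i k) ?m))) = 0"
    using a i ij by (intro sum.neutral) (auto simp: divdiff_def)
  also have "divdiff i j ?b (sc c (\<rho> (transpose i j) ?m)) = single (a(i := - 1, j := - 1)) (sc c (\<rho> (transpose i j) ?m))"
  proof -
    have "{- 1..<0::int} = {-1}" by auto
    moreover have "a(j := - 1, i := - 1, j := - 1) = a(i := - 1, j := - 1)" using ij by auto
    ultimately show ?thesis using a i ij by (simp add: divdiff_def signed_sum_def fun_upd_twist)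
  qed
  also have "\<rho> (transpose i j) ?m = Z i (\<rho> (transpose i j) m)"
    using \<rho>_Z[OF transpose_permutes[OF i j] j] by simp
  finally have S: "(\<Sum>k\<in>{1..n} - {i}. divdiff i k ?b (sc c (\<rho> (transpose i k) ?m))) =
      single (a(i := - 1, j := - 1)) (sc c (Z i (\<rho> (transpose i j) m)))" by (simp only: add_0_right)
  have tw: "?b(i := 0 - 1) = a(i := - 1, j := - 1)" using ij by auto
  have "ND i (ND j (single a m)) = single (?b(i := ?b i - 1)) (sc (t * of_int (?b i)) ?m + Z i ?m) -
      (\<Sum>k\<in>{1..n} - {i}. divdiff i k ?b (sc c (\<rho> (transpose i k) ?m)))"
    unfolding ND_single_base[OF j a] ND_single[OF i] Dphi_def ..
  then show ?thesis unfolding S b(1) tw by (simp add: single_diff)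
qed

text \<open>\<open>Z_comm\<close> enters here: it says precisely that the coefficient found for y_i
  y_j on a constant is symmetric in i and j.\<close>

lemma NC_single_base:
  assumes i: "i \<in> {1..n}" and j: "j \<in> {1..n}" and ij: "i \<noteq> j" and a: "\<forall>k\<in>{1..n}. a k = 0"
  shows "NC i j (single a m) = 0"
proof -
  have "a(j := - 1, i := - 1) = a(i := - 1, j := - 1)" using ij by auto
  moreover have "Z i (Z j m) - sc c (Z i (\<rho> (transpose i j) m)) = Z j (Z i m) - sc c (Z j (\<rho> (transpose j i) m))"
    using Z_comm[OF i j ij, of m]
    by (simp add: transpose_commute[of j i] VS.scale_right_diff_distrib algebra_simps)
  ultimately show ?thesis
    unfolding NC_def ND_ND_single_base[OF i j ij a] ND_ND_single_base[OF j i ij[symmetric] a] by simp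
qed

text \<open>The commutator commutes with every x_k, so an exponent is pushed towards 0: a factor x_k
  is pulled out of a positive power, and a negative power is multiplied by x_k and the factor
  cancelled afterwards. The sum of absolute values decreases until only constants remain.\<close>

lemma NC_single:
  assumes i: "i \<in> {1..n}" and j: "j \<in> {1..n}" and ij: "i \<noteq> j"
  shows "NC i j (single a m) = 0"
proof (induction "\<Sum>k\<in>{1..n}. nat \<bar>a k\<bar>" arbitrary: a rule: less_induct)
  case less
  show ?case
  proof (cases "\<forall>k\<in>{1..n}. a k = 0")
    case True
    then show ?thesis by (rule NC_single_base[OF assms])
  next
    case False
    then obtain k where k: "k \<in> {1..n}" "a k \<noteq> 0" by blast
    have smaller: "(\<Sum>l\<in>{1..n}. nat \<bar>(a(k := v)) l\<bar>) < (\<Sum>l\<in>{1..n}. nat \<bar>a l\<bar>)" if "\<bar>v\<bar> < \<bar>a k\<bar>" for v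
      using k that by (intro sum_strict_mono_ex1) auto
    show ?thesis
    proof (cases "a k > 0")
      case True
      have "NC i j (single (a(k := a k - 1)) m) = 0"
        using True by (intro less smaller) auto
      moreover have "single a m = NX k (single (a(k := a k - 1)) m)" by (simp add: NX_single)
      ultimately show ?thesis by (simp only: NC_NX[OF i j k(1) ij] NX_additive)
    next
      case False
      have "NC i j (single (a(k := a k + 1)) m) = 0"
        using False k by (intro less smaller) auto
      then have "NX k (NC i j (single a m)) = 0" by (simp add: NX_single flip: NC_NX[OF i j k(1) ij])
      then show ?thesis by (rule NX_inj)
    qed
  qed
qed

lemma ND_comm:
  assumes i: "i \<in> {1..n}" and j: "j \<in> {1..n}"
  shows "ND i (ND j f) = ND j (ND i f)"
proof (cases "i = j")
  case False
  have "ND i (ND j (single a m)) = ND j (ND i (single a m))" for a m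
    using NC_single[OF i j False, of a m] by (simp add: NC_def)
  then show ?thesis
    by (intro additive_eqI[where f=f and F="\<lambda>f. ND i (ND j f)"]) (simp_all add: ND_add i j del: atLeastAtMost_iff)
qed simp

sublocale N: cherednik_rep n t c NS NX ND NR
  by unfold_locales
     (use NS_vector_space NX_lin ND_lin NR_lin NR_id NR_comp NR_NX NR_ND NX_comm ND_comm ND_NX ND_NX_same
       in \<open>simp_all del: atLeastAtMost_iff add: vector_space_def\<close>)

end

section \<open>The degenerate affine Hecke algebra\<close>

context cherednik_alg
begin

lemma hU_closed [simp, intro]: "i \<in> {1..n} \<Longrightarrow> hU i \<in> carrier HA"
  unfolding hu_def Let_def
  by (intro HA.minus_closed HA.m_closed HA.smult_closed HA.finsum_closed hX_closed hY_closed)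
     (auto intro!: hP_closed transpose_permutes)

lemma smult_one_closed: "range (\<lambda>z. z \<odot>\<^bsub>HA\<^esub> \<one>\<^bsub>HA\<^esub>) \<subseteq> carrier HA" by auto

lemma hecke_gens: "range (\<lambda>z. z \<odot>\<^bsub>HA\<^esub> \<one>\<^bsub>HA\<^esub>) \<union> (hP ` carrier (sym_group n) \<union> hU ` {1..n}) \<subseteq> carrier HA"
  using smult_one_closed by (auto simp: sym_group_carrier)

lemma hecke_carrier: "carrier (hecke n t c) =
    generate_ring HA (range (\<lambda>z. z \<odot>\<^bsub>HA\<^esub> \<one>\<^bsub>HA\<^esub>) \<union> (hP ` carrier (sym_group n) \<union> hU ` {1..n}))"
  by (simp add: hecke_def gen_subalgebra_def)

lemma hecke_sub: "h \<in> carrier (hecke n t c) \<Longrightarrow> h \<in> carrier HA"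
  using HA.generate_ring_in_carrier[OF hecke_gens] by (simp add: hecke_carrier)

lemma hecke_induct [consumes 1, case_names scalar perm u uminus add mult]:
  assumes "h \<in> carrier (hecke n t c)"
    and "\<And>z. P (z \<odot>\<^bsub>HA\<^esub> \<one>\<^bsub>HA\<^esub>)"
    and "\<And>p. p permutes {1..n} \<Longrightarrow> P (hP p)"
    and "\<And>i. i \<in> {1..n} \<Longrightarrow> P (hU i)"
    and "\<And>h. \<lbrakk>h \<in> carrier (hecke n t c); P h\<rbrakk> \<Longrightarrow> P (\<ominus>\<^bsub>HA\<^esub> h)"
    and "\<And>h k. \<lbrakk>h \<in> carrier (hecke n t c); k \<in> carrier (hecke n t c); P h; P k\<rbrakk> \<Longrightarrow> P (h \<oplus>\<^bsub>HA\<^esub> k)"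
    and "\<And>h k. \<lbrakk>h \<in> carrier (hecke n t c); k \<in> carrier (hecke n t c); P h; P k\<rbrakk> \<Longrightarrow> P (h \<otimes>\<^bsub>HA\<^esub> k)"
  shows "P h"
  using assms(1) unfolding hecke_carrier
proof (induction rule: generate_ring.induct)
  case one
  then show ?case using assms(2)[of 1] by (simp add: HA.smult_one_left)
next
  case (incl h)
  then show ?case using assms(2-4) by (auto simp: sym_group_carrier)
qed (use assms(5-7) in \<open>auto simp: hecke_carrier\<close>)

lemma hecke_mem:
  "z \<odot>\<^bsub>HA\<^esub> \<one>\<^bsub>HA\<^esub> \<in> carrier (hecke n t c)"
  "p permutes {1..n} \<Longrightarrow> hP p \<in> carrier (hecke n t c)"
  "i \<in> {1..n} \<Longrightarrow> hU i \<in> carrier (hecke n t c)"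
  unfolding hecke_carrier by (rule generate_ring.incl; auto simp: sym_group_carrier)+

lemma hecke_simps:
  "x \<otimes>\<^bsub>hecke n t c\<^esub> y = x \<otimes>\<^bsub>HA\<^esub> y" "x \<oplus>\<^bsub>hecke n t c\<^esub> y = x \<oplus>\<^bsub>HA\<^esub> y" "\<one>\<^bsub>hecke n t c\<^esub> = \<one>\<^bsub>HA\<^esub>"
  "z \<odot>\<^bsub>hecke n t c\<^esub> x = z \<odot>\<^bsub>HA\<^esub> x"
  by (simp_all add: hecke_def gen_subalgebra_def)

lemma hecke_closed:
  "\<lbrakk>x \<in> carrier (hecke n t c); y \<in> carrier (hecke n t c)\<rbrakk> \<Longrightarrow> x \<oplus>\<^bsub>HA\<^esub> y \<in> carrier (hecke n t c)"
  "\<lbrakk>x \<in> carrier (hecke n t c); y \<in> carrier (hecke n t c)\<rbrakk> \<Longrightarrow> x \<otimes>\<^bsub>HA\<^esub> y \<in> carrier (hecke n t c)"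
  "x \<in> carrier (hecke n t c) \<Longrightarrow> \<ominus>\<^bsub>HA\<^esub> x \<in> carrier (hecke n t c)"
  "\<one>\<^bsub>HA\<^esub> \<in> carrier (hecke n t c)"
  unfolding hecke_carrier by (auto intro: generate_ring.intros)

lemma hecke_smult_closed: "x \<in> carrier (hecke n t c) \<Longrightarrow> z \<odot>\<^bsub>HA\<^esub> x \<in> carrier (hecke n t c)"
  using hecke_closed(2)[OF hecke_mem(1)[of z], of x] hecke_sub[of x] by (simp add: HA.smult_mult)

lemma parabolic_gens: "range (\<lambda>z. z \<odot>\<^bsub>HA\<^esub> \<one>\<^bsub>HA\<^esub>) \<union> (hU ` {1..n} \<union> hs n t c ` {i \<in> {1..<n}. b i = b (i + 1)}) \<subseteq> carrier HA"
  using smult_one_closed by (auto simp: hs_def intro!: hP_closed transpose_permutes)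

lemma parabolic_carrier: "carrier (parabolic n t c b) =
    generate_ring HA (range (\<lambda>z. z \<odot>\<^bsub>HA\<^esub> \<one>\<^bsub>HA\<^esub>) \<union> (hU ` {1..n} \<union> hs n t c ` {i \<in> {1..<n}. b i = b (i + 1)}))"
  by (simp add: parabolic_def gen_subalgebra_def)

lemma parabolic_sub: "h \<in> carrier (parabolic n t c b) \<Longrightarrow> h \<in> carrier HA"
  using HA.generate_ring_in_carrier[OF parabolic_gens] by (simp add: parabolic_carrier)

lemma parabolic_induct [consumes 1, case_names scalar u s uminus add mult]:
  assumes "h \<in> carrier (parabolic n t c b)"
    and "\<And>z. P (z \<odot>\<^bsub>HA\<^esub> \<one>\<^bsub>HA\<^esub>)"
    and "\<And>i. i \<in> {1..n} \<Longrightarrow> P (hU i)"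
    and "\<And>i. \<lbrakk>i \<in> {1..<n}; b i = b (i + 1)\<rbrakk> \<Longrightarrow> P (hs n t c i)"
    and "\<And>h. \<lbrakk>h \<in> carrier (parabolic n t c b); P h\<rbrakk> \<Longrightarrow> P (\<ominus>\<^bsub>HA\<^esub> h)"
    and "\<And>h k. \<lbrakk>h \<in> carrier (parabolic n t c b); k \<in> carrier (parabolic n t c b); P h; P k\<rbrakk> \<Longrightarrow> P (h \<oplus>\<^bsub>HA\<^esub> k)"
    and "\<And>h k. \<lbrakk>h \<in> carrier (parabolic n t c b); k \<in> carrier (parabolic n t c b); P h; P k\<rbrakk> \<Longrightarrow> P (h \<otimes>\<^bsub>HA\<^esub> k)"
  shows "P h"
  using assms(1) unfolding parabolic_carrier
proof (induction rule: generate_ring.induct)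
  case one
  then show ?case using assms(2)[of 1] by (simp add: HA.smult_one_left)
next
  case (incl h)
  then show ?case using assms(2-4) by auto
qed (use assms(5-7) in \<open>auto simp: parabolic_carrier\<close>)

lemma parabolic_mem:
  "z \<odot>\<^bsub>HA\<^esub> \<one>\<^bsub>HA\<^esub> \<in> carrier (parabolic n t c b)"
  "i \<in> {1..n} \<Longrightarrow> hU i \<in> carrier (parabolic n t c b)"
  "\<lbrakk>i \<in> {1..<n}; b i = b (i + 1)\<rbrakk> \<Longrightarrow> hs n t c i \<in> carrier (parabolic n t c b)"
  unfolding parabolic_carrier by (rule generate_ring.incl; auto)+

lemma parabolic_closed:
  "\<lbrakk>x \<in> carrier (parabolic n t c b); y \<in> carrier (parabolic n t c b)\<rbrakk> \<Longrightarrow> x \<oplus>\<^bsub>HA\<^esub> y \<in> carrier (parabolic n t c b)"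
  "\<lbrakk>x \<in> carrier (parabolic n t c b); y \<in> carrier (parabolic n t c b)\<rbrakk> \<Longrightarrow> x \<otimes>\<^bsub>HA\<^esub> y \<in> carrier (parabolic n t c b)"
  "x \<in> carrier (parabolic n t c b) \<Longrightarrow> \<ominus>\<^bsub>HA\<^esub> x \<in> carrier (parabolic n t c b)"
  "\<one>\<^bsub>HA\<^esub> \<in> carrier (parabolic n t c b)"
  unfolding parabolic_carrier by (auto intro: generate_ring.intros)

lemma parabolic_smult_closed: "x \<in> carrier (parabolic n t c b) \<Longrightarrow> z \<odot>\<^bsub>HA\<^esub> x \<in> carrier (parabolic n t c b)"
  using parabolic_closed(2)[OF parabolic_mem(1)[of z], of x] parabolic_sub[of x] by (simp add: HA.smult_mult)

lemma parabolic_simps: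
  "x \<otimes>\<^bsub>parabolic n t c b\<^esub> y = x \<otimes>\<^bsub>HA\<^esub> y" "x \<oplus>\<^bsub>parabolic n t c b\<^esub> y = x \<oplus>\<^bsub>HA\<^esub> y" "\<one>\<^bsub>parabolic n t c b\<^esub> = \<one>\<^bsub>HA\<^esub>"
  "z \<odot>\<^bsub>parabolic n t c b\<^esub> x = z \<odot>\<^bsub>HA\<^esub> x"
  by (simp_all add: parabolic_def gen_subalgebra_def)

lemma parabolic_hecke: "h \<in> carrier (parabolic n t c b) \<Longrightarrow> h \<in> carrier (hecke n t c)"
proof (induction rule: parabolic_induct)
  case (s i)
  then show ?case unfolding hs_def by (intro hecke_mem(2) transpose_permutes) auto
qed (auto intro: hecke_mem hecke_closed)

end

section \<open>Sorting permutations\<close>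

definition nonincr :: "nat \<Rightarrow> (nat \<Rightarrow> 'a::linorder) \<Rightarrow> bool" where
  "nonincr n d \<longleftrightarrow> (\<forall>i\<in>{1..<n}. d (i + 1) \<le> d i)"

lemma nonincr_le:
  assumes "nonincr n d" "i \<in> {1..n}" "j \<in> {1..n}" "i \<le> j"
  shows "d j \<le> d i"
  using assms(4,3)
proof (induction j rule: dec_induct)
  case (step k)
  then have "d (k + 1) \<le> d k" using assms(1,2) by (auto simp: nonincr_def)
  then show ?case using step assms(2) by (auto simp: Suc_eq_plus1)
qed simp

text \<open>Without descents p is strictly increasing on 1..n; climbing from 1 gives i \<le> p i,
  descending from n gives p i \<le> i, so p would be the identity.\<close>

lemma perm_descent:
  fixes p :: "nat \<Rightarrow> nat"
  assumes p: "p permutes {1..n}" and "p \<noteq> id"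
  shows "\<exists>i\<in>{1..<n}. p (i + 1) < p i"
proof (rule ccontr)
  assume no: "\<not> (\<exists>i\<in>{1..<n}. p (i + 1) < p i)"
  have inc: "p i < p (i + 1)" if "i \<in> {1..<n}" for i
  proof -
    have "i \<noteq> i + 1" by simp
    then have "p i \<noteq> p (i + 1)" using inj_eq[OF permutes_inj[OF p]] by blast
    then show ?thesis using no that by force
  qed
  have rng: "p i \<in> {1..n}" if "i \<in> {1..n}" for i using permutes_in_image[OF p] that by blast
  have low: "i \<le> n \<Longrightarrow> i \<le> p i" if "1 \<le> i" for i
    using that
  proof (induction i rule: dec_induct)
    case base then show ?case using rng[of 1] by auto
  next
    case (step k) then show ?case using inc[of k] by (auto simp flip: Suc_eq_plus1)
  qed
  have up: "1 \<le> i \<Longrightarrow> p i \<le> i" if "i \<le> n" for i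
    using that
  proof (induction i rule: inc_induct)
    case base then show ?case using rng[of n] by auto
  next
    case (step k) then show ?case using inc[of k] by (auto simp flip: Suc_eq_plus1)
  qed
  have "p i = i" for i
  proof (cases "i \<in> {1..n}")
    case True then show ?thesis using low[of i] up[of i] by auto
  next
    case False then show ?thesis by (rule permutes_not_in[OF p])
  qed
  then show False using assms(2) by auto
qed

text \<open>The position-weighted sum is the potential of both sorting arguments that follow: an
  adjacent swap changes it by the difference of the two values.\<close>

lemma sum_adjacent_swap:
  fixes f :: "nat \<Rightarrow> int"
  assumes "i \<in> {1..<n}"
  shows "(\<Sum>k\<in>{1..n}. int k * f (transpose i (i + 1) k)) = (\<Sum>k\<in>{1..n}. int k * f k) + f i - f (i + 1)"
proof -
  have split: "(\<Sum>k\<in>{1..n}. g k) = g i + g (i + 1) + (\<Sum>k\<in>{1..n} - {i, i + 1}. g k)" for g :: "nat \<Rightarrow> int"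
  proof -
    have "(\<Sum>k\<in>{1..n}. g k) = (\<Sum>k\<in>{i, i + 1}. g k) + (\<Sum>k\<in>{1..n} - {i, i + 1}. g k)"
      using assms by (intro sum.subset_diff[of "{i, i+1}" "{1..n}" g, THEN trans]) (auto simp: add.commute)
    then show ?thesis by simp
  qed
  have "(\<Sum>k\<in>{1..n} - {i, i + 1}. int k * f (transpose i (i + 1) k)) = (\<Sum>k\<in>{1..n} - {i, i + 1}. int k * f k)"
    by (intro sum.cong) (auto simp: transpose_def)
  then show ?thesis by (subst (1 2) split) (simp add: algebra_simps)
qed

text \<open>Products of those adjacent transpositions that are generators of H(d, u). For
  non-increasing d they exhaust the stabiliser of d, by
  \<open>nonincr_rearrangement\<close>.\<close>

inductive stab_gen :: "nat \<Rightarrow> (nat \<Rightarrow> 'a) \<Rightarrow> (nat \<Rightarrow> nat) \<Rightarrow> bool" for n d where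
  id: "stab_gen n d id"
| step: "\<lbrakk>stab_gen n d p; i \<in> {1..<n}; d i = d (i + 1)\<rbrakk> \<Longrightarrow> stab_gen n d (p \<circ> transpose i (i + 1))"

text \<open>A descent of \<open>p\<close> is an adjacent swap inside a block of equal entries of \<open>d\<close>; undoing it
  decreases \<open>\<Sum>k. k * (n - p k)\<close>.\<close>

lemma nonincr_rearrangement:
  fixes d :: "nat \<Rightarrow> 'a::linorder"
  assumes "nonincr n d" "p permutes {1..n}" "nonincr n (d \<circ> p)"
  shows "d \<circ> p = d \<and> stab_gen n d p"
  using assms(2,3)
proof (induction "nat (\<Sum>k\<in>{1..n}. int k * (int n - int (p k)))" arbitrary: p rule: less_induct)
  case less
  show ?case
  proof (cases "p = id")
    case True
    then show ?thesis by (auto intro: stab_gen.id)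
  next
    case False
    then obtain i where i: "i \<in> {1..<n}" "p (i + 1) < p i" using perm_descent[OF less.prems(1)] by blast
    let ?s = "transpose i (i + 1)"
    have s: "?s permutes {1..n}" using i by (intro transpose_permutes) auto
    have rng: "p k \<in> {1..n}" if "k \<in> {1..n}" for k using permutes_in_image[OF less.prems(1)] that by blast
    have "d (p i) \<le> d (p (i + 1))" using i rng[of i] rng[of "i+1"] by (intro nonincr_le[OF assms(1)]) auto
    moreover have "d (p (i + 1)) \<le> d (p i)" using less.prems(2) i by (auto simp: nonincr_def)
    ultimately have eq: "d (p i) = d (p (i + 1))" by simp
    then have eq': "d \<circ> (p \<circ> ?s) = d \<circ> p" by (auto simp: fun_eq_iff transpose_def)
    have nn: "0 \<le> (\<Sum>k\<in>{1..n}. int k * (int n - int (q k)))" if "q permutes {1..n}" for q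
    proof (intro sum_nonneg mult_nonneg_nonneg)
      fix k assume "k \<in> {1..n}"
      then show "0 \<le> int n - int (q k)" using permutes_in_image[OF that, of k] by auto
    qed auto
    have ps: "p \<circ> ?s permutes {1..n}" by (rule permutes_compose[OF s less.prems(1)])
    have "(\<Sum>k\<in>{1..n}. int k * (int n - int ((p \<circ> ?s) k))) < (\<Sum>k\<in>{1..n}. int k * (int n - int (p k)))"
      using sum_adjacent_swap[OF i(1), of "\<lambda>k. int n - int (p k)"] i(2) by simp
    then have "d \<circ> (p \<circ> ?s) = d \<and> stab_gen n d (p \<circ> ?s)"
      using nn[OF ps] less.prems(2) eq' by (intro less.hyps ps) auto
    then have dp: "d \<circ> p = d" and st: "stab_gen n d (p \<circ> ?s)" using eq' by auto
    have "d i = d (i + 1)" using eq dp by (metis comp_apply)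
    then have "stab_gen n d ((p \<circ> ?s) \<circ> ?s)" by (rule stab_gen.step[OF st i(1)])
    moreover have "(p \<circ> ?s) \<circ> ?s = p" by (auto simp: fun_eq_iff)
    ultimately show ?thesis using dp by simp
  qed
qed

text \<open>Among the finitely many rearrangements take one minimising the position-weighted sum; an
  ascent at an adjacent pair could be swapped to make it smaller.\<close>

lemma nonincr_exists:
  fixes a :: "nat \<Rightarrow> int"
  shows "\<exists>p. p permutes {1..n} \<and> nonincr n (a \<circ> p)"
proof -
  let ?P = "{p. p permutes {1..n}}"
  let ?m = "\<lambda>p. \<Sum>k\<in>{1..n}. int k * (a \<circ> p) k"
  have fin: "finite ?P" by (rule finite_permutations) simp
  have ne: "?P \<noteq> {}" using permutes_id by blast
  obtain p where p: "p permutes {1..n}" "\<And>q. q permutes {1..n} \<Longrightarrow> ?m p \<le> ?m q"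
    using arg_min_least[OF fin ne, where f = ?m] arg_min_if_finite(1)[OF fin ne, where f = ?m] by auto
  have "nonincr n (a \<circ> p)"
    unfolding nonincr_def
  proof (rule ballI, rule ccontr)
    fix i assume i: "i \<in> {1..<n}" and c: "\<not> (a \<circ> p) (i + 1) \<le> (a \<circ> p) i"
    let ?s = "transpose i (i + 1)"
    have s: "?s permutes {1..n}" using i by (intro transpose_permutes) auto
    have "?m p \<le> ?m (p \<circ> ?s)" by (rule p(2)[OF permutes_compose[OF s p(1)]])
    then show False using sum_adjacent_swap[OF i, of "a \<circ> p"] c by simp
  qed
  then show ?thesis using p by blast
qed

definition sort_pred :: "nat \<Rightarrow> (nat \<Rightarrow> nat) \<Rightarrow> nat \<Rightarrow> nat set" where
  "sort_pred n d i = {k \<in> {1..n}. d k < d i \<or> (d k = d i \<and> k < i)}"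

text \<open>\<open>sort_perm\<close> made the identity outside 1..n, as \<open>permutes\<close>
  demands.\<close>

definition sorter :: "nat \<Rightarrow> (nat \<Rightarrow> nat) \<Rightarrow> nat \<Rightarrow> nat" where
  "sorter n d i = (if i \<in> {1..n} then sort_perm n d i else i)"

text \<open>\<open>sort_perm\<close> counts i itself among the entries equal to d i, whereas
  \<open>sort_pred\<close> contains only strict predecessors; hence the shift by one.\<close>

lemma sort_perm_card:
  assumes "i \<in> {1..n}"
  shows "sort_perm n d i = card (sort_pred n d i) + 1"
proof -
  have "{j \<in> {1..i}. d j = d i} = insert i {j \<in> {1..<i}. d j = d i}" using assms by auto
  then have "card {j \<in> {1..i}. d j = d i} = card {j \<in> {1..<i}. d j = d i} + 1" by simp
  moreover have W: "sort_pred n d i = {j \<in> {1..n}. d j < d i} \<union> {j \<in> {1..<i}. d j = d i}"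
    using assms by (auto simp: sort_pred_def)
  have "card (sort_pred n d i) = card {j \<in> {1..n}. d j < d i} + card {j \<in> {1..<i}. d j = d i}"
    unfolding W by (rule card_Un_disjoint) auto
  ultimately show ?thesis by (simp add: sort_perm_def)
qed

lemma finite_sort_pred [simp]: "finite (sort_pred n d i)"
  by (simp add: sort_pred_def)

text \<open>Predecessor sets of the stable sorting order are strictly nested, and
  \<open>sorter\<close> measures their cardinality.\<close>

lemma sorter_less:
  assumes "i \<in> {1..n}" "k \<in> sort_pred n d i"
  shows "sorter n d k < sorter n d i"
proof -
  have k: "k \<in> {1..n}" using assms by (auto simp: sort_pred_def)
  have "sort_pred n d k \<subset> sort_pred n d i" using assms k by (auto simp: sort_pred_def)
  then have "card (sort_pred n d k) < card (sort_pred n d i)" by (intro psubset_card_mono) simp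
  then show ?thesis using assms k by (simp add: sorter_def sort_perm_card)
qed

lemma sorter_permutes: "sorter n d permutes {1..n}"
proof -
  have inj: "inj_on (sorter n d) {1..n}"
  proof (rule inj_onI, rule ccontr)
    fix i k assume ik: "i \<in> {1..n}" "k \<in> {1..n}" "sorter n d i = sorter n d k" "i \<noteq> k"
    then have "i \<in> sort_pred n d k \<or> k \<in> sort_pred n d i" by (auto simp: sort_pred_def)
    then show False using sorter_less[of k n i d] sorter_less[of i n k d] ik by auto
  qed
  have sub: "sorter n d ` {1..n} \<subseteq> {1..n}"
  proof (rule image_subsetI)
    fix i assume i: "i \<in> {1..n}"
    have "sort_pred n d i \<subseteq> {1..n} - {i}" by (auto simp: sort_pred_def)
    then have "card (sort_pred n d i) \<le> card ({1..n} - {i})" by (intro card_mono) auto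
    then show "sorter n d i \<in> {1..n}" using i by (auto simp: sorter_def sort_perm_card)
  qed
  have "bij_betw (sorter n d) {1..n} {1..n}"
    using inj sub by (simp add: bij_betw_def endo_inj_surj)
  then show ?thesis by (rule bij_imp_permutes) (auto simp: sorter_def)
qed

text \<open>An injection into an interval of the same cardinality. It converts the sum over
  \<open>sort_pred\<close>, which is what u_i produces on x^d, into the Jucys-Murphy sum at the
  sorted position of i.\<close>

lemma sorter_image_pred:
  assumes "i \<in> {1..n}"
  shows "sorter n d ` sort_pred n d i = {1..<sorter n d i}"
proof (rule card_subset_eq)
  show "sorter n d ` sort_pred n d i \<subseteq> {1..<sorter n d i}"
  proof (rule image_subsetI)
    fix k assume k: "k \<in> sort_pred n d i"
    then have "k \<in> {1..n}" by (simp add: sort_pred_def)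
    then have "sorter n d k \<in> {1..n}" using permutes_in_image[OF sorter_permutes] by blast
    then show "sorter n d k \<in> {1..<sorter n d i}" using sorter_less[OF assms k] by simp
  qed
  have "card (sorter n d ` sort_pred n d i) = card (sort_pred n d i)"
    by (rule card_image) (meson permutes_inj_on sorter_permutes)
  also have "\<dots> = card {1..<sorter n d i}" using assms by (simp add: sorter_def sort_perm_card)
  finally show "card (sorter n d ` sort_pred n d i) = card {1..<sorter n d i}" .
qed simp

text \<open>Stability of the sorting: adjacent equal entries stay adjacent, so conjugation turns s_i
  into the simple reflection s_{g(i)}.\<close>

lemma sorter_Suc:
  assumes "i \<in> {1..<n}" "d i = d (i + 1)"
  shows "sorter n d (i + 1) = sorter n d i + 1"
proof -
  have "sort_pred n d (i + 1) = insert i (sort_pred n d i)" using assms by (auto simp: sort_pred_def)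
  moreover have "i \<notin> sort_pred n d i" by (auto simp: sort_pred_def)
  ultimately show ?thesis using assms by (simp add: sorter_def sort_perm_card)
qed

section \<open>Action of the Hecke algebra on Laurent monomials\<close>

definition qform :: "nat \<Rightarrow> (nat \<Rightarrow> int) \<Rightarrow> int" where
  "qform n a = (\<Sum>i\<in>{1..n}. (a i)\<^sup>2)"

definition orb :: "nat \<Rightarrow> (nat \<Rightarrow> int) \<Rightarrow> (nat \<Rightarrow> int) set" where
  "orb n a = {a \<circ> p |p. p permutes {1..n}}"

text \<open>Besides the drop in the sum of squares, non-negative exponents are required to stay
  non-negative, so that lower terms of polynomials are polynomials.\<close>

definition below :: "nat \<Rightarrow> (nat \<Rightarrow> int) \<Rightarrow> (nat \<Rightarrow> int) set" where
  "below n a = {b. qform n b < qform n a \<and> (\<forall>i. i \<notin> {1..n} \<longrightarrow> b i = a i) \<and>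
     ((\<forall>i. 0 \<le> a i) \<longrightarrow> (\<forall>i. 0 \<le> b i))}"

lemma qform_perm: "p permutes {1..n} \<Longrightarrow> qform n (a \<circ> p) = qform n a"
  unfolding qform_def using sum.permute[of p "{1..n}" "\<lambda>i. (a i)\<^sup>2"] by (simp add: comp_def)

lemma below_perm:
  assumes p: "p permutes {1..n}"
  shows "below n (a \<circ> p) = below n a"
proof -
  have "(\<forall>i. 0 \<le> (a \<circ> p) i) \<longleftrightarrow> (\<forall>i. 0 \<le> a i)"
    by (metis comp_apply permutes_inverses(1)[OF p])
  moreover have "i \<notin> {1..n} \<Longrightarrow> p i = i" for i by (rule permutes_not_in[OF p])
  ultimately show ?thesis unfolding below_def qform_perm[OF p] by auto
qed

lemma orb_perm:
  assumes p: "p permutes {1..n}"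
  shows "orb n (a \<circ> p) = orb n a"
proof -
  have "\<exists>q'. a \<circ> p \<circ> q = a \<circ> q' \<and> q' permutes {1..n}" if "q permutes {1..n}" for q
    using permutes_compose[OF that p] by (auto simp: comp_assoc)
  moreover have "\<exists>q'. a \<circ> q = a \<circ> p \<circ> q' \<and> q' permutes {1..n}" if "q permutes {1..n}" for q
    using permutes_compose[OF that permutes_inv[OF p]] permutes_inv_o(1)[OF p]
    by (intro exI[of _ "inv' p \<circ> q"]) (simp add: comp_assoc fun_eq_iff permutes_inverses(1)[OF p])
  ultimately show ?thesis unfolding orb_def by blast
qed

lemma orb_self: "a \<in> orb n a"
  unfolding orb_def using permutes_id[of "{1..n}"] by (auto intro!: exI[of _ id])

lemma orbI: "p permutes {1..n} \<Longrightarrow> a \<circ> p \<in> orb n a"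
  unfolding orb_def by blast

lemma below_closed: "b \<in> below n a \<Longrightarrow> orb n b \<union> below n b \<subseteq> below n a"
proof
  fix x assume b: "b \<in> below n a" and "x \<in> orb n b \<union> below n b"
  then consider p where "p permutes {1..n}" "x = b \<circ> p" | "x \<in> below n b" unfolding orb_def by blast
  then show "x \<in> below n a"
  proof cases
    case 1
    then show ?thesis using b permutes_not_in[OF 1(1)] by (auto simp: below_def qform_perm)
  next
    case 2
    then show ?thesis using b by (auto simp: below_def)
  qed
qed

text \<open>Both parts depend only on the orbit, and the sum of squares is invariant on it. Support
  bounds can thus be composed along products in the Hecke algebra.\<close>

lemma cone_closed: "b \<in> orb n a \<union> below n a \<Longrightarrow> orb n b \<union> below n b \<subseteq> orb n a \<union> below n a"
proof (erule UnE)
  assume "b \<in> orb n a"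
  then obtain p where "p permutes {1..n}" "b = a \<circ> p" unfolding orb_def by blast
  then show ?thesis by (simp add: orb_perm below_perm)
next
  assume "b \<in> below n a"
  then show ?thesis using below_closed[of b n a] by blast
qed

lemma keys_additive_subset:
  fixes T :: "('k \<Rightarrow>\<^sub>0 'm::ab_group_add) \<Rightarrow> ('l \<Rightarrow>\<^sub>0 'w::ab_group_add)"
  assumes "\<And>x y. T (x + y) = T x + T y"
    and "\<And>k m. k \<in> keys f \<Longrightarrow> keys (T (single k m)) \<subseteq> S"
  shows "keys (T f) \<subseteq> S"
proof -
  have "T f = (\<Sum>k\<in>keys f. T (single k (lookup f k)))"
    by (subst poly_mapping_eq_sum_single[of f]) (rule additive_sum, rule assms)
  moreover have "keys (\<Sum>k\<in>keys f. T (single k (lookup f k))) \<subseteq> S"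
    using assms(2) by (intro order_trans[OF keys_sum]) blast
  ultimately show ?thesis by simp
qed

lemma keys_diff_subset: "keys f \<subseteq> S \<Longrightarrow> keys g \<subseteq> S \<Longrightarrow> keys (f - g) \<subseteq> S" for f g :: "'k \<Rightarrow>\<^sub>0 'm::ab_group_add"
  using keys_diff[of f g] by blast

lemma keys_add_subset: "keys f \<subseteq> S \<Longrightarrow> keys g \<subseteq> S \<Longrightarrow> keys (f + g) \<subseteq> S" for f g :: "'k \<Rightarrow>\<^sub>0 'm::ab_group_add"
  using keys_add[of f g] by blast

text \<open>After multiplication by x_i the exponent pairs are (r, a_i + a_k - r), with r running
  between a_k and a_i. Interior values of r lie below; of the two end points, a half-open range
  contains exactly one. It is x^a itself if a_k < a_i, and the transposed monomial with a minus sign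
  if a_i < a_k.\<close>

lemma NX_divdiff:
  assumes i: "i \<in> {1..n}" and k: "k \<in> {1..n}" and ik: "i \<noteq> k"
  obtains g where "keys g \<subseteq> below n a"
    "NX i (divdiff i k a m) = (if a k < a i then single a m else
      if a i < a k then - single (a \<circ> transpose i k) m else 0) + g"
proof -
  define g where "g = (\<lambda>r. single (a(i := r, k := a i + a k - r)) m)"
  have S: "NX i (divdiff i k a m) = signed_sum (\<lambda>r. g (r + 1)) (a k) (a i)"
    unfolding divdiff_def using ik
    by (subst signed_sum_additive[OF NX_add]) (auto simp: g_def NX_single fun_upd_twist[of i k] algebra_simps)
  have low: "a(i := r, k := a i + a k - r) \<in> below n a" if r: "min (a i) (a k) < r" "r < max (a i) (a k)" for r
  proof -
    let ?b = "a(i := r, k := a i + a k - r)"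
    have split: "(\<Sum>l\<in>{1..n}. g l) = g i + g k + (\<Sum>l\<in>{1..n} - {i, k}. g l)" for g :: "nat \<Rightarrow> int"
    proof -
      have "(\<Sum>l\<in>{1..n}. g l) = (\<Sum>l\<in>{i, k}. g l) + (\<Sum>l\<in>{1..n} - {i, k}. g l)"
        using assms by (intro sum.subset_diff[of "{i, k}" "{1..n}" g, THEN trans]) (auto simp: add.commute)
      then show ?thesis using ik by simp
    qed
    have "(\<Sum>l\<in>{1..n} - {i, k}. (?b l)\<^sup>2) = (\<Sum>l\<in>{1..n} - {i, k}. (a l)\<^sup>2)"
      by (intro sum.cong) auto
    moreover have "r\<^sup>2 + (a i + a k - r)\<^sup>2 < (a i)\<^sup>2 + (a k)\<^sup>2"
    proof -
      \<comment> \<open>Twice this product is the change of the sum of squares when (a_i, a_k) is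
        replaced by (r, a_i + a_k - r).\<close>
      have "(r - a i) * (r - a k) < 0" using r by (auto simp: mult_less_0_iff min_def max_def split: if_splits)
      then show ?thesis by (simp add: power2_eq_square algebra_simps)
    qed
    ultimately have "qform n ?b < qform n a"
      unfolding qform_def by (subst (1 2) split) (use ik in auto)
    moreover have "\<forall>l. 0 \<le> ?b l" if "\<forall>l. 0 \<le> a l"
    proof -
      have "0 \<le> a i" "0 \<le> a k" using that by auto
      then have "0 \<le> r" "r \<le> a i + a k" using r by (auto simp: min_def max_def split: if_splits)
      then show ?thesis using that by auto
    qed
    ultimately show ?thesis using i k by (auto simp: below_def)
  qed
  have tr: "g (a k) = single (a \<circ> transpose i k) m" "g (a i) = single a m"
    unfolding g_def using ik by (intro arg_cong2[where f=single] refl; auto simp: fun_eq_iff transpose_def)+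
  consider "a k < a i" | "a i < a k" | "a i = a k" by linarith
  then show thesis
  proof cases
    case 1
    have "signed_sum (\<lambda>r. g (r + 1)) (a k) (a i) = signed_sum g (a k + 1) (a i) + g (a i)"
      using signed_sum_shift[of g "a k" "a i"] by (simp add: signed_sum_right)
    also have "signed_sum g (a k + 1) (a i) = (\<Sum>r\<in>{a k + 1..<a i}. g r)"
      using 1 by (simp add: signed_sum_def)
    finally have "NX i (divdiff i k a m) = single a m + (\<Sum>r\<in>{a k + 1..<a i}. g r)"
      unfolding S tr by simp
    moreover have "keys (\<Sum>r\<in>{a k + 1..<a i}. g r) \<subseteq> below n a"
      using 1 low by (intro order_trans[OF keys_sum]) (auto simp: g_def split: if_splits)
    ultimately show ?thesis using that[of "\<Sum>r\<in>{a k + 1..<a i}. g r"] 1 by simp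
  next
    case 2
    have "signed_sum (\<lambda>r. g (r + 1)) (a k) (a i) = - signed_sum g (a i + 1) (a k) - g (a k)"
      using signed_sum_shift[of g "a k" "a i"] signed_sum_swap[of g "a k + 1" "a i + 1"]
      by (simp add: signed_sum_right)
    also have "signed_sum g (a i + 1) (a k) = (\<Sum>r\<in>{a i + 1..<a k}. g r)"
      using 2 by (simp add: signed_sum_def)
    finally have "NX i (divdiff i k a m) = - single (a \<circ> transpose i k) m + - (\<Sum>r\<in>{a i + 1..<a k}. g r)"
      unfolding S tr by simp
    moreover have "keys (- (\<Sum>r\<in>{a i + 1..<a k}. g r)) \<subseteq> below n a"
      unfolding keys_minus
      using 2 low by (intro order_trans[OF keys_sum]) (auto simp: g_def split: if_splits)
    ultimately show ?thesis using that[of "- (\<Sum>r\<in>{a i + 1..<a k}. g r)"] 2 by simp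
  next
    case 3
    then show ?thesis using that[of 0] by (simp add: S)
  qed
qed

lemma Pminus_nonincr: "d \<in> Pminus n \<Longrightarrow> nonincr n d"
  by (auto simp: Pminus_def nonincr_def)

lemma keys_sum_subset:
  fixes b :: "'i \<Rightarrow> 'k \<Rightarrow>\<^sub>0 'm::ab_group_add"
  shows "(\<And>i. i \<in> I \<Longrightarrow> keys (b i) \<subseteq> S) \<Longrightarrow> keys (sum b I) \<subseteq> S"
  using keys_sum[of b I] by blast

section \<open>Triangularity and leading terms of the Hecke action\<close>

context hecke_rep
begin

interpretation VS: vector_space sc by (rule vs)

lemma act_hU:
  assumes i: "i \<in> {1..n}"
  shows "N.act (hU i) f = NX i (ND i f) - NS c (\<Sum>j\<in>{1..<i}. NR (transpose i j) f)"
proof -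
  have tp: "transpose i j permutes {1..n}" if "j \<in> {1..<i}" for j
    using i that by (intro transpose_permutes) auto
  have cl: "(\<lambda>j. hP (transpose i j)) \<in> {1..<i} \<rightarrow> carrier HA" using tp by auto
  have "N.act (\<Oplus>\<^bsub>HA\<^esub>j\<in>{1..<i}. hP (transpose i j)) f = (\<Sum>j\<in>{1..<i}. NR (transpose i j) f)"
    using tp by (simp add: N.act_finsum[OF _ cl] N.act_gens)
  then show ?thesis
    unfolding hu_def Let_def
    using i HA.finsum_closed[OF cl]
    by (simp add: N.act_minus N.act_mult N.act_smult N.act_gens del: atLeastAtMost_iff)
qed

lemma NX_ND_single:
  assumes i: "i \<in> {1..n}"
  shows "NX i (ND i (single a m)) = single a (sc (t * of_int (a i)) m + Z i m)
    - (\<Sum>k\<in>{1..n} - {i}. NX i (divdiff i k a (sc c (\<rho> (transpose i k) m))))"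
  unfolding ND_single[OF i] Dphi_def NX_additive NX_single by simp

text \<open>Only the generators need inspection: permutations stay in the orbit, and u_i is a
  combination of terms x_i times a divided difference and of transpositions. Products are handled by
  \<open>cone_closed\<close>.\<close>

lemma keys_act_single:
  assumes "h \<in> carrier (hecke n t c)"
  shows "keys (N.act h (single a m)) \<subseteq> orb n a \<union> below n a"
  using assms
proof (induction arbitrary: a m rule: hecke_induct)
  case (scalar z)
  then show ?case using orb_self[of a n] by (simp add: N.act_smult N.act_one NS_single)
next
  case (perm p)
  then show ?case using orbI[OF permutes_inv[OF perm], of a] by (simp add: N.act_gens NR_single)
next
  case (u i)
  have 1: "keys (NX i (divdiff i k a m')) \<subseteq> orb n a \<union> below n a" if k: "k \<in> {1..n} - {i}" for k m'
  proof -
    have k': "k \<in> {1..n}" "i \<noteq> k" using k by auto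
    obtain g where g: "keys g \<subseteq> below n a" "NX i (divdiff i k a m') = (if a k < a i then single a m' else
      if a i < a k then - single (a \<circ> transpose i k) m' else 0) + g"
      by (rule NX_divdiff[OF u k', of a m'])
    show ?thesis unfolding g(2)
      using g(1) orb_self[of a n] orbI[OF transpose_permutes[OF u k'(1)], of a]
      by (intro keys_add_subset) auto
  qed
  have 2: "keys (NR (transpose i j) (single a m)) \<subseteq> orb n a \<union> below n a" if "j \<in> {1..<i}" for j
  proof -
    have j: "j \<in> {1..n}" using that u by auto
    show ?thesis using orbI[OF transpose_permutes[OF u j], of a] by (simp add: NR_transpose_single[OF u j])
  qed
  have 3: "keys (NS c f) \<subseteq> S" if "keys f \<subseteq> S" for f S
    by (rule keys_additive_subset[where T = "NS c", OF NS_add]) (use that in \<open>auto simp: NS_single\<close>)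
  have "keys (\<Sum>k\<in>{1..n} - {i}. NX i (divdiff i k a (sc c (\<rho> (transpose i k) m)))) \<subseteq> orb n a \<union> below n a"
    using 1 by (rule keys_sum_subset)
  moreover have "keys (single a (sc (t * of_int (a i)) m + Z i m)) \<subseteq> orb n a \<union> below n a"
    using orb_self[of a n] by simp
  moreover have "keys (\<Sum>j\<in>{1..<i}. NR (transpose i j) (single a m)) \<subseteq> orb n a \<union> below n a"
    using 2 by (rule keys_sum_subset)
  ultimately show ?case
    unfolding act_hU[OF u] NX_ND_single[OF u]
    using keys_diff_subset[OF keys_diff_subset 3] by blast
next
  case (uminus h)
  then show ?case using hecke_sub[of h] by (simp add: N.act_uminus)
next
  case (add h k)
  then show ?case using hecke_sub[of h] hecke_sub[of k] by (simp add: N.act_add keys_add_subset)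
next
  case (mult h k)
  have hk: "h \<in> carrier HA" "k \<in> carrier HA" using mult hecke_sub by auto
  have "keys (N.act h (N.act k (single a m))) \<subseteq> orb n a \<union> below n a"
    by (rule keys_additive_subset[where T = "N.act h", OF lin_opD(1)[OF N.act_lin[OF hk(1)]]])
       (use mult.IH cone_closed in blast)
  then show ?case using hk by (simp add: N.act_mult)
qed

lemma keys_act:
  assumes "h \<in> carrier (hecke n t c)" "\<And>b. b \<in> S \<Longrightarrow> orb n b \<union> below n b \<subseteq> S" "keys f \<subseteq> S"
  shows "keys (N.act h f) \<subseteq> S"
  by (rule keys_additive_subset[where T = "N.act h", OF lin_opD(1)[OF N.act_lin[OF hecke_sub[OF assms(1)]]]])
     (use assms(2,3) keys_act_single[OF assms(1)] in blast)

lemma keys_act_below: "\<lbrakk>h \<in> carrier (hecke n t c); keys f \<subseteq> below n a\<rbrakk> \<Longrightarrow> keys (N.act h f) \<subseteq> below n a"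
  by (rule keys_act) (auto dest: below_closed)

text \<open>On a non-increasing exponent the contributions of \<open>x\<^sub>i y\<^sub>i\<close> and of the Jucys-Murphy sum to the
  other monomials of the orbit cancel.\<close>

lemma act_hU_lead:
  assumes d: "nonincr n d" and i: "i \<in> {1..n}"
  obtains g where "keys g \<subseteq> below n (int \<circ> d)"
    "N.act (hU i) (single (int \<circ> d) m) = single (int \<circ> d) (sc (t * of_nat (d i)) m + Z i m
      - sc c (\<Sum>k\<in>sort_pred n d i. \<rho> (transpose i k) m)) + g"
proof -
  define a where "a = int \<circ> d"
  have ad: "a k = int (d k)" for k by (simp add: a_def)
  let ?S = "{1..n} - {i}"
  let ?\<mu> = "\<lambda>k. sc c (\<rho> (transpose i k) m)"
  let ?L = "\<lambda>k. if a k < a i then single a (?\<mu> k) else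
      if a i < a k then - single (a \<circ> transpose i k) (?\<mu> k) else 0"
  have "\<exists>g. keys g \<subseteq> below n a \<and> NX i (divdiff i k a (?\<mu> k)) = ?L k + g" if k: "k \<in> ?S" for k
  proof -
    have k': "k \<in> {1..n}" "i \<noteq> k" using k by auto
    show ?thesis by (rule NX_divdiff[OF i k', of a "?\<mu> k"]) blast
  qed
  then obtain g where g: "\<And>k. k \<in> ?S \<Longrightarrow> keys (g k) \<subseteq> below n a"
    "\<And>k. k \<in> ?S \<Longrightarrow> NX i (divdiff i k a (?\<mu> k)) = ?L k + g k" by metis
  \<comment> \<open>Since d is non-increasing, d_k < d_i forces i < k, and only the divided
    difference contributes, with x^a. If d_k > d_i then k < i, and the transposed monomial cancels
    against the Jucys-Murphy term. If d_k = d_i the divided difference vanishes, and the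
    Jucys-Murphy term, present for k < i, fixes x^a.\<close>
  have pt: "?L k + (if k < i then single (a \<circ> transpose i k) (?\<mu> k) else 0) =
      (if k \<in> sort_pred n d i then single a (?\<mu> k) else 0)" if k: "k \<in> ?S" for k
  proof -
    have le: "k < i \<Longrightarrow> d i \<le> d k" "i < k \<Longrightarrow> d k \<le> d i"
      using nonincr_le[OF d, of k i] nonincr_le[OF d, of i k] k i by auto
    have s: "a \<circ> transpose i k = a" if "d i = d k" using that by (auto simp: transpose_def fun_eq_iff ad)
    consider "d k < d i" | "d i < d k" | "d k = d i" by linarith
    then show ?thesis
    proof cases
      case 1
      then have "\<not> k < i" using le by auto
      then show ?thesis using 1 k by (auto simp: sort_pred_def ad)
    next
      case 2
      then have "k < i" using le k by (metis DiffE insertCI linorder_neqE_nat not_less)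
      then show ?thesis using 2 k by (auto simp: sort_pred_def ad)
    next
      case 3
      then show ?thesis using s k by (auto simp: sort_pred_def ad)
    qed
  qed
  have jm: "NS c (\<Sum>j\<in>{1..<i}. NR (transpose i j) (single a m)) =
      (\<Sum>k\<in>?S. if k < i then single (a \<circ> transpose i k) (?\<mu> k) else 0)"
  proof -
    have "NS c (\<Sum>j\<in>{1..<i}. NR (transpose i j) (single a m)) = (\<Sum>k\<in>{1..<i}. single (a \<circ> transpose i k) (?\<mu> k))"
      unfolding NS_additive
    proof (rule sum.cong[OF refl])
      fix j assume "j \<in> {1..<i}"
      then have "j \<in> {1..n}" using i by auto
      then show "NS c (NR (transpose i j) (single a m)) = single (a \<circ> transpose i j) (?\<mu> j)"
        by (simp only: NR_transpose_single[OF i] NS_single)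
    qed
    also have "\<dots> = (\<Sum>k\<in>?S. if k < i then single (a \<circ> transpose i k) (?\<mu> k) else 0)"
      using i by (intro sum.mono_neutral_cong_left) auto
    finally show ?thesis .
  qed
  have sp: "(\<Sum>k\<in>?S. if k \<in> sort_pred n d i then single a (?\<mu> k) else 0) =
      single a (sc c (\<Sum>k\<in>sort_pred n d i. \<rho> (transpose i k) m))"
  proof -
    have "(\<Sum>k\<in>?S. if k \<in> sort_pred n d i then single a (?\<mu> k) else 0) = (\<Sum>k\<in>sort_pred n d i. single a (?\<mu> k))"
      by (intro sum.mono_neutral_cong_right) (auto simp: sort_pred_def)
    also have "\<dots> = single a (\<Sum>k\<in>sort_pred n d i. ?\<mu> k)"
      by (rule additive_sum[symmetric]) (rule single_add)
    finally show ?thesis by (simp add: VS.scale_sum_right)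
  qed
  have "N.act (hU i) (single a m) = single a (sc (t * of_int (a i)) m + Z i m) - (\<Sum>k\<in>?S. ?L k + g k)
      - (\<Sum>k\<in>?S. if k < i then single (a \<circ> transpose i k) (?\<mu> k) else 0)"
    unfolding act_hU[OF i] NX_ND_single[OF i] jm using g(2)
    by (intro arg_cong2[where f=minus] sum.cong refl) auto
  also have "\<dots> = single a (sc (t * of_int (a i)) m + Z i m)
      - (\<Sum>k\<in>?S. ?L k + (if k < i then single (a \<circ> transpose i k) (?\<mu> k) else 0)) - (\<Sum>k\<in>?S. g k)"
    by (simp only: sum.distrib algebra_simps)
  also have "(\<Sum>k\<in>?S. ?L k + (if k < i then single (a \<circ> transpose i k) (?\<mu> k) else 0)) =
      single a (sc c (\<Sum>k\<in>sort_pred n d i. \<rho> (transpose i k) m))"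
    unfolding sp[symmetric] by (rule sum.cong[OF refl], rule pt)
  finally have "N.act (hU i) (single a m) = single a (sc (t * of_nat (d i)) m + Z i m
      - sc c (\<Sum>k\<in>sort_pred n d i. \<rho> (transpose i k) m)) + (- (\<Sum>k\<in>?S. g k))"
    by (simp add: single_diff ad[of i])
  moreover have "keys (- (\<Sum>k\<in>?S. g k)) \<subseteq> below n a"
    unfolding keys_minus using g(1) by (intro keys_sum_subset)
  ultimately show thesis using that unfolding a_def by blast
qed

text \<open>The inverse of g = \<open>sorter n d\<close> applied to the monomial with increasingly
  sorted exponents and coefficient \<open>v\<close>. This normalisation is what makes the leading
  action match rev_d instead of a conjugate of it.\<close>

definition top :: "(nat \<Rightarrow> nat) \<Rightarrow> 'm \<Rightarrow> (nat \<Rightarrow> int) \<Rightarrow>\<^sub>0 'm" where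
  "top d v = single (int \<circ> d) (\<rho> (inv' (sorter n d)) v)"

text \<open>Modulo lower monomials, \<open>h\<close> sends the leading vector of \<open>v\<close> to
  that of \<open>v'\<close>. A relation is used so that it can be built up along the generation of
  the parabolic subalgebra.\<close>

definition lead :: "(nat \<Rightarrow> nat) \<Rightarrow> free_elt set \<Rightarrow> 'm \<Rightarrow> 'm \<Rightarrow> bool" where
  "lead d h v v' \<longleftrightarrow> keys (N.act h (top d v) - top d v') \<subseteq> below n (int \<circ> d)"

lemma inv_sorter_permutes: "inv' (sorter n d) permutes {1..n}"
  by (rule permutes_inv[OF sorter_permutes])

lemma top_add: "top d (x + y) = top d x + top d y"
  by (simp add: top_def lin_opD(1)[OF \<rho>_lin[OF inv_sorter_permutes]] single_add)

lemmas top_additive = top_add additive_zero[of "top d" for d, OF top_add]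
  additive_uminus[of "top d" for d, OF top_add] additive_diff[of "top d" for d, OF top_add]

lemma top_scale: "top d (sc z x) = NS z (top d x)"
  by (simp add: top_def lin_opD(2)[OF \<rho>_lin[OF inv_sorter_permutes]] NS_single)

lemma top_eq_0: "keys (top d v) \<subseteq> below n (int \<circ> d) \<Longrightarrow> v = 0"
proof -
  assume k: "keys (top d v) \<subseteq> below n (int \<circ> d)"
  have "int \<circ> d \<notin> below n (int \<circ> d)" by (simp add: below_def)
  then have 0: "\<rho> (inv' (sorter n d)) v = 0" using k by (auto simp: top_def split: if_splits)
  have "v = \<rho> (sorter n d) (\<rho> (inv' (sorter n d)) v)"
    by (simp add: \<rho>_comp[OF sorter_permutes inv_sorter_permutes] permutes_inv_o(1)[OF sorter_permutes])
  also have "\<dots> = 0" unfolding 0 by (rule lin_opD(3)[OF \<rho>_lin[OF sorter_permutes]])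
  finally show "v = 0" .
qed

text \<open>The exponent d is not below itself and \<open>\<rho>\<close> is invertible, so a leading
  vector with support below d has coefficient 0.\<close>

lemma lead_unique:
  assumes "lead d h v v1" "lead d h v v2" shows "v1 = v2"
proof -
  have "top d (v1 - v2) = (N.act h (top d v) - top d v2) - (N.act h (top d v) - top d v1)"
    by (simp add: top_additive)
  then have "keys (top d (v1 - v2)) \<subseteq> below n (int \<circ> d)"
    using assms keys_diff_subset unfolding lead_def by metis
  then show ?thesis using top_eq_0 by fastforce
qed

lemma lead_add:
  assumes "h \<in> carrier HA" "k \<in> carrier HA" "lead d h v v1" "lead d k v v2"
  shows "lead d (h \<oplus>\<^bsub>HA\<^esub> k) v (v1 + v2)"
proof -
  have "N.act (h \<oplus>\<^bsub>HA\<^esub> k) (top d v) - top d (v1 + v2) =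
     (N.act h (top d v) - top d v1) + (N.act k (top d v) - top d v2)"
    using assms by (simp add: N.act_add top_additive)
  then show ?thesis using assms keys_add_subset unfolding lead_def by metis
qed

lemma lead_uminus:
  assumes "h \<in> carrier HA" "lead d h v v1"
  shows "lead d (\<ominus>\<^bsub>HA\<^esub> h) v (- v1)"
proof -
  have "N.act (\<ominus>\<^bsub>HA\<^esub> h) (top d v) - top d (- v1) = - (N.act h (top d v) - top d v1)"
    using assms by (simp add: N.act_uminus top_additive)
  then show ?thesis using assms unfolding lead_def by (metis keys_minus)
qed

lemma lead_scalar: "lead d (z \<odot>\<^bsub>HA\<^esub> \<one>\<^bsub>HA\<^esub>) v (sc z v)"
  by (simp add: lead_def N.act_smult N.act_one top_scale)

text \<open>The error made by \<open>k\<close> is supported below d, and the Hecke algebra preserves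
  that support; so applying \<open>h\<close> creates no new leading contribution.\<close>

lemma lead_mult:
  assumes h: "h \<in> carrier (hecke n t c)" "k \<in> carrier (hecke n t c)" and "lead d k v v1" "lead d h v1 v2"
  shows "lead d (h \<otimes>\<^bsub>HA\<^esub> k) v v2"
proof -
  note hk = hecke_sub[OF h(1)] hecke_sub[OF h(2)]
  have "N.act (h \<otimes>\<^bsub>HA\<^esub> k) (top d v) - top d v2 =
     N.act h (N.act k (top d v) - top d v1) + (N.act h (top d v1) - top d v2)"
    using hk by (simp add: N.act_mult lin_opD(5)[OF N.act_lin])
  moreover have "keys (N.act h (N.act k (top d v) - top d v1)) \<subseteq> below n (int \<circ> d)"
    using assms(3) by (intro keys_act_below[OF h(1)]) (simp add: lead_def)
  ultimately show ?thesis using assms(4) keys_add_subset unfolding lead_def by metis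
qed

lemma \<rho>_inv_sorter_transpose:
  assumes "i \<in> {1..n}" "k \<in> {1..n}"
  shows "\<rho> (transpose i k) (\<rho> (inv' (sorter n d)) v) =
    \<rho> (inv' (sorter n d)) (\<rho> (transpose (sorter n d i) (sorter n d k)) v)"
proof -
  let ?g = "sorter n d"
  have g: "?g i \<in> {1..n}" "?g k \<in> {1..n}" using assms permutes_in_image[OF sorter_permutes] by blast+
  have "inv' ?g \<circ> transpose (?g i) (?g k) = transpose i k \<circ> inv' ?g"
    using perm_transpose[OF inv_sorter_permutes, of d "?g i" "?g k"] permutes_inverses(2)[OF sorter_permutes]
    by simp
  then show ?thesis
    by (simp add: \<rho>_comp inv_sorter_permutes transpose_permutes[OF assms] transpose_permutes[OF g])
qed

text \<open>The source of rev_d: the coefficient is multiplied by d_i t + Z_g - c (Jucys-Murphy sum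
  at g), with g = \<open>sorter n d i\<close>. When Z_g is x_g y_g this is u_g + d_i t.\<close>

lemma lead_hU:
  assumes d: "nonincr n d" and i: "i \<in> {1..n}"
  shows "lead d (hU i) v (sc (of_nat (d i) * t) v + Z (sorter n d i) v
      - sc c (\<Sum>j\<in>{1..<sorter n d i}. \<rho> (transpose (sorter n d i) j) v))"
proof -
  let ?g = "sorter n d"
  let ?r = "\<rho> (inv' ?g)"
  note L = lin_opD[OF \<rho>_lin[OF inv_sorter_permutes, of d]]
  have gi: "?g i \<in> {1..n}" using i permutes_in_image[OF sorter_permutes] by blast
  obtain g where g: "keys g \<subseteq> below n (int \<circ> d)"
    "N.act (hU i) (single (int \<circ> d) (?r v)) = single (int \<circ> d) (sc (t * of_nat (d i)) (?r v) + Z i (?r v)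
      - sc c (\<Sum>k\<in>sort_pred n d i. \<rho> (transpose i k) (?r v))) + g"
    by (rule act_hU_lead[OF d i])
  have "Z i (?r v) = ?r (Z (?g i) v)"
    using \<rho>_Z[OF inv_sorter_permutes gi] by (simp add: permutes_inverses(2)[OF sorter_permutes])
  moreover have "(\<Sum>k\<in>sort_pred n d i. \<rho> (transpose i k) (?r v)) =
      ?r (\<Sum>j\<in>{1..<?g i}. \<rho> (transpose (?g i) j) v)"
  proof -
    have "(\<Sum>k\<in>sort_pred n d i. \<rho> (transpose i k) (?r v)) =
        (\<Sum>k\<in>sort_pred n d i. ?r (\<rho> (transpose (?g i) (?g k)) v))"
      by (rule sum.cong[OF refl], rule \<rho>_inv_sorter_transpose[OF i]) (simp add: sort_pred_def)
    also have "\<dots> = (\<Sum>j\<in>?g ` sort_pred n d i. ?r (\<rho> (transpose (?g i) j) v))"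
      by (subst sum.reindex) (auto simp: permutes_inj_on[OF sorter_permutes])
    finally show ?thesis by (simp add: L sorter_image_pred[OF i])
  qed
  ultimately have "N.act (hU i) (top d v) - top d (sc (of_nat (d i) * t) v + Z (?g i) v
      - sc c (\<Sum>j\<in>{1..<?g i}. \<rho> (transpose (?g i) j) v)) = g"
    by (simp add: g(2) top_def L mult.commute)
  then show ?thesis using g(1) by (simp add: lead_def)
qed

text \<open>x^d is fixed by s_i, so no lower terms arise; conjugation by the sorting permutation
  moves s_i to the sorted position.\<close>

lemma lead_hs:
  assumes i: "i \<in> {1..<n}" "d i = d (i + 1)"
  shows "lead d (hs n t c i) v (\<rho> (transpose (sorter n d i) (sorter n d i + 1)) v)"
proof -
  have i': "i \<in> {1..n}" "i + 1 \<in> {1..n}" using i by auto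
  have "(int \<circ> d) \<circ> transpose i (i + 1) = int \<circ> d" using i(2) by (auto simp: fun_eq_iff transpose_def)
  then have "N.act (hs n t c i) (top d v) = top d (\<rho> (transpose (sorter n d i) (sorter n d i + 1)) v)"
    unfolding hs_def top_def N.act_gens(3)[OF transpose_permutes[OF i']] NR_transpose_single[OF i']
      \<rho>_inv_sorter_transpose[OF i'] sorter_Suc[OF i] by simp
  then show ?thesis by (simp add: lead_def)
qed

end

section \<open>The evaluation homomorphism\<close>

lemma group_alg_calgebra: "calgebra (group_alg n)"
  unfolding group_alg_def by (intro monoid_algebra_calgebra group.is_monoid sym_group_is_group)

definition group_alg_act ::
    "nat \<Rightarrow> (complex \<Rightarrow> 'v \<Rightarrow> 'v) \<Rightarrow> ((nat \<Rightarrow> nat) \<Rightarrow> 'v \<Rightarrow> 'v::ab_group_add) \<Rightarrow> ((nat \<Rightarrow> nat) \<Rightarrow> complex) \<Rightarrow> 'v \<Rightarrow> 'v" where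
  "group_alg_act n sc \<rho> f v = (\<Sum>p\<in>carrier (sym_group n). sc (f p) (\<rho> p v))"

lemma finite_sym_group: "finite (carrier (sym_group n))"
  using finite_permutations[of "{1..n}"] by (simp add: sym_group_def)

lemma group_alg_finite_support:
  "f \<in> carrier (group_alg n) \<Longrightarrow> finite {p. f p \<noteq> 0}"
  by (simp add: group_alg_def monoid_algebra_carrier)

context
  fixes n :: nat and sc :: "complex \<Rightarrow> 'v \<Rightarrow> 'v::ab_group_add" and \<rho>
  assumes rep: "sym_rep n sc \<rho>"
begin

interpretation V: vector_space sc using rep by (simp add: sym_rep_def)

text \<open>With t = c = 0 and Z = 0 the locale conditions reduce to those on \<open>\<rho>\<close>;
  the interpretation supplies linearity and composition for an arbitrary representation.\<close>

interpretation H: hecke_rep n 0 0 sc \<rho> "\<lambda>_ _. 0"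
proof
  show "lin_op sc (\<lambda>_. 0)" by (simp add: lin_op_def)
  show "\<rho> p 0 = 0" if "p permutes {1..n}" for p
  proof -
    interpret l: Vector_Spaces.linear sc sc "\<rho> p"
      using rep that by (simp add: sym_rep_def sym_group_carrier)
    show ?thesis by (rule l.zero)
  qed
  show "0 - 0 = sc 0 (0 - 0)" by simp
qed (rule rep)

lemma group_alg_act_lincomb:
  assumes "f \<in> carrier (group_alg n)"
  shows "group_alg_act n sc \<rho> f v = lincomb sc f (\<lambda>p. \<rho> p v)"
  unfolding group_alg_act_def
  by (rule lincomb_superset[OF H.vs finite_sym_group, symmetric])
     (use assms in \<open>simp add: group_alg_def monoid_algebra_carrier\<close>)

lemma group_alg_act_add:
  "\<lbrakk>f \<in> carrier (group_alg n); g \<in> carrier (group_alg n)\<rbrakk> \<Longrightarrow>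
    group_alg_act n sc \<rho> (f \<oplus>\<^bsub>group_alg n\<^esub> g) v = group_alg_act n sc \<rho> f v + group_alg_act n sc \<rho> g v"
  using vector_space.vector_space_assms(2)[OF H.vs]
  by (simp add: group_alg_act_def group_alg_def monoid_algebra_simps sum.distrib)

lemma group_alg_act_smult:
  "group_alg_act n sc \<rho> (z \<odot>\<^bsub>group_alg n\<^esub> f) v = sc z (group_alg_act n sc \<rho> f v)"
  by (simp add: group_alg_act_def group_alg_def monoid_algebra_simps V.scale_sum_right)

lemma group_alg_act_basis: "p permutes {1..n} \<Longrightarrow> group_alg_act n sc \<rho> (basis_elt p) v = \<rho> p v"
  by (subst group_alg_act_lincomb)
     (auto simp: lincomb_basis[OF H.vs] group_alg_def basis_elt_closed sym_group_carrier)

lemma group_alg_act_mult: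
  assumes "f \<in> carrier (group_alg n)" "g \<in> carrier (group_alg n)"
  shows "group_alg_act n sc \<rho> (f \<otimes>\<^bsub>group_alg n\<^esub> g) v = group_alg_act n sc \<rho> f (group_alg_act n sc \<rho> g v)"
proof -
  interpret G: calgebra "group_alg n" by (rule group_alg_calgebra)
  have "group_alg_act n sc \<rho> (f \<otimes>\<^bsub>group_alg n\<^esub> g) v = lincomb sc f (\<lambda>p. lincomb sc g (\<lambda>q. \<rho> (p \<circ> q) v))"
    using lincomb_mult[OF H.vs group_alg_finite_support[OF assms(1)] group_alg_finite_support[OF assms(2)],
        of "sym_group n" "\<lambda>p. \<rho> p v"] assms
    by (simp add: group_alg_act_lincomb sym_group_mult flip: group_alg_def)
  also have "\<dots> = lincomb sc f (\<lambda>p. \<rho> p (lincomb sc g (\<lambda>q. \<rho> q v)))"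
    unfolding lincomb_def[of sc f]
  proof (intro sum.cong refl arg_cong2[where f=sc])
    fix p assume "p \<in> {k. f k \<noteq> 0}"
    then have p: "p permutes {1..n}"
      using assms(1) by (auto simp: group_alg_def monoid_algebra_carrier sym_group_carrier)
    have "lincomb sc g (\<lambda>q. \<rho> (p \<circ> q) v) = lincomb sc g (\<lambda>q. \<rho> p (\<rho> q v))"
      unfolding lincomb_def
    proof (intro sum.cong refl arg_cong2[where f=sc])
      fix q assume "q \<in> {k. g k \<noteq> 0}"
      then have q: "q permutes {1..n}"
        using assms(2) by (auto simp: group_alg_def monoid_algebra_carrier sym_group_carrier)
      show "\<rho> (p \<circ> q) v = \<rho> p (\<rho> q v)" by (rule H.\<rho>_comp[OF p q, symmetric])
    qed
    then show "lincomb sc g (\<lambda>q. \<rho> (p \<circ> q) v) = \<rho> p (lincomb sc g (\<lambda>q. \<rho> q v))"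
      by (simp add: lin_op_lincomb[OF H.\<rho>_lin[OF p]])
  qed
  finally show ?thesis using assms by (simp add: group_alg_act_lincomb)
qed

lemma group_alg_act_zero: "group_alg_act n sc \<rho> \<zero>\<^bsub>group_alg n\<^esub> v = 0"
  by (simp add: group_alg_act_def group_alg_def monoid_algebra_simps)

lemma group_alg_act_finsum:
  assumes "finite J" "F \<in> J \<rightarrow> carrier (group_alg n)"
  shows "group_alg_act n sc \<rho> (\<Oplus>\<^bsub>group_alg n\<^esub>j\<in>J. F j) v = (\<Sum>j\<in>J. group_alg_act n sc \<rho> (F j) v)"
proof -
  interpret G: calgebra "group_alg n" by (rule group_alg_calgebra)
  show ?thesis using assms
    by (induction J rule: finite_induct) (auto simp: group_alg_act_zero group_alg_act_add Pi_def)
qed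

lemma hecke_rep_zero: "hecke_rep n c sc \<rho> (\<lambda>_ _. 0)" for c
  by unfold_locales
     (use rep H.Z_lin lin_opD(3)[OF H.\<rho>_lin] lin_opD(3)[OF H.lin_sc] in auto)

end

text \<open>Indices are all functions, not just permutations, so that the space is a whole type, as
  \<open>sym_rep\<close> requires. Permutations act by left composition, and the group algebra sits
  inside as the orbit span of \<open>single id 1\<close>.\<close>

type_synonym regular = "(nat \<Rightarrow> nat) \<Rightarrow>\<^sub>0 complex"

definition reg_scale :: "complex \<Rightarrow> regular \<Rightarrow> regular" where
  "reg_scale z = ext_op (\<lambda>p w. single p (z * w))"

definition reg_perm :: "(nat \<Rightarrow> nat) \<Rightarrow> regular \<Rightarrow> regular" where
  "reg_perm p = ext_op (\<lambda>q w. single (p \<circ> q) w)"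

lemma reg_scale_add: "reg_scale z (f + g) = reg_scale z f + reg_scale z g"
  and reg_scale_single: "reg_scale z (single p w) = single p (z * w)"
  unfolding reg_scale_def by (subst ext_op_add ext_op_single; simp add: single_add distrib_left)+

lemma reg_perm_add: "reg_perm p (f + g) = reg_perm p f + reg_perm p g"
  and reg_perm_single: "reg_perm p (single q w) = single (p \<circ> q) w"
  unfolding reg_perm_def by (subst ext_op_add ext_op_single; simp add: single_add)+

lemma reg_vector_space: "vector_space reg_scale"
proof
  fix x y :: regular and z w :: complex
  show "reg_scale z (x + y) = reg_scale z x + reg_scale z y" by (rule reg_scale_add)
  show "reg_scale (z + w) x = reg_scale z x + reg_scale w x"
    by (rule additive_eqI[where f=x]) (auto simp: reg_scale_add reg_scale_single distrib_right single_add)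
  show "reg_scale z (reg_scale w x) = reg_scale (z * w) x"
    by (rule additive_eqI[where f=x]) (auto simp: reg_scale_add reg_scale_single mult.assoc)
  show "reg_scale 1 x = x"
    by (rule additive_eqI[where f=x]) (auto simp: reg_scale_add reg_scale_single)
qed

lemma reg_sym_rep: "sym_rep n reg_scale reg_perm"
proof -
  have "reg_perm p (reg_scale z x) = reg_scale z (reg_perm p x)" for p z x
    by (rule additive_eqI[where f=x]) (auto simp: reg_scale_add reg_scale_single reg_perm_add reg_perm_single)
  then have "Vector_Spaces.linear reg_scale reg_scale (reg_perm p)" for p
    by (intro Vector_Spaces.linear.intro reg_vector_space module_hom.intro module_hom_axioms.intro)
       (auto simp: reg_perm_add module_iff_vector_space reg_vector_space)
  moreover have "reg_perm id x = x" for x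
    by (rule additive_eqI[where f=x and F = "reg_perm id"]) (simp_all only: reg_perm_add reg_perm_single id_o)
  moreover have "reg_perm (p \<circ> q) x = reg_perm p (reg_perm q x)" for p q x
    by (rule additive_eqI[where f=x and F = "reg_perm (p \<circ> q)"])
       (simp_all only: reg_perm_add reg_perm_single comp_assoc)
  ultimately show ?thesis
    unfolding sym_rep_def by (auto simp: reg_vector_space fun_eq_iff)
qed

text \<open>Acting on the basis vector of the identity returns the coefficients of \<open>f\<close>,
  so elements of the group algebra are separated by the regular action.\<close>

lemma reg_faithful:
  assumes "f \<in> carrier (group_alg n)"
  shows "lookup (group_alg_act n reg_scale reg_perm f (single id 1)) = f"
proof
  fix p
  have "lookup (group_alg_act n reg_scale reg_perm f (single id 1)) p = (\<Sum>q\<in>carrier (sym_group n). f q when q = p)"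
    unfolding group_alg_act_def by (simp add: lookup_sum reg_perm_single reg_scale_single lookup_single)
  also have "\<dots> = (if p \<in> carrier (sym_group n) then f p else 0)"
    using finite_sym_group by (simp add: when_def)
  also have "\<dots> = f p" using assms by (auto simp: group_alg_def monoid_algebra_carrier)
  finally show "lookup (group_alg_act n reg_scale reg_perm f (single id 1)) p = f p" .
qed

context cherednik_alg
begin

text \<open>Conjugation by s_i carries x_i y_i to x_{i+1} y_{i+1} and each (i j) with j < i to (i+1
  j); the transposition (i+1 i), absent from this image, gives -c s_i. The recursion makes u_1 and
  the s_i determine all u_i.\<close>

lemma hs_hU:
  assumes i: "i \<in> {1..<n}"
  shows "hU (i + 1) = hs n t c i \<otimes>\<^bsub>HA\<^esub> hU i \<otimes>\<^bsub>HA\<^esub> hs n t c i \<ominus>\<^bsub>HA\<^esub> c \<odot>\<^bsub>HA\<^esub> hs n t c i"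
proof -
  let ?s = "transpose i (i + 1)"
  have i': "i \<in> {1..n}" "i + 1 \<in> {1..n}" using i by auto
  have s: "?s permutes {1..n}" by (rule transpose_permutes[OF i'])
  have s1: "hP ?s \<otimes>\<^bsub>HA\<^esub> hP ?s = \<one>\<^bsub>HA\<^esub>" by (simp add: hP_mult[OF s s] hP_id)
  have tp: "transpose i j permutes {1..n}" "transpose (i + 1) j permutes {1..n}" if "j \<in> {1..<i}" for j
    using i that by (auto intro!: transpose_permutes)
  define S1 where "S1 = (\<Oplus>\<^bsub>HA\<^esub>j\<in>{1..<i}. hP (transpose i j))"
  define S2 where "S2 = (\<Oplus>\<^bsub>HA\<^esub>j\<in>{1..<i}. hP (transpose (i + 1) j))"
  have S: "S1 \<in> carrier HA" "S2 \<in> carrier HA"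
    unfolding S1_def S2_def using tp by (auto intro!: HA.finsum_closed)
  have conj: "hP ?s \<otimes>\<^bsub>HA\<^esub> hP (transpose i j) \<otimes>\<^bsub>HA\<^esub> hP ?s = hP (transpose (i + 1) j)" if j: "j \<in> {1..<i}" for j
  proof -
    have "?s \<circ> transpose i j \<circ> ?s = transpose (i + 1) j"
      using j by (auto simp: fun_eq_iff transpose_def)
    then show ?thesis
      by (simp only: hP_mult[OF s tp(1)[OF j]] hP_mult[OF permutes_compose[OF tp(1)[OF j] s] s])
  qed
  have sS: "hP ?s \<otimes>\<^bsub>HA\<^esub> S1 \<otimes>\<^bsub>HA\<^esub> hP ?s = S2"
  proof -
    have "hP ?s \<otimes>\<^bsub>HA\<^esub> S1 = (\<Oplus>\<^bsub>HA\<^esub>j\<in>{1..<i}. hP ?s \<otimes>\<^bsub>HA\<^esub> hP (transpose i j))"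
      unfolding S1_def using tp s by (intro HA.finsum_rdistr) auto
    then have "hP ?s \<otimes>\<^bsub>HA\<^esub> S1 \<otimes>\<^bsub>HA\<^esub> hP ?s = (\<Oplus>\<^bsub>HA\<^esub>j\<in>{1..<i}. hP ?s \<otimes>\<^bsub>HA\<^esub> hP (transpose i j) \<otimes>\<^bsub>HA\<^esub> hP ?s)"
      using tp s by (simp, intro HA.finsum_ldistr) auto
    also have "\<dots> = S2" unfolding S2_def using tp conj by (intro HA.finsum_cong') auto
    finally show ?thesis .
  qed
  have xy: "hP ?s \<otimes>\<^bsub>HA\<^esub> (hX i \<otimes>\<^bsub>HA\<^esub> hY i) \<otimes>\<^bsub>HA\<^esub> hP ?s = hX (i + 1) \<otimes>\<^bsub>HA\<^esub> hY (i + 1)"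
  proof -
    have "hP ?s \<otimes>\<^bsub>HA\<^esub> (hX i \<otimes>\<^bsub>HA\<^esub> hY i) = hX (i + 1) \<otimes>\<^bsub>HA\<^esub> hY (i + 1) \<otimes>\<^bsub>HA\<^esub> hP ?s"
      using hP_hX[OF s i'(1)] hP_hY[OF s i'(1)] i' s HA.m_assoc[of "hP ?s" "hX i" "hY i"]
        HA.m_assoc[of "hX (i + 1)" "hP ?s" "hY i"] HA.m_assoc[of "hX (i + 1)" "hY (i + 1)" "hP ?s"]
      by (simp del: atLeastAtMost_iff)
    then show ?thesis using i' s s1 by (simp add: HA.m_assoc del: atLeastAtMost_iff)
  qed
  have U: "hU i = hX i \<otimes>\<^bsub>HA\<^esub> hY i \<ominus>\<^bsub>HA\<^esub> c \<odot>\<^bsub>HA\<^esub> S1" by (simp add: hu_def S1_def Let_def)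
  have "{1..<i + 1} = insert i {1..<i}" using i by auto
  moreover have "(\<Oplus>\<^bsub>HA\<^esub>j\<in>insert i {1..<i}. hP (transpose (i + 1) j)) = hP (transpose (i + 1) i) \<oplus>\<^bsub>HA\<^esub> S2"
    unfolding S2_def using tp s by (intro HA.finsum_insert) (auto simp: transpose_commute[of "i + 1" i])
  ultimately have U1: "hU (i + 1) = hX (i + 1) \<otimes>\<^bsub>HA\<^esub> hY (i + 1) \<ominus>\<^bsub>HA\<^esub> c \<odot>\<^bsub>HA\<^esub> (hP ?s \<oplus>\<^bsub>HA\<^esub> S2)"
    by (simp add: hu_def Let_def transpose_commute[of "i + 1" i])
  have "hP ?s \<otimes>\<^bsub>HA\<^esub> hU i \<otimes>\<^bsub>HA\<^esub> hP ?s = hX (i + 1) \<otimes>\<^bsub>HA\<^esub> hY (i + 1) \<ominus>\<^bsub>HA\<^esub> c \<odot>\<^bsub>HA\<^esub> S2"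
  proof -
    have "hP ?s \<otimes>\<^bsub>HA\<^esub> hU i \<otimes>\<^bsub>HA\<^esub> hP ?s = hP ?s \<otimes>\<^bsub>HA\<^esub> (hX i \<otimes>\<^bsub>HA\<^esub> hY i) \<otimes>\<^bsub>HA\<^esub> hP ?s \<ominus>\<^bsub>HA\<^esub> c \<odot>\<^bsub>HA\<^esub> (hP ?s \<otimes>\<^bsub>HA\<^esub> S1 \<otimes>\<^bsub>HA\<^esub> hP ?s)"
      unfolding U a_minus_def using i' s S
      by (simp add: HA.r_distr HA.l_distr HA.r_minus HA.l_minus HA.smult_mult HA.mult_smult del: atLeastAtMost_iff)
    then show ?thesis by (simp only: xy sS)
  qed
  then show ?thesis
    unfolding hs_def U1 a_minus_def using i' s S
    by (simp add: HA.smult_add_right HA.minus_add HA.a_ac del: atLeastAtMost_iff)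
qed

text \<open>Lets a property of the images of permutations be proved by appending generators s_i on
  the right, and so links \<open>stab_gen\<close> with the parabolic subalgebra.\<close>

lemma hP_stab_induct:
  assumes "stab_gen n d p"
    and "P \<one>\<^bsub>HA\<^esub>"
    and "\<And>h i. \<lbrakk>h \<in> carrier HA; P h; i \<in> {1..<n}; d i = d (i + 1)\<rbrakk> \<Longrightarrow> P (h \<otimes>\<^bsub>HA\<^esub> hs n t c i)"
  shows "p permutes {1..n} \<and> P (hP p)"
  using assms(1)
proof induction
  case id
  then show ?case using assms(2) permutes_id[of "{1..n}"] by (simp only: hP_id simp_thms)
next
  case (step p i)
  have s: "transpose i (i + 1) permutes {1..n}" using step.hyps by (intro transpose_permutes) auto
  have "hP (p \<circ> transpose i (i + 1)) = hP p \<otimes>\<^bsub>HA\<^esub> hs n t c i"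
    using step s by (simp add: hs_def hP_mult)
  moreover have "p \<circ> transpose i (i + 1) permutes {1..n}" using step by (intro permutes_compose[OF s]) simp
  moreover have "P (hP p \<otimes>\<^bsub>HA\<^esub> hs n t c i)" using step by (intro assms(3)) auto
  ultimately show ?case by (simp only: simp_thms)
qed

text \<open>A constant sequence has the full symmetric group as stabiliser, so the rearrangement
  result specialises to generation of the symmetric group by adjacent transpositions.\<close>

lemma stab_gen_const: "p permutes {1..n} \<Longrightarrow> stab_gen n (\<lambda>_. 0::nat) p"
  using nonincr_rearrangement[of n "\<lambda>_. 0::nat" p] by (simp add: nonincr_def comp_def)

text \<open>The property inside the description defining \<open>ev0\<close>, named so that existence
  and uniqueness can be stated separately.\<close>

definition is_ev0 :: "(free_elt set \<Rightarrow> (nat \<Rightarrow> nat) \<Rightarrow> complex) \<Rightarrow> bool" where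
  "is_ev0 f \<longleftrightarrow> f \<in> alg_hom (hecke n t c) (group_alg n) \<and>
       (\<forall>i\<in>{1..<n}. f (hs n t c i) = basis_elt (transpose i (i + 1))) \<and>
       f (hu n t c 1) = \<zero>\<^bsub>group_alg n\<^esub>"

sublocale GA: calgebra "group_alg n" by (rule group_alg_calgebra)

lemma alg_homD:
  assumes "f \<in> alg_hom A B"
  shows "a \<in> carrier A \<Longrightarrow> f a \<in> carrier B"
    "\<lbrakk>a \<in> carrier A; b \<in> carrier A\<rbrakk> \<Longrightarrow> f (a \<otimes>\<^bsub>A\<^esub> b) = f a \<otimes>\<^bsub>B\<^esub> f b"
    "\<lbrakk>a \<in> carrier A; b \<in> carrier A\<rbrakk> \<Longrightarrow> f (a \<oplus>\<^bsub>A\<^esub> b) = f a \<oplus>\<^bsub>B\<^esub> f b"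
    "f \<one>\<^bsub>A\<^esub> = \<one>\<^bsub>B\<^esub>"
    "a \<in> carrier A \<Longrightarrow> f (z \<odot>\<^bsub>A\<^esub> a) = z \<odot>\<^bsub>B\<^esub> f a"
  using assms by (auto simp: alg_hom_def ring_hom_def)

text \<open>Agreement on the s_i gives agreement on all permutations; \<open>hs_hU\<close> then
  propagates the value at u_1 to every u_i, and these generate.\<close>

lemma ev0_unique:
  assumes n: "n \<ge> 1" and f: "is_ev0 f" and g: "is_ev0 g"
  shows "f = g"
proof -
  let ?H = "hecke n t c"
  have F: "f \<in> alg_hom ?H (group_alg n)" and G: "g \<in> alg_hom ?H (group_alg n)"
    using f g by (auto simp: is_ev0_def)
  note Fs = alg_homD[OF F, unfolded hecke_simps] and Gs = alg_homD[OF G, unfolded hecke_simps]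
  have neg: "\<ominus>\<^bsub>HA\<^esub> h = (- 1) \<odot>\<^bsub>HA\<^esub> h" if "h \<in> carrier HA" for h using HA.smult_neg_one[OF that] by simp
  have hs: "hs n t c i \<in> carrier ?H" "f (hs n t c i) = g (hs n t c i)" if "i \<in> {1..<n}" for i
    using f g that by (auto simp: is_ev0_def hs_def intro!: hecke_mem transpose_permutes)
  have perm: "f (hP p) = g (hP p)" if p: "p permutes {1..n}" for p
  proof -
    have "p permutes {1..n} \<and> (hP p \<in> carrier ?H \<and> f (hP p) = g (hP p))"
      by (rule hP_stab_induct[OF stab_gen_const[OF p], where P = "\<lambda>h. h \<in> carrier ?H \<and> f h = g h"])
         (use hs Fs Gs hecke_closed in auto)
    then show ?thesis by simp
  qed
  have u: "f (hU i) = g (hU i)" if "1 \<le> i" "i \<le> n" for i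
    using that
  proof (induction i rule: dec_induct)
    case base
    then show ?case using f g by (simp add: is_ev0_def)
  next
    case (step k)
    then have k: "k \<in> {1..<n}" "k \<in> {1..n}" by auto
    note hk = hecke_mem(3)[OF k(2)] hs(1)[OF k(1)]
    have "hU (k + 1) = hs n t c k \<otimes>\<^bsub>HA\<^esub> hU k \<otimes>\<^bsub>HA\<^esub> hs n t c k \<oplus>\<^bsub>HA\<^esub> (- c) \<odot>\<^bsub>HA\<^esub> hs n t c k"
      using hs_hU[OF k(1)] hecke_sub[OF hk(2)]
      by (simp add: a_minus_def neg HA.smult_assoc)
    then show ?case
      using hk hs(2)[OF k(1)] step k by (simp add: Fs Gs hecke_closed hecke_smult_closed Suc_eq_plus1)
  qed
  have "f h = g h" if "h \<in> carrier ?H" for h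
    using that
  proof (induction rule: hecke_induct)
    case (scalar z)
    then show ?case by (simp add: Fs Gs hecke_closed)
  next
    case (uminus h)
    then show ?case by (simp add: neg hecke_sub Fs Gs)
  qed (use perm u Fs Gs in auto)
  then show ?thesis
    using F G unfolding alg_hom_def by (intro extensionalityI[of f "carrier ?H"]) auto
qed

text \<open>Minus c times the Jucys-Murphy element, which is what u_i must become once u_1 is sent
  to 0.\<close>

definition jm :: "nat \<Rightarrow> (nat \<Rightarrow> nat) \<Rightarrow> complex" where
  "jm i = (- c) \<odot>\<^bsub>group_alg n\<^esub> (\<Oplus>\<^bsub>group_alg n\<^esub>j\<in>{1..<i}. basis_elt (transpose i j))"

lemma basis_elt_group_alg [simp]: "p permutes {1..n} \<Longrightarrow> basis_elt p \<in> carrier (group_alg n)"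
  by (simp add: group_alg_def basis_elt_closed sym_group_carrier)

lemma jm_summands: "i \<in> {1..n} \<Longrightarrow> (\<lambda>j. basis_elt (transpose i j)) \<in> {1..<i} \<rightarrow> carrier (group_alg n)"
  by (auto intro!: basis_elt_group_alg transpose_permutes)

lemma jm_closed: "i \<in> {1..n} \<Longrightarrow> jm i \<in> carrier (group_alg n)"
  unfolding jm_def by (intro GA.smult_closed GA.finsum_closed jm_summands)

lemma group_alg_act_jm:
  assumes "sym_rep n sc \<rho>" "i \<in> {1..n}"
  shows "group_alg_act n sc \<rho> (jm i) v = - sc c (\<Sum>j\<in>{1..<i}. \<rho> (transpose i j) v)"
proof -
  interpret V: vector_space sc using assms by (simp add: sym_rep_def)
  have "(\<Sum>j\<in>{1..<i}. group_alg_act n sc \<rho> (basis_elt (transpose i j)) v) = (\<Sum>j\<in>{1..<i}. \<rho> (transpose i j) v)"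
    using assms(2) by (intro sum.cong refl group_alg_act_basis[OF assms(1)] transpose_permutes) auto
  then show ?thesis
    unfolding jm_def
    by (simp add: group_alg_act_smult[OF assms(1)] group_alg_act_finsum[OF assms(1) _ jm_summands[OF assms(2)]])
qed

interpretation R: hecke_rep n t c reg_scale reg_perm "\<lambda>_ _. 0"
  by (rule hecke_rep_zero[OF reg_sym_rep])

abbreviation "reg_act \<equiv> group_alg_act n reg_scale reg_perm"

text \<open>The graph of ev_0: \<open>h\<close> preserves the constants among Laurent polynomials
  over the regular representation and acts there as \<open>f\<close>. Faithfulness makes
  \<open>f\<close> unique, and closure under the operations makes it exist, so compatibility with
  the Hecke relations never has to be checked on generators.\<close>

definition ev0_rel :: "free_elt set \<Rightarrow> ((nat \<Rightarrow> nat) \<Rightarrow> complex) \<Rightarrow> bool" where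
  "ev0_rel h f \<longleftrightarrow> f \<in> carrier (group_alg n) \<and>
     (\<forall>v. R.N.act h (single (\<lambda>_. 0) v) = single (\<lambda>_. 0) (reg_act f v))"

lemma ev0_rel_unique: "ev0_rel h f \<Longrightarrow> ev0_rel h g \<Longrightarrow> f = g"
proof -
  assume a: "ev0_rel h f" "ev0_rel h g"
  let ?v = "single id 1 :: regular"
  have "R.N.act h (single (\<lambda>_. 0) ?v) = single (\<lambda>_. 0) (reg_act f ?v)"
    "R.N.act h (single (\<lambda>_. 0) ?v) = single (\<lambda>_. 0) (reg_act g ?v)"
    using a unfolding ev0_rel_def by blast+
  from arg_cong[OF trans[OF this(1)[symmetric] this(2)], of "\<lambda>x. lookup x (\<lambda>_. 0)"]
  have e: "reg_act f ?v = reg_act g ?v" by (simp only: lookup_single_eq)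
  have cf: "f \<in> carrier (group_alg n)" "g \<in> carrier (group_alg n)"
    using a unfolding ev0_rel_def by blast+
  have "f = lookup (reg_act f ?v)" by (rule reg_faithful[OF cf(1), symmetric])
  also have "\<dots> = lookup (reg_act g ?v)" by (simp only: e)
  also have "\<dots> = g" by (rule reg_faithful[OF cf(2)])
  finally show "f = g" .
qed

lemma ev0_rel_smult: "h \<in> carrier HA \<Longrightarrow> ev0_rel h f \<Longrightarrow> ev0_rel (z \<odot>\<^bsub>HA\<^esub> h) (z \<odot>\<^bsub>group_alg n\<^esub> f)"
  by (simp add: ev0_rel_def R.N.act_smult R.NS_single group_alg_act_smult[OF reg_sym_rep])

lemma ev0_rel_add: "\<lbrakk>h \<in> carrier HA; k \<in> carrier HA; ev0_rel h f; ev0_rel k g\<rbrakk>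
    \<Longrightarrow> ev0_rel (h \<oplus>\<^bsub>HA\<^esub> k) (f \<oplus>\<^bsub>group_alg n\<^esub> g)"
  by (simp add: ev0_rel_def R.N.act_add single_add group_alg_act_add[OF reg_sym_rep])

lemma ev0_rel_mult: "\<lbrakk>h \<in> carrier HA; k \<in> carrier HA; ev0_rel h f; ev0_rel k g\<rbrakk>
    \<Longrightarrow> ev0_rel (h \<otimes>\<^bsub>HA\<^esub> k) (f \<otimes>\<^bsub>group_alg n\<^esub> g)"
  by (simp add: ev0_rel_def R.N.act_mult group_alg_act_mult[OF reg_sym_rep])

lemma ev0_rel_perm:
  assumes p: "p permutes {1..n}" shows "ev0_rel (hP p) (basis_elt p)"
proof -
  have "(\<lambda>_. 0::int) \<circ> inv' p = (\<lambda>_. 0)" by auto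
  then show ?thesis
    by (simp add: ev0_rel_def R.N.act_gens(3)[OF p] R.NR_single[OF p] p group_alg_act_basis[OF reg_sym_rep])
qed

lemma ev0_rel_one: "ev0_rel \<one>\<^bsub>HA\<^esub> \<one>\<^bsub>group_alg n\<^esub>"
  using ev0_rel_perm[OF permutes_id] by (simp only: hP_id group_alg_def monoid_algebra_simps sym_group_one)

text \<open>With Z = 0 the Dunkl operators kill constants, so x_i y_i contributes nothing and only
  the Jucys-Murphy sum remains.\<close>

lemma ev0_rel_hU:
  assumes i: "i \<in> {1..n}" shows "ev0_rel (hU i) (jm i)"
proof -
  have "R.N.act (hU i) (single (\<lambda>_. 0) v) = single (\<lambda>_. 0) (reg_act (jm i) v)" for v
  proof -
    have 1: "R.NR (transpose i j) (single (\<lambda>_. 0) v) = single (\<lambda>_. 0) (reg_perm (transpose i j) v)"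
      if "j \<in> {1..<i}" for j
    proof -
      have "j \<in> {1..n}" using that i by auto
      moreover have "(\<lambda>_. 0::int) \<circ> transpose i j = (\<lambda>_. 0)" by auto
      ultimately show ?thesis using R.NR_transpose_single[OF i] by simp
    qed
    have "R.N.act (hU i) (single (\<lambda>_. 0) v) = - R.NS c (\<Sum>j\<in>{1..<i}. single (\<lambda>_. 0) (reg_perm (transpose i j) v))"
      unfolding R.act_hU[OF i] using 1 by (simp add: R.ND_single_base[OF i] NX_additive)
    also have "(\<Sum>j\<in>{1..<i}. single (\<lambda>_. 0::int) (reg_perm (transpose i j) v)) =
        single (\<lambda>_. 0) (\<Sum>j\<in>{1..<i}. reg_perm (transpose i j) v)"
      by (rule additive_sum[symmetric, where f = "single (\<lambda>_. 0)"]) (rule single_add)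
    finally show ?thesis
      by (simp add: group_alg_act_jm[OF reg_sym_rep i] R.NS_single single_uminus)
  qed
  then show ?thesis using jm_closed[OF i] by (simp add: ev0_rel_def)
qed

lemma ev0_rel_exists:
  assumes "h \<in> carrier (hecke n t c)" shows "\<exists>f. ev0_rel h f"
  using assms
proof (induction rule: hecke_induct)
  case (scalar z)
  then show ?case using ev0_rel_smult[OF _ ev0_rel_one] by blast
next
  case (uminus h)
  then show ?case using ev0_rel_smult[of h _ "-1"] hecke_sub[of h] by (metis HA.smult_neg_one)
next
  case (add h k)
  then show ?case using ev0_rel_add hecke_sub by blast
next
  case (mult h k)
  then show ?case using ev0_rel_mult hecke_sub by blast
qed (use ev0_rel_perm ev0_rel_hU in blast)+

text \<open>The values on all permutations and all u_i are recorded along with the defining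
  property, because the action on V is later computed from them.\<close>

lemma is_ev0_exists: "\<exists>f. is_ev0 f \<and> (\<forall>p. p permutes {1..n} \<longrightarrow> f (hP p) = basis_elt p) \<and> (\<forall>i\<in>{1..n}. f (hU i) = jm i)"
  if n: "n \<ge> 1"
proof -
  define F where "F = (\<lambda>h\<in>carrier (hecke n t c). THE f. ev0_rel h f)"
  have F: "ev0_rel h (F h)" if "h \<in> carrier (hecke n t c)" for h
    using ev0_rel_exists[OF that] ev0_rel_unique that unfolding F_def by (simp, metis theI')
  have Fe: "F h = f" if "h \<in> carrier (hecke n t c)" "ev0_rel h f" for h f
    using F[OF that(1)] that(2) by (rule ev0_rel_unique)
  have perm: "F (hP p) = basis_elt p" if "p permutes {1..n}" for p
    by (rule Fe[OF hecke_mem(2)[OF that] ev0_rel_perm[OF that]])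
  have u: "F (hU i) = jm i" if "i \<in> {1..n}" for i
    by (rule Fe[OF hecke_mem(3)[OF that] ev0_rel_hU[OF that]])
  have "F \<in> alg_hom (hecke n t c) (group_alg n)"
    unfolding alg_hom_def
  proof (intro CollectI conjI allI ballI)
    show "F \<in> ring_hom (hecke n t c) (group_alg n)"
    proof (rule ring_hom_memI, unfold hecke_simps)
      fix x assume "x \<in> carrier (hecke n t c)"
      then show "F x \<in> carrier (group_alg n)" using F by (simp add: ev0_rel_def)
    next
      fix x y assume xy: "x \<in> carrier (hecke n t c)" "y \<in> carrier (hecke n t c)"
      note s = hecke_sub[OF xy(1)] hecke_sub[OF xy(2)] F[OF xy(1)] F[OF xy(2)]
      show "F (x \<otimes>\<^bsub>HA\<^esub> y) = F x \<otimes>\<^bsub>group_alg n\<^esub> F y"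
        by (rule Fe[OF hecke_closed(2)[OF xy] ev0_rel_mult[OF s]])
      show "F (x \<oplus>\<^bsub>HA\<^esub> y) = F x \<oplus>\<^bsub>group_alg n\<^esub> F y"
        by (rule Fe[OF hecke_closed(1)[OF xy] ev0_rel_add[OF s]])
    next
      show "F \<one>\<^bsub>HA\<^esub> = \<one>\<^bsub>group_alg n\<^esub>" by (rule Fe[OF hecke_closed(4) ev0_rel_one])
    qed
    show "F \<in> extensional (carrier (hecke n t c))" by (simp add: F_def)
    fix z a assume a: "a \<in> carrier (hecke n t c)"
    show "F (z \<odot>\<^bsub>hecke n t c\<^esub> a) = z \<odot>\<^bsub>group_alg n\<^esub> F a"
      unfolding hecke_simps by (rule Fe[OF hecke_smult_closed[OF a] ev0_rel_smult[OF hecke_sub[OF a] F[OF a]]])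
  qed
  moreover have "F (hU 1) = \<zero>\<^bsub>group_alg n\<^esub>" using u[of 1] n by (simp add: jm_def GA.smult_zero_right)
  moreover have "F (hs n t c i) = basis_elt (transpose i (i + 1))" if "i \<in> {1..<n}" for i
    using that unfolding hs_def by (intro perm transpose_permutes) auto
  ultimately have "is_ev0 F" by (simp add: is_ev0_def)
  then show ?thesis using perm u by blast
qed

lemma ev0_props:
  assumes n: "n \<ge> 1"
  shows "ev0 n t c \<in> alg_hom (hecke n t c) (group_alg n)"
    "p permutes {1..n} \<Longrightarrow> ev0 n t c (hP p) = basis_elt p"
    "i \<in> {1..n} \<Longrightarrow> ev0 n t c (hU i) = jm i"
proof -
  obtain f where f: "is_ev0 f" "\<And>p. p permutes {1..n} \<Longrightarrow> f (hP p) = basis_elt p" "\<And>i. i \<in> {1..n} \<Longrightarrow> f (hU i) = jm i"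
    using is_ev0_exists[OF n] by blast
  have "ev0 n t c = (THE f. is_ev0 f)" by (simp add: ev0_def is_ev0_def)
  also have "\<dots> = f" using f(1) ev0_unique[OF n] by (intro the_equality) auto
  finally have e: "ev0 n t c = f" .
  show "ev0 n t c \<in> alg_hom (hecke n t c) (group_alg n)" using f(1) by (simp add: e is_ev0_def)
  show "p permutes {1..n} \<Longrightarrow> ev0 n t c (hP p) = basis_elt p" "i \<in> {1..n} \<Longrightarrow> ev0 n t c (hU i) = jm i"
    using f by (simp_all add: e)
qed

end

section \<open>The reversal homomorphism\<close>

text \<open>The algebras \<open>cherednik n t c\<close> are not types. Their product over all parameters is one, and it
  contains each of them as a direct factor, on which the Hecke algebra acts faithfully.\<close>

typedef cherednik_family =
    "{F :: nat \<Rightarrow> complex \<Rightarrow> complex \<Rightarrow> free_elt set. \<forall>n t c. F n t c \<in> carrier (cherednik n t c)}"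
  morphisms fam_at Abs_fam
proof -
  have "\<zero>\<^bsub>cherednik n t c\<^esub> \<in> carrier (cherednik n t c)" for n t c
  proof -
    interpret cherednik_alg n t c .
    show ?thesis by simp
  qed
  then show ?thesis by (intro exI[of _ "\<lambda>n t c. \<zero>\<^bsub>cherednik n t c\<^esub>"]) auto
qed

lemma fam_at_closed [simp, intro]: "fam_at x n t c \<in> carrier (cherednik n t c)"
  using fam_at[of x] by auto

lemma fam_eqI: "(\<And>n t c. fam_at x n t c = fam_at y n t c) \<Longrightarrow> x = y"
  by (metis fam_at_inject ext)

lemma fam_at_Abs: "(\<And>n t c. F n t c \<in> carrier (cherednik n t c)) \<Longrightarrow> fam_at (Abs_fam F) n t c = F n t c"
  by (subst Abs_fam_inverse) auto

instantiation cherednik_family :: ab_group_add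
begin

definition "0 = Abs_fam (\<lambda>n t c. \<zero>\<^bsub>cherednik n t c\<^esub>)"
definition "x + y = Abs_fam (\<lambda>n t c. fam_at x n t c \<oplus>\<^bsub>cherednik n t c\<^esub> fam_at y n t c)"
definition "- x = Abs_fam (\<lambda>n t c. \<ominus>\<^bsub>cherednik n t c\<^esub> fam_at x n t c)"
definition "x - y = x + - (y :: cherednik_family)"

lemma fam_at_simps:
  "fam_at 0 n t c = \<zero>\<^bsub>cherednik n t c\<^esub>"
  "fam_at (x + y) n t c = fam_at x n t c \<oplus>\<^bsub>cherednik n t c\<^esub> fam_at y n t c"
  "fam_at (- x) n t c = \<ominus>\<^bsub>cherednik n t c\<^esub> fam_at x n t c"
proof -
  have "\<zero>\<^bsub>cherednik n t c\<^esub> \<in> carrier (cherednik n t c)"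
    "fam_at x n t c \<oplus>\<^bsub>cherednik n t c\<^esub> fam_at y n t c \<in> carrier (cherednik n t c)"
    "\<ominus>\<^bsub>cherednik n t c\<^esub> fam_at x n t c \<in> carrier (cherednik n t c)" for n t c
  proof -
    interpret cherednik_alg n t c .
    show "\<zero>\<^bsub>cherednik n t c\<^esub> \<in> carrier (cherednik n t c)"
      "fam_at x n t c \<oplus>\<^bsub>cherednik n t c\<^esub> fam_at y n t c \<in> carrier (cherednik n t c)"
      "\<ominus>\<^bsub>cherednik n t c\<^esub> fam_at x n t c \<in> carrier (cherednik n t c)" by simp_all
  qed
  then show "fam_at 0 n t c = \<zero>\<^bsub>cherednik n t c\<^esub>"
    "fam_at (x + y) n t c = fam_at x n t c \<oplus>\<^bsub>cherednik n t c\<^esub> fam_at y n t c"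
    "fam_at (- x) n t c = \<ominus>\<^bsub>cherednik n t c\<^esub> fam_at x n t c"
    by (simp_all add: zero_cherednik_family_def plus_cherednik_family_def uminus_cherednik_family_def fam_at_Abs)
qed

instance
proof
  fix x y z :: cherednik_family
  show "x + y + z = x + (y + z)"
  proof (rule fam_eqI)
    fix n t c interpret cherednik_alg n t c .
    show "fam_at (x + y + z) n t c = fam_at (x + (y + z)) n t c" by (simp add: fam_at_simps HA.a_assoc)
  qed
  show "x + y = y + x"
  proof (rule fam_eqI)
    fix n t c interpret cherednik_alg n t c .
    show "fam_at (x + y) n t c = fam_at (y + x) n t c" by (simp add: fam_at_simps HA.a_comm)
  qed
  show "0 + x = x"
  proof (rule fam_eqI)
    fix n t c interpret cherednik_alg n t c .
    show "fam_at (0 + x) n t c = fam_at x n t c" by (simp add: fam_at_simps)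
  qed
  show "- x + x = 0"
  proof (rule fam_eqI)
    fix n t c interpret cherednik_alg n t c .
    show "fam_at (- x + x) n t c = fam_at 0 n t c" by (simp add: fam_at_simps HA.l_neg)
  qed
qed (rule minus_cherednik_family_def)

end

definition fam_scale :: "complex \<Rightarrow> cherednik_family \<Rightarrow> cherednik_family" where
  "fam_scale z x = Abs_fam (\<lambda>n t c. z \<odot>\<^bsub>cherednik n t c\<^esub> fam_at x n t c)"

lemma fam_at_scale: "fam_at (fam_scale z x) n t c = z \<odot>\<^bsub>cherednik n t c\<^esub> fam_at x n t c"
proof -
  have "z \<odot>\<^bsub>cherednik n t c\<^esub> fam_at x n t c \<in> carrier (cherednik n t c)" for n t c
  proof -
    interpret cherednik_alg n t c .
    show ?thesis by (simp add: HA.smult_closed)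
  qed
  then show ?thesis by (simp add: fam_scale_def fam_at_Abs)
qed

lemma fam_at_diff: "fam_at (x - y) n t c = fam_at x n t c \<ominus>\<^bsub>cherednik n t c\<^esub> fam_at y n t c"
  unfolding minus_cherednik_family_def fam_at_simps a_minus_def ..

lemma fam_vector_space: "vector_space fam_scale"
proof
  fix x y :: cherednik_family and z w :: complex
  show "fam_scale z (x + y) = fam_scale z x + fam_scale z y"
  proof (rule fam_eqI)
    fix n t c interpret cherednik_alg n t c .
    show "fam_at (fam_scale z (x + y)) n t c = fam_at (fam_scale z x + fam_scale z y) n t c"
      by (simp add: fam_at_simps fam_at_scale HA.smult_add_right)
  qed
  show "fam_scale (z + w) x = fam_scale z x + fam_scale w x"
  proof (rule fam_eqI)
    fix n t c interpret cherednik_alg n t c .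
    show "fam_at (fam_scale (z + w) x) n t c = fam_at (fam_scale z x + fam_scale w x) n t c"
      by (simp add: fam_at_simps fam_at_scale HA.smult_add_left)
  qed
  show "fam_scale z (fam_scale w x) = fam_scale (z * w) x"
  proof (rule fam_eqI)
    fix n t c interpret cherednik_alg n t c .
    show "fam_at (fam_scale z (fam_scale w x)) n t c = fam_at (fam_scale (z * w) x) n t c"
      by (simp add: fam_at_simps fam_at_scale HA.smult_assoc)
  qed
  show "fam_scale 1 x = x"
  proof (rule fam_eqI)
    fix n t c interpret cherednik_alg n t c .
    show "fam_at (fam_scale 1 x) n t c = fam_at x n t c"
      by (simp add: fam_at_simps fam_at_scale HA.smult_one_left)
  qed
qed

context cherednik_alg
begin

text \<open>Left multiplication by \<open>a\<close> on the factor \<open>HA\<close>; the flag \<open>b\<close> tells whether the other factors are kept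
  or killed.\<close>

definition fam_mult :: "bool \<Rightarrow> free_elt set \<Rightarrow> cherednik_family \<Rightarrow> cherednik_family" where
  "fam_mult b a x = Abs_fam (\<lambda>n' t' c'. if n' = n \<and> t' = t \<and> c' = c then a \<otimes>\<^bsub>HA\<^esub> fam_at x n t c
     else if b then fam_at x n' t' c' else \<zero>\<^bsub>cherednik n' t' c'\<^esub>)"

lemma fam_zero_closed [simp, intro]: "\<zero>\<^bsub>cherednik n' t' c'\<^esub> \<in> carrier (cherednik n' t' c')"
  using fam_at_closed[of 0 n' t' c'] by (simp add: fam_at_simps)

lemma fam_at_mult:
  "a \<in> carrier HA \<Longrightarrow> fam_at (fam_mult b a x) n' t' c' = (if n' = n \<and> t' = t \<and> c' = c then a \<otimes>\<^bsub>HA\<^esub> fam_at x n t c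
     else if b then fam_at x n' t' c' else \<zero>\<^bsub>cherednik n' t' c'\<^esub>)"
  unfolding fam_mult_def by (subst fam_at_Abs) auto

lemma fam_mult_lin:
  assumes a: "a \<in> carrier HA" shows "lin_op fam_scale (fam_mult b a)"
  unfolding lin_op_def
proof (intro conjI allI)
  fix x y z
  show "fam_mult b a (x + y) = fam_mult b a x + fam_mult b a y"
  proof (rule fam_eqI)
    fix n' t' c' interpret O: cherednik_alg n' t' c' .
    show "fam_at (fam_mult b a (x + y)) n' t' c' = fam_at (fam_mult b a x + fam_mult b a y) n' t' c'"
      using a by (auto simp: fam_at_simps fam_at_mult HA.r_distr)
  qed
  show "fam_mult b a (fam_scale z x) = fam_scale z (fam_mult b a x)"
  proof (rule fam_eqI)
    fix n' t' c' interpret O: cherednik_alg n' t' c' .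
    show "fam_at (fam_mult b a (fam_scale z x)) n' t' c' = fam_at (fam_scale z (fam_mult b a x)) n' t' c'"
      using a by (auto simp: fam_at_scale fam_at_mult HA.mult_smult O.HA.smult_zero_right)
  qed
qed

lemma fam_mult_mult: "\<lbrakk>a \<in> carrier HA; a' \<in> carrier HA\<rbrakk> \<Longrightarrow>
    fam_mult b a (fam_mult b' a' x) = fam_mult (b \<and> b') (a \<otimes>\<^bsub>HA\<^esub> a') x"
  by (rule fam_eqI) (auto simp: fam_at_mult HA.m_assoc)

lemma fam_mult_one: "fam_mult True \<one>\<^bsub>HA\<^esub> x = x"
  by (rule fam_eqI) (auto simp: fam_at_mult)

lemma fam_mult_scale: "a \<in> carrier HA \<Longrightarrow> fam_scale z (fam_mult False a x) = fam_mult False (z \<odot>\<^bsub>HA\<^esub> a) x"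
proof (rule fam_eqI)
  fix n' t' c' assume a: "a \<in> carrier HA"
  interpret O: cherednik_alg n' t' c' .
  show "fam_at (fam_scale z (fam_mult False a x)) n' t' c' = fam_at (fam_mult False (z \<odot>\<^bsub>HA\<^esub> a) x) n' t' c'"
    using a by (auto simp: fam_at_scale fam_at_mult HA.smult_mult O.HA.smult_zero_right)
qed

lemma fam_mult_diff: "\<lbrakk>a \<in> carrier HA; a' \<in> carrier HA\<rbrakk> \<Longrightarrow>
    fam_mult False a x - fam_mult False a' x = fam_mult False (a \<ominus>\<^bsub>HA\<^esub> a') x"
proof (rule fam_eqI)
  fix n' t' c' assume a: "a \<in> carrier HA" "a' \<in> carrier HA"
  interpret O: cherednik_alg n' t' c' .
  show "fam_at (fam_mult False a x - fam_mult False a' x) n' t' c' = fam_at (fam_mult False (a \<ominus>\<^bsub>HA\<^esub> a') x) n' t' c'"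
    using a by (auto simp: fam_at_diff fam_at_mult a_minus_def HA.l_distr HA.l_minus O.HA.r_neg)
qed

text \<open>Moving y_i past x_j produces one transposition. The first summand is symmetric in i and
  j, so the commutator of x_i y_i and x_j y_j is left with the two transposition terms, as
  \<open>Z_comm\<close> requires.\<close>

lemma xy_comm:
  assumes i: "i \<in> {1..n}" and j: "j \<in> {1..n}" and ij: "i \<noteq> j"
  shows "(hX i \<otimes>\<^bsub>HA\<^esub> hY i) \<otimes>\<^bsub>HA\<^esub> (hX j \<otimes>\<^bsub>HA\<^esub> hY j) =
    hX i \<otimes>\<^bsub>HA\<^esub> hX j \<otimes>\<^bsub>HA\<^esub> (hY i \<otimes>\<^bsub>HA\<^esub> hY j) \<oplus>\<^bsub>HA\<^esub> c \<odot>\<^bsub>HA\<^esub> (hX i \<otimes>\<^bsub>HA\<^esub> hY i \<otimes>\<^bsub>HA\<^esub> hP (transpose i j))"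
proof -
  let ?s = "transpose i j"
  note s = transpose_permutes[OF i j]
  note cl = hX_closed[OF i] hX_closed[OF j] hY_closed[OF i] hY_closed[OF j] hP_closed[OF s]
  have "(hX i \<otimes>\<^bsub>HA\<^esub> hY i) \<otimes>\<^bsub>HA\<^esub> (hX j \<otimes>\<^bsub>HA\<^esub> hY j) = hX i \<otimes>\<^bsub>HA\<^esub> (hY i \<otimes>\<^bsub>HA\<^esub> hX j) \<otimes>\<^bsub>HA\<^esub> hY j"
    using cl by (simp add: HA.m_assoc)
  also have "\<dots> = hX i \<otimes>\<^bsub>HA\<^esub> hX j \<otimes>\<^bsub>HA\<^esub> (hY i \<otimes>\<^bsub>HA\<^esub> hY j) \<oplus>\<^bsub>HA\<^esub> c \<odot>\<^bsub>HA\<^esub> (hX i \<otimes>\<^bsub>HA\<^esub> (hP ?s \<otimes>\<^bsub>HA\<^esub> hY j))"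
    unfolding hY_hX[OF i j ij] using cl
    by (simp add: HA.m_assoc HA.r_distr HA.l_distr HA.smult_mult HA.mult_smult)
  also have "hP ?s \<otimes>\<^bsub>HA\<^esub> hY j = hY i \<otimes>\<^bsub>HA\<^esub> hP ?s" using hP_hY[OF s j] by simp
  finally show ?thesis using cl by (simp add: HA.m_assoc)
qed

text \<open>Permutations keep the other factors because the identity must act as the identity on the
  whole type; the Z_i kill them because \<open>Z_comm\<close>, with this value of c, then holds
  there trivially.\<close>

abbreviation "fam_perm p \<equiv> fam_mult True (hP p)"
abbreviation "fam_Z i \<equiv> fam_mult False (hX i \<otimes>\<^bsub>HA\<^esub> hY i)"

lemma fam_sym_rep: "sym_rep n fam_scale fam_perm"
proof -
  have "Vector_Spaces.linear fam_scale fam_scale (fam_perm p)" if "p permutes {1..n}" for p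
    using fam_mult_lin[OF hP_closed[OF that]]
    by (intro Vector_Spaces.linear.intro fam_vector_space module_hom.intro module_hom_axioms.intro)
       (auto simp: module_iff_vector_space fam_vector_space lin_op_def)
  moreover have "fam_perm id = id" unfolding hP_id by (auto simp: fun_eq_iff fam_mult_one)
  moreover have "fam_perm (p \<circ> q) = fam_perm p \<circ> fam_perm q" if "p permutes {1..n}" "q permutes {1..n}" for p q
    unfolding hP_mult[OF that, symmetric] using that by (intro ext) (simp add: fam_mult_mult)
  ultimately show ?thesis unfolding sym_rep_def using fam_vector_space by (auto simp only: sym_group_carrier)
qed

lemma fam_hecke_rep: "hecke_rep n c fam_scale fam_perm fam_Z"
proof (rule hecke_rep.intro)
  show "sym_rep n fam_scale fam_perm" by (rule fam_sym_rep)
  fix i assume i: "i \<in> {1..n}"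
  show "lin_op fam_scale (fam_Z i)" using i by (intro fam_mult_lin HA.m_closed) auto
  { fix p m assume p: "p permutes {1..n}"
    have pi: "p i \<in> {1..n}" using permutes_in_image[OF p] i by blast
    note cl = hP_closed[OF p] hX_closed[OF i] hY_closed[OF i] hX_closed[OF pi] hY_closed[OF pi]
    have "hP p \<otimes>\<^bsub>HA\<^esub> (hX i \<otimes>\<^bsub>HA\<^esub> hY i) = (hX (p i) \<otimes>\<^bsub>HA\<^esub> hY (p i)) \<otimes>\<^bsub>HA\<^esub> hP p"
      using cl hP_hX[OF p i] hP_hY[OF p i] HA.m_assoc[of "hP p" "hX i" "hY i"]
        HA.m_assoc[of "hX (p i)" "hP p" "hY i"] HA.m_assoc[of "hX (p i)" "hY (p i)" "hP p"] by simp
    then show "fam_perm p (fam_Z i m) = fam_Z (p i) (fam_perm p m)"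
      using cl by (simp add: fam_mult_mult) }
  fix j m assume j: "j \<in> {1..n}" and ij: "i \<noteq> j"
  note s = transpose_permutes[OF i j]
  note cl = hX_closed[OF i] hX_closed[OF j] hY_closed[OF i] hY_closed[OF j] hP_closed[OF s]
  let ?q = "hX i \<otimes>\<^bsub>HA\<^esub> hX j \<otimes>\<^bsub>HA\<^esub> (hY i \<otimes>\<^bsub>HA\<^esub> hY j)"
  let ?zi = "hX i \<otimes>\<^bsub>HA\<^esub> hY i \<otimes>\<^bsub>HA\<^esub> hP (transpose i j)" and ?zj = "hX j \<otimes>\<^bsub>HA\<^esub> hY j \<otimes>\<^bsub>HA\<^esub> hP (transpose i j)"
  have "(hX j \<otimes>\<^bsub>HA\<^esub> hY j) \<otimes>\<^bsub>HA\<^esub> (hX i \<otimes>\<^bsub>HA\<^esub> hY i) = ?q \<oplus>\<^bsub>HA\<^esub> c \<odot>\<^bsub>HA\<^esub> ?zj"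
    using xy_comm[OF j i] ij hX_comm[OF j i] hY_comm[OF j i] by (simp add: transpose_commute[of j i])
  moreover have "(?q \<oplus>\<^bsub>HA\<^esub> c \<odot>\<^bsub>HA\<^esub> ?zi) \<ominus>\<^bsub>HA\<^esub> (?q \<oplus>\<^bsub>HA\<^esub> c \<odot>\<^bsub>HA\<^esub> ?zj) = c \<odot>\<^bsub>HA\<^esub> (?zi \<ominus>\<^bsub>HA\<^esub> ?zj)"
  proof -
    have m: "\<ominus>\<^bsub>HA\<^esub> (c \<odot>\<^bsub>HA\<^esub> ?zj) = c \<odot>\<^bsub>HA\<^esub> (\<ominus>\<^bsub>HA\<^esub> ?zj)"
      using cl by (simp add: HA.smult_assoc mult.commute flip: HA.smult_neg_one)
    have "(q \<oplus>\<^bsub>HA\<^esub> u) \<ominus>\<^bsub>HA\<^esub> (q \<oplus>\<^bsub>HA\<^esub> v) = u \<oplus>\<^bsub>HA\<^esub> (\<ominus>\<^bsub>HA\<^esub> v)"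
      if "q \<in> carrier HA" "u \<in> carrier HA" "v \<in> carrier HA" for q u v
    proof -
      have "(q \<oplus>\<^bsub>HA\<^esub> u) \<ominus>\<^bsub>HA\<^esub> (q \<oplus>\<^bsub>HA\<^esub> v) = (u \<oplus>\<^bsub>HA\<^esub> q) \<oplus>\<^bsub>HA\<^esub> (\<ominus>\<^bsub>HA\<^esub> q \<oplus>\<^bsub>HA\<^esub> \<ominus>\<^bsub>HA\<^esub> v)"
        using that by (simp add: a_minus_def HA.minus_add HA.a_comm[of q u])
      then show ?thesis using that by (simp add: HA.a_assoc HA.r_neg2)
    qed
    then show ?thesis using cl by (simp add: m a_minus_def HA.smult_add_right)
  qed
  ultimately show "fam_Z i (fam_Z j m) - fam_Z j (fam_Z i m) =
      fam_scale c (fam_Z i (fam_perm (transpose i j) m) - fam_Z j (fam_perm (transpose i j) m))"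
    using cl by (simp add: fam_mult_mult fam_mult_diff fam_mult_scale xy_comm[OF i j ij])
qed

definition fam_in :: "free_elt set \<Rightarrow> cherednik_family" where
  "fam_in k = Abs_fam (\<lambda>n' t' c'. if n' = n \<and> t' = t \<and> c' = c then k else \<zero>\<^bsub>cherednik n' t' c'\<^esub>)"

lemma fam_at_in: "k \<in> carrier HA \<Longrightarrow> fam_at (fam_in k) n' t' c' =
    (if n' = n \<and> t' = t \<and> c' = c then k else \<zero>\<^bsub>cherednik n' t' c'\<^esub>)"
  unfolding fam_in_def by (subst fam_at_Abs) auto

lemma fam_in_inj: "\<lbrakk>k \<in> carrier HA; l \<in> carrier HA; fam_in k = fam_in l\<rbrakk> \<Longrightarrow> k = l"
  by (drule arg_cong[where f = "\<lambda>x. fam_at x n t c"]) (simp add: fam_at_in)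

lemma fam_mult_in: "\<lbrakk>a \<in> carrier HA; k \<in> carrier HA\<rbrakk> \<Longrightarrow> fam_mult b a (fam_in k) = fam_in (a \<otimes>\<^bsub>HA\<^esub> k)"
  by (rule fam_eqI) (auto simp: fam_at_mult fam_at_in)

lemma fam_in_add: "\<lbrakk>k \<in> carrier HA; l \<in> carrier HA\<rbrakk> \<Longrightarrow> fam_in k + fam_in l = fam_in (k \<oplus>\<^bsub>HA\<^esub> l)"
proof (rule fam_eqI)
  fix n' t' c' assume a: "k \<in> carrier HA" "l \<in> carrier HA"
  interpret O: cherednik_alg n' t' c' .
  show "fam_at (fam_in k + fam_in l) n' t' c' = fam_at (fam_in (k \<oplus>\<^bsub>HA\<^esub> l)) n' t' c'"
    using a by (auto simp: fam_at_simps fam_at_in)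
qed

lemma fam_in_scale: "k \<in> carrier HA \<Longrightarrow> fam_scale z (fam_in k) = fam_in (z \<odot>\<^bsub>HA\<^esub> k)"
proof (rule fam_eqI)
  fix n' t' c' assume a: "k \<in> carrier HA"
  interpret O: cherednik_alg n' t' c' .
  show "fam_at (fam_scale z (fam_in k)) n' t' c' = fam_at (fam_in (z \<odot>\<^bsub>HA\<^esub> k)) n' t' c'"
    using a by (auto simp: fam_at_scale fam_at_in O.HA.smult_zero_right)
qed

lemma fam_in_uminus: "k \<in> carrier HA \<Longrightarrow> - fam_in k = fam_in (\<ominus>\<^bsub>HA\<^esub> k)"
proof (rule fam_eqI)
  fix n' t' c' assume a: "k \<in> carrier HA"
  interpret O: cherednik_alg n' t' c' .
  show "fam_at (- fam_in k) n' t' c' = fam_at (fam_in (\<ominus>\<^bsub>HA\<^esub> k)) n' t' c'"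
    using a by (auto simp: fam_at_simps fam_at_in)
qed

lemma fam_in_sum: "\<lbrakk>finite J; F \<in> J \<rightarrow> carrier HA\<rbrakk> \<Longrightarrow> (\<Sum>j\<in>J. fam_in (F j)) = fam_in (\<Oplus>\<^bsub>HA\<^esub>j\<in>J. F j)"
proof (induction J rule: finite_induct)
  case empty
  have "fam_in \<zero>\<^bsub>HA\<^esub> = 0" by (rule fam_eqI) (auto simp: fam_at_in fam_at_simps)
  then show ?case by simp
qed (auto simp: fam_in_add Pi_def)

end

lemma rev_permutes: "(\<lambda>i. if i \<in> {1..n} then n + 1 - i else i) permutes {1..n::nat}"
proof (rule bij_imp_permutes)
  show "bij_betw (\<lambda>i. if i \<in> {1..n} then n + 1 - i else i) {1..n} {1..n}"
    by (rule bij_betw_byWitness[where f' = "\<lambda>i. n + 1 - i"]) auto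
qed auto

text \<open>Ensures that s_{g(i)} is a generator of the parabolic subalgebra of d^rev. Sorting d
  increasingly and then reversing the positions gives a non-increasing rearrangement of d, which
  must be d itself.\<close>

lemma rev_seq_sorter:
  assumes d: "d \<in> Pminus n" and i: "i \<in> {1..n}"
  shows "rev_seq n d (sorter n d i) = d i"
proof -
  let ?g = "sorter n d" and ?w = "\<lambda>i. if i \<in> {1..n} then n + 1 - i else i"
  note g = sorter_permutes[of n d]
  have "nonincr n (d \<circ> (inv' ?g \<circ> ?w))"
    unfolding nonincr_def
  proof
    fix k assume k: "k \<in> {1..<n}"
    define a b where "a = inv' ?g (n - k)" and "b = inv' ?g (n + 1 - k)"
    have nk: "n - k \<in> {1..n}" "n + 1 - k \<in> {1..n}" using k by auto
    have ab: "a \<in> {1..n}" "b \<in> {1..n}"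
      unfolding a_def b_def using permutes_in_image[OF permutes_inv[OF g]] nk by blast+
    have gab: "?g a < ?g b" using k by (auto simp: a_def b_def permutes_inverses[OF g])
    \<comment> \<open>\<open>a\<close> and \<open>b\<close> are the indices placed at the adjacent
      sorted positions n - k and n + 1 - k; a smaller entry at \<open>b\<close> would have been
      placed before \<open>a\<close>.\<close>
    have "\<not> d b < d a"
    proof
      assume "d b < d a"
      then have "b \<in> sort_pred n d a" using ab by (simp add: sort_pred_def)
      then show False using sorter_less[OF ab(1), of b d] gab by simp
    qed
    then show "(d \<circ> (inv' ?g \<circ> ?w)) (k + 1) \<le> (d \<circ> (inv' ?g \<circ> ?w)) k"
      using k by (simp add: a_def b_def)
  qed
  then have eq: "d \<circ> (inv' ?g \<circ> ?w) = d"
    using nonincr_rearrangement[OF Pminus_nonincr[OF d] permutes_compose[OF rev_permutes permutes_inv[OF g]]] by blast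
  have gi: "?g i \<in> {1..n}" using permutes_in_image[OF g] i by blast
  then have j: "n + 1 - ?g i \<in> {1..n}" "n + 1 - (n + 1 - ?g i) = ?g i" by auto
  have "d (n + 1 - ?g i) = (d \<circ> (inv' ?g \<circ> ?w)) (n + 1 - ?g i)" by (simp only: eq)
  also have "\<dots> = d i" using j by (simp add: permutes_inverses[OF g])
  finally show ?thesis using gi by (simp add: rev_seq_def)
qed

section \<open>Construction of rev_d from leading terms over the Cherednik algebra\<close>

context cherednik_alg
begin

interpretation F: hecke_rep n t c fam_scale fam_perm fam_Z
  by (rule fam_hecke_rep)

text \<open>The graph of rev_d: on the leading coefficient of x^d, taken in the Cherednik algebra,
  \<open>h\<close> acts as left multiplication by \<open>z\<close>. Applying it to the coefficient 1
  recovers \<open>z\<close>, so the relation is single-valued.\<close>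

definition rev_rel :: "(nat \<Rightarrow> nat) \<Rightarrow> free_elt set \<Rightarrow> free_elt set \<Rightarrow> bool" where
  "rev_rel d h z \<longleftrightarrow> z \<in> carrier (parabolic n t c (rev_seq n d)) \<and>
     (\<forall>k\<in>carrier HA. F.lead d h (fam_in k) (fam_in (z \<otimes>\<^bsub>HA\<^esub> k)))"

lemma rev_rel_unique:
  assumes "rev_rel d h z" "rev_rel d h z'" shows "z = z'"
proof -
  have c: "z \<in> carrier HA" "z' \<in> carrier HA" using assms parabolic_sub unfolding rev_rel_def by blast+
  have "F.lead d h (fam_in \<one>\<^bsub>HA\<^esub>) (fam_in (z \<otimes>\<^bsub>HA\<^esub> \<one>\<^bsub>HA\<^esub>))" "F.lead d h (fam_in \<one>\<^bsub>HA\<^esub>) (fam_in (z' \<otimes>\<^bsub>HA\<^esub> \<one>\<^bsub>HA\<^esub>))"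
    using assms HA.one_closed unfolding rev_rel_def by blast+
  from F.lead_unique[OF this] show ?thesis using c by (intro fam_in_inj) simp_all
qed

lemma rev_rel_add:
  assumes "h \<in> carrier HA" "h' \<in> carrier HA" "rev_rel d h z" "rev_rel d h' z'"
  shows "rev_rel d (h \<oplus>\<^bsub>HA\<^esub> h') (z \<oplus>\<^bsub>HA\<^esub> z')"
  unfolding rev_rel_def
proof (intro conjI ballI)
  show "z \<oplus>\<^bsub>HA\<^esub> z' \<in> carrier (parabolic n t c (rev_seq n d))"
    using assms by (intro parabolic_closed) (auto simp: rev_rel_def)
  have c: "z \<in> carrier HA" "z' \<in> carrier HA" using assms parabolic_sub unfolding rev_rel_def by blast+
  fix k assume k: "k \<in> carrier HA"
  have "F.lead d (h \<oplus>\<^bsub>HA\<^esub> h') (fam_in k) (fam_in (z \<otimes>\<^bsub>HA\<^esub> k) + fam_in (z' \<otimes>\<^bsub>HA\<^esub> k))"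
    using assms k by (intro F.lead_add) (auto simp: rev_rel_def)
  then show "F.lead d (h \<oplus>\<^bsub>HA\<^esub> h') (fam_in k) (fam_in ((z \<oplus>\<^bsub>HA\<^esub> z') \<otimes>\<^bsub>HA\<^esub> k))"
    using c k by (simp add: fam_in_add HA.l_distr)
qed

lemma rev_rel_mult:
  assumes "h \<in> carrier (parabolic n t c d)" "h' \<in> carrier (parabolic n t c d)" "rev_rel d h z" "rev_rel d h' z'"
  shows "rev_rel d (h \<otimes>\<^bsub>HA\<^esub> h') (z \<otimes>\<^bsub>HA\<^esub> z')"
  unfolding rev_rel_def
proof (intro conjI ballI)
  show "z \<otimes>\<^bsub>HA\<^esub> z' \<in> carrier (parabolic n t c (rev_seq n d))"
    using assms by (intro parabolic_closed) (auto simp: rev_rel_def)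
  have c: "z \<in> carrier HA" "z' \<in> carrier HA" using assms parabolic_sub unfolding rev_rel_def by blast+
  fix k assume k: "k \<in> carrier HA"
  have "F.lead d (h \<otimes>\<^bsub>HA\<^esub> h') (fam_in k) (fam_in (z \<otimes>\<^bsub>HA\<^esub> (z' \<otimes>\<^bsub>HA\<^esub> k)))"
    using assms k c parabolic_hecke
    by (intro F.lead_mult[where ?v1.0 = "fam_in (z' \<otimes>\<^bsub>HA\<^esub> k)"]) (auto simp: rev_rel_def)
  then show "F.lead d (h \<otimes>\<^bsub>HA\<^esub> h') (fam_in k) (fam_in ((z \<otimes>\<^bsub>HA\<^esub> z') \<otimes>\<^bsub>HA\<^esub> k))"
    using c k by (simp add: HA.m_assoc)
qed

lemma rev_rel_scalar: "rev_rel d (w \<odot>\<^bsub>HA\<^esub> \<one>\<^bsub>HA\<^esub>) (w \<odot>\<^bsub>HA\<^esub> \<one>\<^bsub>HA\<^esub>)"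
  unfolding rev_rel_def
proof (intro conjI ballI parabolic_mem)
  fix k assume k: "k \<in> carrier HA"
  show "F.lead d (w \<odot>\<^bsub>HA\<^esub> \<one>\<^bsub>HA\<^esub>) (fam_in k) (fam_in (w \<odot>\<^bsub>HA\<^esub> \<one>\<^bsub>HA\<^esub> \<otimes>\<^bsub>HA\<^esub> k))"
    using F.lead_scalar[of d w "fam_in k"] k by (simp add: fam_in_scale HA.smult_mult)
qed

lemma rev_rel_one: "rev_rel d \<one>\<^bsub>HA\<^esub> \<one>\<^bsub>HA\<^esub>"
  using rev_rel_scalar[of d 1] by (simp add: HA.smult_one_left)

lemma rev_rel_smult:
  assumes "h \<in> carrier (parabolic n t c d)" "rev_rel d h z"
  shows "rev_rel d (w \<odot>\<^bsub>HA\<^esub> h) (w \<odot>\<^bsub>HA\<^esub> z)"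
proof -
  have "z \<in> carrier HA" using assms parabolic_sub unfolding rev_rel_def by blast
  then show ?thesis
    using rev_rel_mult[OF parabolic_mem(1) assms(1) rev_rel_scalar assms(2), of w] parabolic_sub[OF assms(1)]
    by (simp add: HA.smult_mult)
qed

text \<open>For coefficients in the algebra Z_g is left multiplication by x_g y_g, so the leading
  coefficient in \<open>lead_hU\<close> assembles to left multiplication by u_g + d_i t.\<close>

lemma rev_rel_hU:
  assumes d: "d \<in> Pminus n" and i: "i \<in> {1..n}"
  shows "rev_rel d (hU i) (hU (sorter n d i) \<oplus>\<^bsub>HA\<^esub> (of_nat (d i) * t) \<odot>\<^bsub>HA\<^esub> \<one>\<^bsub>HA\<^esub>)"
  unfolding rev_rel_def
proof (intro conjI ballI)
  let ?g = "sorter n d i" and ?w = "of_nat (d i) * t"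
  have gi: "?g \<in> {1..n}" using permutes_in_image[OF sorter_permutes] i by blast
  show "hU ?g \<oplus>\<^bsub>HA\<^esub> ?w \<odot>\<^bsub>HA\<^esub> \<one>\<^bsub>HA\<^esub> \<in> carrier (parabolic n t c (rev_seq n d))"
    by (intro parabolic_closed parabolic_mem gi)
  fix k assume k: "k \<in> carrier HA"
  have tp: "transpose ?g j permutes {1..n}" if "j \<in> {1..<?g}" for j
    using gi that by (intro transpose_permutes) auto
  let ?S = "\<Oplus>\<^bsub>HA\<^esub>j\<in>{1..<?g}. hP (transpose ?g j)"
  have S: "?S \<in> carrier HA" using tp by (intro HA.finsum_closed) auto
  have Sk: "(\<Sum>j\<in>{1..<?g}. fam_perm (transpose ?g j) (fam_in k)) = fam_in (?S \<otimes>\<^bsub>HA\<^esub> k)"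
  proof -
    have "(\<Sum>j\<in>{1..<?g}. fam_perm (transpose ?g j) (fam_in k)) = (\<Sum>j\<in>{1..<?g}. fam_in (hP (transpose ?g j) \<otimes>\<^bsub>HA\<^esub> k))"
      using tp k by (intro sum.cong refl fam_mult_in hP_closed)
    also have "\<dots> = fam_in (\<Oplus>\<^bsub>HA\<^esub>j\<in>{1..<?g}. hP (transpose ?g j) \<otimes>\<^bsub>HA\<^esub> k)"
      using tp k by (intro fam_in_sum) auto
    also have "(\<Oplus>\<^bsub>HA\<^esub>j\<in>{1..<?g}. hP (transpose ?g j) \<otimes>\<^bsub>HA\<^esub> k) = ?S \<otimes>\<^bsub>HA\<^esub> k"
      using tp k by (intro HA.finsum_ldistr[symmetric]) auto
    finally show ?thesis .
  qed
  let ?q = "hX ?g \<otimes>\<^bsub>HA\<^esub> hY ?g"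
  have q: "?q \<in> carrier HA" using gi by blast
  have "fam_scale ?w (fam_in k) + fam_Z ?g (fam_in k) - fam_scale c (\<Sum>j\<in>{1..<?g}. fam_perm (transpose ?g j) (fam_in k)) =
      fam_in (?w \<odot>\<^bsub>HA\<^esub> k) + fam_in (?q \<otimes>\<^bsub>HA\<^esub> k) + - fam_in (c \<odot>\<^bsub>HA\<^esub> (?S \<otimes>\<^bsub>HA\<^esub> k))"
    using k S q by (simp add: Sk fam_in_scale fam_mult_in)
  also have "\<dots> = fam_in (?w \<odot>\<^bsub>HA\<^esub> k \<oplus>\<^bsub>HA\<^esub> ?q \<otimes>\<^bsub>HA\<^esub> k \<oplus>\<^bsub>HA\<^esub> (\<ominus>\<^bsub>HA\<^esub> (c \<odot>\<^bsub>HA\<^esub> (?S \<otimes>\<^bsub>HA\<^esub> k))))"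
    unfolding fam_in_uminus[OF HA.smult_closed[OF HA.m_closed[OF S k]]] using k S q by (simp add: fam_in_add)
  also have "?w \<odot>\<^bsub>HA\<^esub> k \<oplus>\<^bsub>HA\<^esub> ?q \<otimes>\<^bsub>HA\<^esub> k \<oplus>\<^bsub>HA\<^esub> (\<ominus>\<^bsub>HA\<^esub> (c \<odot>\<^bsub>HA\<^esub> (?S \<otimes>\<^bsub>HA\<^esub> k))) =
      (hU ?g \<oplus>\<^bsub>HA\<^esub> ?w \<odot>\<^bsub>HA\<^esub> \<one>\<^bsub>HA\<^esub>) \<otimes>\<^bsub>HA\<^esub> k"
    unfolding hu_def Let_def a_minus_def using k S q
    by (simp add: HA.l_distr HA.l_minus HA.smult_mult HA.a_ac)
  finally show "F.lead d (hU i) (fam_in k) (fam_in ((hU ?g \<oplus>\<^bsub>HA\<^esub> ?w \<odot>\<^bsub>HA\<^esub> \<one>\<^bsub>HA\<^esub>) \<otimes>\<^bsub>HA\<^esub> k))"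
    using F.lead_hU[OF Pminus_nonincr[OF d] i, of "fam_in k"] by simp
qed

text \<open>Besides the leading term, membership in the parabolic subalgebra of d^rev has to be
  shown; \<open>rev_seq_sorter\<close> identifies the two adjacent entries there with d_i and
  d_{i+1}.\<close>

lemma rev_rel_hs:
  assumes d: "d \<in> Pminus n" and i: "i \<in> {1..<n}" "d i = d (i + 1)"
  shows "rev_rel d (hs n t c i) (hs n t c (sorter n d i))"
  unfolding rev_rel_def
proof (intro conjI ballI)
  let ?g = "sorter n d i"
  have i': "i \<in> {1..n}" "i + 1 \<in> {1..n}" using i by auto
  note S = sorter_Suc[OF i]
  have gi: "?g \<in> {1..n}" "?g + 1 \<in> {1..n}" using permutes_in_image[OF sorter_permutes[of n d]] i' S by metis+
  have "rev_seq n d ?g = rev_seq n d (?g + 1)"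
    using rev_seq_sorter[OF d i'(1)] rev_seq_sorter[OF d i'(2)] i(2) by (simp add: S)
  then show "hs n t c ?g \<in> carrier (parabolic n t c (rev_seq n d))"
    using gi by (intro parabolic_mem(3)) auto
  fix k assume k: "k \<in> carrier HA"
  have "fam_perm (transpose ?g (?g + 1)) (fam_in k) = fam_in (hs n t c ?g \<otimes>\<^bsub>HA\<^esub> k)"
    unfolding hs_def by (rule fam_mult_in[OF hP_closed[OF transpose_permutes[OF gi]] k])
  then show "F.lead d (hs n t c i) (fam_in k) (fam_in (hs n t c ?g \<otimes>\<^bsub>HA\<^esub> k))"
    using F.lead_hs[OF i, of "fam_in k"] by simp
qed

lemma rev_rel_exists:
  assumes d: "d \<in> Pminus n" and "h \<in> carrier (parabolic n t c d)"
  shows "\<exists>z. rev_rel d h z"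
  using assms(2)
proof (induction rule: parabolic_induct)
  case (scalar z)
  then show ?case using rev_rel_scalar by blast
next
  case (u i)
  then show ?case using rev_rel_hU[OF d] by blast
next
  case (s i)
  then show ?case using rev_rel_hs[OF d] by blast
next
  case (uminus h)
  then show ?case using rev_rel_smult[of h d _ "-1"] parabolic_sub[of h] by (metis HA.smult_neg_one)
next
  case (add h k)
  then show ?case using rev_rel_add parabolic_sub by blast
next
  case (mult h k)
  then show ?case using rev_rel_mult by blast
qed

definition is_rev :: "(nat \<Rightarrow> nat) \<Rightarrow> (free_elt set \<Rightarrow> free_elt set) \<Rightarrow> bool" where
  "is_rev d f \<longleftrightarrow> f \<in> alg_hom (parabolic n t c d) (parabolic n t c (rev_seq n d)) \<and>
       (\<forall>i\<in>{1..<n}. d i = d (i + 1) \<longrightarrow> f (hs n t c i) = hs n t c (sort_perm n d i)) \<and>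
       (\<forall>j\<in>{1..n}. f (hu n t c j) =
          hu n t c (sort_perm n d j) \<oplus>\<^bsub>HA\<^esub> (of_nat (d j) * t) \<odot>\<^bsub>HA\<^esub> \<one>\<^bsub>HA\<^esub>)"

lemma is_rev_unique:
  assumes f: "is_rev d f" and g: "is_rev d g"
  shows "f = g"
proof -
  have F: "f \<in> alg_hom (parabolic n t c d) (parabolic n t c (rev_seq n d))"
    and G: "g \<in> alg_hom (parabolic n t c d) (parabolic n t c (rev_seq n d))"
    using f g by (auto simp: is_rev_def)
  note Fs = alg_homD[OF F, unfolded parabolic_simps] and Gs = alg_homD[OF G, unfolded parabolic_simps]
  have neg: "\<ominus>\<^bsub>HA\<^esub> h = (- 1) \<odot>\<^bsub>HA\<^esub> h" if "h \<in> carrier HA" for h using HA.smult_neg_one[OF that] by simp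
  have "f h = g h" if "h \<in> carrier (parabolic n t c d)" for h
    using that
  proof (induction rule: parabolic_induct)
    case (scalar z)
    then show ?case by (simp add: Fs Gs parabolic_closed)
  next
    case (uminus h)
    then show ?case by (simp add: neg parabolic_sub Fs Gs)
  next
    case (u i)
    then show ?case using f g unfolding is_rev_def by simp
  next
    case (s i)
    then show ?case using f g unfolding is_rev_def by simp
  qed (simp_all add: Fs Gs)
  then show ?thesis
    using F G unfolding alg_hom_def by (intro extensionalityI[of f "carrier (parabolic n t c d)"]) auto
qed

lemma is_rev_exists:
  assumes d: "d \<in> Pminus n" shows "\<exists>f. is_rev d f"
proof -
  let ?P = "parabolic n t c d"
  define F where "F = (\<lambda>h\<in>carrier ?P. THE z. rev_rel d h z)"
  have F: "rev_rel d h (F h)" if "h \<in> carrier ?P" for h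
    using rev_rel_exists[OF d that] rev_rel_unique that unfolding F_def by (simp, metis theI')
  have Fe: "F h = f" if "h \<in> carrier ?P" "rev_rel d h f" for h f
    using F[OF that(1)] that(2) by (rule rev_rel_unique)
  have "F \<in> alg_hom ?P (parabolic n t c (rev_seq n d))"
    unfolding alg_hom_def
  proof (intro CollectI conjI allI ballI)
    show "F \<in> ring_hom ?P (parabolic n t c (rev_seq n d))"
    proof (rule ring_hom_memI, unfold parabolic_simps)
      fix x assume "x \<in> carrier ?P"
      then show "F x \<in> carrier (parabolic n t c (rev_seq n d))" using F by (simp add: rev_rel_def)
    next
      fix x y assume xy: "x \<in> carrier ?P" "y \<in> carrier ?P"
      note s = F[OF xy(1)] F[OF xy(2)]
      show "F (x \<otimes>\<^bsub>HA\<^esub> y) = F x \<otimes>\<^bsub>HA\<^esub> F y"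
        by (rule Fe[OF parabolic_closed(2)[OF xy] rev_rel_mult[OF xy s]])
      show "F (x \<oplus>\<^bsub>HA\<^esub> y) = F x \<oplus>\<^bsub>HA\<^esub> F y"
        by (rule Fe[OF parabolic_closed(1)[OF xy] rev_rel_add[OF parabolic_sub[OF xy(1)] parabolic_sub[OF xy(2)] s]])
    next
      show "F \<one>\<^bsub>HA\<^esub> = \<one>\<^bsub>HA\<^esub>" by (rule Fe[OF parabolic_closed(4) rev_rel_one])
    qed
    show "F \<in> extensional (carrier ?P)" by (simp add: F_def)
    fix z a assume a: "a \<in> carrier ?P"
    show "F (z \<odot>\<^bsub>?P\<^esub> a) = z \<odot>\<^bsub>parabolic n t c (rev_seq n d)\<^esub> F a"
      unfolding parabolic_simps by (rule Fe[OF parabolic_smult_closed[OF a] rev_rel_smult[OF a F[OF a]]])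
  qed
  moreover have "F (hs n t c i) = hs n t c (sort_perm n d i)" if "i \<in> {1..<n}" "d i = d (i + 1)" for i
    using Fe[OF parabolic_mem(3)[OF that] rev_rel_hs[OF d that]] that by (simp add: sorter_def)
  moreover have "F (hU j) = hU (sort_perm n d j) \<oplus>\<^bsub>HA\<^esub> (of_nat (d j) * t) \<odot>\<^bsub>HA\<^esub> \<one>\<^bsub>HA\<^esub>" if "j \<in> {1..n}" for j
    using Fe[OF parabolic_mem(2)[OF that] rev_rel_hU[OF d that]] that by (simp add: sorter_def)
  ultimately show ?thesis unfolding is_rev_def by blast
qed

lemma is_rev_rev_hom: "d \<in> Pminus n \<Longrightarrow> is_rev d (rev_hom n t c d)"
proof -
  assume d: "d \<in> Pminus n"
  obtain f where f: "is_rev d f" using is_rev_exists[OF d] by blast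
  have "rev_hom n t c d = (THE f. is_rev d f)" by (simp add: rev_hom_def is_rev_def Let_def)
  also have "\<dots> = f" using f is_rev_unique by (intro the_equality) auto
  finally show ?thesis using f by simp
qed

end

section \<open>Recognising induced modules\<close>

text \<open>Only sums are taken: the generating sets it is applied to already absorb scalars, and
  with them signs.\<close>

inductive_set add_span :: "('a, 'z) ring_scheme \<Rightarrow> 'a set \<Rightarrow> 'a set" for A S where
  base: "s \<in> S \<Longrightarrow> s \<in> add_span A S"
| add: "\<lbrakk>x \<in> add_span A S; y \<in> add_span A S\<rbrakk> \<Longrightarrow> x \<oplus>\<^bsub>A\<^esub> y \<in> add_span A S"

text \<open>If \<open>A\<close> is spanned by the products of \<open>\<alpha> k\<close> with the image of \<open>B\<close>, and a balanced map \<open>\<beta>\<close> sends the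
  elements \<open>\<alpha> k \<otimes> m\<close> bijectively to the different homogeneous components of a graded space, then the
  induced module is that graded space.\<close>

locale induction_data = ring A for A :: "(complex, 'a) module" (structure) +
  fixes f :: "'b \<Rightarrow> 'a" and B :: "(complex, 'b) module" and M :: "('b, 'm::ab_group_add) module"
    and scW :: "complex \<Rightarrow> ('k \<Rightarrow>\<^sub>0 'm) \<Rightarrow> 'k \<Rightarrow>\<^sub>0 'm"
    and \<beta> :: "'a \<Rightarrow> 'm \<Rightarrow> 'k \<Rightarrow>\<^sub>0 'm" and T :: "'a \<Rightarrow> ('k \<Rightarrow>\<^sub>0 'm) \<Rightarrow> 'k \<Rightarrow>\<^sub>0 'm"
    and E :: "'k set" and \<alpha> :: "'k \<Rightarrow> 'a" and \<tau> :: "'k \<Rightarrow> 'm \<Rightarrow> 'm"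
  assumes M_carrier: "carrier M = UNIV" and M_add: "x \<oplus>\<^bsub>M\<^esub> y = x + y"
    and f_closed: "b \<in> carrier B \<Longrightarrow> f b \<in> carrier A"
    and scW: "vector_space scW"
    and \<beta>_add_left: "\<lbrakk>a \<in> carrier A; a' \<in> carrier A\<rbrakk> \<Longrightarrow> \<beta> (a \<oplus> a') m = \<beta> a m + \<beta> a' m"
    and \<beta>_add_right: "a \<in> carrier A \<Longrightarrow> \<beta> a (m + m') = \<beta> a m + \<beta> a m'"
    and \<beta>_balanced: "\<lbrakk>a \<in> carrier A; b \<in> carrier B\<rbrakk> \<Longrightarrow> \<beta> (a \<otimes> f b) m = \<beta> a (b \<odot>\<^bsub>M\<^esub> m)"
    and T_lin: "a \<in> carrier A \<Longrightarrow> lin_op scW (T a)"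
    and T_\<beta>: "\<lbrakk>a \<in> carrier A; a' \<in> carrier A\<rbrakk> \<Longrightarrow> \<beta> (a \<otimes> a') m = T a (\<beta> a' m)"
    and \<alpha>_closed: "k \<in> E \<Longrightarrow> \<alpha> k \<in> carrier A"
    and \<beta>_\<alpha>: "k \<in> E \<Longrightarrow> \<beta> (\<alpha> k) m = single k (\<tau> k m)"
    and \<tau>_bij: "k \<in> E \<Longrightarrow> bij (\<tau> k)"
    and spanning: "carrier A \<subseteq> add_span A {\<alpha> k \<otimes> f b |k b. k \<in> E \<and> b \<in> carrier B}"
begin

abbreviation "FG \<equiv> free_Abelian_group (carrier A \<times> carrier M)"
abbreviation "REL \<equiv> tensor_rels f B A M"
abbreviation "NN \<equiv> generate FG REL"
abbreviation "IND \<equiv> induced f B A M"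

interpretation G: comm_group FG by (rule abelian_free_Abelian_group)
interpretation W: vector_space scW by (rule scW)

lemma rels_cases:
  assumes "r \<in> REL"
  obtains (add_left) a a' m where "a \<in> carrier A" "a' \<in> carrier A"
      "r = frag_of (a \<oplus> a', m) - frag_of (a, m) - frag_of (a', m)"
    | (add_right) a m m' where "a \<in> carrier A" "r = frag_of (a, m + m') - frag_of (a, m) - frag_of (a, m')"
    | (balanced) a b m where "a \<in> carrier A" "b \<in> carrier B" "r = frag_of (a \<otimes> f b, m) - frag_of (a, b \<odot>\<^bsub>M\<^esub> m)"
  using assms unfolding tensor_rels_def M_add Un_iff mem_Collect_eq
proof (elim disjE exE conjE)
  fix a a' m assume r: "r = frag_of (a \<oplus> a', m) - frag_of (a, m) - frag_of (a', m)"
    and a: "a \<in> carrier A" "a' \<in> carrier A"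
  show thesis by (rule that(1)[OF a r])
next
  fix a m m' assume r: "r = frag_of (a, m + m') - frag_of (a, m) - frag_of (a, m')" and a: "a \<in> carrier A"
  show thesis by (rule that(2)[OF a r])
next
  fix a b m assume r: "r = frag_of (a \<otimes> f b, m) - frag_of (a, b \<odot>\<^bsub>M\<^esub> m)"
    and a: "a \<in> carrier A" "b \<in> carrier B"
  show thesis by (rule that(3)[OF a r])
qed

lemma rels_closed: "REL \<subseteq> carrier FG"
proof
  fix r assume "r \<in> REL"
  then show "r \<in> carrier FG"
    unfolding carrier_free_Abelian_group_iff
  proof (cases rule: rels_cases)
    case 1: (add_left a a' m)
    show "keys r \<subseteq> carrier A \<times> carrier M" unfolding 1(3)
      by (intro keys_diff_subset) (use 1 in \<open>simp_all add: M_carrier\<close>)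
  next
    case 2: (add_right a m m')
    show "keys r \<subseteq> carrier A \<times> carrier M" unfolding 2(2)
      by (intro keys_diff_subset) (use 2 in \<open>simp_all add: M_carrier\<close>)
  next
    case 3: (balanced a b m)
    show "keys r \<subseteq> carrier A \<times> carrier M" unfolding 3(3)
      by (intro keys_diff_subset) (use 3 in \<open>simp_all add: M_carrier f_closed\<close>)
  qed
qed

lemma sub_NN: "subgroup NN FG" by (rule G.generate_is_subgroup[OF rels_closed])

lemma NN_keys: "z \<in> NN \<Longrightarrow> keys z \<subseteq> carrier A \<times> carrier M"
  using subgroup.mem_carrier[OF sub_NN] by simp

lemma NN_add: "\<lbrakk>x \<in> NN; y \<in> NN\<rbrakk> \<Longrightarrow> x + y \<in> NN"
  using subgroup.m_closed[OF sub_NN] by simp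

lemma NN_uminus: "x \<in> NN \<Longrightarrow> - x \<in> NN"
  using subgroup.m_inv_closed[OF sub_NN, of x] NN_keys[of x] by simp

lemma NN_diff: "\<lbrakk>x \<in> NN; y \<in> NN\<rbrakk> \<Longrightarrow> x - y \<in> NN"
  using NN_add[of x "- y"] NN_uminus[of y] by simp

lemma NN_zero: "0 \<in> NN"
  using subgroup.one_closed[OF sub_NN] by simp

lemma NN_sum: "(\<And>i. i \<in> I \<Longrightarrow> F i \<in> NN) \<Longrightarrow> sum F I \<in> NN"
  by (induction I rule: infinite_finite_induct) (auto simp: NN_zero NN_add)

lemma NN_rels:
  "\<lbrakk>a \<in> carrier A; a' \<in> carrier A\<rbrakk> \<Longrightarrow> frag_of (a \<oplus> a', m) - frag_of (a, m) - frag_of (a', m) \<in> NN"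
  "a \<in> carrier A \<Longrightarrow> frag_of (a, m + m') - frag_of (a, m) - frag_of (a, m') \<in> NN"
  "\<lbrakk>a \<in> carrier A; b \<in> carrier B\<rbrakk> \<Longrightarrow> frag_of (a \<otimes> f b, m) - frag_of (a, b \<odot>\<^bsub>M\<^esub> m) \<in> NN"
proof -
  show "frag_of (a \<oplus> a', m) - frag_of (a, m) - frag_of (a', m) \<in> NN" if "a \<in> carrier A" "a' \<in> carrier A"
    by (rule generate.incl) (use that in \<open>unfold tensor_rels_def M_carrier, blast\<close>)
  show "frag_of (a, m + m') - frag_of (a, m) - frag_of (a, m') \<in> NN" if "a \<in> carrier A"
    unfolding M_add[symmetric]
    by (rule generate.incl) (use that in \<open>unfold tensor_rels_def M_carrier, blast\<close>)
  show "frag_of (a \<otimes> f b, m) - frag_of (a, b \<odot>\<^bsub>M\<^esub> m) \<in> NN" if "a \<in> carrier A" "b \<in> carrier B"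
    by (rule generate.incl) (use that in \<open>unfold tensor_rels_def M_carrier, blast\<close>)
qed

text \<open>The additivity relation at m = m' = 0 is minus the generator (a, 0).\<close>

lemma NN_zero_right: "a \<in> carrier A \<Longrightarrow> frag_of (a, 0) \<in> NN"
proof -
  assume "a \<in> carrier A"
  from NN_uminus[OF NN_rels(2)[OF this, of 0 0]]
  have "- (frag_of (a, 0 + 0) - frag_of (a, 0) - frag_of (a, 0)) \<in> NN" .
  moreover have "- (frag_of (a, 0 + 0) - frag_of (a, 0) - frag_of (a, 0)) = frag_of (a, 0 :: 'm)" by simp
  ultimately show ?thesis by (simp only:)
qed

lemma NN_induct [consumes 1, case_names zero add_left add_right balanced uminus add]:
  assumes "z \<in> NN" and "P 0"
    and "\<And>a a' m. \<lbrakk>a \<in> carrier A; a' \<in> carrier A\<rbrakk> \<Longrightarrow> P (frag_of (a \<oplus> a', m) - frag_of (a, m) - frag_of (a', m))"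
    and "\<And>a m m'. a \<in> carrier A \<Longrightarrow> P (frag_of (a, m + m') - frag_of (a, m) - frag_of (a, m'))"
    and "\<And>a b m. \<lbrakk>a \<in> carrier A; b \<in> carrier B\<rbrakk> \<Longrightarrow> P (frag_of (a \<otimes> f b, m) - frag_of (a, b \<odot>\<^bsub>M\<^esub> m))"
    and "\<And>x. P x \<Longrightarrow> P (- x)" and "\<And>x y. P x \<Longrightarrow> P y \<Longrightarrow> P (x + y)"
  shows "P z"
proof -
  have rel: "P r" if "r \<in> REL" for r
    using that
  proof (cases rule: rels_cases)
    case 1: (add_left a a' m)
    show ?thesis unfolding 1(3) by (rule assms(3)[OF 1(1,2)])
  next
    case 2: (add_right a m m')
    show ?thesis unfolding 2(2) by (rule assms(4)[OF 2(1)])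
  next
    case 3: (balanced a b m)
    show ?thesis unfolding 3(3) by (rule assms(5)[OF 3(1,2)])
  qed
  show ?thesis using assms(1)
  proof (induction rule: generate.induct)
    case (inv h)
    then have e: "inv\<^bsub>FG\<^esub> h = - h" using subsetD[OF rels_closed, of h] by simp
    show ?case unfolding e by (rule assms(6)[OF rel[OF inv]])
  next
    case one
    show ?case unfolding one_free_Abelian_group by (rule assms(2))
  next
    case (incl h)
    then show ?case by (rule rel)
  next
    case (eng x y)
    show ?case unfolding mult_free_Abelian_group by (rule assms(7)[OF eng(3,4)])
  qed
qed

text \<open>The homomorphism induced by \<open>\<beta>\<close> on the free abelian group of pairs;
  integer multiplicities act through the complex scalars of the target.\<close>

definition bext :: "('a \<times> 'm \<Rightarrow>\<^sub>0 int) \<Rightarrow> 'k \<Rightarrow>\<^sub>0 'm" where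
  "bext = ext_op (\<lambda>(a, m) j. scW (of_int j) (\<beta> a m))"

lemma bext_add: "bext (x + y) = bext x + bext y"
  unfolding bext_def by (rule ext_op_add) (auto simp: W.scale_left_distrib split: prod.splits)

lemma bext_of: "bext (frag_of (a, m)) = \<beta> a m"
  unfolding bext_def
  by (subst ext_op_single) (auto simp: W.scale_left_distrib split: prod.splits)

lemmas bext_additive = bext_add additive_zero[of bext, OF bext_add] additive_uminus[of bext, OF bext_add]
  additive_diff[of bext, OF bext_add] additive_sum[of bext, OF bext_add]

lemma bext_NN: "z \<in> NN \<Longrightarrow> bext z = 0"
  by (induction rule: NN_induct)
     (auto simp: bext_additive bext_of \<beta>_add_left \<beta>_add_right \<beta>_balanced)

definition lmult :: "'a \<Rightarrow> ('a \<times> 'm \<Rightarrow>\<^sub>0 int) \<Rightarrow> 'a \<times> 'm \<Rightarrow>\<^sub>0 int" where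
  "lmult a = frag_extend (\<lambda>(a', m). frag_of (a \<otimes> a', m))"

lemma lmult_additive: "lmult a (x + y) = lmult a x + lmult a y" "lmult a (x - y) = lmult a x - lmult a y"
  "lmult a 0 = 0" "lmult a (- x) = - lmult a x" "lmult a (frag_of (a', m)) = frag_of (a \<otimes> a', m)"
  by (simp_all add: lmult_def frag_extend_add frag_extend_diff frag_extend_minus)

lemma lmult_NN:
  assumes a: "a \<in> carrier A" and "z \<in> NN" shows "lmult a z \<in> NN"
  using assms(2)
proof (induction rule: NN_induct)
  case (add_left x y m)
  then show ?case using NN_rels(1)[of "a \<otimes> x" "a \<otimes> y" m] a by (simp add: lmult_additive r_distr)
next
  case (add_right x m m')
  then show ?case using NN_rels(2)[of "a \<otimes> x" m m'] a by (simp add: lmult_additive)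
next
  case (balanced x b m)
  then show ?case using NN_rels(3)[of "a \<otimes> x" b m] a by (simp add: lmult_additive m_assoc f_closed)
qed (simp_all add: lmult_additive NN_zero NN_uminus NN_add)

lemma lmult_closed:
  assumes a: "a \<in> carrier A" and z: "z \<in> carrier FG"
  shows "lmult a z \<in> carrier FG"
proof -
  have "keys z \<subseteq> carrier A \<times> carrier M" using z by simp
  then have "keys (lmult a z) \<subseteq> carrier A \<times> carrier M"
  proof (induction rule: frag_induction)
    case (one x)
    then show ?case using a by (cases x) (auto simp: lmult_additive)
  next
    case (diff x y)
    then show ?case unfolding lmult_additive by (rule keys_diff_subset)
  qed (simp add: lmult_additive)
  then show ?thesis by simp
qed

lemma bext_lmult:
  assumes a: "a \<in> carrier A" and z: "z \<in> carrier FG"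
  shows "bext (lmult a z) = T a (bext z)"
proof -
  have "keys z \<subseteq> carrier A \<times> carrier M" using z by simp
  then show ?thesis
  proof (induction rule: frag_induction)
    case (one x)
    then show ?case using a by (cases x) (auto simp: lmult_additive bext_of T_\<beta>)
  qed (auto simp: lmult_additive bext_additive lin_opD[OF T_lin[OF a]])
qed

text \<open>The normal form sum_k \<alpha>_k \<otimes> w_k of a tensor. Its image under
  \<open>bext\<close> has components \<tau>_k (w_k), so \<open>sec\<close> is a section only up to
  the bijections \<tau>_k.\<close>

definition sec :: "('k \<Rightarrow>\<^sub>0 'm) \<Rightarrow> 'a \<times> 'm \<Rightarrow>\<^sub>0 int" where
  "sec w = (\<Sum>k\<in>keys w. frag_of (\<alpha> k, lookup w k))"

text \<open>A vanishing coefficient contributes the generator (\<alpha>_k, 0), which is non-zero in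
  the free abelian group but lies in the relation subgroup. Hence normal forms may be computed over
  any larger index set modulo relations.\<close>

lemma sec_superset:
  assumes "finite S" "keys w \<subseteq> S" "S \<subseteq> E"
  shows "(\<Sum>k\<in>S. frag_of (\<alpha> k, lookup w k)) - sec w \<in> NN"
proof -
  have "(\<Sum>k\<in>S. frag_of (\<alpha> k, lookup w k)) - sec w = (\<Sum>k\<in>S - keys w. frag_of (\<alpha> k, lookup w k))"
    unfolding sec_def using assms by (simp add: sum_diff)
  also have "\<dots> \<in> NN"
    using assms(3) by (intro NN_sum) (auto simp: in_keys_iff intro!: NN_zero_right \<alpha>_closed)
  finally show ?thesis .
qed

lemma sec_add:
  assumes "keys w \<subseteq> E" "keys w' \<subseteq> E"
  shows "sec (w + w') - sec w - sec w' \<in> NN"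
proof -
  let ?S = "keys w \<union> keys w'"
  let ?F = "\<lambda>w. \<Sum>k\<in>?S. frag_of (\<alpha> k, lookup w k)"
  have S: "finite ?S" "?S \<subseteq> E" using assms by auto
  have "?F (w + w') - ?F w - ?F w' = (\<Sum>k\<in>?S. frag_of (\<alpha> k, lookup w k + lookup w' k) - frag_of (\<alpha> k, lookup w k) - frag_of (\<alpha> k, lookup w' k))"
    by (simp add: sum_subtractf lookup_add)
  also have "\<dots> \<in> NN" using S by (intro NN_sum NN_rels(2) \<alpha>_closed) auto
  finally have 1: "?F (w + w') - ?F w - ?F w' \<in> NN" .
  have 2: "?F (w + w') - sec (w + w') \<in> NN" "?F w - sec w \<in> NN" "?F w' - sec w' \<in> NN"
    using S keys_add[of w w'] by (auto intro!: sec_superset)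
  have "sec (w + w') - sec w - sec w' = (?F (w + w') - ?F w - ?F w') - (?F (w + w') - sec (w + w'))
     + (?F w - sec w) + (?F w' - sec w')" by simp
  also have "\<dots> \<in> NN" by (rule NN_add[OF NN_add[OF NN_diff[OF 1 2(1)] 2(2)] 2(3)])
  finally show ?thesis .
qed

definition has_sec :: "('a \<times> 'm \<Rightarrow>\<^sub>0 int) \<Rightarrow> bool" where
  "has_sec z \<longleftrightarrow> (\<exists>w. keys w \<subseteq> E \<and> z - sec w \<in> NN)"

lemma has_sec_zero: "has_sec 0"
  unfolding has_sec_def by (intro exI[of _ 0]) (simp add: sec_def NN_zero)

lemma has_sec_diff: "\<lbrakk>has_sec x; has_sec y\<rbrakk> \<Longrightarrow> has_sec (x - y)"
proof -
  assume "has_sec x" "has_sec y"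
  then obtain w v where w: "keys w \<subseteq> E" "x - sec w \<in> NN" and v: "keys v \<subseteq> E" "y - sec v \<in> NN"
    unfolding has_sec_def by blast
  have wv: "keys (w - v) \<subseteq> E" using w v by (intro keys_diff_subset)
  have "sec w - sec (w - v) - sec v \<in> NN" using sec_add[OF wv v(1)] by simp
  from NN_add[OF NN_diff[OF w(2) v(2)] this]
  have "x - y - sec (w - v) \<in> NN" by (simp add: algebra_simps)
  then show ?thesis unfolding has_sec_def using wv by blast
qed

lemma has_sec_NN: "\<lbrakk>has_sec x; x - y \<in> NN\<rbrakk> \<Longrightarrow> has_sec y"
proof -
  assume x: "has_sec x" and xy: "x - y \<in> NN"
  then obtain w where w: "keys w \<subseteq> E" "x - sec w \<in> NN" unfolding has_sec_def by blast
  have "(x - sec w) - (x - y) \<in> NN" by (rule NN_diff[OF w(2) xy])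
  then show ?thesis using w(1) unfolding has_sec_def by (intro exI[of _ w]) simp
qed

text \<open>By spanning, \<open>a\<close> is a sum of elements \<alpha>_k f(b), and balancing moves
  each f(b) across the tensor sign onto the coefficient.\<close>

lemma has_sec_of:
  assumes "a \<in> carrier A" shows "has_sec (frag_of (a, m))"
proof -
  have "a \<in> add_span A {\<alpha> k \<otimes> f b |k b. k \<in> E \<and> b \<in> carrier B}" using assms spanning by blast
  then have "a \<in> carrier A \<and> has_sec (frag_of (a, m))"
  proof induction
    case (base s)
    then obtain k b where s: "s = \<alpha> k \<otimes> f b" and k: "k \<in> E" and b: "b \<in> carrier B" by blast
    let ?w = "single k (b \<odot>\<^bsub>M\<^esub> m)"
    have "frag_of (\<alpha> k, b \<odot>\<^bsub>M\<^esub> m) - sec ?w \<in> NN"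
      using sec_superset[of "{k}" ?w] k by simp
    then have "has_sec (frag_of (\<alpha> k, b \<odot>\<^bsub>M\<^esub> m))"
      unfolding has_sec_def using k by (intro exI[of _ ?w]) simp
    moreover have "frag_of (\<alpha> k, b \<odot>\<^bsub>M\<^esub> m) - frag_of (s, m) \<in> NN"
      using NN_uminus[OF NN_rels(3)[OF \<alpha>_closed[OF k] b, of m]] by (simp add: s)
    ultimately show ?case using has_sec_NN \<alpha>_closed[OF k] f_closed[OF b] s by blast
  next
    case (add x y)
    have "has_sec (frag_of (x, m) - (0 - frag_of (y, m)))"
      using add by (intro has_sec_diff has_sec_zero) auto
    moreover have "(frag_of (x, m) - (0 - frag_of (y, m))) - frag_of (x \<oplus> y, m) \<in> NN"
      using NN_uminus[OF NN_rels(1)[of x y m]] add by (simp add: algebra_simps)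
    ultimately show ?case using has_sec_NN add by blast
  qed
  then show ?thesis by simp
qed

lemma has_sec_all: "z \<in> carrier FG \<Longrightarrow> has_sec z"
proof -
  assume "z \<in> carrier FG"
  then have "keys z \<subseteq> carrier A \<times> carrier M" by simp
  then show ?thesis
    by (induction rule: frag_induction) (auto intro: has_sec_zero has_sec_diff has_sec_of)
qed

lemma \<tau>_add: "k \<in> E \<Longrightarrow> \<tau> k (m + m') = \<tau> k m + \<tau> k m'"
  using \<beta>_add_right[OF \<alpha>_closed, of k m m'] \<beta>_\<alpha>[of k] lookup_single_eq by (metis lookup_add)

lemma bext_sec: "keys w \<subseteq> E \<Longrightarrow> bext (sec w) = (\<Sum>k\<in>keys w. single k (\<tau> k (lookup w k)))"
  unfolding sec_def by (auto simp: bext_additive bext_of \<beta>_\<alpha> intro!: sum.cong)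

lemma lookup_bext_sec:
  assumes w: "keys w \<subseteq> E" shows "lookup (bext (sec w)) k = (if k \<in> keys w then \<tau> k (lookup w k) else 0)"
  unfolding bext_sec[OF w] by (simp add: lookup_sum lookup_single when_def)

lemma keys_bext: "z \<in> carrier FG \<Longrightarrow> keys (bext z) \<subseteq> E"
proof -
  assume z: "z \<in> carrier FG"
  obtain w where w: "keys w \<subseteq> E" "z - sec w \<in> NN" using has_sec_all[OF z] unfolding has_sec_def by blast
  have "bext z = bext (sec w)" using bext_NN[OF w(2)] by (simp add: bext_additive)
  then show ?thesis using lookup_bext_sec[OF w(1)] w(1) by (auto simp: in_keys_iff split: if_splits)
qed

text \<open>Injectivity on the induced module. Modulo relations z is a normal form; if its image
  vanishes, then so do all \<tau>_k (w_k), hence all w_k.\<close>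

lemma bext_eq_0:
  assumes z: "z \<in> carrier FG" and "bext z = 0" shows "z \<in> NN"
proof -
  obtain w where w: "keys w \<subseteq> E" "z - sec w \<in> NN" using has_sec_all[OF z] unfolding has_sec_def by blast
  have b: "bext (sec w) = 0" using bext_NN[OF w(2)] assms(2) by (simp add: bext_additive)
  have "keys w = {}"
  proof (rule ccontr)
    assume "keys w \<noteq> {}"
    then obtain k where k: "k \<in> keys w" by blast
    then have kE: "k \<in> E" using w by blast
    have "\<tau> k (lookup w k) = 0" using lookup_bext_sec[OF w(1), of k] b k by simp
    also have "0 = \<tau> k 0" using additive_zero[of "\<tau> k"] \<tau>_add[OF kE] by simp
    finally have "lookup w k = 0" using \<tau>_bij[OF kE] by (metis bij_pointE)
    then show False using k by (simp add: in_keys_iff)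
  qed
  then show ?thesis using w(2) by (simp add: sec_def)
qed

lemma bext_surj:
  assumes w: "keys w \<subseteq> E" shows "\<exists>z\<in>carrier FG. bext z = w"
proof -
  let ?z = "\<Sum>k\<in>keys w. frag_of (\<alpha> k, inv' (\<tau> k) (lookup w k))"
  have "keys ?z \<subseteq> carrier A \<times> carrier M"
    using w by (intro keys_sum_subset) (auto simp: M_carrier \<alpha>_closed)
  moreover have "bext ?z = (\<Sum>k\<in>keys w. single k (lookup w k))"
    unfolding bext_additive using w by (intro sum.cong refl)
     (auto simp: bext_of \<beta>_\<alpha> surj_f_inv_f[OF bij_is_surj[OF \<tau>_bij]])
  ultimately show ?thesis using poly_mapping_eq_sum_single[of w] by (intro bexI[of _ ?z]) auto
qed

lemma IND_simps:
  "carrier IND = rcosets\<^bsub>FG\<^esub> NN" "x \<oplus>\<^bsub>IND\<^esub> y = x <#>\<^bsub>FG\<^esub> y" "\<zero>\<^bsub>IND\<^esub> = NN"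
  "a \<odot>\<^bsub>IND\<^esub> K = (\<Union>k\<in>K. NN #>\<^bsub>FG\<^esub> lmult a k)"
  by (simp_all add: induced_def Let_def module_of_group_def FactGroup_def lmult_def)

lemma NN_normal: "NN \<lhd> FG"
  by (rule G.subgroup_imp_normal[OF sub_NN])

lemma IND_comm_group: "comm_group (add_monoid IND)"
proof -
  interpret Q: comm_group "FG Mod NN" by (rule G.abelian_FactGroup[OF sub_NN])
  have eq: "carrier (FG Mod NN) = rcosets\<^bsub>FG\<^esub> NN" "\<one>\<^bsub>FG Mod NN\<^esub> = NN"
    "x \<otimes>\<^bsub>FG Mod NN\<^esub> y = x <#>\<^bsub>FG\<^esub> y" for x y
    by (simp_all add: FactGroup_def)
  show ?thesis
    by (rule comm_groupI, simp_all only: monoid.simps partial_object.simps IND_simps)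
       (use Q.m_closed Q.m_assoc Q.m_comm Q.one_closed Q.l_one Q.l_inv_ex in \<open>simp_all only: eq\<close>)
qed

text \<open>\<open>bext\<close> on cosets; it is constant on each of them because it kills the
  relations. By \<open>Phi_bij\<close> it identifies the induced module with the elements supported
  in \<open>E\<close>.\<close>

definition Phi :: "('a \<times> 'm \<Rightarrow>\<^sub>0 int) set \<Rightarrow> 'k \<Rightarrow>\<^sub>0 'm" where
  "Phi K = bext (SOME z. z \<in> K)"

lemma coset_mem: "y \<in> NN #>\<^bsub>FG\<^esub> z \<longleftrightarrow> y - z \<in> NN"
  by (auto simp: r_coset_def) (metis diff_add_cancel)

lemma Phi_coset: "Phi (NN #>\<^bsub>FG\<^esub> z) = bext z"
proof -
  define y where "y = (SOME y. y \<in> NN #>\<^bsub>FG\<^esub> z)"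
  have "z \<in> NN #>\<^bsub>FG\<^esub> z" by (simp add: coset_mem NN_zero)
  then have "y \<in> NN #>\<^bsub>FG\<^esub> z" unfolding y_def by (rule someI[where P = "\<lambda>y. y \<in> NN #>\<^bsub>FG\<^esub> z"])
  then have "bext (y - z) = 0" by (simp add: coset_mem bext_NN)
  then show ?thesis by (simp add: Phi_def y_def[symmetric] bext_additive)
qed

lemma IND_carrier_iff: "K \<in> carrier IND \<longleftrightarrow> (\<exists>z\<in>carrier FG. K = NN #>\<^bsub>FG\<^esub> z)"
  by (auto simp: IND_simps RCOSETS_def)

lemma coset_eq: "NN #>\<^bsub>FG\<^esub> y = NN #>\<^bsub>FG\<^esub> z \<longleftrightarrow> y - z \<in> NN"
proof
  assume "NN #>\<^bsub>FG\<^esub> y = NN #>\<^bsub>FG\<^esub> z"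
  moreover have "y \<in> NN #>\<^bsub>FG\<^esub> y" by (simp add: coset_mem NN_zero)
  ultimately show "y - z \<in> NN" by (simp add: coset_mem)
next
  assume yz: "y - z \<in> NN"
  have "x - y \<in> NN \<longleftrightarrow> x - z \<in> NN" for x
    using NN_add[OF _ yz, of "x - y"] NN_diff[OF _ yz, of "x - z"] by auto
  then show "NN #>\<^bsub>FG\<^esub> y = NN #>\<^bsub>FG\<^esub> z" using coset_mem by blast
qed

lemma IND_smult:
  assumes "a \<in> carrier A" shows "a \<odot>\<^bsub>IND\<^esub> (NN #>\<^bsub>FG\<^esub> z) = NN #>\<^bsub>FG\<^esub> lmult a z"
proof -
  have "NN #>\<^bsub>FG\<^esub> lmult a y = NN #>\<^bsub>FG\<^esub> lmult a z" if "y \<in> NN #>\<^bsub>FG\<^esub> z" for y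
    using lmult_NN[OF assms, of "y - z"] that by (simp add: coset_mem coset_eq lmult_additive)
  then have "(\<Union>k\<in>NN #>\<^bsub>FG\<^esub> z. NN #>\<^bsub>FG\<^esub> lmult a k) = (\<Union>k\<in>NN #>\<^bsub>FG\<^esub> z. NN #>\<^bsub>FG\<^esub> lmult a z)"
    by (intro SUP_cong refl)
  moreover have "z \<in> NN #>\<^bsub>FG\<^esub> z" by (simp add: coset_mem NN_zero)
  ultimately show ?thesis unfolding IND_simps by auto
qed

lemma Phi_bij: "bij_betw Phi (carrier IND) {w. keys w \<subseteq> E}"
  unfolding bij_betw_def
proof (intro conjI inj_onI)
  fix K L assume "K \<in> carrier IND" "L \<in> carrier IND" and eq: "Phi K = Phi L"
  then obtain y z where yz: "y \<in> carrier FG" "z \<in> carrier FG" "K = NN #>\<^bsub>FG\<^esub> y" "L = NN #>\<^bsub>FG\<^esub> z"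
    unfolding IND_carrier_iff by blast
  have "y - z \<in> carrier FG" using yz keys_diff_subset[of y _ z] by simp
  then have "y - z \<in> NN" using yz eq by (intro bext_eq_0) (simp_all add: Phi_coset bext_additive)
  then show "K = L" by (simp add: yz coset_eq)
next
  show "Phi ` carrier IND = {w. keys w \<subseteq> E}"
  proof (intro subset_antisym subsetI)
  fix w assume "w \<in> Phi ` carrier IND"
  then obtain K where "K \<in> carrier IND" "w = Phi K" by blast
  then obtain z where "z \<in> carrier FG" "w = Phi (NN #>\<^bsub>FG\<^esub> z)" unfolding IND_carrier_iff by blast
  then show "w \<in> {w. keys w \<subseteq> E}" using keys_bext[of z] by (simp add: Phi_coset)
next
  fix w :: "'k \<Rightarrow>\<^sub>0 'm" assume "w \<in> {w. keys w \<subseteq> E}"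
  then obtain z where "z \<in> carrier FG" "bext z = w" using bext_surj[of w] by blast
  then show "w \<in> Phi ` carrier IND"
    by (intro image_eqI[of _ _ "NN #>\<^bsub>FG\<^esub> z"]) (simp add: Phi_coset, unfold IND_carrier_iff, blast)
  qed
qed

lemma Phi_add:
  assumes "K \<in> carrier IND" "L \<in> carrier IND"
  shows "Phi (K \<oplus>\<^bsub>IND\<^esub> L) = Phi K + Phi L"
proof -
  obtain y z where yz: "y \<in> carrier FG" "z \<in> carrier FG" "K = NN #>\<^bsub>FG\<^esub> y" "L = NN #>\<^bsub>FG\<^esub> z"
    using assms unfolding IND_carrier_iff by blast
  then show ?thesis
    unfolding IND_simps using normal.rcos_sum[OF NN_normal yz(1,2)]
    by (simp add: Phi_coset bext_additive)
qed

lemma Phi_smult: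
  assumes "a \<in> carrier A" "K \<in> carrier IND"
  shows "Phi (a \<odot>\<^bsub>IND\<^esub> K) = T a (Phi K)" "a \<odot>\<^bsub>IND\<^esub> K \<in> carrier IND"
proof -
  obtain z where z: "z \<in> carrier FG" "K = NN #>\<^bsub>FG\<^esub> z"
    using assms unfolding IND_carrier_iff by blast
  show "Phi (a \<odot>\<^bsub>IND\<^esub> K) = T a (Phi K)"
    using bext_lmult[OF assms(1) z(1)] by (simp add: z(2) IND_smult[OF assms(1)] Phi_coset)
  show "a \<odot>\<^bsub>IND\<^esub> K \<in> carrier IND"
    using lmult_closed[OF assms(1) z(1)] unfolding z(2) IND_smult[OF assms(1)] IND_carrier_iff by blast
qed

end

section \<open>The standard module\<close>

definition sorted_word :: "(nat \<Rightarrow> nat letter) \<Rightarrow> nat \<Rightarrow> (nat \<Rightarrow> nat) \<Rightarrow> nat letter list" where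
  "sorted_word C n k = concat (map (\<lambda>i. replicate (k i) (C i)) [1..<Suc n])"

lemma count_sorted_word:
  assumes "inj C"
  shows "count (mset (sorted_word C n k)) (C j) = (if j \<in> {1..n} then k j else 0)"
proof (induction n)
  case (Suc n)
  have "sorted_word C (Suc n) k = sorted_word C n k @ replicate (k (Suc n)) (C (Suc n))"
    by (simp add: sorted_word_def)
  then show ?case using Suc by (auto simp: inj_eq[OF assms] le_Suc_eq)
qed (simp add: sorted_word_def)

lemma set_sorted_word: "set (sorted_word C n k) \<subseteq> C ` {1..n}"
  by (auto simp: sorted_word_def)

lemma mset_sorted_word:
  assumes C: "inj C" and u: "set u \<subseteq> C ` {1..n}"
  shows "mset (sorted_word C n (\<lambda>i. count (mset u) (C i))) = mset u"
proof (rule multiset_eqI)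
  fix l
  show "count (mset (sorted_word C n (\<lambda>i. count (mset u) (C i)))) l = count (mset u) l"
  proof (cases "l \<in> C ` {1..n}")
    case True
    then show ?thesis using count_sorted_word[OF C] by auto
  next
    case False
    then show ?thesis using u set_sorted_word[of C n] by (metis count_mset_0_iff subsetD)
  qed
qed

section \<open>Normal ordering in the Cherednik algebra\<close>

context cherednik_alg
begin

lemma CL_mon_Cons:
  assumes "l # u \<in> carrier (words n)" "p permutes {1..n}"
  shows "CL (mon (l # u) p) = CL (mon [l] id) \<otimes>\<^bsub>HA\<^esub> CL (mon u p)"
  using CL_mon_append[of "[l]" u p] assms by (simp add: words_carrier)

lemma CL_mon_move:
  assumes comm: "\<And>l l' w. \<lbrakk>l \<in> L; l' \<in> L; w \<in> carrier (words n)\<rbrakk> \<Longrightarrow> CL (mon (l # l' # w) p) = CL (mon (l' # l # w) p)"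
    and L: "L \<subseteq> LX ` {1..n} \<union> LY ` {1..n}" and p: "p permutes {1..n}"
    and "set u \<subseteq> L" "l \<in> L" "w \<in> carrier (words n)"
  shows "CL (mon (u @ l # w) p) = CL (mon (l # u @ w) p)"
  using assms(4-)
proof (induction u)
  case (Cons x u)
  have in_words: "u @ l # w \<in> carrier (words n)" "l # u @ w \<in> carrier (words n)" "u @ w \<in> carrier (words n)"
    "x # u @ l # w \<in> carrier (words n)" "x # l # u @ w \<in> carrier (words n)"
    using Cons.prems L by (auto simp: words_carrier)
  have "CL (mon ((x # u) @ l # w) p) = CL (mon (x # l # u @ w) p)"
    using CL_mon_Cons[OF in_words(4) p] CL_mon_Cons[OF in_words(5) p] Cons by simp
  also have "\<dots> = CL (mon (l # x # u @ w) p)"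
    using Cons.prems in_words by (intro comm) auto
  finally show ?case by simp
qed simp

text \<open>For pairwise commuting letters only the multiset of the word matters: the first letter
  of u is located in v and moved to the front by \<open>CL_mon_move\<close>.\<close>

lemma CL_mon_sort:
  assumes comm: "\<And>l l' w. \<lbrakk>l \<in> L; l' \<in> L; w \<in> carrier (words n)\<rbrakk> \<Longrightarrow> CL (mon (l # l' # w) p) = CL (mon (l' # l # w) p)"
    and L: "L \<subseteq> LX ` {1..n} \<union> LY ` {1..n}" and p: "p permutes {1..n}"
    and "set u \<subseteq> L" "mset u = mset v"
  shows "CL (mon u p) = CL (mon v p)"
  using assms(4-)
proof (induction u arbitrary: v)
  case (Cons x u)
  then have "x \<in> set v" by (metis list.set_intros(1) mset_eq_setD)
  then obtain v1 v2 where v: "v = v1 @ x # v2" by (meson split_list)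
  have "mset u = mset (v1 @ v2)" using Cons.prems v by simp
  then have IH: "CL (mon u p) = CL (mon (v1 @ v2) p)" using Cons by simp
  have sv: "set v \<subseteq> L" using Cons.prems by (metis mset_eq_setD)
  have w: "x # u \<in> carrier (words n)" "x # v1 @ v2 \<in> carrier (words n)" "v2 \<in> carrier (words n)"
    using Cons.prems(1) sv v L by (auto simp: words_carrier)
  have "CL (mon (x # u) p) = CL (mon (x # v1 @ v2) p)"
    using CL_mon_Cons[OF w(1) p] CL_mon_Cons[OF w(2) p] IH by simp
  also have "\<dots> = CL (mon v p)"
    unfolding v using sv v w(3) by (intro CL_mon_move[OF comm L p, symmetric]) auto
  finally show ?case .
qed simp

lemma CL_mon_swap_LX:
  assumes "l \<in> LX ` {1..n}" "l' \<in> LX ` {1..n}" "w \<in> carrier (words n)" "p permutes {1..n}"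
  shows "CL (mon (l # l' # w) p) = CL (mon (l' # l # w) p)"
proof -
  obtain i j where ij: "l = LX i" "l' = LX j" "i \<in> {1..n}" "j \<in> {1..n}" using assms by blast
  have c: "CL (mon w p) \<in> carrier HA" using assms by (simp add: mon_closed)
  have "hX i \<otimes>\<^bsub>HA\<^esub> (hX j \<otimes>\<^bsub>HA\<^esub> CL (mon w p)) = hX j \<otimes>\<^bsub>HA\<^esub> (hX i \<otimes>\<^bsub>HA\<^esub> CL (mon w p))"
    using hX_comm[OF ij(3,4)] HA.m_assoc[of "hX i" "hX j" "CL (mon w p)"] HA.m_assoc[of "hX j" "hX i" "CL (mon w p)"]
      ij(3,4) c by (simp del: atLeastAtMost_iff)
  then show ?thesis using ij assms by (simp add: CL_mon_LX del: atLeastAtMost_iff)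
qed

lemma CL_mon_swap_LY:
  assumes "l \<in> LY ` {1..n}" "l' \<in> LY ` {1..n}" "w \<in> carrier (words n)" "p permutes {1..n}"
  shows "CL (mon (l # l' # w) p) = CL (mon (l' # l # w) p)"
proof -
  obtain i j where ij: "l = LY i" "l' = LY j" "i \<in> {1..n}" "j \<in> {1..n}" using assms by blast
  have c: "CL (mon w p) \<in> carrier HA" using assms by (simp add: mon_closed)
  have "hY i \<otimes>\<^bsub>HA\<^esub> (hY j \<otimes>\<^bsub>HA\<^esub> CL (mon w p)) = hY j \<otimes>\<^bsub>HA\<^esub> (hY i \<otimes>\<^bsub>HA\<^esub> CL (mon w p))"
    using hY_comm[OF ij(3,4)] HA.m_assoc[of "hY i" "hY j" "CL (mon w p)"] HA.m_assoc[of "hY j" "hY i" "CL (mon w p)"]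
      ij(3,4) c by (simp del: atLeastAtMost_iff)
  then show ?thesis using ij assms by (simp add: CL_mon_LY del: atLeastAtMost_iff)
qed

lemma CL_mon_sort_LX:
  assumes "p permutes {1..n}" "set u \<subseteq> LX ` {1..n}" "mset u = mset v"
  shows "CL (mon u p) = CL (mon v p)"
proof (rule CL_mon_sort[where L = "LX ` {1..n}"])
  show "CL (mon (l # l' # w) p) = CL (mon (l' # l # w) p)"
    if "l \<in> LX ` {1..n}" "l' \<in> LX ` {1..n}" "w \<in> carrier (words n)" for l l' w
    using that assms(1) by (rule CL_mon_swap_LX)
qed (use assms in simp_all)

lemma CL_mon_sort_LY:
  assumes "p permutes {1..n}" "set u \<subseteq> LY ` {1..n}" "mset u = mset v"
  shows "CL (mon u p) = CL (mon v p)"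
proof (rule CL_mon_sort[where L = "LY ` {1..n}"])
  show "CL (mon (l # l' # w) p) = CL (mon (l' # l # w) p)"
    if "l \<in> LY ` {1..n}" "l' \<in> LY ` {1..n}" "w \<in> carrier (words n)" for l l' w
    using that assms(1) by (rule CL_mon_swap_LY)
qed (use assms in simp_all)

definition xy_set :: "free_elt set set" where
  "xy_set = {z \<odot>\<^bsub>HA\<^esub> CL (mon (u @ v) q) |z u v q.
     set u \<subseteq> LX ` {1..n} \<and> set v \<subseteq> LY ` {1..n} \<and> q permutes {1..n}}"

abbreviation "xy_span \<equiv> add_span HA xy_set"

lemma xy_setI: "\<lbrakk>set u \<subseteq> LX ` {1..n}; set v \<subseteq> LY ` {1..n}; q permutes {1..n}\<rbrakk> \<Longrightarrow>
    z \<odot>\<^bsub>HA\<^esub> CL (mon (u @ v) q) \<in> xy_span"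
  by (rule add_span.base) (auto simp: xy_set_def)

lemma xy_word: "\<lbrakk>set u \<subseteq> LX ` {1..n}; set v \<subseteq> LY ` {1..n}\<rbrakk> \<Longrightarrow> u @ v \<in> carrier (words n)"
  by (auto simp: words_carrier)

lemma CL_mon_closed [simp, intro]: "\<lbrakk>u \<in> carrier (words n); p permutes {1..n}\<rbrakk> \<Longrightarrow> CL (mon u p) \<in> carrier HA"
  by (simp add: mon_closed)

lemma xy_span_sub: "x \<in> xy_span \<Longrightarrow> x \<in> carrier HA"
proof (induction rule: add_span.induct)
  case (base s)
  then obtain z u v q where "s = z \<odot>\<^bsub>HA\<^esub> CL (mon (u @ v) q)" "u @ v \<in> carrier (words n)" "q permutes {1..n}"
    unfolding xy_set_def using xy_word by blast
  then show ?case by (simp add: mon_closed)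
qed simp

text \<open>Stability of the span under left multiplication by \<open>a\<close> has to be tested on
  ordered monomials only. Closure under scalars is a premise, since the spanning elements carry
  scalar factors.\<close>

lemma xy_span_left:
  assumes a: "a \<in> carrier HA"
    and gen: "\<And>u v q. \<lbrakk>set u \<subseteq> LX ` {1..n}; set v \<subseteq> LY ` {1..n}; q permutes {1..n}\<rbrakk> \<Longrightarrow>
      a \<otimes>\<^bsub>HA\<^esub> CL (mon (u @ v) q) \<in> xy_span"
    and sm: "\<And>z x. x \<in> xy_span \<Longrightarrow> z \<odot>\<^bsub>HA\<^esub> x \<in> xy_span"
    and x: "x \<in> xy_span"
  shows "a \<otimes>\<^bsub>HA\<^esub> x \<in> xy_span"
  using x
proof (induction rule: add_span.induct)
  case (base s)
  then obtain z u v q where s: "s = z \<odot>\<^bsub>HA\<^esub> CL (mon (u @ v) q)" "set u \<subseteq> LX ` {1..n}" "set v \<subseteq> LY ` {1..n}" "q permutes {1..n}"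
    unfolding xy_set_def by blast
  then show ?case using sm[OF gen[OF s(2-4)], of z] a xy_word[OF s(2,3)]
    by (simp add: HA.mult_smult mon_closed)
next
  case (add x y)
  then show ?case using a xy_span_sub by (simp add: HA.r_distr add_span.add)
qed

lemma xy_span_smult: "x \<in> xy_span \<Longrightarrow> z \<odot>\<^bsub>HA\<^esub> x \<in> xy_span"
proof (induction rule: add_span.induct)
  case (base s)
  then obtain w u v q where s: "s = w \<odot>\<^bsub>HA\<^esub> CL (mon (u @ v) q)" "set u \<subseteq> LX ` {1..n}" "set v \<subseteq> LY ` {1..n}" "q permutes {1..n}"
    unfolding xy_set_def by blast
  then show ?case using xy_setI[OF s(2-4), of "z * w"] xy_word[OF s(2,3)] by (simp add: HA.smult_assoc mon_closed)
next
  case (add x y)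
  then show ?case using xy_span_sub by (simp add: HA.smult_add_right add_span.add)
qed

lemma xy_span_CL: "\<lbrakk>set u \<subseteq> LX ` {1..n}; set v \<subseteq> LY ` {1..n}; q permutes {1..n}\<rbrakk> \<Longrightarrow> CL (mon (u @ v) q) \<in> xy_span"
  using xy_setI[of u v q 1] xy_word[of u v] by (simp add: HA.smult_one_left mon_closed)

lemma xy_span_zero: "\<zero>\<^bsub>HA\<^esub> \<in> xy_span"
  using xy_span_smult[OF xy_span_CL[of "[]" "[]" id], of 0] by (simp add: permutes_id HA.smult_zero_left mon_closed)

lemma xy_span_finsum: "\<lbrakk>finite J; \<And>j. j \<in> J \<Longrightarrow> F j \<in> xy_span\<rbrakk> \<Longrightarrow> (\<Oplus>\<^bsub>HA\<^esub>j\<in>J. F j) \<in> xy_span"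
proof (induction J rule: finite_induct)
  case (insert x J)
  then show ?case using xy_span_sub by (subst HA.finsum_insert) (auto intro!: add_span.add)
qed (simp add: xy_span_zero)

lemma xy_span_hP: "p permutes {1..n} \<Longrightarrow> x \<in> xy_span \<Longrightarrow> hP p \<otimes>\<^bsub>HA\<^esub> x \<in> xy_span"
proof (rule xy_span_left[OF _ _ xy_span_smult])
  fix u v q assume p: "p permutes {1..n}" and uv: "set u \<subseteq> LX ` {1..n}" "set v \<subseteq> LY ` {1..n}" "q permutes {1..n}"
  have i: "p i \<in> {1..n}" if "i \<in> {1..n}" for i using permutes_in_image[OF p] that by blast
  have l: "map_letter p l \<in> LX ` {1..n}" if "l \<in> LX ` {1..n}" for l using that i by (cases l) auto
  have l': "map_letter p l \<in> LY ` {1..n}" if "l \<in> LY ` {1..n}" for l using that i by (cases l) auto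
  have "set (map (map_letter p) u) \<subseteq> LX ` {1..n}" "set (map (map_letter p) v) \<subseteq> LY ` {1..n}"
    unfolding set_map using subsetD[OF uv(1)] subsetD[OF uv(2)] by (intro image_subsetI l l'; simp)+
  from xy_span_CL[OF this permutes_compose[OF uv(3) p]]
  show "hP p \<otimes>\<^bsub>HA\<^esub> CL (mon (u @ v) q) \<in> xy_span"
    using hP_CL_mon[OF xy_word[OF uv(1,2)] p uv(3)] by simp
qed auto

lemma xy_span_hX: "i \<in> {1..n} \<Longrightarrow> x \<in> xy_span \<Longrightarrow> hX i \<otimes>\<^bsub>HA\<^esub> x \<in> xy_span"
proof (rule xy_span_left[OF _ _ xy_span_smult])
  fix u v q assume i: "i \<in> {1..n}" and uv: "set u \<subseteq> LX ` {1..n}" "set v \<subseteq> LY ` {1..n}" "q permutes {1..n}"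
  show "hX i \<otimes>\<^bsub>HA\<^esub> CL (mon (u @ v) q) \<in> xy_span"
    using xy_span_CL[of "LX i # u" v q] i uv CL_mon_LX[OF i xy_word[OF uv(1,2)] uv(3)] by simp
qed auto

text \<open>The only genuine reordering. Moving y_i past the first x-letter costs a commutator in
  the group algebra, which preserves the span; induction on the number of x-letters handles the
  rest.\<close>

lemma xy_span_hY: "i \<in> {1..n} \<Longrightarrow> x \<in> xy_span \<Longrightarrow> hY i \<otimes>\<^bsub>HA\<^esub> x \<in> xy_span"
proof (rule xy_span_left[OF _ _ xy_span_smult])
  fix u v q assume i: "i \<in> {1..n}" and uv: "set u \<subseteq> LX ` {1..n}" "set v \<subseteq> LY ` {1..n}" "q permutes {1..n}"
  show "hY i \<otimes>\<^bsub>HA\<^esub> CL (mon (u @ v) q) \<in> xy_span"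
    using uv(1)
  proof (induction u)
    case Nil
    show ?case using xy_span_CL[of "[]" "LY i # v" q] i uv CL_mon_LY[OF i xy_word[of "[]" v] uv(3)] by simp
  next
    case (Cons l u)
    then obtain j where j: "l = LX j" "j \<in> {1..n}" and u: "set u \<subseteq> LX ` {1..n}" by auto
    let ?C = "CL (mon (u @ v) q)"
    have C: "?C \<in> xy_span" "?C \<in> carrier HA" using xy_span_CL[OF u uv(2,3)] xy_span_sub by auto
    have l: "CL (mon ((l # u) @ v) q) = hX j \<otimes>\<^bsub>HA\<^esub> ?C"
      using CL_mon_LX[OF j(2) xy_word[OF u uv(2)] uv(3)] j by simp
    have tp: "transpose i k permutes {1..n}" if "k \<in> {1..n} - {i}" for k using that i by (auto intro!: transpose_permutes)
    have *: "hY i \<otimes>\<^bsub>HA\<^esub> (hX j \<otimes>\<^bsub>HA\<^esub> ?C) = hX j \<otimes>\<^bsub>HA\<^esub> (hY i \<otimes>\<^bsub>HA\<^esub> ?C) \<oplus>\<^bsub>HA\<^esub> e \<otimes>\<^bsub>HA\<^esub> ?C"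
      if "hY i \<otimes>\<^bsub>HA\<^esub> hX j = hX j \<otimes>\<^bsub>HA\<^esub> hY i \<oplus>\<^bsub>HA\<^esub> e" "e \<in> carrier HA" for e
      using that C i j HA.m_assoc[of "hY i" "hX j" ?C, symmetric]
      by (simp add: HA.l_distr HA.m_assoc del: atLeastAtMost_iff)
    have "hX j \<otimes>\<^bsub>HA\<^esub> (hY i \<otimes>\<^bsub>HA\<^esub> ?C) \<in> xy_span" using Cons.IH[OF u] by (rule xy_span_hX[OF j(2)])
    moreover have "e \<otimes>\<^bsub>HA\<^esub> ?C \<in> xy_span"
      if "e = c \<odot>\<^bsub>HA\<^esub> hP (transpose i j)" "i \<noteq> j" for e
      using xy_span_smult[OF xy_span_hP[OF transpose_permutes[OF i j(2)] C(1)], of c] C(2) transpose_permutes[OF i j(2)]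
      by (simp add: that HA.smult_mult)
    moreover have "commE i \<otimes>\<^bsub>HA\<^esub> ?C \<in> xy_span" "commE i \<in> carrier HA"
    proof -
      let ?S = "\<Oplus>\<^bsub>HA\<^esub>k\<in>{1..n} - {i}. hP (transpose i k)"
      have S: "?S \<in> carrier HA" using tp by (intro HA.finsum_closed) auto
      then show "commE i \<in> carrier HA" by (simp add: commE_def)
      have "?S \<otimes>\<^bsub>HA\<^esub> ?C = (\<Oplus>\<^bsub>HA\<^esub>k\<in>{1..n} - {i}. hP (transpose i k) \<otimes>\<^bsub>HA\<^esub> ?C)"
        using tp C(2) by (intro HA.finsum_ldistr) auto
      also have "\<dots> \<in> xy_span" using tp by (intro xy_span_finsum xy_span_hP C(1)) auto
      finally have "t \<odot>\<^bsub>HA\<^esub> ?C \<oplus>\<^bsub>HA\<^esub> (- 1) \<odot>\<^bsub>HA\<^esub> (c \<odot>\<^bsub>HA\<^esub> (?S \<otimes>\<^bsub>HA\<^esub> ?C)) \<in> xy_span"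
        by (intro add_span.add xy_span_smult C(1))
      also have "t \<odot>\<^bsub>HA\<^esub> ?C \<oplus>\<^bsub>HA\<^esub> (- 1) \<odot>\<^bsub>HA\<^esub> (c \<odot>\<^bsub>HA\<^esub> (?S \<otimes>\<^bsub>HA\<^esub> ?C)) = commE i \<otimes>\<^bsub>HA\<^esub> ?C"
        using S C(2) by (simp add: commE_def a_minus_def HA.l_distr HA.smult_mult HA.l_minus HA.smult_neg_one)
      finally show "commE i \<otimes>\<^bsub>HA\<^esub> ?C \<in> xy_span" .
    qed
    ultimately obtain e where e: "hY i \<otimes>\<^bsub>HA\<^esub> hX j = hX j \<otimes>\<^bsub>HA\<^esub> hY i \<oplus>\<^bsub>HA\<^esub> e" "e \<in> carrier HA"
      "e \<otimes>\<^bsub>HA\<^esub> ?C \<in> xy_span" "hX j \<otimes>\<^bsub>HA\<^esub> (hY i \<otimes>\<^bsub>HA\<^esub> ?C) \<in> xy_span"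
      using hY_hX[OF i j(2)] hY_hX_same[OF i] HA.smult_closed[OF hP_closed[OF transpose_permutes[OF i j(2)]], of c]
      by (cases "i = j") metis+
    show ?case unfolding l *[OF e(1,2)] by (rule add_span.add[OF e(4,3)])
  qed
qed auto

text \<open>The spanning half of PBW. Every word is built from a permutation by left multiplication
  with generators, and each of these preserves the span of ordered monomials.\<close>

lemma xy_span_all: "carrier HA \<subseteq> xy_span"
proof
  fix a assume "a \<in> carrier HA"
  then show "a \<in> xy_span"
  proof (induction rule: cherednik_induct)
    case (add z w p b)
    have "CL (mon w p) \<in> xy_span"
      using add(1)
    proof (induction w)
      case Nil
      then show ?case using xy_span_CL[of "[]" "[]" p] add(2) by simp
    next
      case (Cons l w)
      then show ?case
        by (cases l) (auto simp: CL_mon_LX CL_mon_LY add(2) intro!: xy_span_hX xy_span_hY)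
    qed
    then show ?case by (intro add_span.add xy_span_smult add)
  qed (rule xy_span_zero)
qed

definition poly_exps :: "(nat \<Rightarrow> int) set" where
  "poly_exps = {a. (\<forall>i. 0 \<le> a i) \<and> (\<forall>i. i \<notin> {1..n} \<longrightarrow> a i = 0)}"

definition x_mon :: "(nat \<Rightarrow> int) \<Rightarrow> free_elt set" where
  "x_mon a = CL (mon (sorted_word LX n (\<lambda>i. nat (a i))) id)"

lemma y_word_eq: "y_word n a = sorted_word LY n a"
  by (simp add: y_word_def sorted_word_def)

lemma y_to_cherednik_closed:
  assumes "b \<in> carrier (y_smash n)" shows "y_to_cherednik n t c b \<in> carrier HA"
proof -
  have "cls n t c (basis_elt (y_word n (fst k), snd k)) \<in> carrier HA" if "b k \<noteq> 0" for k
  proof (rule CL_mon_closed)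
    show "y_word n (fst k) \<in> carrier (words n)"
      using set_sorted_word[of LY n] by (auto simp: y_word_eq words_carrier)
    show "snd k permutes {1..n}"
      using assms that by (auto simp: y_smash_def monoid_algebra_carrier semidirect_simps sym_group_carrier)
  qed
  then show ?thesis unfolding y_to_cherednik_def Let_def by (intro HA.finsum_closed) auto
qed

text \<open>Sorting the x-letters and the y-letters of an ordered monomial separately splits it into
  a standard x-monomial and the image of a one-term element of \<open>y_smash n\<close>.\<close>

lemma standard_spanning:
  "carrier HA \<subseteq> add_span HA {x_mon a \<otimes>\<^bsub>HA\<^esub> y_to_cherednik n t c b |a b. a \<in> poly_exps \<and> b \<in> carrier (y_smash n)}"
    (is "_ \<subseteq> add_span HA ?S")
proof
  fix x assume "x \<in> carrier HA"
  then have "x \<in> xy_span" using xy_span_all by blast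
  then show "x \<in> add_span HA ?S"
  proof (induction rule: add_span.induct)
    case (base s)
    then obtain z u v q where s: "s = z \<odot>\<^bsub>HA\<^esub> CL (mon (u @ v) q)" "set u \<subseteq> LX ` {1..n}" "set v \<subseteq> LY ` {1..n}" "q permutes {1..n}"
      unfolding xy_set_def by blast
    \<comment> \<open>The exponents are letter multiplicities; the scalar goes into the one-term
      element \<open>b\<close>.\<close>
    define a where "a = (\<lambda>i. if i \<in> {1..n} then int (count (mset u) (LX i)) else 0)"
    define e where "e = (\<lambda>i. if i \<in> {1..n} then count (mset v) (LY i) else 0)"
    define b :: y_elt where "b = (\<lambda>k. if k = (e, q) then z else 0)"
    have inj: "inj LX" "inj LY" by (auto intro: injI)
    have u: "CL (mon u id) = x_mon a"
    proof -
      have "sorted_word LX n (\<lambda>i. nat (a i)) = sorted_word LX n (\<lambda>i. count (mset u) (LX i))"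
        by (auto simp: sorted_word_def a_def intro!: arg_cong[where f=concat])
      then show ?thesis
        unfolding x_mon_def using mset_sorted_word[OF inj(1) s(2)]
        by (intro CL_mon_sort_LX[OF permutes_id s(2)]) simp
    qed
    have v: "CL (mon v q) = CL (mon (y_word n e) q)"
    proof -
      have "sorted_word LY n e = sorted_word LY n (\<lambda>i. count (mset v) (LY i))"
        by (auto simp: sorted_word_def e_def intro!: arg_cong[where f=concat])
      then show ?thesis
        unfolding y_word_eq using mset_sorted_word[OF inj(2) s(3)]
        by (intro CL_mon_sort_LY[OF s(4,3)]) simp
    qed
    have uw: "u \<in> carrier (words n)" "v \<in> carrier (words n)" using s by (auto simp: words_carrier)
    have b: "b \<in> carrier (y_smash n)"
      using s(4) by (auto simp: b_def e_def y_smash_def monoid_algebra_carrier semidirect_simps sym_group_carrier exponents_def)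
    have "y_to_cherednik n t c b = z \<odot>\<^bsub>HA\<^esub> CL (mon v q)"
    \<comment> \<open>For z = 0 the element \<open>b\<close> has empty support, so its image is an
      empty sum rather than a one-term sum.\<close>
    proof (cases "z = 0")
      case True
      then show ?thesis using uw s(4) by (simp add: y_to_cherednik_def Let_def b_def HA.smult_zero_left mon_closed)
    next
      case False
      then have S: "{k. b k \<noteq> 0} = {(e, q)}" by (auto simp: b_def)
      have cy: "CL (mon (y_word n e) q) \<in> carrier HA" using CL_mon_closed[OF uw(2) s(4)] v by simp
      have "(\<Oplus>\<^bsub>HA\<^esub>k\<in>{(e, q)}. b k \<odot>\<^bsub>HA\<^esub> CL (mon (y_word n (fst k)) (snd k))) = z \<odot>\<^bsub>HA\<^esub> CL (mon (y_word n e) q)"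
        using cy by (subst HA.finsum_insert) (auto simp: b_def)
      then show ?thesis unfolding y_to_cherednik_def Let_def S v .
    qed
    then have "s = x_mon a \<otimes>\<^bsub>HA\<^esub> y_to_cherednik n t c b"
      using CL_mon_append[OF uw s(4)] uw s(4) by (simp add: s(1) HA.mult_smult mon_closed permutes_id flip: u)
    moreover have "a \<in> poly_exps" by (auto simp: poly_exps_def a_def)
    ultimately show ?case using b by (intro add_span.base) blast
  qed (rule add_span.add)
qed

end

section \<open>The standard module as polynomials with coefficients in V\<close>

locale standard_rep = cherednik_alg n t c for n t c +
  fixes sc :: "complex \<Rightarrow> 'v \<Rightarrow> 'v::ab_group_add" and \<rho> :: "(nat \<Rightarrow> nat) \<Rightarrow> 'v \<Rightarrow> 'v"
  assumes n1: "n \<ge> 1" and srep: "sym_rep n sc \<rho>"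

sublocale standard_rep \<subseteq> hecke_rep n t c sc \<rho> "\<lambda>_ _. 0"
  by (rule hecke_rep_zero[OF srep])

context standard_rep
begin

abbreviation "gact \<equiv> group_alg_act n sc \<rho>"
abbreviation "zexp \<equiv> (\<lambda>_. 0) :: nat \<Rightarrow> int"
abbreviation "Mstd \<equiv> pullback y_zero (rep_module n sc \<rho>)"

interpretation V: vector_space sc by (rule vs)

lemma rep_module_simps:
  "carrier (rep_module n sc \<rho>) = UNIV" "x \<oplus>\<^bsub>rep_module n sc \<rho>\<^esub> y = x + y"
  "\<zero>\<^bsub>rep_module n sc \<rho>\<^esub> = 0" "a \<odot>\<^bsub>rep_module n sc \<rho>\<^esub> v = gact a v"
  by (simp_all add: rep_module_def module_of_group_def group_alg_act_def)

lemma pullback_simps: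
  "carrier (pullback g M) = carrier M" "x \<oplus>\<^bsub>pullback g M\<^esub> y = x \<oplus>\<^bsub>M\<^esub> y"
  "b \<odot>\<^bsub>pullback g M\<^esub> x = g b \<odot>\<^bsub>M\<^esub> x"
  by (simp_all add: pullback_def module_of_group_def)

lemma wop_LX:
  "set u \<subseteq> LX ` {1..n} \<Longrightarrow> N.wop u (single b m) = single (\<lambda>i. b i + int (count (mset u) (LX i))) m"
proof (induction u)
  case (Cons l u)
  then obtain j where j: "l = LX j" "set u \<subseteq> LX ` {1..n}" by auto
  have "(\<lambda>i. b i + int (count (mset u) (LX i)))(j := b j + int (count (mset u) (LX j)) + 1) =
      (\<lambda>i. b i + int (count (mset (l # u)) (LX i)))" by (auto simp: j)
  then show ?case using Cons.IH[OF j(2)] j by (simp add: NX_single)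
qed simp

lemma act_x_mon:
  assumes "a \<in> poly_exps" shows "N.act (x_mon a) (single zexp m) = single a m"
proof -
  let ?u = "sorted_word LX n (\<lambda>i. nat (a i))"
  have u: "set ?u \<subseteq> LX ` {1..n}" by (rule set_sorted_word)
  then have w: "?u \<in> carrier (words n)" by (auto simp: words_carrier)
  have "(\<lambda>i. zexp i + int (count (mset ?u) (LX i))) = a"
    using assms by (auto simp: fun_eq_iff count_sorted_word inj_def poly_exps_def)
  then show ?thesis unfolding x_mon_def N.act_mon[OF w permutes_id] NR_id wop_LX[OF u] by simp
qed

text \<open>With Z = 0 the rightmost y already kills a constant, so only the empty word survives.
  This is the inflation of V to the y-smash product.\<close>

lemma wop_LY: "set v \<subseteq> LY ` {1..n} \<Longrightarrow> N.wop v (single zexp m) = (if v = [] then single zexp m else 0)"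
proof (cases v rule: rev_cases)
  case (snoc v' l)
  assume v: "set v \<subseteq> LY ` {1..n}"
  then obtain i where i: "l = LY i" "i \<in> {1..n}" "set v' \<subseteq> LY ` {1..n}" using snoc by auto
  have "ND i (single zexp m) = 0" by (simp add: ND_single_base[OF i(2)])
  moreover have "v' \<in> carrier (words n)" using i by (auto simp: words_carrier)
  ultimately show ?thesis using snoc i lin_opD(3)[OF N.wop_lin] by (simp add: word_op_append)
qed simp

text \<open>The constants are a copy of V on which the y-smash product acts as in the inflated
  module; this is the balancing condition for the standard module.\<close>

lemma act_y_to_cherednik:
  assumes b: "b \<in> carrier (y_smash n)"
  shows "N.act (y_to_cherednik n t c b) (single zexp m) = single zexp (gact (y_zero b) m)"
proof -
  let ?S = "{k. b k \<noteq> 0}" and ?P = "carrier (sym_group n)"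
  let ?T = "Pair (\<lambda>_. 0) ` ?P :: ((nat \<Rightarrow> nat) \<times> (nat \<Rightarrow> nat)) set"
  let ?f = "\<lambda>k :: (nat \<Rightarrow> nat) \<times> (nat \<Rightarrow> nat). if fst k = (\<lambda>_. 0) then single zexp (sc (b k) (\<rho> (snd k) m)) else 0"
  have fin: "finite ?S" and sub: "\<And>k. b k \<noteq> 0 \<Longrightarrow> (\<forall>i. i \<notin> {1..n} \<longrightarrow> fst k i = 0) \<and> snd k permutes {1..n}"
    using b by (auto simp: y_smash_def monoid_algebra_carrier semidirect_simps exponents_def sym_group_carrier)
  have word: "y_word n a \<in> carrier (words n)" "set (y_word n a) \<subseteq> LY ` {1..n}" for a
    using set_sorted_word[of LY n] by (auto simp: y_word_eq words_carrier)
  have nil: "y_word n a = [] \<longleftrightarrow> a = (\<lambda>_. 0)" if "\<forall>i. i \<notin> {1..n} \<longrightarrow> a i = 0" for a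
  proof
    assume e: "y_word n a = []"
    have "a i = 0" for i
    proof (cases "i \<in> {1..n}")
      case True
      then show ?thesis using count_sorted_word[of LY n a i] e by (simp add: y_word_eq inj_def)
    qed (use that in blast)
    then show "a = (\<lambda>_. 0)" by auto
  qed (simp add: y_word_def)
  have cl: "(\<lambda>k. b k \<odot>\<^bsub>HA\<^esub> CL (mon (y_word n (fst k)) (snd k))) \<in> ?S \<rightarrow> carrier HA"
    using sub word(1) by auto
  have "N.act (y_to_cherednik n t c b) (single zexp m) =
      (\<Sum>k\<in>?S. N.act (b k \<odot>\<^bsub>HA\<^esub> CL (mon (y_word n (fst k)) (snd k))) (single zexp m))"
    unfolding y_to_cherednik_def Let_def by (rule N.act_finsum[OF fin cl])
  also have "\<dots> = (\<Sum>k\<in>?S. ?f k)"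
  proof (rule sum.cong[OF refl])
    fix k assume k: "k \<in> ?S"
    then have q: "snd k permutes {1..n}" and e: "\<forall>i. i \<notin> {1..n} \<longrightarrow> fst k i = 0" using sub by auto
    have "zexp \<circ> inv' (snd k) = zexp" by auto
    then have "N.act (b k \<odot>\<^bsub>HA\<^esub> CL (mon (y_word n (fst k)) (snd k))) (single zexp m) =
        NS (b k) (N.wop (y_word n (fst k)) (single zexp (\<rho> (snd k) m)))"
      using word(1) q by (simp add: N.act_smult N.act_mon NR_single)
    then show "N.act (b k \<odot>\<^bsub>HA\<^esub> CL (mon (y_word n (fst k)) (snd k))) (single zexp m) = ?f k"
      using wop_LY[OF word(2)] nil[OF e] by (simp add: NS_single NS_additive)
  qed
  \<comment> \<open>The index set is exchanged through the union: outside the support of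
    \<open>b\<close> the coefficient is 0, and off the pairs with zero exponent the summand is
    0.\<close>
  also have "\<dots> = (\<Sum>k\<in>?S \<union> ?T. ?f k)"
    using fin finite_sym_group[of n] by (intro sum.mono_neutral_left) auto
  also have "\<dots> = (\<Sum>k\<in>?T. ?f k)"
  proof (rule sum.mono_neutral_right)
    show "\<forall>k\<in>?S \<union> ?T - ?T. ?f k = 0"
    proof
      fix k assume k: "k \<in> ?S \<union> ?T - ?T"
      then have "b k \<noteq> 0" by blast
      then have "snd k \<in> ?P" using sub[of k] by (simp add: sym_group_carrier)
      then have "fst k \<noteq> (\<lambda>_. 0)" using k by (metis Diff_iff image_eqI prod.collapse)
      then show "?f k = 0" by simp
    qed
  qed (use fin finite_sym_group[of n] in auto)
  also have "\<dots> = (\<Sum>q\<in>?P. single zexp (sc (b (\<lambda>_. 0, q)) (\<rho> q m)))"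
    by (subst sum.reindex) (auto simp: inj_on_def)
  also have "\<dots> = single zexp (gact (y_zero b) m)"
    unfolding group_alg_act_def y_zero_def by (rule additive_sum[symmetric, where f = "single zexp"]) (rule single_add)
  finally show ?thesis .
qed

text \<open>The tensor a \<otimes> m is sent to \<open>a\<close> applied to the constant
  \<open>m\<close>. Since x^a sends that constant to \<open>single a m\<close>, the tensors x^a
  \<otimes> m land in different components and \<tau> is the identity.\<close>

sublocale D: induction_data HA "y_to_cherednik n t c" "y_smash n" Mstd NS
    "\<lambda>a m. N.act a (single zexp m)" N.act poly_exps x_mon "\<lambda>_ m. m"
proof (rule induction_data.intro[OF HA.ring_axioms], rule induction_data_axioms.intro)
  show "carrier HA \<subseteq> add_span HA {x_mon a \<otimes>\<^bsub>HA\<^esub> y_to_cherednik n t c b |a b. a \<in> poly_exps \<and> b \<in> carrier (y_smash n)}"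
    by (rule standard_spanning)
  show "x_mon a \<in> carrier HA" for a
    unfolding x_mon_def using set_sorted_word[of LX n] by (intro CL_mon_closed permutes_id) (auto simp: words_carrier)
  fix a b m assume a: "a \<in> carrier HA" and b: "b \<in> carrier (y_smash n)"
  show "N.act (a \<otimes>\<^bsub>HA\<^esub> y_to_cherednik n t c b) (single zexp m) = N.act a (single zexp (b \<odot>\<^bsub>Mstd\<^esub> m))"
    using a b y_to_cherednik_closed[OF b]
    by (simp add: N.act_mult act_y_to_cherednik pullback_simps rep_module_simps)
next
  show "bij (\<lambda>m. m)" by (simp add: bij_def inj_def)
qed (simp_all add: pullback_simps rep_module_simps y_to_cherednik_closed NS_vector_space N.act_add N.act_mult
    single_add lin_opD(1)[OF N.act_lin] N.act_lin act_x_mon)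

lemma standard_module_eq: "standard_module n t c sc \<rho> = induced (y_to_cherednik n t c) (y_smash n) HA Mstd"
  by (simp add: standard_module_def)

end

section \<open>The modules induced from parabolic subalgebras\<close>

definition proj :: "'k set \<Rightarrow> ('k \<Rightarrow>\<^sub>0 'm) \<Rightarrow> 'k \<Rightarrow>\<^sub>0 'm::ab_group_add" where
  "proj S = ext_op (\<lambda>k m. if k \<in> S then single k m else 0)"

lemma proj_add: "proj S (x + y) = proj S x + proj S y"
  unfolding proj_def by (rule ext_op_add) (simp add: single_add)

lemma proj_single: "proj S (single k m) = (if k \<in> S then single k m else 0)"
  unfolding proj_def by (rule ext_op_single) (simp add: single_add)

lemmas proj_additive = proj_add additive_zero[of "proj S" for S, OF proj_add]
  additive_diff[of "proj S" for S, OF proj_add]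

lemma lookup_proj: "lookup (proj S w) k = (if k \<in> S then lookup w k else 0)"
  by (rule additive_eqI[where f=w and F="\<lambda>w. lookup (proj S w) k" and G="\<lambda>w. if k \<in> S then lookup w k else 0"])
     (auto simp: proj_add lookup_add proj_single lookup_single when_def)

lemma keys_proj: "keys (proj S w) = keys w \<inter> S"
  by (auto simp: in_keys_iff lookup_proj split: if_splits)

lemma proj_id: "keys w \<subseteq> S \<Longrightarrow> proj S w = w"
  by (rule poly_mapping_eqI) (auto simp: lookup_proj in_keys_iff)

lemma proj_zero: "keys w \<inter> S = {} \<Longrightarrow> proj S w = 0"
  by (rule poly_mapping_eqI) (auto simp: lookup_proj in_keys_iff)

lemma orb_below_disjoint: "orb n a \<inter> below n a = {}"
  by (auto simp: orb_def below_def qform_perm)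

context cherednik_alg
begin

lemma hecke_ring: "ring (hecke n t c)"
  using HA.generate_ring_is_ring[OF hecke_gens] by (simp add: hecke_def gen_subalgebra_def)

definition hz :: "nat \<Rightarrow> free_elt set" where "hz i = hX i \<otimes>\<^bsub>HA\<^esub> hY i"

definition hjm :: "nat \<Rightarrow> free_elt set" where "hjm i = (\<Oplus>\<^bsub>HA\<^esub>j\<in>{1..<i}. hP (transpose i j))"

lemma hjm_summands: "i \<in> {1..n} \<Longrightarrow> (\<lambda>j. hP (transpose i j)) \<in> {1..<i} \<rightarrow> carrier HA"
  by (auto intro!: hP_closed transpose_permutes)

lemma hz_closed [simp, intro]: "i \<in> {1..n} \<Longrightarrow> hz i \<in> carrier HA"
  unfolding hz_def by (intro HA.m_closed hX_closed hY_closed)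

lemma hjm_closed [simp, intro]: "i \<in> {1..n} \<Longrightarrow> hjm i \<in> carrier HA"
  unfolding hjm_def by (intro HA.finsum_closed hjm_summands)

lemma hU_eq: "hU i = hz i \<ominus>\<^bsub>HA\<^esub> c \<odot>\<^bsub>HA\<^esub> hjm i"
  by (simp add: hu_def hz_def hjm_def Let_def)

lemma hP_hz:
  assumes p: "p permutes {1..n}" and i: "i \<in> {1..n}"
  shows "hP p \<otimes>\<^bsub>HA\<^esub> hz i = hz (p i) \<otimes>\<^bsub>HA\<^esub> hP p"
proof -
  have pi: "p i \<in> {1..n}" using permutes_in_image[OF p] i by blast
  note cl = hP_closed[OF p] hX_closed[OF i] hY_closed[OF i] hX_closed[OF pi] hY_closed[OF pi]
  show ?thesis
    unfolding hz_def using cl hP_hX[OF p i] hP_hY[OF p i] HA.m_assoc[of "hP p" "hX i" "hY i"]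
      HA.m_assoc[of "hX (p i)" "hP p" "hY i"] HA.m_assoc[of "hX (p i)" "hY (p i)" "hP p"] by simp
qed

text \<open>The x_i y_i are permuted by S_n, so moving u past a permutation leaves an error
  consisting only of Jucys-Murphy sums multiplied by that permutation, an element of the group
  algebra.\<close>

lemma hU_hP:
  assumes p: "p permutes {1..n}" and j: "j \<in> {1..n}"
  shows "hU (p j) \<otimes>\<^bsub>HA\<^esub> hP p = hP p \<otimes>\<^bsub>HA\<^esub> hU j \<oplus>\<^bsub>HA\<^esub> (c \<odot>\<^bsub>HA\<^esub> (hP p \<otimes>\<^bsub>HA\<^esub> hjm j) \<oplus>\<^bsub>HA\<^esub> (- c) \<odot>\<^bsub>HA\<^esub> (hjm (p j) \<otimes>\<^bsub>HA\<^esub> hP p))"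
proof -
  have pj: "p j \<in> {1..n}" using permutes_in_image[OF p] j by blast
  note cl = hP_closed[OF p] hz_closed[OF j] hz_closed[OF pj] hjm_closed[OF j] hjm_closed[OF pj]
  have neg: "\<ominus>\<^bsub>HA\<^esub> (c \<odot>\<^bsub>HA\<^esub> x) = (- c) \<odot>\<^bsub>HA\<^esub> x" if "x \<in> carrier HA" for x
    using that by (simp add: HA.smult_assoc flip: HA.smult_neg_one)
  let ?a = "hP p \<otimes>\<^bsub>HA\<^esub> hz j" and ?b = "c \<odot>\<^bsub>HA\<^esub> (hP p \<otimes>\<^bsub>HA\<^esub> hjm j)" and ?d = "(- c) \<odot>\<^bsub>HA\<^esub> (hjm (p j) \<otimes>\<^bsub>HA\<^esub> hP p)"
  have "hU (p j) \<otimes>\<^bsub>HA\<^esub> hP p = ?a \<oplus>\<^bsub>HA\<^esub> ?d"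
    unfolding hU_eq a_minus_def using cl by (simp add: neg HA.l_distr HA.smult_mult hP_hz[OF p j])
  moreover have "hP p \<otimes>\<^bsub>HA\<^esub> hU j = ?a \<oplus>\<^bsub>HA\<^esub> (\<ominus>\<^bsub>HA\<^esub> ?b)"
    unfolding hU_eq a_minus_def using cl by (simp add: HA.r_distr HA.r_minus HA.mult_smult)
  moreover have "(?a \<oplus>\<^bsub>HA\<^esub> (\<ominus>\<^bsub>HA\<^esub> ?b)) \<oplus>\<^bsub>HA\<^esub> (?b \<oplus>\<^bsub>HA\<^esub> ?d) = ?a \<oplus>\<^bsub>HA\<^esub> ?d"
    using cl by (simp add: HA.a_assoc HA.r_neg1)
  ultimately show ?thesis by simp
qed

definition perm_span :: "(nat \<Rightarrow> nat) \<Rightarrow> free_elt set set" where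
  "perm_span d = add_span HA {hP p \<otimes>\<^bsub>HA\<^esub> b |p b. p permutes {1..n} \<and> b \<in> carrier (parabolic n t c d)}"

lemma perm_spanI: "\<lbrakk>p permutes {1..n}; b \<in> carrier (parabolic n t c d)\<rbrakk> \<Longrightarrow> hP p \<otimes>\<^bsub>HA\<^esub> b \<in> perm_span d"
  unfolding perm_span_def by (rule add_span.base) blast

lemma perm_span_induct [consumes 1, case_names base add]:
  assumes "x \<in> perm_span d"
    and "\<And>p b. \<lbrakk>p permutes {1..n}; b \<in> carrier (parabolic n t c d)\<rbrakk> \<Longrightarrow> P (hP p \<otimes>\<^bsub>HA\<^esub> b)"
    and "\<And>x y. \<lbrakk>x \<in> perm_span d; y \<in> perm_span d; P x; P y\<rbrakk> \<Longrightarrow> P (x \<oplus>\<^bsub>HA\<^esub> y)"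
  shows "P x"
  using assms(1) unfolding perm_span_def
proof (induction rule: add_span.induct)
  case (base s)
  then obtain p b where "s = hP p \<otimes>\<^bsub>HA\<^esub> b" "p permutes {1..n}" "b \<in> carrier (parabolic n t c d)" by blast
  then show ?case using assms(2) by simp
next
  case (add x y)
  then show ?case by (intro assms(3)) (simp_all add: perm_span_def)
qed

lemma perm_span_add: "\<lbrakk>x \<in> perm_span d; y \<in> perm_span d\<rbrakk> \<Longrightarrow> x \<oplus>\<^bsub>HA\<^esub> y \<in> perm_span d"
  unfolding perm_span_def by (rule add_span.add)

lemma perm_span_sub: "x \<in> perm_span d \<Longrightarrow> x \<in> carrier HA"
  by (induction rule: perm_span_induct) (use parabolic_sub in auto)

lemma perm_span_smult: "x \<in> perm_span d \<Longrightarrow> z \<odot>\<^bsub>HA\<^esub> x \<in> perm_span d"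
proof (induction rule: perm_span_induct)
  case (base p b)
  then show ?case using perm_spanI[OF base(1) parabolic_smult_closed[OF base(2)], of z] parabolic_sub[OF base(2)]
    by (simp add: HA.mult_smult)
next
  case (add x y)
  then show ?case using perm_span_sub perm_span_add by (simp add: HA.smult_add_right)
qed

lemma perm_span_hP:
  assumes p: "p permutes {1..n}" and x: "x \<in> perm_span d"
  shows "hP p \<otimes>\<^bsub>HA\<^esub> x \<in> perm_span d"
  using x
proof (induction rule: perm_span_induct)
  case (base q b)
  then show ?case
    using perm_spanI[OF permutes_compose[OF base(1) p] base(2)] parabolic_sub[OF base(2)]
      HA.m_assoc[of "hP p" "hP q" b] p by (simp add: hP_mult)
next
  case (add x y)
  then show ?case using perm_span_sub perm_span_add p by (simp add: HA.r_distr)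
qed

lemma perm_span_one: "b \<in> carrier (parabolic n t c d) \<Longrightarrow> b \<in> perm_span d"
  using perm_spanI[OF permutes_id, of b d] parabolic_sub[of b d] by (simp only: hP_id HA.l_one)

lemma perm_span_hjm:
  assumes i: "i \<in> {1..n}" and x: "x \<in> perm_span d"
  shows "hjm i \<otimes>\<^bsub>HA\<^esub> x \<in> perm_span d"
proof -
  have fs: "(\<Oplus>\<^bsub>HA\<^esub>j\<in>J. F j) \<in> perm_span d" if "finite J" "\<And>j. j \<in> J \<Longrightarrow> F j \<in> perm_span d" for J :: "nat set" and F
    using that
  proof (induction J rule: finite_induct)
    case empty
    then show ?case using perm_span_smult[OF x, of 0] perm_span_sub[OF x] by (simp add: HA.smult_zero_left)
  next
    case (insert x J)
    then show ?case using perm_span_sub by (subst HA.finsum_insert) (auto intro!: perm_span_add)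
  qed
  have tp: "transpose i j permutes {1..n}" if "j \<in> {1..<i}" for j using that i by (auto intro!: transpose_permutes)
  have "hjm i \<otimes>\<^bsub>HA\<^esub> x = (\<Oplus>\<^bsub>HA\<^esub>j\<in>{1..<i}. hP (transpose i j) \<otimes>\<^bsub>HA\<^esub> x)"
    unfolding hjm_def using hjm_summands[OF i] perm_span_sub[OF x] by (intro HA.finsum_ldistr) auto
  then show ?thesis using fs[of "{1..<i}" "\<lambda>j. hP (transpose i j) \<otimes>\<^bsub>HA\<^esub> x"] perm_span_hP[OF tp x] by simp
qed

text \<open>u_i p equals p u_j plus an error, with j the preimage of i under p; u_j is absorbed by
  the parabolic factor, and the error only involves permutations, which preserve the span.\<close>

lemma perm_span_hU:
  assumes i: "i \<in> {1..n}" and x: "x \<in> perm_span d"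
  shows "hU i \<otimes>\<^bsub>HA\<^esub> x \<in> perm_span d"
  using x
proof (induction rule: perm_span_induct)
  case (base p b)
  define j where "j = inv' p i"
  have j: "j \<in> {1..n}" "p j = i"
    unfolding j_def using permutes_in_image[OF permutes_inv[OF base(1)]] i permutes_inverses[OF base(1)] by auto
  have bH: "b \<in> carrier HA" by (rule parabolic_sub[OF base(2)])
  note cl = hP_closed[OF base(1)] hU_closed[OF j(1)] hU_closed[OF i] hjm_closed[OF j(1)] hjm_closed[OF i] bH
  have "hU i \<otimes>\<^bsub>HA\<^esub> (hP p \<otimes>\<^bsub>HA\<^esub> b) = hP p \<otimes>\<^bsub>HA\<^esub> (hU j \<otimes>\<^bsub>HA\<^esub> b) \<oplus>\<^bsub>HA\<^esub>
      (c \<odot>\<^bsub>HA\<^esub> (hP p \<otimes>\<^bsub>HA\<^esub> (hjm j \<otimes>\<^bsub>HA\<^esub> b)) \<oplus>\<^bsub>HA\<^esub> (- c) \<odot>\<^bsub>HA\<^esub> (hjm i \<otimes>\<^bsub>HA\<^esub> (hP p \<otimes>\<^bsub>HA\<^esub> b)))"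
    using hU_hP[OF base(1) j(1)] cl HA.m_assoc[of "hU i" "hP p" b, symmetric]
    by (simp add: j(2) HA.l_distr HA.smult_mult HA.m_assoc)
  also have "\<dots> \<in> perm_span d"
    by (intro perm_span_add perm_span_smult perm_span_hP perm_span_hjm perm_spanI perm_span_one
        parabolic_closed(2) parabolic_mem(2) base j(1) i)
  finally show ?case .
next
  case (add x y)
  then show ?case using perm_span_sub perm_span_add i by (simp add: HA.r_distr del: atLeastAtMost_iff)
qed

text \<open>The span contains 1 and is stable under left multiplication by all generators, so
  multiplying 1 by \<open>h\<close> stays inside.\<close>

lemma hecke_perm_span:
  assumes h: "h \<in> carrier (hecke n t c)" shows "h \<in> perm_span d"
proof -
  have "\<forall>x\<in>perm_span d. h \<otimes>\<^bsub>HA\<^esub> x \<in> perm_span d"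
    using h
  proof (induction rule: hecke_induct)
    case (scalar z)
    then show ?case using perm_span_sub perm_span_smult by (simp add: HA.smult_mult)
  next
    case (uminus h)
    then show ?case using perm_span_sub hecke_sub[of h] perm_span_smult[of "h \<otimes>\<^bsub>HA\<^esub> _" d "-1"]
      by (metis HA.l_minus HA.m_closed HA.smult_neg_one)
  next
    case (add h k)
    then show ?case using perm_span_sub perm_span_add hecke_sub by (simp add: HA.l_distr)
  next
    case (mult h k)
    then show ?case using perm_span_sub hecke_sub by (simp add: HA.m_assoc)
  qed (use perm_span_hP perm_span_hU in blast)+
  then have "h \<otimes>\<^bsub>HA\<^esub> \<one>\<^bsub>HA\<^esub> \<in> perm_span d" using perm_span_one[OF parabolic_closed(4)] by blast
  then show ?thesis using hecke_sub[OF h] by simp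
qed

end

section \<open>The modules V_d realised on the orbit of x^d\<close>

context standard_rep
begin

interpretation VS: vector_space sc by (rule vs)

abbreviation "OB d \<equiv> orb n (int \<circ> d)"
abbreviation "Mrev d \<equiv> pullback (rev_hom n t c d) (pullback (ev0 n t c) (rep_module n sc \<rho>))"

text \<open>The Hecke action on the orbit component modulo lower terms, realised by projection
  instead of by a quotient.\<close>

definition pact :: "(nat \<Rightarrow> nat) \<Rightarrow> free_elt set \<Rightarrow> ((nat \<Rightarrow> int) \<Rightarrow>\<^sub>0 'v) \<Rightarrow> (nat \<Rightarrow> int) \<Rightarrow>\<^sub>0 'v" where
  "pact d h w = proj (OB d) (N.act h w)"

lemma proj_NS: "proj S (NS z w) = NS z (proj S w)"
proof (rule additive_eqI[where f=w])
  show "proj S (NS z (single k m)) = NS z (proj S (single k m))" for k m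
    by (simp add: NS_single proj_single NS_additive)
qed (simp_all add: NS_add proj_add)

lemma pact_lin: "h \<in> carrier HA \<Longrightarrow> lin_op NS (pact d h)"
  using N.act_lin[of h] by (simp add: lin_op_def pact_def proj_add proj_NS)

lemma pact_below:
  assumes "h \<in> carrier (hecke n t c)" "keys w \<subseteq> below n (int \<circ> d)"
  shows "pact d h w = 0"
  unfolding pact_def using keys_act_below[OF assms] orb_below_disjoint by (intro proj_zero) blast

text \<open>Lower terms may be discarded before or after acting, since they form an invariant
  subspace; this makes \<open>pact\<close> multiplicative on leading vectors.\<close>

lemma pact_proj:
  assumes h: "h \<in> carrier (hecke n t c)" and w: "keys w \<subseteq> OB d \<union> below n (int \<circ> d)"
  shows "pact d h (proj (OB d) w) = pact d h w"
proof -
  have "keys (w - proj (OB d) w) \<subseteq> below n (int \<circ> d)"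
    using w by (auto simp: in_keys_iff lookup_proj lookup_minus split: if_splits)
  from pact_below[OF h this] show ?thesis by (simp add: lin_opD(5)[OF pact_lin[OF hecke_sub[OF h]]])
qed

lemma keys_act_top: "h \<in> carrier (hecke n t c) \<Longrightarrow> keys (N.act h (top d v)) \<subseteq> OB d \<union> below n (int \<circ> d)"
  unfolding top_def by (rule keys_act_single)

text \<open>The balancing condition for V_d. Leading terms and the twisted module are both
  multiplicative, so it suffices to compare generators; for u_i both sides give d_i t minus c times
  the Jucys-Murphy sum at the sorted position.\<close>

lemma lead_parabolic:
  assumes d: "d \<in> Pminus n" and b: "b \<in> carrier (parabolic n t c d)"
  shows "lead d b v (b \<odot>\<^bsub>Mrev d\<^esub> v)"
proof -
  let ?R = "rev_hom n t c d" and ?E = "ev0 n t c" and ?P = "parabolic n t c d"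
  have R: "is_rev d ?R" by (rule is_rev_rev_hom[OF d])
  then have Rh: "?R \<in> alg_hom ?P (parabolic n t c (rev_seq n d))" by (simp add: is_rev_def)
  note Rs = alg_homD[OF Rh, unfolded parabolic_simps]
  note E = ev0_props[OF n1]
  note Es = alg_homD[OF E(1), unfolded hecke_simps]
  have Rc: "?R h \<in> carrier (hecke n t c)" if "h \<in> carrier ?P" for h
    using Rs(1)[OF that] by (rule parabolic_hecke)
  note G = group_alg_act_add[OF srep] group_alg_act_mult[OF srep] group_alg_act_smult[OF srep]
  have sm: "h \<odot>\<^bsub>Mrev d\<^esub> v = gact (?E (?R h)) v" for h v by (simp add: pullback_simps rep_module_simps)
  have one: "gact \<one>\<^bsub>group_alg n\<^esub> v = v" for v
    using group_alg_act_basis[OF srep permutes_id, of v] \<rho>_id by (simp add: group_alg_def monoid_algebra_simps sym_group_one)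
  have neg: "\<ominus>\<^bsub>HA\<^esub> h = (- 1) \<odot>\<^bsub>HA\<^esub> h" if "h \<in> carrier HA" for h using HA.smult_neg_one[OF that] by simp
  show ?thesis unfolding sm using b
  proof (induction arbitrary: v rule: parabolic_induct)
    case (scalar z)
    have "?E (?R (z \<odot>\<^bsub>HA\<^esub> \<one>\<^bsub>HA\<^esub>)) = z \<odot>\<^bsub>group_alg n\<^esub> \<one>\<^bsub>group_alg n\<^esub>"
      using Rs(5)[OF parabolic_closed(4)] Es(5)[OF hecke_closed(4)] by (simp add: Rs(4) Es(4))
    then show ?case using lead_scalar[of d z v] by (simp add: G one)
  next
    case (u i)
    have gi: "sorter n d i \<in> {1..n}" using permutes_in_image[OF sorter_permutes] u by blast
    have "?R (hU i) = hU (sorter n d i) \<oplus>\<^bsub>HA\<^esub> (of_nat (d i) * t) \<odot>\<^bsub>HA\<^esub> \<one>\<^bsub>HA\<^esub>"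
      using R u unfolding is_rev_def by (simp add: sorter_def)
    then have "?E (?R (hU i)) = jm (sorter n d i) \<oplus>\<^bsub>group_alg n\<^esub> (of_nat (d i) * t) \<odot>\<^bsub>group_alg n\<^esub> \<one>\<^bsub>group_alg n\<^esub>"
      using Es(3)[OF hecke_mem(3)[OF gi] hecke_mem(1)] Es(5)[OF hecke_closed(4)] E(3)[OF gi] by (simp add: Es(4))
    \<comment> \<open>The summand 0 stands for Z = 0, so that the shape matches
      \<open>lead_hU\<close>.\<close>
    then have "gact (?E (?R (hU i))) v = sc (of_nat (d i) * t) v + 0
       - sc c (\<Sum>j\<in>{1..<sorter n d i}. \<rho> (transpose (sorter n d i) j) v)"
      using jm_closed[OF gi] by (simp add: G one group_alg_act_jm[OF srep gi])
    then show ?case using lead_hU[OF Pminus_nonincr[OF d] u, of v] by simp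
  next
    case (s i)
    let ?g = "sorter n d i"
    have i': "i \<in> {1..n}" "i + 1 \<in> {1..n}" using s by auto
    have gi: "?g \<in> {1..n}" "?g + 1 \<in> {1..n}"
      using permutes_in_image[OF sorter_permutes[of n d]] i' sorter_Suc[OF s] by metis+
    note tp = transpose_permutes[OF gi]
    have "?R (hs n t c i) = hs n t c ?g" using R s i' unfolding is_rev_def by (simp add: sorter_def)
    then have "gact (?E (?R (hs n t c i))) v = \<rho> (transpose ?g (?g + 1)) v"
      using E(2)[OF tp] group_alg_act_basis[OF srep tp] by (simp add: hs_def)
    then show ?case using lead_hs[OF s, of v] by simp
  next
    case (uminus h)
    have "?E (?R (\<ominus>\<^bsub>HA\<^esub> h)) = (- 1) \<odot>\<^bsub>group_alg n\<^esub> ?E (?R h)"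
      using Rs(5)[OF uminus(1)] Es(5)[OF Rc[OF uminus(1)]] parabolic_sub[OF uminus(1)] by (simp add: neg)
    then have "gact (?E (?R (\<ominus>\<^bsub>HA\<^esub> h))) v = - gact (?E (?R h)) v"
      by (simp add: G)
    then show ?case using lead_uminus[OF parabolic_sub[OF uminus(1)] uminus(2)] by simp
  next
    case (add h k)
    have "gact (?E (?R (h \<oplus>\<^bsub>HA\<^esub> k))) v = gact (?E (?R h)) v + gact (?E (?R k)) v"
      using add(1,2) by (simp add: Rs(3) Es(1,3) Rc G)
    then show ?case
      using lead_add[OF parabolic_sub[OF add(1)] parabolic_sub[OF add(2)] add(3) add(4)] by simp
  next
    case (mult h k)
    have "gact (?E (?R (h \<otimes>\<^bsub>HA\<^esub> k))) v = gact (?E (?R h)) (gact (?E (?R k)) v)"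
      using mult(1,2) by (simp add: Rs(2) Es(1,2) Rc G)
    then show ?case
      using lead_mult[OF parabolic_hecke[OF mult(1)] parabolic_hecke[OF mult(2)] mult(4) mult(3)] by simp
  qed
qed

text \<open>A chosen permutation carrying x^d to x^a. Two choices differ by an element of the
  stabiliser of d, which the parabolic subalgebra absorbs.\<close>

definition wperm :: "(nat \<Rightarrow> nat) \<Rightarrow> (nat \<Rightarrow> int) \<Rightarrow> nat \<Rightarrow> nat" where
  "wperm d a = (SOME p. p permutes {1..n} \<and> (int \<circ> d) \<circ> inv' p = a)"

lemma wperm:
  assumes "a \<in> OB d" shows "wperm d a permutes {1..n}" "(int \<circ> d) \<circ> inv' (wperm d a) = a"
proof -
  obtain q where q: "q permutes {1..n}" "a = (int \<circ> d) \<circ> q" using assms unfolding orb_def by blast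
  have "inv' q permutes {1..n} \<and> (int \<circ> d) \<circ> inv' (inv' q) = a"
    using q permutes_inv[OF q(1)] permutes_inv_inv[OF q(1)] by simp
  then have "wperm d a permutes {1..n} \<and> (int \<circ> d) \<circ> inv' (wperm d a) = a"
    unfolding wperm_def by (rule someI[where P = "\<lambda>p. p permutes {1..n} \<and> (int \<circ> d) \<circ> inv' p = a"])
  then show "wperm d a permutes {1..n}" "(int \<circ> d) \<circ> inv' (wperm d a) = a" by blast+
qed

text \<open>Any p factors as w q, with w the chosen coset representative and q in the stabiliser of
  d; the image of q is absorbed into the parabolic factor.\<close>

lemma parabolic_spanning:
  assumes d: "d \<in> Pminus n"
  shows "carrier (hecke n t c) \<subseteq> add_span (hecke n t c)
    {hP (wperm d a) \<otimes>\<^bsub>hecke n t c\<^esub> b |a b. a \<in> OB d \<and> b \<in> carrier (parabolic n t c d)}" (is "_ \<subseteq> add_span _ ?S")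
proof
  fix h assume "h \<in> carrier (hecke n t c)"
  then have "h \<in> perm_span d" by (rule hecke_perm_span)
  then show "h \<in> add_span (hecke n t c) ?S"
  proof (induction rule: perm_span_induct)
    case (base p b)
    let ?a = "(int \<circ> d) \<circ> inv' p"
    have a: "?a \<in> OB d" by (rule orbI[OF permutes_inv[OF base(1)]])
    define w where "w = wperm d ?a"
    have w: "w permutes {1..n}" "(int \<circ> d) \<circ> inv' w = ?a" using wperm[OF a] by (simp_all add: w_def)
    define q where "q = inv' w \<circ> p"
    have q: "q permutes {1..n}" unfolding q_def by (rule permutes_compose[OF base(1) permutes_inv[OF w(1)]])
    have "(int \<circ> d) \<circ> q = int \<circ> d"
    proof
      fix i
      have "((int \<circ> d) \<circ> q) i = ((int \<circ> d) \<circ> inv' w) (p i)" by (simp add: q_def)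
      also have "\<dots> = (int \<circ> d) i" unfolding w(2) by (simp add: permutes_inverses[OF base(1)])
      finally show "((int \<circ> d) \<circ> q) i = (int \<circ> d) i" .
    qed
    then have "d \<circ> q = d" by (auto simp: fun_eq_iff)
    \<comment> \<open>Here d must be non-increasing: equal entries are then adjacent, so the
      stabiliser is generated by the s_i that lie in the parabolic subalgebra.\<close>
    then have "stab_gen n d q" using nonincr_rearrangement[OF Pminus_nonincr[OF d] q] Pminus_nonincr[OF d] by simp
    then have "q permutes {1..n} \<and> hP q \<in> carrier (parabolic n t c d)"
      by (rule hP_stab_induct) (rule parabolic_closed(4), rule parabolic_closed(2), assumption, rule parabolic_mem(3))
    then have qb: "hP q \<otimes>\<^bsub>HA\<^esub> b \<in> carrier (parabolic n t c d)" using base(2) by (intro parabolic_closed) auto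
    have "p = w \<circ> q" by (auto simp: q_def fun_eq_iff permutes_inverses[OF w(1)])
    then have "hP p \<otimes>\<^bsub>HA\<^esub> b = hP w \<otimes>\<^bsub>HA\<^esub> (hP q \<otimes>\<^bsub>HA\<^esub> b)"
      using HA.m_assoc[of "hP w" "hP q" b] w(1) q parabolic_sub[OF base(2)] hP_mult[OF w(1) q] by simp
    then have "hP p \<otimes>\<^bsub>HA\<^esub> b \<in> ?S" unfolding hecke_simps w_def using a qb by blast
    then show ?case by (rule add_span.base)
  next
    case (add x y)
    show ?case using add_span.add[OF add(3,4)] unfolding hecke_simps .
  qed
qed

text \<open>The tensor h \<otimes> v corresponds to \<open>h\<close> acting on the leading vector of
  v, modulo lower terms. Coset representatives spread this vector over the orbit of x^d, each
  twisting the coefficient by an invertible operator.\<close>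

lemma V_induction_data:
  assumes d: "d \<in> Pminus n"
  shows "induction_data (hecke n t c) (\<lambda>h. h) (parabolic n t c d) (Mrev d) NS
    (\<lambda>h v. pact d h (top d v)) (pact d) (OB d) (\<lambda>a. hP (wperm d a)) (\<lambda>a v. \<rho> (wperm d a) (\<rho> (inv' (sorter n d)) v))"
proof (rule induction_data.intro[OF hecke_ring], rule induction_data_axioms.intro)
  show "carrier (hecke n t c) \<subseteq> add_span (hecke n t c)
    {hP (wperm d k) \<otimes>\<^bsub>hecke n t c\<^esub> b |k b. k \<in> OB d \<and> b \<in> carrier (parabolic n t c d)}"
    by (rule parabolic_spanning[OF d])
next
  fix a b v assume a: "a \<in> carrier (hecke n t c)" and b: "b \<in> carrier (parabolic n t c d)"
  have bh: "b \<in> carrier (hecke n t c)" by (rule parabolic_hecke[OF b])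
  have "pact d (a \<otimes>\<^bsub>HA\<^esub> b) (top d v) = pact d a (N.act b (top d v))"
    using hecke_sub[OF a] hecke_sub[OF bh] by (simp add: pact_def N.act_mult)
  also have "\<dots> = pact d a (top d (b \<odot>\<^bsub>Mrev d\<^esub> v))"
    using pact_below[OF a lead_parabolic[OF d b, of v, unfolded lead_def]]
    by (simp add: lin_opD(5)[OF pact_lin[OF hecke_sub[OF a]]])
  finally show "pact d (a \<otimes>\<^bsub>hecke n t c\<^esub> b) (top d v) = pact d a (top d (b \<odot>\<^bsub>Mrev d\<^esub> v))" by (simp add: hecke_simps)
next
  fix a a' v assume a: "a \<in> carrier (hecke n t c)" "a' \<in> carrier (hecke n t c)"
  show "pact d (a \<otimes>\<^bsub>hecke n t c\<^esub> a') (top d v) = pact d a (pact d a' (top d v))"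
    unfolding pact_def[of d a'] pact_proj[OF a(1) keys_act_top[OF a(2)]]
    using hecke_sub[OF a(1)] hecke_sub[OF a(2)] by (simp add: pact_def N.act_mult hecke_simps)
  show "pact d (a \<oplus>\<^bsub>hecke n t c\<^esub> a') (top d v) = pact d a (top d v) + pact d a' (top d v)"
    using hecke_sub[OF a(1)] hecke_sub[OF a(2)] by (simp add: pact_def N.act_add proj_add hecke_simps)
next
  fix k v assume k: "k \<in> OB d"
  note w = wperm[OF k]
  show "pact d (hP (wperm d k)) (top d v) = single k (\<rho> (wperm d k) (\<rho> (inv' (sorter n d)) v))"
    using k by (simp add: pact_def top_def N.act_gens(3)[OF w(1)] NR_single[OF w(1)] w(2) proj_single)
  show "bij (\<lambda>v. \<rho> (wperm d k) (\<rho> (inv' (sorter n d)) v))"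
  proof (rule o_bij[of "\<lambda>v. \<rho> (sorter n d) (\<rho> (inv' (wperm d k)) v)"])
    note p = w(1) permutes_inv[OF w(1)] sorter_permutes inv_sorter_permutes
    have r: "\<rho> p (\<rho> (inv' p) x) = x" "\<rho> (inv' p) (\<rho> p x) = x" if "p permutes {1..n}" for p x
      using \<rho>_comp[OF that permutes_inv[OF that]] \<rho>_comp[OF permutes_inv[OF that] that]
        permutes_inv_o[OF that] \<rho>_id by (metis)+
    show "(\<lambda>v. \<rho> (sorter n d) (\<rho> (inv' (wperm d k)) v)) \<circ> (\<lambda>v. \<rho> (wperm d k) (\<rho> (inv' (sorter n d)) v)) = id"
      "(\<lambda>v. \<rho> (wperm d k) (\<rho> (inv' (sorter n d)) v)) \<circ> (\<lambda>v. \<rho> (sorter n d) (\<rho> (inv' (wperm d k)) v)) = id"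
      using r[OF w(1)] r[OF sorter_permutes] by (auto simp: fun_eq_iff)
  qed
  show "hP (wperm d k) \<in> carrier (hecke n t c)" by (rule hecke_mem(2)[OF w(1)])
next
  show "b \<in> carrier (hecke n t c)" if "b \<in> carrier (parabolic n t c d)" for b
    using that by (rule parabolic_hecke)
  show "lin_op NS (pact d a)" if "a \<in> carrier (hecke n t c)" for a
    using that by (rule pact_lin[OF hecke_sub])
  show "pact d a (top d (m + m')) = pact d a (top d m) + pact d a (top d m')" if "a \<in> carrier (hecke n t c)" for a m m'
    using lin_opD(1)[OF pact_lin[OF hecke_sub[OF that]]] by (simp add: top_add)
qed (simp_all add: pullback_simps rep_module_simps NS_vector_space)

lemma V_ind_eq: "V_ind n t c sc \<rho> d = induced (\<lambda>h. h) (parabolic n t c d) (hecke n t c) (Mrev d)"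
  by (simp add: V_ind_def)

end

section \<open>The filtration\<close>

text \<open>Finite levels allow the elements of \<open>D\<close> to be ranked level by level; since
  \<open>D\<close> is infinite, enumerating the ranks in increasing order indexes it by all natural
  numbers.\<close>

lemma enumeration_exists:
  fixes Q :: "'d \<Rightarrow> nat"
  assumes inf: "infinite D" and fin: "\<And>m. finite {d \<in> D. Q d = m}"
  shows "\<exists>e :: nat \<Rightarrow> 'd. bij_betw e UNIV D \<and> (\<forall>i j. i \<le> j \<longrightarrow> Q (e i) \<le> Q (e j))"
proof -
  let ?L = "\<lambda>m. {d \<in> D. Q d = m}"
  have "\<forall>m. \<exists>h. bij_betw h (?L m) {0..<card (?L m)}" by (intro allI ex_bij_betw_finite_nat fin)
  from choice[OF this] obtain idx where idx: "\<And>m. bij_betw (idx m) (?L m) {0..<card (?L m)}" by blast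
  \<comment> \<open>The number of elements in all lower levels plus a position within the own level,
    so ranks of different levels cannot overlap.\<close>
  define \<kappa> where "\<kappa> d = (\<Sum>l<Q d. card (?L l)) + idx (Q d) d" for d
  have lt: "\<kappa> d < \<kappa> d'" if "d \<in> D" "d' \<in> D" "Q d < Q d'" for d d'
  proof -
    have "idx (Q d) d < card (?L (Q d))" using bij_betwE[OF idx[of "Q d"]] that by auto
    then have "\<kappa> d < (\<Sum>l<Suc (Q d). card (?L l))" by (simp add: \<kappa>_def)
    also have "\<dots> \<le> (\<Sum>l<Q d'. card (?L l))" using that by (intro sum_mono2) auto
    finally show ?thesis by (simp add: \<kappa>_def)
  qed
  have inj: "inj_on \<kappa> D"
  proof (rule inj_onI)
    fix d d' assume d: "d \<in> D" "d' \<in> D" "\<kappa> d = \<kappa> d'"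
    then have Q: "Q d = Q d'" using lt[of d d'] lt[of d' d] by (metis less_irrefl linorder_neqE_nat)
    then have "idx (Q d) d = idx (Q d) d'" using d by (simp add: \<kappa>_def)
    then show "d = d'" using bij_betw_imp_inj_on[OF idx[of "Q d"]] d Q by (auto simp: inj_on_def)
  qed
  let ?N = "\<kappa> ` D"
  have infN: "infinite ?N" using inf finite_imageD[OF _ inj] by blast
  define e where "e = inv_into D \<kappa> \<circ> enumerate ?N"
  have bij: "bij_betw e UNIV D"
    unfolding e_def
    by (rule bij_betw_trans[OF bij_enumerate[OF infN]]) (rule bij_betw_inv_into[OF inj_on_imp_bij_betw[OF inj]])
  have \<kappa>e: "\<kappa> (e i) = enumerate ?N i" and eD: "e i \<in> D" for i
    using enumerate_in_set[OF infN, of i] unfolding e_def by (auto simp: f_inv_into_f inv_into_into)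
  have mono: "Q (e i) \<le> Q (e j)" if "i \<le> j" for i j
  proof (rule ccontr)
    assume "\<not> Q (e i) \<le> Q (e j)"
    then have "enumerate ?N j < enumerate ?N i" using lt[OF eD eD, of j i] by (simp add: \<kappa>e)
    then show False using that infN enumerate_mono[of i j ?N] by (cases "i = j") auto
  qed
  show ?thesis by (intro exI[of _ e] conjI allI impI bij mono)
qed

lemma infinite_Pminus:
  assumes "n \<ge> 1" shows "infinite (Pminus n)"
proof -
  let ?f = "\<lambda>m i. if i \<in> {1..n} then m else (0::nat)"
  have "inj ?f"
  proof (rule injI)
    fix x y assume "?f x = ?f y"
    then have "?f x 1 = ?f y 1" by (rule fun_cong)
    then show "x = y" using assms by simp
  qed
  moreover have "range ?f \<subseteq> Pminus n" by (auto simp: Pminus_def)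
  ultimately show ?thesis using range_inj_infinite finite_subset by blast
qed

text \<open>Each entry is bounded by its square and hence by the sum of squares.\<close>

lemma finite_Pminus_qform: "finite {d \<in> Pminus n. nat (qform n (int \<circ> d)) = m}"
proof (rule finite_subset)
  let ?S = "{f. \<forall>x. (x \<in> {1..n} \<longrightarrow> f x \<in> {0..m}) \<and> (x \<notin> {1..n} \<longrightarrow> f x = (0::nat))}"
  show "finite ?S" by (rule finite_set_of_finite_funs) auto
  show "{d \<in> Pminus n. nat (qform n (int \<circ> d)) = m} \<subseteq> ?S"
  proof (rule subsetI, rule CollectI, rule allI)
    fix d x assume d: "d \<in> {d \<in> Pminus n. nat (qform n (int \<circ> d)) = m}"
    have "d x \<le> m" if x: "x \<in> {1..n}"
    proof -
      have "int (d x) \<le> (int (d x))\<^sup>2" unfolding power2_eq_square of_nat_mult[symmetric] of_nat_le_iff by (rule le_square)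
      also have "\<dots> \<le> (\<Sum>i\<in>{1..n}. ((int \<circ> d) i)\<^sup>2)"
        using member_le_sum[OF x, of "\<lambda>i. ((int \<circ> d) i)\<^sup>2"] by simp
      also have "\<dots> = int m"
      proof -
        have "0 \<le> qform n (int \<circ> d)" unfolding qform_def by (intro sum_nonneg) simp
        then show ?thesis using d unfolding qform_def by auto
      qed
      finally show ?thesis by simp
    qed
    then show "(x \<in> {1..n} \<longrightarrow> d x \<in> {0..m}) \<and> (x \<notin> {1..n} \<longrightarrow> d x = 0)" using d by (auto simp: Pminus_def)
  qed
qed

text \<open>An orbit contains only one non-increasing sequence, so distinct d give disjoint orbits
  and each d is used in one step only.\<close>

lemma orb_Pminus_inj:
  assumes d: "d \<in> Pminus n" and d': "d' \<in> Pminus n" and a: "a \<in> orb n (int \<circ> d)" "a \<in> orb n (int \<circ> d')"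
  shows "d = d'"
proof -
  obtain p q where p: "p permutes {1..n}" "a = (int \<circ> d) \<circ> p" and q: "q permutes {1..n}" "a = (int \<circ> d') \<circ> q"
    using a unfolding orb_def by blast
  let ?r = "p \<circ> inv' q"
  have r: "?r permutes {1..n}" by (rule permutes_compose[OF permutes_inv[OF q(1)] p(1)])
  have eq: "d \<circ> ?r = d'"
  proof
    fix i
    have "int ((d \<circ> ?r) i) = a (inv' q i)" by (simp add: p(2))
    also have "\<dots> = int (d' i)" by (simp add: q(2) permutes_inverses[OF q(1)])
    finally show "(d \<circ> ?r) i = d' i" by simp
  qed
  then have "nonincr n (d \<circ> ?r)" using Pminus_nonincr[OF d'] by simp
  then show ?thesis using nonincr_rearrangement[OF Pminus_nonincr[OF d] r] eq by simp
qed

text \<open>Subquotient and induced module are compared through a common concrete model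
  \<open>W\<close> with operators \<open>T\<close>; inverting the second identification yields the
  isomorphism.\<close>

lemma module_isomorphic_via:
  fixes W :: "'w::plus set"
  assumes 1: "bij_betw \<Psi>1 (carrier M1) W"
    and add1: "\<And>x y. \<lbrakk>x \<in> carrier M1; y \<in> carrier M1\<rbrakk> \<Longrightarrow> \<Psi>1 (x \<oplus>\<^bsub>M1\<^esub> y) = \<Psi>1 x + \<Psi>1 y"
    and T1: "\<And>a x. \<lbrakk>a \<in> carrier A; x \<in> carrier M1\<rbrakk> \<Longrightarrow> \<Psi>1 (a \<odot>\<^bsub>M1\<^esub> x) = T a (\<Psi>1 x)"
    and 2: "bij_betw \<Psi>2 (carrier M2) W"
    and add2: "\<And>x y. \<lbrakk>x \<in> carrier M2; y \<in> carrier M2\<rbrakk> \<Longrightarrow> \<Psi>2 (x \<oplus>\<^bsub>M2\<^esub> y) = \<Psi>2 x + \<Psi>2 y"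
    and T2: "\<And>a x. \<lbrakk>a \<in> carrier A; x \<in> carrier M2\<rbrakk> \<Longrightarrow> \<Psi>2 (a \<odot>\<^bsub>M2\<^esub> x) = T a (\<Psi>2 x)"
    and cl: "\<And>x y. \<lbrakk>x \<in> carrier M2; y \<in> carrier M2\<rbrakk> \<Longrightarrow> x \<oplus>\<^bsub>M2\<^esub> y \<in> carrier M2"
      "\<And>a x. \<lbrakk>a \<in> carrier A; x \<in> carrier M2\<rbrakk> \<Longrightarrow> a \<odot>\<^bsub>M2\<^esub> x \<in> carrier M2"
  shows "module_isomorphic A M1 M2"
proof -
  define g where "g = inv_into (carrier M2) \<Psi>2"
  have g: "bij_betw g W (carrier M2)" unfolding g_def by (rule bij_betw_inv_into[OF 2])
  have gw: "g w \<in> carrier M2" "\<Psi>2 (g w) = w" if "w \<in> W" for w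
    using bij_betwE[OF g] that bij_betw_inv_into_right[OF 2 that] by (auto simp: g_def)
  have gi: "g (\<Psi>2 x) = x" if "x \<in> carrier M2" for x unfolding g_def by (rule bij_betw_inv_into_left[OF 2 that])
  have W: "\<Psi>1 x \<in> W" if "x \<in> carrier M1" for x using bij_betwE[OF 1] that by blast
  have "(g \<circ> \<Psi>1) (x \<oplus>\<^bsub>M1\<^esub> y) = (g \<circ> \<Psi>1) x \<oplus>\<^bsub>M2\<^esub> (g \<circ> \<Psi>1) y" if "x \<in> carrier M1" "y \<in> carrier M1" for x y
    using gi[OF cl(1)[OF gw(1)[OF W[OF that(1)]] gw(1)[OF W[OF that(2)]]]] that
    by (simp add: add1 add2 gw W)
  moreover have "(g \<circ> \<Psi>1) (a \<odot>\<^bsub>M1\<^esub> x) = a \<odot>\<^bsub>M2\<^esub> (g \<circ> \<Psi>1) x" if "a \<in> carrier A" "x \<in> carrier M1" for a x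
    using gi[OF cl(2)[OF that(1) gw(1)[OF W[OF that(2)]]]] that
    by (simp add: T1 T2 gw W)
  ultimately show ?thesis
    unfolding module_isomorphic_def using bij_betw_trans[OF 1 g] by (intro exI[of _ "g \<circ> \<Psi>1"]) blast
qed

text \<open>The first isomorphism theorem for an additive map defined on \<open>L\<close> with
  kernel \<open>N\<close>, stated with the coset encoding of \<open>subquotient\<close> and with
  operators transported along the map.\<close>

lemma subquotient_iso:
  fixes Mo :: "('a, 'm) module" and \<psi> :: "'m \<Rightarrow> 'w::ab_group_add"
  assumes G: "comm_group (add_monoid Mo)"
    and L: "subgroup L (add_monoid Mo)" and N: "subgroup N (add_monoid Mo)" and NL: "N \<subseteq> L"
    and add: "\<And>x y. \<lbrakk>x \<in> L; y \<in> L\<rbrakk> \<Longrightarrow> \<psi> (x \<oplus>\<^bsub>Mo\<^esub> y) = \<psi> x + \<psi> y"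
    and ker: "\<And>x. x \<in> L \<Longrightarrow> \<psi> x = 0 \<longleftrightarrow> x \<in> N"
    and sm: "\<And>a x. \<lbrakk>a \<in> S; x \<in> L\<rbrakk> \<Longrightarrow> a \<odot>\<^bsub>Mo\<^esub> x \<in> L"
    and T: "\<And>a x. \<lbrakk>a \<in> S; x \<in> L\<rbrakk> \<Longrightarrow> \<psi> (a \<odot>\<^bsub>Mo\<^esub> x) = T a (\<psi> x)"
  obtains \<Psi> where "bij_betw \<Psi> (carrier (subquotient Mo L N)) (\<psi> ` L)"
    "\<And>x y. \<lbrakk>x \<in> carrier (subquotient Mo L N); y \<in> carrier (subquotient Mo L N)\<rbrakk> \<Longrightarrow>
      \<Psi> (x \<oplus>\<^bsub>subquotient Mo L N\<^esub> y) = \<Psi> x + \<Psi> y"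
    "\<And>a x. \<lbrakk>a \<in> S; x \<in> carrier (subquotient Mo L N)\<rbrakk> \<Longrightarrow> \<Psi> (a \<odot>\<^bsub>subquotient Mo L N\<^esub> x) = T a (\<Psi> x)"
proof -
  let ?A = "add_monoid Mo" and ?Q = "subquotient Mo L N"
  interpret A: comm_group ?A by (rule G)
  have Lc: "x \<in> carrier ?A" if "x \<in> L" for x using subgroup.mem_carrier[OF L that] .
  have car: "K \<in> carrier ?Q \<longleftrightarrow> (\<exists>x\<in>L. K = N #>\<^bsub>?A\<^esub> x)" for K
    by (auto simp: subquotient_def module_of_group_def A_FactGroup_def FactGroup_def RCOSETS_def r_coset_def)
  have plus: "K \<oplus>\<^bsub>?Q\<^esub> K' = K <#>\<^bsub>?A\<^esub> K'" for K K'
    by (simp add: subquotient_def module_of_group_def A_FactGroup_def FactGroup_def set_mult_def)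
  have smq: "a \<odot>\<^bsub>?Q\<^esub> K = (\<Union>k\<in>K. N #>\<^bsub>?A\<^esub> (a \<odot>\<^bsub>Mo\<^esub> k))" for a K
    by (simp add: subquotient_def module_of_group_def a_r_coset_def)
  define \<Psi> where "\<Psi> K = \<psi> (SOME x. x \<in> K)" for K
  have mem: "y \<in> L" "\<psi> y = \<psi> x" if x: "x \<in> L" and y: "y \<in> N #>\<^bsub>?A\<^esub> x" for x y
  proof -
    obtain m where m: "m \<in> N" "y = m \<oplus>\<^bsub>Mo\<^esub> x" using y by (auto simp: r_coset_def)
    then have mL: "m \<in> L" using NL by blast
    show "y \<in> L" using subgroup.m_closed[OF L mL x] m by simp
    show "\<psi> y = \<psi> x" using add[OF mL x] ker[OF mL] m by simp
  qed
  have self: "x \<in> N #>\<^bsub>?A\<^esub> x" if "x \<in> L" for x using A.rcos_self[OF Lc[OF that] N] .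
  have \<Psi>c: "\<Psi> (N #>\<^bsub>?A\<^esub> x) = \<psi> x" if "x \<in> L" for x
    unfolding \<Psi>_def by (rule mem(2)[OF that], rule someI[where P = "\<lambda>y. y \<in> N #>\<^bsub>?A\<^esub> x"], rule self[OF that])
  have \<psi>inv: "\<psi> (inv\<^bsub>?A\<^esub> x) = - \<psi> x" if "x \<in> L" for x
  proof -
    have i: "inv\<^bsub>?A\<^esub> x \<in> L" by (rule subgroup.m_inv_closed[OF L that])
    have "\<zero>\<^bsub>Mo\<^esub> \<in> N" using subgroup.one_closed[OF N] by simp
    then have "\<psi> (\<zero>\<^bsub>Mo\<^esub>) = 0" using ker NL by blast
    moreover have "inv\<^bsub>?A\<^esub> x \<oplus>\<^bsub>Mo\<^esub> x = \<zero>\<^bsub>Mo\<^esub>" using A.l_inv[OF Lc[OF that]] by simp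
    ultimately have "\<psi> (inv\<^bsub>?A\<^esub> x) + \<psi> x = 0" using add[OF i that] by simp
    then show ?thesis by (simp add: eq_neg_iff_add_eq_0)
  qed
  have eq: "N #>\<^bsub>?A\<^esub> x = N #>\<^bsub>?A\<^esub> y" if xy: "x \<in> L" "y \<in> L" "\<psi> x = \<psi> y" for x y
  proof -
    have i: "inv\<^bsub>?A\<^esub> x \<in> L" by (rule subgroup.m_inv_closed[OF L xy(1)])
    have yx: "y \<oplus>\<^bsub>Mo\<^esub> inv\<^bsub>?A\<^esub> x \<in> L" using subgroup.m_closed[OF L xy(2) i] by simp
    have "y \<oplus>\<^bsub>Mo\<^esub> inv\<^bsub>?A\<^esub> x \<in> N" using ker[OF yx] add[OF xy(2) i] \<psi>inv[OF xy(1)] xy(3) by simp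
    moreover have "y = (y \<oplus>\<^bsub>Mo\<^esub> inv\<^bsub>?A\<^esub> x) \<oplus>\<^bsub>Mo\<^esub> x"
      using A.inv_solve_right'[of "y \<oplus>\<^bsub>Mo\<^esub> inv\<^bsub>?A\<^esub> x" y x] Lc[OF xy(1)] Lc[OF xy(2)] Lc[OF yx] A.m_assoc[of y "inv\<^bsub>?A\<^esub> x" x]
      by simp
    ultimately have "y \<in> N #>\<^bsub>?A\<^esub> x" unfolding r_coset_def by auto
    then show ?thesis by (rule A.repr_independence[OF _ Lc[OF xy(1)] N])
  qed
  have "bij_betw \<Psi> (carrier ?Q) (\<psi> ` L)"
    unfolding bij_betw_def
  proof
    show "inj_on \<Psi> (carrier ?Q)" by (rule inj_onI) (use car \<Psi>c eq in metis)
    show "\<Psi> ` carrier ?Q = \<psi> ` L"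
    proof
      show "\<Psi> ` carrier ?Q \<subseteq> \<psi> ` L" using car \<Psi>c by auto
      show "\<psi> ` L \<subseteq> \<Psi> ` carrier ?Q"
      proof (rule image_subsetI)
        fix x assume x: "x \<in> L"
        show "\<psi> x \<in> \<Psi> ` carrier ?Q"
          by (rule image_eqI[of _ _ "N #>\<^bsub>?A\<^esub> x"]) (use car \<Psi>c x in auto)
      qed
    qed
  qed
  moreover have "\<Psi> (K \<oplus>\<^bsub>?Q\<^esub> K') = \<Psi> K + \<Psi> K'" if K: "K \<in> carrier ?Q" and K': "K' \<in> carrier ?Q" for K K'
  proof -
    obtain x where x: "x \<in> L" "K = N #>\<^bsub>?A\<^esub> x" using K unfolding car by blast
    obtain y where y: "y \<in> L" "K' = N #>\<^bsub>?A\<^esub> y" using K' unfolding car by blast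
    note xy = x(1) y(1) x(2) y(2)
    have "K \<oplus>\<^bsub>?Q\<^esub> K' = N #>\<^bsub>?A\<^esub> (x \<oplus>\<^bsub>Mo\<^esub> y)"
      unfolding plus xy using normal.rcos_sum[OF A.subgroup_imp_normal[OF N] Lc[OF xy(1)] Lc[OF xy(2)]] by simp
    moreover have "x \<oplus>\<^bsub>Mo\<^esub> y \<in> L" using subgroup.m_closed[OF L xy(1,2)] by simp
    ultimately show ?thesis using xy by (simp add: \<Psi>c add)
  qed
  moreover have "\<Psi> (a \<odot>\<^bsub>?Q\<^esub> K) = T a (\<Psi> K)" if a: "a \<in> S" and K: "K \<in> carrier ?Q" for a K
  proof -
    obtain x where x: "x \<in> L" "K = N #>\<^bsub>?A\<^esub> x" using K unfolding car by blast
    have "N #>\<^bsub>?A\<^esub> (a \<odot>\<^bsub>Mo\<^esub> k) = N #>\<^bsub>?A\<^esub> (a \<odot>\<^bsub>Mo\<^esub> x)" if "k \<in> K" for k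
      using mem[OF x(1)] that x sm[OF a] T[OF a] by (intro eq) auto
    then have "(\<Union>k\<in>K. N #>\<^bsub>?A\<^esub> (a \<odot>\<^bsub>Mo\<^esub> k)) = (\<Union>k\<in>K. N #>\<^bsub>?A\<^esub> (a \<odot>\<^bsub>Mo\<^esub> x))" by (intro SUP_cong refl)
    moreover have "K \<noteq> {}" using self[OF x(1)] x(2) by blast
    ultimately have "a \<odot>\<^bsub>?Q\<^esub> K = N #>\<^bsub>?A\<^esub> (a \<odot>\<^bsub>Mo\<^esub> x)" unfolding smq by simp
    then show ?thesis using x a by (simp add: \<Psi>c sm T)
  qed
  ultimately show thesis using that by blast
qed

section \<open>Assembly of the filtration\<close>

context standard_rep
begin

lemma poly_exps_orb:
  assumes a: "a \<in> poly_exps" shows "\<exists>d\<in>Pminus n. a \<in> OB d"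
proof -
  obtain p where p: "p permutes {1..n}" "nonincr n (a \<circ> p)" using nonincr_exists by blast
  define d where "d i = nat (a (p i))" for i
  have nn: "0 \<le> a i" for i using a by (simp add: poly_exps_def)
  have "d i = 0" if "i \<notin> {1..n}" for i
    using a permutes_not_in[OF p(1) that] that by (simp add: poly_exps_def d_def)
  moreover have "d (i + 1) \<le> d i" if "i \<in> {1..<n}" for i
    using p(2) that unfolding nonincr_def d_def by (intro nat_mono) simp
  ultimately have d: "d \<in> Pminus n" by (auto simp: Pminus_def)
  have "a = (int \<circ> d) \<circ> inv' p" using nn by (auto simp: d_def permutes_inverses[OF p(1)])
  then have "a \<in> OB d" using orbI[OF permutes_inv[OF p(1)], of "int \<circ> d"] by simp
  then show ?thesis using d by blast
qed

lemma OB_poly_exps: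
  assumes d: "d \<in> Pminus n" shows "OB d \<subseteq> poly_exps"
proof
  fix a assume "a \<in> OB d"
  then obtain p where p: "p permutes {1..n}" "a = (int \<circ> d) \<circ> p" unfolding orb_def by blast
  have "a i = 0" if "i \<notin> {1..n}" for i
    using d permutes_not_in[OF p(1) that] that by (simp add: p(2) Pminus_def)
  then show "a \<in> poly_exps" by (auto simp: poly_exps_def p(2))
qed

lemma below_poly_exps:
  assumes d: "d \<in> Pminus n" shows "below n (int \<circ> d) \<subseteq> poly_exps"
  using d by (auto simp: below_def poly_exps_def Pminus_def)

lemma filtration:
  "has_filtration_by (hecke n t c) (standard_module n t c sc \<rho>) (Pminus n) (V_ind n t c sc \<rho>)"
proof -
  obtain e :: "nat \<Rightarrow> nat \<Rightarrow> nat" where e: "bij_betw e UNIV (Pminus n)"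
    and em: "\<forall>i j. i \<le> j \<longrightarrow> nat (qform n (int \<circ> e i)) \<le> nat (qform n (int \<circ> e j))"
    using enumeration_exists[OF infinite_Pminus[OF n1] finite_Pminus_qform] by (elim exE conjE)
  have emono: "nat (qform n (int \<circ> e i)) \<le> nat (qform n (int \<circ> e j))" if "i \<le> j" for i j
    using em that by blast
  have eP: "e i \<in> Pminus n" for i using bij_betwE[OF e] by blast
  have esurj: "\<exists>j. d = e j" if "d \<in> Pminus n" for d using e that by (metis bij_betw_imp_surj_on imageE)
  \<comment> \<open>The exponents in the first k orbits. The filtration step \<open>F k\<close> will
    consist of the polynomials supported there, so the step k to k + 1 adds exactly the orbit of
    \<open>e k\<close>.\<close>
  define Ek where "Ek k = (\<Union>i<k. OB (e i))" for k :: nat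
  have Ek_Suc: "Ek (Suc k) = Ek k \<union> OB (e k)" for k by (auto simp: Ek_def less_Suc_eq)
  have disj: "OB (e k) \<inter> Ek k = {}" for k
  proof (rule ccontr)
    assume "OB (e k) \<inter> Ek k \<noteq> {}"
    then obtain a i where a: "a \<in> OB (e k)" "i < k" "a \<in> OB (e i)" unfolding Ek_def by blast
    then have "e k = e i" using orb_Pminus_inj[OF eP eP] by blast
    then show False using a(2) bij_betw_imp_inj_on[OF e] by (simp add: inj_eq)
  qed
  \<comment> \<open>Lower terms of the i-th orbit are polynomial exponents with a strictly smaller
    sum of squares, so the ordered enumeration lists their orbits before i. This makes every
    \<open>F k\<close> a submodule.\<close>
  have Ek_closed: "orb n b \<union> below n b \<subseteq> Ek k" if b: "b \<in> Ek k" for b k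
  proof -
    obtain i where i: "i < k" "b \<in> OB (e i)" using b unfolding Ek_def by blast
    obtain p where p: "p permutes {1..n}" "b = (int \<circ> e i) \<circ> p" using i(2) unfolding orb_def by blast
    have "orb n b = OB (e i)" unfolding p(2) by (rule orb_perm[OF p(1)])
    then have "orb n b \<subseteq> Ek k" using i(1) unfolding Ek_def by blast
    moreover have "x \<in> Ek k" if "x \<in> below n b" for x
    proof -
      have x: "x \<in> below n (int \<circ> e i)" using that unfolding p(2) below_perm[OF p(1)] .
      then obtain j where j: "x \<in> OB (e j)" using below_poly_exps[OF eP] poly_exps_orb esurj by blast
      obtain q where q: "q permutes {1..n}" "x = (int \<circ> e j) \<circ> q" using j unfolding orb_def by blast
      have "qform n (int \<circ> e j) < qform n (int \<circ> e i)"
        using x qform_perm[OF q(1), of "int \<circ> e j"] unfolding below_def q(2) by simp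
      \<comment> \<open>The enumeration is monotone for \<open>nat\<close> of the sum of squares,
        which agrees with the integer order only because the sum is non-negative.\<close>
      moreover have "0 \<le> qform n (int \<circ> e j)" unfolding qform_def by (intro sum_nonneg) simp
      ultimately have "\<not> i \<le> j" using emono[of i j] by linarith
      then have "j < k" using i(1) by simp
      then show ?thesis using j unfolding Ek_def by blast
    qed
    ultimately show ?thesis by blast
  qed
  define F where "F k = {x \<in> carrier D.IND. keys (D.Phi x) \<subseteq> Ek k}" for k
  interpret A: comm_group "add_monoid D.IND" by (rule D.IND_comm_group)
  have Aclosed: "x \<oplus>\<^bsub>D.IND\<^esub> y \<in> carrier D.IND" if "x \<in> carrier D.IND" "y \<in> carrier D.IND" for x y
    using A.m_closed[of x y] that by simp
  have zero: "\<zero>\<^bsub>D.IND\<^esub> \<in> carrier D.IND" using A.one_closed by simp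
  have Phi0: "D.Phi \<zero>\<^bsub>D.IND\<^esub> = 0"
    using D.Phi_add[OF zero zero] A.l_one[of "\<zero>\<^bsub>D.IND\<^esub>"] zero by simp
  have Phi_inv: "D.Phi (inv\<^bsub>add_monoid D.IND\<^esub> x) = - D.Phi x" if x: "x \<in> carrier D.IND" for x
  proof -
    have i: "inv\<^bsub>add_monoid D.IND\<^esub> x \<in> carrier D.IND" using A.inv_closed[of x] x by simp
    have "inv\<^bsub>add_monoid D.IND\<^esub> x \<oplus>\<^bsub>D.IND\<^esub> x = \<zero>\<^bsub>D.IND\<^esub>" using A.l_inv[of x] x by simp
    then have "D.Phi (inv\<^bsub>add_monoid D.IND\<^esub> x) + D.Phi x = 0" using D.Phi_add[OF i x] Phi0 by simp
    then show ?thesis by (simp add: eq_neg_iff_add_eq_0)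
  qed
  have F_sub: "subgroup (F k) (add_monoid D.IND)" for k
  proof (rule A.subgroupI)
    show "F k \<subseteq> carrier (add_monoid D.IND)" by (auto simp: F_def)
    show "F k \<noteq> {}" using zero Phi0 by (auto simp: F_def intro!: exI[of _ "\<zero>\<^bsub>D.IND\<^esub>"])
    show "inv\<^bsub>add_monoid D.IND\<^esub> x \<in> F k" if "x \<in> F k" for x
      using that A.inv_closed[of x] Phi_inv[of x] by (simp add: F_def)
    show "x \<otimes>\<^bsub>add_monoid D.IND\<^esub> y \<in> F k" if "x \<in> F k" "y \<in> F k" for x y
      using that Aclosed[of x y] D.Phi_add[of x y] keys_add_subset[of "D.Phi x" "Ek k" "D.Phi y"] by (simp add: F_def)
  qed
  have F_smult: "h \<odot>\<^bsub>D.IND\<^esub> x \<in> F k" if h: "h \<in> carrier (hecke n t c)" and x: "x \<in> F k" for h x k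
    using D.Phi_smult[OF hecke_sub[OF h], of x] x keys_act[OF h Ek_closed, of k "D.Phi x"] by (simp add: F_def)
  have F_mono: "F k \<subseteq> F (Suc k)" for k by (auto simp: F_def Ek_Suc)
  have F0: "F 0 = {\<zero>\<^bsub>D.IND\<^esub>}"
  proof -
    have inj: "x = \<zero>\<^bsub>D.IND\<^esub>" if x: "x \<in> carrier D.IND" and 0: "D.Phi x = 0" for x
      by (rule inj_onD[OF bij_betw_imp_inj_on[OF D.Phi_bij] _ x zero]) (simp only: 0 Phi0)
    show ?thesis
    proof (intro equalityI subsetI)
      fix x assume "x \<in> F 0"
      then have "x \<in> carrier D.IND" "keys (D.Phi x) = {}" by (simp_all add: F_def Ek_def)
      then show "x \<in> {\<zero>\<^bsub>D.IND\<^esub>}" using inj[of x] by simp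
    next
      fix x assume "x \<in> {\<zero>\<^bsub>D.IND\<^esub>}"
      then show "x \<in> F 0" using zero Phi0 by (simp add: F_def)
    qed
  qed
  have Phi_keys: "keys (D.Phi x) \<subseteq> poly_exps" if "x \<in> carrier D.IND" for x
    using bij_betwE[OF D.Phi_bij] that by blast
  have F_union: "(\<Union>k. F k) = carrier D.IND"
  proof
    show "(\<Union>k. F k) \<subseteq> carrier D.IND" by (auto simp: F_def)
    show "carrier D.IND \<subseteq> (\<Union>k. F k)"
    proof
      fix x assume x: "x \<in> carrier D.IND"
      have "\<exists>k. S \<subseteq> Ek k" if "finite S" "S \<subseteq> poly_exps" for S
        using that
      proof (induction S rule: finite_induct)
        case (insert a S)
        then obtain k where k: "S \<subseteq> Ek k" by blast
        obtain j where j: "a \<in> OB (e j)" using poly_exps_orb[of a] esurj insert.prems by blast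
        have "Ek k \<subseteq> Ek (max k (Suc j))" "OB (e j) \<subseteq> Ek (max k (Suc j))"
          unfolding Ek_def by (rule UN_mono, simp_all) (rule UN_upper, simp)
        then have "insert a S \<subseteq> Ek (max k (Suc j))" using k j by blast
        then show ?case by blast
      qed simp
      from this[OF finite_keys Phi_keys[OF x]] show "x \<in> (\<Union>k. F k)" using x by (auto simp: F_def)
    qed
  qed
  have iso: "module_isomorphic (hecke n t c) (subquotient D.IND (F (Suc k)) (F k)) (V_ind n t c sc \<rho> (e k))" for k
  proof -
    let ?\<psi> = "\<lambda>x. proj (OB (e k)) (D.Phi x)" and ?T = "pact (e k)"
    have carF: "x \<in> carrier D.IND" "keys (D.Phi x) \<subseteq> Ek k \<union> OB (e k)" if "x \<in> F (Suc k)" for x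
      using that by (auto simp: F_def Ek_Suc)
    have ker: "?\<psi> x = 0 \<longleftrightarrow> x \<in> F k" if x: "x \<in> F (Suc k)" for x
    proof
      assume "?\<psi> x = 0"
      then have "keys (D.Phi x) \<inter> OB (e k) = {}" using keys_proj[of "OB (e k)" "D.Phi x"] by simp
      then show "x \<in> F k" using carF[OF x] by (auto simp: F_def)
    next
      assume "x \<in> F k"
      then have "keys (D.Phi x) \<inter> OB (e k) = {}" using disj[of k] by (auto simp: F_def)
      then show "?\<psi> x = 0" by (rule proj_zero)
    qed
    \<comment> \<open>The part of the polynomial off the newest orbit is supported on earlier
      orbits, an invariant set disjoint from the newest one; projection removes its contribution
      after acting as well.\<close>
    have T: "?\<psi> (h \<odot>\<^bsub>D.IND\<^esub> x) = ?T h (?\<psi> x)" if h: "h \<in> carrier (hecke n t c)" and x: "x \<in> F (Suc k)" for h x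
    proof -
      let ?w = "D.Phi x"
      have "keys (?w - ?\<psi> x) \<subseteq> Ek k"
      proof
        fix a assume "a \<in> keys (?w - ?\<psi> x)"
        then have "a \<in> keys ?w" "a \<notin> OB (e k)"
          by (auto simp: in_keys_iff lookup_minus lookup_proj split: if_splits)
        then show "a \<in> Ek k" using carF(2)[OF x] by blast
      qed
      then have "keys (N.act h (?w - ?\<psi> x)) \<subseteq> Ek k"
        using keys_act[OF h Ek_closed, of k "?w - ?\<psi> x"] by simp
      then have "keys (N.act h (?w - ?\<psi> x)) \<inter> OB (e k) = {}" using disj[of k] by blast
      then have "proj (OB (e k)) (N.act h (?w - ?\<psi> x)) = 0" by (rule proj_zero)
      then show ?thesis
        using D.Phi_smult(1)[OF hecke_sub[OF h] carF(1)[OF x]]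
        by (simp add: pact_def lin_opD(5)[OF N.act_lin[OF hecke_sub[OF h]]] proj_additive)
    qed
    have img: "?\<psi> ` F (Suc k) = {w. keys w \<subseteq> OB (e k)}"
    proof
      show "?\<psi> ` F (Suc k) \<subseteq> {w. keys w \<subseteq> OB (e k)}" by (auto simp: keys_proj)
      show "{w. keys w \<subseteq> OB (e k)} \<subseteq> ?\<psi> ` F (Suc k)"
      proof
        fix w :: "(nat \<Rightarrow> int) \<Rightarrow>\<^sub>0 'v" assume "w \<in> {w. keys w \<subseteq> OB (e k)}"
        then have w: "keys w \<subseteq> OB (e k)" by simp
        then have "w \<in> {w. keys w \<subseteq> poly_exps}" using OB_poly_exps[OF eP] by blast
        then obtain x where x: "x \<in> carrier D.IND" "D.Phi x = w"
          unfolding bij_betw_imp_surj_on[OF D.Phi_bij, symmetric] by (elim imageE) (rule that, assumption, simp)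
        then have "x \<in> F (Suc k)" using w by (auto simp: F_def Ek_Suc)
        moreover have "?\<psi> x = w" using x(2) proj_id[OF w] by simp
        ultimately show "w \<in> ?\<psi> ` F (Suc k)" by blast
      qed
    qed
    obtain \<Psi> where \<Psi>: "bij_betw \<Psi> (carrier (subquotient D.IND (F (Suc k)) (F k))) (?\<psi> ` F (Suc k))"
      "\<And>x y. \<lbrakk>x \<in> carrier (subquotient D.IND (F (Suc k)) (F k)); y \<in> carrier (subquotient D.IND (F (Suc k)) (F k))\<rbrakk> \<Longrightarrow>
        \<Psi> (x \<oplus>\<^bsub>subquotient D.IND (F (Suc k)) (F k)\<^esub> y) = \<Psi> x + \<Psi> y"
      "\<And>a x. \<lbrakk>a \<in> carrier (hecke n t c); x \<in> carrier (subquotient D.IND (F (Suc k)) (F k))\<rbrakk> \<Longrightarrow>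
        \<Psi> (a \<odot>\<^bsub>subquotient D.IND (F (Suc k)) (F k)\<^esub> x) = ?T a (\<Psi> x)"
    proof (rule subquotient_iso[OF D.IND_comm_group F_sub[of "Suc k"] F_sub[of k] F_mono[of k],
          where \<psi> = ?\<psi> and S = "carrier (hecke n t c)" and T = ?T])
      show "?\<psi> (x \<oplus>\<^bsub>D.IND\<^esub> y) = ?\<psi> x + ?\<psi> y" if "x \<in> F (Suc k)" "y \<in> F (Suc k)" for x y
        using D.Phi_add[OF carF(1)[OF that(1)] carF(1)[OF that(2)]] by (simp add: proj_add)
    qed (use ker F_smult T in blast)+
    \<comment> \<open>The model of V_d has the same underlying space, the elements supported on the
      orbit of \<open>e k\<close>, and the same operators \<open>pact (e k)\<close> as the image of
      the subquotient, so the two identifications compose.\<close>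
    interpret VI: induction_data "hecke n t c" "\<lambda>h. h" "parabolic n t c (e k)" "Mrev (e k)" NS
      "\<lambda>h v. pact (e k) h (top (e k) v)" "pact (e k)" "OB (e k)" "\<lambda>a. hP (wperm (e k) a)"
      "\<lambda>a v. \<rho> (wperm (e k) a) (\<rho> (inv' (sorter n (e k))) v)"
      by (rule V_induction_data[OF eP])
    interpret VA: comm_group "add_monoid VI.IND" by (rule VI.IND_comm_group)
    show ?thesis
      unfolding V_ind_eq
    proof (rule module_isomorphic_via[OF \<Psi>(1)[unfolded img] \<Psi>(2,3) VI.Phi_bij VI.Phi_add VI.Phi_smult(1)])
      show "x \<oplus>\<^bsub>VI.IND\<^esub> y \<in> carrier VI.IND" if "x \<in> carrier VI.IND" "y \<in> carrier VI.IND" for x y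
        using VA.m_closed[of x y] that by simp
    qed (use VI.Phi_smult(2) in blast)+
  qed
  have "submodule (F k) (hecke n t c) D.IND" for k
    by (intro submodule.intro F_sub submodule_axioms.intro F_smult)
  then show ?thesis
    unfolding has_filtration_by_def standard_module_eq
    by (intro exI[of _ F] exI[of _ e] conjI allI e F0 F_mono F_union iso)
qed

end

theorem theorem4p10:
  fixes n :: nat and t c :: complex
    and scale :: "complex \<Rightarrow> 'v \<Rightarrow> 'v :: ab_group_add"
    and \<rho> :: "(nat \<Rightarrow> nat) \<Rightarrow> 'v \<Rightarrow> 'v"
  assumes "n \<ge> 1"
    and "sym_rep n scale \<rho>"
  shows "has_filtration_by (hecke n t c) (standard_module n t c scale \<rho>)
           (Pminus n) (V_ind n t c scale \<rho>)"
proof -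
  interpret standard_rep n t c scale \<rho> using assms by unfold_locales
  show ?thesis by (rule filtration)
qed

end
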